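(* Let $T$ be a Gaussian $SPHAR(p)$ process on $\mathbb{S}^2\times\mathbb{Z}$ with kernels $k=(k_1,\dots,k_p)'$, eigenvalues $\phi_{\ell;j}$ and Gaussian spherical white noise $Z$ with angular power spectrum $\{C_{\ell;Z}\}$ (all as defined in the context). Assume: (1) (Stationarity) there exists $\delta>0$ such that for all $\ell\ge 0$ the polynomial $\phi_\ell(z)=1-\phi_{\ell;1}z-\cdots-\phi_{\ell;p}z^p$ satisfies $\phi_\ell(z)\neq 0$ for all $z\in\mathbb{C}$ with $|z|\le 1+\delta$; (2) (Identifiability) $C_{\ell;Z}>0$ for all $\ell=0,1,2,\dots$; (3) (Finite expansion) there exists an integer $L>0$ such that $\int_{-1}^1k_j(z)P_\ell(z)\,dz=0$ for all $j=1,\dots,p$ and all $\ell>L$. Let $\widehat{k}_N$ be the least squares estimator of $k$ with fixed truncation level $L$, as defined in the context. Then $$\sqrt{N}\left(\widehat{k}_N(\cdot)-k(\cdot)\right)\Longrightarrow W_p(\cdot),\qquad N\to\infty,$$ where $\Longrightarrow$ denotes weak convergence in $C_p[-1,1]$, the space of continuous functions from $[-1,1]$ to $\mathbb{R}^p$ with the standard uniform metric, and $W_p$ is the zero-mean $p$-dimensional Gaussian process with covariance function $$\Gamma_k(z,z')=\sum_{\ell=0}^LC_{\ell;Z}\,\Gamma_\ell^{-1}\,\frac{2\ell+1}{16\pi^2}P_\ell(z)P_\ell(z'),$$ $\Gamma_\ell$ being the $p\times p$ autocovariance matrix with $(i,j)$ entry $C_\ell(i-j)$.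
   Context: Notation. $\mathbb{S}^2$ is the unit sphere in $\mathbb{R}^3$; $\{Y_{\ell,m}:\ell\ge 0,\,-\ell\le m\le\ell\}$ is the standard real orthonormal basis of spherical harmonics of $L^2(\mathbb{S}^2)$; $P_\ell$ is the $\ell$-th Legendre polynomial ($P_\ell(1)=1$). White noise. A Gaussian spherical white noise $\{Z(x,t):(x,t)\in\mathbb{S}^2\times\mathbb{Z}\}$ is a sequence (in $t$) of i.i.d. Gaussian zero-mean isotropic random fields $Z_t(\cdot)=Z(\cdot,t)$ on $\mathbb{S}^2$ with covariance $\Gamma_Z(x,y)=\sum_{\ell\ge 0}\frac{2\ell+1}{4\pi}C_{\ell;Z}P_\ell(\langle x,y\rangle)$, where $\sum_{\ell}\frac{2\ell+1}{4\pi}C_{\ell;Z}<\infty$; $\{C_{\ell;Z}\}$ is its angular power spectrum. $SPHAR(p)$ process ($p\ge 1$ fixed). For $j=1,\dots,p$ let $k_j\in L^2[-1,1]$ and let $\Phi_j:L^2(\mathbb{S}^2)\to L^2(\mathbb{S}^2)$, $(\Phi_jf)(x)=\int_{\mathbb{S}^2}k_j(\langle x,y\rangle)f(y)\,dy$. Then $\Phi_jY_{\ell,m}=\phi_{\ell;j}Y_{\ell,m}$ for real numbers $\phi_{\ell;j}$, and $k_j(z)=\sum_{\ell\ge0}\phi_{\ell;j}\frac{2\ell+1}{4\pi}P_\ell(z)$ in $L^2[-1,1]$; under (3) this is a finite sum over $\ell\le L$, with which $k_j$ is identified. It is assumed that $\phi_{\ell;p}\ne0$ for at least one $\ell$. $\{T(x,t)\}$,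 with $T_t(\cdot)=T(\cdot,t)$, is the zero-mean, finite-variance, Gaussian, isotropic and (temporally) stationary random field satisfying $$T_t(x)-(\Phi_1T_{t-1})(x)-\cdots-(\Phi_pT_{t-p})(x)-Z_t(x)=0$$ for all $(x,t)\in\mathbb{S}^2\times\mathbb{Z}$, equality holding in $L^2(\Omega)$ and in $L^2(\Omega\times\mathbb{S}^2)$; under the stationarity assumption (1) the stationary isotropic solution exists and is unique. Equivalently, $a_{\ell,m}(t)=\int_{\mathbb{S}^2}T(x,t)Y_{\ell,m}(x)dx$ and $a_{\ell,m;Z}(t)=\int_{\mathbb{S}^2}Z(x,t)Y_{\ell,m}(x)dx$ satisfy $a_{\ell,m}(t)=\sum_{j=1}^p\phi_{\ell;j}a_{\ell,m}(t-j)+a_{\ell,m;Z}(t)$, where the processes are independent over $(\ell,m)$ and $\{a_{\ell,m;Z}(t)\}_t$ is i.i.d. $\mathcal{N}(0,C_{\ell;Z})$. The autocovariances are $C_\ell(\tau)=\mathbb{E}[a_{\ell,m}(t)a_{\ell,m}(t+\tau)]$ (not depending on $m,t$, even in $\tau$), with $C_\ell=C_\ell(0)$. Estimator. One observes $a_{\ell,m}(t)$ for $t=1,\dots,n$; set $N=n-p$, $N>p$. Let $\mathcal{P}=\mathrm{span}\{\frac{2\ell+1}{4\pi}P_\ell(\cdot):\ell\le L\}$ with $L$ the integer in (3), and $$\widehat{k}_N=(\widehat{k}_{1;N},\dots,\widehat{k}_{p;N})'=\underset{k\in\mathcal{P}^p}{\arg\min}\sum_{t=1}^N\Big\Vert T_{t+p}-\sum_{j=1}^p\Phi_jT_{t+p-j}\Big\Vert^2_{L^2(\mathbb{S}^2)},$$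 where in the minimization $\Phi_j$ denotes the operator with kernel $k_j$, $k=(k_1,\dots,k_p)'$. *)

theory Defs
  imports "HOL-Probability.Probability" "HOL-Computational_Algebra.Polynomial"
begin

section \<open>Integration and harmonic analysis on the unit sphere\<close>

abbreviation S2 :: "(real^3) set" where
  "S2 \<equiv> sphere 0 1"

text \<open>Surface area on the sphere, as the cone measure: the area of a Borel set A is three times the
  volume of the cone \<open>{r x | 0 < r < 1, x \<in> A}\<close> (because \<open>dx = r\<^sup>2 dr d\<sigma>\<close>). It is the
  rotation invariant measure of total mass \<open>4 \<pi>\<close>.\<close>

definition sphere_measure :: "(real^3) measure" where
  "sphere_measure =
     distr (scale_measure 3 (restrict_space lborel (ball 0 1 - {0})))
       (restrict_space borel S2) (\<lambda>x. x /\<^sub>R norm x)"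

definition in_L2 :: "'a measure \<Rightarrow> ('a \<Rightarrow> real) \<Rightarrow> bool" where
  "in_L2 M f \<longleftrightarrow> f \<in> borel_measurable M \<and> integrable M (\<lambda>x. (f x)\<^sup>2)"

text \<open>Rodrigues' formula.\<close>

definition legendre_poly :: "nat \<Rightarrow> real poly" where
  "legendre_poly l = smult (1 / (2 ^ l * fact l)) ((pderiv ^^ l) ([:-1, 0, 1:] ^ l))"

definition legendre :: "nat \<Rightarrow> real \<Rightarrow> real" where
  "legendre l z = poly (legendre_poly l) z"

text \<open>The standard real spherical harmonics \<open>Y\<^sub>l\<^sub>,\<^sub>m\<close>, for \<open>-l \<le> m \<le> l\<close>. In polar
  coordinates, with \<open>x\<^sub>3 = cos \<theta>\<close>, the factors \<open>(sin \<theta>)\<^bsup>\<bar>m\<bar>\<^esup> cos (\<bar>m\<bar> \<phi>)\<close> and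
  \<open>(sin \<theta>)\<^bsup>\<bar>m\<bar>\<^esup> sin (\<bar>m\<bar> \<phi>)\<close> are the real and imaginary part of \<open>(x\<^sub>1 + i x\<^sub>2)\<^bsup>\<bar>m\<bar>\<^esup>\<close>;
  the remaining factor of the associated Legendre function is the \<open>\<bar>m\<bar>\<close>-th derivative of \<open>P\<^sub>l\<close>
  (without the sign \<open>(-1)\<^sup>m\<close>).\<close>

definition sph_harm :: "nat \<Rightarrow> int \<Rightarrow> real^3 \<Rightarrow> real" where
  "sph_harm l m x =
     (let a = nat \<bar>m\<bar>; w = Complex (x $ 1) (x $ 2) ^ a in
      sqrt ((2 * real l + 1) / (4 * pi) * fact (l - a) / fact (l + a))
      * poly ((pderiv ^^ a) (legendre_poly l)) (x $ 3)
      * (if m = 0 then 1 else if m > 0 then sqrt 2 * Re w else sqrt 2 * Im w))"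

definition sph_coeff :: "(real^3 \<Rightarrow> real) \<Rightarrow> nat \<Rightarrow> int \<Rightarrow> real" where
  "sph_coeff f l m = (\<integral>x. f x * sph_harm l m x \<partial>sphere_measure)"

definition kernel_op :: "(real \<Rightarrow> real) \<Rightarrow> (real^3 \<Rightarrow> real) \<Rightarrow> real^3 \<Rightarrow> real" where
  "kernel_op \<kappa> f x = (\<integral>y. \<kappa> (x \<bullet> y) * f y \<partial>sphere_measure)"


section \<open>Gaussian, isotropic and stationary random fields\<close>

text \<open>Degenerate (constant) variables count as Gaussian.\<close>

definition gaussian_rv :: "'w measure \<Rightarrow> ('w \<Rightarrow> real) \<Rightarrow> bool" where
  "gaussian_rv M X \<longleftrightarrow>
     X \<in> borel_measurable M \<and>
     ((\<exists>\<mu>. AE \<omega> in M. X \<omega> = \<mu>) \<or>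
      (\<exists>\<mu> \<sigma>. \<sigma> > 0 \<and> distributed M lborel X (\<lambda>x. ennreal (normal_density \<mu> \<sigma> x))))"

definition gaussian_process :: "'w measure \<Rightarrow> 'i set \<Rightarrow> ('i \<Rightarrow> 'w \<Rightarrow> real) \<Rightarrow> bool" where
  "gaussian_process M I X \<longleftrightarrow>
     (\<forall>J c. finite J \<and> J \<subseteq> I \<longrightarrow> gaussian_rv M (\<lambda>\<omega>. \<Sum>i\<in>J. c i * X i \<omega>))"

text \<open>The law of a family of random variables on the product sigma-algebra; equality of two such
  laws is equality of all finite-dimensional distributions.\<close>

definition process_law ::
    "'w measure \<Rightarrow> 'i set \<Rightarrow> ('i \<Rightarrow> 'w \<Rightarrow> real) \<Rightarrow> ('i \<Rightarrow> real) measure" where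
  "process_law M I X = distr M (PiM I (\<lambda>_. borel)) (\<lambda>\<omega>. \<lambda>i\<in>I. X i \<omega>)"

text \<open>Zero-mean, finite-variance random fields on the sphere; measurability in the pair of sample
  point and location gives a meaning to integrals over the sphere.\<close>

definition centered_field :: "'w measure \<Rightarrow> (real^3 \<Rightarrow> 'w \<Rightarrow> real) \<Rightarrow> bool" where
  "centered_field M X \<longleftrightarrow>
     (\<lambda>(\<omega>, x). X x \<omega>) \<in> borel_measurable (M \<Otimes>\<^sub>M sphere_measure) \<and>
     (\<forall>x\<in>S2. in_L2 M (X x) \<and> (\<integral>\<omega>. X x \<omega> \<partial>M) = 0)"

text \<open>A space-time field is a map \<open>X t x \<omega>\<close>.\<close>

definition isotropic_stationary :: "'w measure \<Rightarrow> (int \<Rightarrow> real^3 \<Rightarrow> 'w \<Rightarrow> real) \<Rightarrow> bool" where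
  "isotropic_stationary M X \<longleftrightarrow>
     (\<forall>R h. rotation_matrix R \<longrightarrow>
        process_law M (S2 \<times> UNIV) (\<lambda>(x, t). X (t + h) (R *v x)) =
        process_law M (S2 \<times> UNIV) (\<lambda>(x, t). X t x))"

definition gaussian_white_noise ::
    "'w measure \<Rightarrow> (int \<Rightarrow> real^3 \<Rightarrow> 'w \<Rightarrow> real) \<Rightarrow> (nat \<Rightarrow> real) \<Rightarrow> bool" where
  "gaussian_white_noise M Z CZ \<longleftrightarrow>
     (\<forall>t. centered_field M (Z t) \<and> gaussian_process M S2 (Z t)) \<and>
     (\<forall>t R. rotation_matrix R \<longrightarrow>
        process_law M S2 (\<lambda>x. Z t (R *v x)) = process_law M S2 (Z t)) \<and>
     prob_space.indep_vars M (\<lambda>_. PiM S2 (\<lambda>_. borel)) (\<lambda>t \<omega>. \<lambda>x\<in>S2. Z t x \<omega>) UNIV \<and>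
     (\<forall>s t. process_law M S2 (Z s) = process_law M S2 (Z t)) \<and>
     (\<forall>l. CZ l \<ge> 0) \<and>
     summable (\<lambda>l. (2 * real l + 1) / (4 * pi) * CZ l) \<and>
     (\<forall>t. \<forall>x\<in>S2. \<forall>y\<in>S2.
        (\<integral>\<omega>. Z t x \<omega> * Z t y \<omega> \<partial>M) =
        (\<Sum>l. (2 * real l + 1) / (4 * pi) * CZ l * legendre l (x \<bullet> y)))"


section \<open>Spherical autoregressive processes\<close>

text \<open>The order \<open>p \<ge> 1\<close> is the cardinality of the index type \<open>'p\<close>, and the indices are numbered
  \<open>1, \<dots>, p\<close> in increasing order. A vector of kernels is a function \<open>real \<Rightarrow> real^'p\<close>; its
  component with index \<open>j\<close> acts at time lag \<open>lag j\<close>.\<close>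

definition lag :: "'p::{finite,linorder} \<Rightarrow> nat" where
  "lag j = card {..j}"

definition kernel_L2 :: "(real \<Rightarrow> real^'p) \<Rightarrow> bool" where
  "kernel_L2 k \<longleftrightarrow> (\<forall>j. in_L2 (restrict_space lborel {-1..1}) (\<lambda>z. k z $ j))"

definition kernel_eigenvalues :: "(real \<Rightarrow> real^'p) \<Rightarrow> (nat \<Rightarrow> real^'p) \<Rightarrow> bool" where
  "kernel_eigenvalues k \<phi> \<longleftrightarrow>
     (\<forall>j l m. \<bar>m\<bar> \<le> int l \<longrightarrow>
        (AE x in sphere_measure.
           kernel_op (\<lambda>z. k z $ j) (sph_harm l m) x = \<phi> l $ j * sph_harm l m x))"

definition ar_residual ::
    "(int \<Rightarrow> real^3 \<Rightarrow> 'w \<Rightarrow> real) \<Rightarrow> (real \<Rightarrow> real^'p::{finite,linorder}) \<Rightarrow>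
     int \<Rightarrow> real^3 \<Rightarrow> 'w \<Rightarrow> real" where
  "ar_residual T k t x \<omega> =
     T t x \<omega> - (\<Sum>j\<in>UNIV. kernel_op (\<lambda>z. k z $ j) (\<lambda>y. T (t - int (lag j)) y \<omega>) x)"

definition gaussian_sphar ::
    "'w measure \<Rightarrow> (int \<Rightarrow> real^3 \<Rightarrow> 'w \<Rightarrow> real) \<Rightarrow> (nat \<Rightarrow> real) \<Rightarrow>
     (real \<Rightarrow> real^'p::{finite,linorder}) \<Rightarrow> (nat \<Rightarrow> real^'p::{finite,linorder}) \<Rightarrow>
     (int \<Rightarrow> real^3 \<Rightarrow> 'w \<Rightarrow> real) \<Rightarrow> bool" where
  "gaussian_sphar M Z CZ k \<phi> T \<longleftrightarrow>
     gaussian_white_noise M Z CZ \<and>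
     kernel_L2 k \<and> kernel_eigenvalues k \<phi> \<and> (\<exists>l. \<phi> l $ Max UNIV \<noteq> 0) \<and>
     (\<forall>t. centered_field M (T t)) \<and>
     gaussian_process M (S2 \<times> UNIV) (\<lambda>(x, t). T t x) \<and>
     isotropic_stationary M T \<and>
     (\<forall>t. \<forall>x\<in>S2. AE \<omega> in M. ar_residual T k t x \<omega> - Z t x \<omega> = 0) \<and>
     (\<forall>t. AE (\<omega>, x) in M \<Otimes>\<^sub>M sphere_measure. ar_residual T k t x \<omega> - Z t x \<omega> = 0)"

text \<open>For such a process the expectation of \<open>a\<^sub>l\<^sub>,\<^sub>m(t) a\<^sub>l\<^sub>,\<^sub>m(t + \<tau>)\<close> depends neither on \<open>m\<close>
  nor on \<open>t\<close>; it is taken at \<open>m = 0\<close> and \<open>t = 0\<close>.\<close>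

definition autocov ::
    "'w measure \<Rightarrow> (int \<Rightarrow> real^3 \<Rightarrow> 'w \<Rightarrow> real) \<Rightarrow> nat \<Rightarrow> int \<Rightarrow> real" where
  "autocov M T l \<tau> =
     (\<integral>\<omega>. sph_coeff (\<lambda>x. T 0 x \<omega>) l 0 * sph_coeff (\<lambda>x. T \<tau> x \<omega>) l 0 \<partial>M)"

definition autocov_matrix ::
    "'w measure \<Rightarrow> (int \<Rightarrow> real^3 \<Rightarrow> 'w \<Rightarrow> real) \<Rightarrow> nat \<Rightarrow>
     real^'p::{finite,linorder}^'p::{finite,linorder}" where
  "autocov_matrix M T l = (\<chi> i j. autocov M T l (int (lag i) - int (lag j)))"

text \<open>The finite Legendre expansion with which kernels orthogonal to all \<open>P\<^sub>l\<close>, \<open>l > L\<close>, are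
  identified; the kernels themselves equal it only almost everywhere.\<close>

definition kernel_expansion :: "(nat \<Rightarrow> real^'p) \<Rightarrow> nat \<Rightarrow> real \<Rightarrow> real^'p" where
  "kernel_expansion \<phi> L z =
     (\<Sum>l\<le>L. ((2 * real l + 1) / (4 * pi) * legendre l z) *\<^sub>R \<phi> l)"


section \<open>Weak convergence in a metric space and the space of continuous functions\<close>

definition metric_borel :: "'a metric \<Rightarrow> 'a measure" where
  "metric_borel m = sigma (mspace m) {U. openin (mtopology_of m) U}"

definition conv_in_distribution ::
    "'a metric \<Rightarrow> 'w measure \<Rightarrow> (nat \<Rightarrow> 'w \<Rightarrow> 'a) \<Rightarrow> 'a measure \<Rightarrow> bool" where
  "conv_in_distribution m M X \<nu> \<longleftrightarrow>
     (\<forall>\<^sub>F n in sequentially. X n \<in> measurable M (metric_borel m)) \<and>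
     (\<forall>F. continuous_map (mtopology_of m) euclideanreal F \<and> bounded (F ` mspace m) \<longrightarrow>
        (\<lambda>n. \<integral>\<omega>. F (X n \<omega>) \<partial>M) \<longlonglongrightarrow> (\<integral>f. F f \<partial>\<nu>))"

text \<open>The elements of this metric space are extensional functions: continuous on \<open>{-1..1}\<close> and
  \<open>undefined\<close> elsewhere. The metric is the uniform one.\<close>

definition C_metric :: "(real \<Rightarrow> real^'p) metric" where
  "C_metric = cfunspace (top_of_set {-1..1}) euclidean_metric"

text \<open>Laws of zero-mean Gaussian processes with paths in \<open>C\<^sub>p[-1,1]\<close> and given matrix-valued
  covariance function.\<close>

definition centered_gaussian_law ::
    "(real \<Rightarrow> real^'p) measure \<Rightarrow> (real \<Rightarrow> real \<Rightarrow> real^'p^'p) \<Rightarrow> bool" where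
  "centered_gaussian_law \<nu> \<Gamma> \<longleftrightarrow>
     prob_space \<nu> \<and> sets \<nu> = sets (metric_borel C_metric) \<and>
     gaussian_process \<nu> (UNIV \<times> {-1..1}) (\<lambda>(j, z) f. f z $ j) \<and>
     (\<forall>j. \<forall>z\<in>{-1..1}. (\<integral>f. f z $ j \<partial>\<nu>) = 0) \<and>
     (\<forall>i j. \<forall>z\<in>{-1..1}. \<forall>z'\<in>{-1..1}. (\<integral>f. f z $ i * f z' $ j \<partial>\<nu>) = \<Gamma> z z' $ i $ j)"


section \<open>Least squares estimation\<close>

definition kernel_space :: "nat \<Rightarrow> (real \<Rightarrow> real) set" where
  "kernel_space L =
     {\<lambda>z. \<Sum>l\<le>L. c l * ((2 * real l + 1) / (4 * pi) * legendre l z) | c. True}"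

definition ls_loss ::
    "(int \<Rightarrow> real^3 \<Rightarrow> 'w \<Rightarrow> real) \<Rightarrow> nat \<Rightarrow> 'w \<Rightarrow>
     (real \<Rightarrow> real^'p::{finite,linorder}) \<Rightarrow> real" where
  "ls_loss T N \<omega> \<kappa> =
     (\<Sum>t=1..N. \<integral>x. (ar_residual T \<kappa> (int t + int CARD('p)) x \<omega>)\<^sup>2 \<partial>sphere_measure)"

text \<open>The minimizer is almost surely unique for \<open>N > p\<close>, so the estimator is determined up to a null
  event; any version that is a random element of \<open>C\<^sub>p[-1,1]\<close> is admitted.\<close>

definition ls_estimator ::
    "'w measure \<Rightarrow> (int \<Rightarrow> real^3 \<Rightarrow> 'w \<Rightarrow> real) \<Rightarrow> nat \<Rightarrow> nat \<Rightarrow>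
     ('w \<Rightarrow> real \<Rightarrow> real^'p::{finite,linorder}) \<Rightarrow> bool" where
  "ls_estimator M T L N khat \<longleftrightarrow>
     (\<lambda>\<omega>. restrict (khat \<omega>) {-1..1}) \<in> measurable M (metric_borel C_metric) \<and>
     (AE \<omega> in M.
        is_arg_min (ls_loss T N \<omega>) (\<lambda>\<kappa>. \<forall>j. (\<lambda>z. \<kappa> z $ j) \<in> kernel_space L) (khat \<omega>))"

definition limit_covariance ::
    "'w measure \<Rightarrow> (int \<Rightarrow> real^3 \<Rightarrow> 'w \<Rightarrow> real) \<Rightarrow> (nat \<Rightarrow> real) \<Rightarrow> nat \<Rightarrow>
     real \<Rightarrow> real \<Rightarrow> real^'p::{finite,linorder}^'p::{finite,linorder}" where
  "limit_covariance M T CZ L z z' =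
     (\<Sum>l\<le>L. (CZ l * ((2 * real l + 1) / (16 * pi\<^sup>2)) * legendre l z * legendre l z') *\<^sub>R
        matrix_inv (autocov_matrix M T l))"

end

theory Submission imports Defs "HOL-Complex_Analysis.Cauchy_Integral_Formula"
begin

text \<open>Spherical harmonics decouple the model. The coefficients of the field are jointly Gaussian autoregressions of order
  \<open>p\<close>, uncorrelated for different pairs \<open>(l, m)\<close>, and the \<open>2 l + 1\<close> coefficients of degree \<open>l\<close> share the
  autoregressive coefficients \<open>\<phi> l\<close>, the noise variance \<open>CZ l\<close> and hence the autocovariances. By the addition
  theorem, an operator whose kernel is a Legendre sum with coefficients \<open>c l\<close> multiplies the harmonics of degree \<open>l\<close>
  by \<open>c l\<close>; by Pythagoras the least squares loss is, up to a term independent of \<open>c\<close>, the sum of the ordinary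
  autoregressive losses of all coefficients of degree at most \<open>L\<close> (\<open>ls_loss_modes\<close>). For each degree the error
  \<open>V = \<surd>N (c l - \<phi> l)\<close> of a minimizer therefore solves the normal equations
  \<open>gram N l V = score N l\<close> (\<open>estimator_solves\<close>), where the Gram matrix averages products of lagged coefficients and
  the score is the normalised sum of noise times lagged coefficients.

  The Gram matrices tend in mean to \<open>(2 l + 1) \<Gamma>\<^sub>l\<close>, because the autocovariances of a causal autoregression
  vanish at infinity (\<open>gram_limit\<close>), and this limit is positive definite (\<open>autocov_matrix_invertible\<close>). The scores
  have a joint centred Gaussian limit with covariance \<open>(2 l + 1) CZ l \<Gamma>\<^sub>l\<close>, independent over the degrees
  (\<open>score_weak_limit\<close>). A perturbation argument for linear equations (\<open>linear_equations_weak_limit\<close>) turns this into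
  weak convergence of the errors, and the continuous map from coefficients to paths transfers it to
  \<open>C\<^sub>p[-1,1]\<close> (\<open>estimator_weak_limit\<close>). The covariance of the limit is computed in \<open>limit_value_cov\<close>.

  The limit of the scores rests on \<open>gaussian_martingale_clt\<close>. The noise at each time is Gaussian and independent of the
  past, so that compensating the phase of the sum by half of its conditional variance gives an exact martingale, and the
  law of large numbers makes the compensator constant in the limit. Passing from characteristic functions to bounded
  continuous functions of several variables uses trigonometric approximation on a torus (\<open>multivariate_levy_continuity\<close>).
  The Gaussianity of the harmonic coefficients, which are integrals over the sphere and not finite combinations of values
  of the field, comes from approximating such integrals in mean square by averages over well chosen points
  (\<open>msq_sampling\<close>). Orthonormality of the harmonics and the addition theorem are derived from the rotation
  invariance of the surface measure: the derivative along a rotation moves the order \<open>m\<close> one step up and one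
  step down.\<close>

section \<open>Weak convergence from characteristic functions\<close>

lemma compact_product:
  assumes "\<And>i. compact (C i)"
  shows "compact {x. \<forall>i. x i \<in> C i}"
proof -
  have "compactin (product_topology (\<lambda>i. euclidean) UNIV) (PiE UNIV C)"
    using assms by (subst compactin_PiE) auto
  then have "compact (PiE UNIV C)" by (simp add: euclidean_product_topology)
  also have "PiE UNIV C = {x. \<forall>i. x i \<in> C i}" by auto
  finally show ?thesis .
qed

text \<open>Finite sums of cosines of affine forms in the coordinates of \<open>I\<close>, the functions whose expectations are
  controlled by characteristic functions.\<close>

inductive_set trig_span :: "'i set \<Rightarrow> (('i \<Rightarrow> real) \<Rightarrow> real) set" for I where
  cos: "(\<lambda>x. w * cos (b + (\<Sum>i\<in>I. c i * x i))) \<in> trig_span I"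
| add: "f \<in> trig_span I \<Longrightarrow> g \<in> trig_span I \<Longrightarrow> (\<lambda>x. f x + g x) \<in> trig_span I"

lemma trig_span_mult:
  assumes "f \<in> trig_span I" "g \<in> trig_span I"
  shows "(\<lambda>x. f x * g x) \<in> trig_span I"
  using assms(1)
proof induction
  case (cos w b c)
  show ?case using assms(2)
  proof induction
    case (cos w' b' c')
    have "(\<lambda>x. (w * cos (b + (\<Sum>i\<in>I. c i * x i))) * (w' * cos (b' + (\<Sum>i\<in>I. c' i * x i)))) =
      (\<lambda>x. (w * w' / 2) * cos ((b - b') + (\<Sum>i\<in>I. (c i - c' i) * x i)) + (w * w' / 2) * cos ((b + b') + (\<Sum>i\<in>I. (c i + c' i) * x i)))"
    proof
      fix x
      have "w * cos A * (w' * cos B) = (w * w' / 2) * cos (A - B) + (w * w' / 2) * cos (A + B)" for A B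
      proof -
        have "w * cos A * (w' * cos B) = (w * w') * (cos A * cos B)" by simp
        then show ?thesis unfolding cos_times_cos by (simp add: field_simps)
      qed
      moreover have "(b - b') + (\<Sum>i\<in>I. (c i - c' i) * x i) = (b + (\<Sum>i\<in>I. c i * x i)) - (b' + (\<Sum>i\<in>I. c' i * x i))"
        "(b + b') + (\<Sum>i\<in>I. (c i + c' i) * x i) = (b + (\<Sum>i\<in>I. c i * x i)) + (b' + (\<Sum>i\<in>I. c' i * x i))"
        by (simp_all add: left_diff_distrib distrib_right sum_subtractf sum.distrib)
      ultimately show "(w * cos (b + (\<Sum>i\<in>I. c i * x i))) * (w' * cos (b' + (\<Sum>i\<in>I. c' i * x i))) =
        (w * w' / 2) * cos ((b - b') + (\<Sum>i\<in>I. (c i - c' i) * x i)) + (w * w' / 2) * cos ((b + b') + (\<Sum>i\<in>I. (c i + c' i) * x i))"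
        by (simp only:)
    qed
    then show ?case by (simp only:) (rule trig_span.add[OF trig_span.cos trig_span.cos])
  qed (auto simp: distrib_left intro: trig_span.add)
qed (auto simp: distrib_right intro: trig_span.add)

text \<open>Wrapping each coordinate around the unit circle turns trigonometric sums into functions on a compact torus, where
  the Stone-Weierstrass theorem applies. On the box the wrapping is inverted by \<open>y \<mapsto> R arcsin (Im y)\<close>, and this
  formula is continuous on the whole circle; it transports \<open>G\<close> to the torus, and the approximation there bounds the
  trigonometric sum also outside the box.\<close>

lemma trig_span_approximation:
  fixes G :: "('i::countable \<Rightarrow> real) \<Rightarrow> real"
  assumes I: "finite I" and G: "continuous_on UNIV G" and GB: "\<And>x. \<bar>G x\<bar> \<le> B" and R: "R > 0" and e: "e > 0"
  obtains p where "p \<in> trig_span I" "\<And>x. \<bar>p x\<bar> \<le> B + e"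
    "\<And>x. (\<And>i. i \<in> I \<Longrightarrow> \<bar>x i\<bar> \<le> R) \<Longrightarrow> (\<And>i. i \<notin> I \<Longrightarrow> x i = 0) \<Longrightarrow> \<bar>G x - p x\<bar> \<le> e"
proof -
  define q where "q x i = (if i \<in> I then cis (x i / R) else 1)" for x :: "'i \<Rightarrow> real" and i
  define C :: "'i \<Rightarrow> complex set" where "C i = (if i \<in> I then sphere 0 1 else {1})" for i
  define S where "S = {y. \<forall>i. y i \<in> C i}"
  define A where "A = {f. continuous_on S f \<and> (\<lambda>x. f (q x)) \<in> trig_span I}"
  have coord: "continuous_on S (\<lambda>y. y i)" for i by (rule continuous_on_product_then_coordinatewise[OF continuous_on_id])
  have single: "(\<Sum>j\<in>I. (if j = i then 1 / R else 0) * x j) = x i / R" if "i \<in> I" for i and x :: "'i \<Rightarrow> real"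
  proof -
    have "(\<Sum>j\<in>I. (if j = i then 1 / R else 0) * x j) = (\<Sum>j\<in>I. if j = i then x j / R else 0)" by (intro sum.cong) auto
    then show ?thesis using I that by simp
  qed
  interpret function_ring_on A S
  proof
    show "compact S" unfolding S_def C_def by (rule compact_product) auto
    fix x y assume xy: "x \<in> S" "y \<in> S" "x \<noteq> y"
    then obtain i where i: "x i \<noteq> y i" by auto
    with xy have iI: "i \<in> I" by (force simp: S_def C_def split: if_splits)
    have "(\<lambda>x. Re (q x i)) \<in> trig_span I"
      using trig_span.cos[of 1 0 "\<lambda>j. if j = i then 1 / R else 0" I] unfolding single[OF iI] by (simp add: q_def iI)
    then have 1: "(\<lambda>y. Re (y i)) \<in> A" unfolding A_def by (auto intro!: continuous_intros coord)
    have "sin t = cos (- (pi / 2) + t)" for t using cos_add[of "- (pi / 2)" t] by simp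
    then have "(\<lambda>x. Im (q x i)) \<in> trig_span I"
      using trig_span.cos[of 1 "- (pi / 2)" "\<lambda>j. if j = i then 1 / R else 0" I] unfolding single[OF iI] by (simp add: q_def iI)
    then have 2: "(\<lambda>y. Im (y i)) \<in> A" unfolding A_def by (auto intro!: continuous_intros coord)
    show "\<exists>f\<in>A. f x \<noteq> f y" 
    proof (cases "Re (x i) = Re (y i)")
      case True
      then show ?thesis using i by (intro bexI[OF _ 2]) (simp add: complex_eq_iff)
    qed (intro bexI[OF _ 1])
  next
    have "(\<lambda>x. c) \<in> trig_span I" for c :: real using trig_span.cos[of c 0 "\<lambda>_. 0" I] by simp
    then show "(\<lambda>_. c) \<in> A" for c by (simp add: A_def)
  qed (auto simp: A_def intro: continuous_intros trig_span.add trig_span_mult)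
  define r where "r y i = (if i \<in> I then R * arcsin (Im (y i)) else 0)" for y :: "'i \<Rightarrow> complex" and i
  have "continuous_on S r"
  proof (rule continuous_on_coordinatewise_then_product)
    fix i
    have "- 1 \<le> Im (y i) \<and> Im (y i) \<le> 1" if "i \<in> I" "y \<in> S" for y
    proof -
      have "y i \<in> C i" using that by (simp add: S_def)
      then have "cmod (y i) = 1" using that by (simp add: C_def)
      then show ?thesis using abs_Im_le_cmod[of "y i"] by linarith
    qed
    then show "continuous_on S (\<lambda>y. r y i)" unfolding r_def
      by (cases "i \<in> I") (auto intro!: continuous_intros coord)
  qed
  then have "continuous_on S (\<lambda>y. G (r y))" by (rule continuous_on_compose2[OF G]) simp
  from Stone_Weierstrass_basic[OF this e] obtain g where g: "g \<in> A" "\<And>y. y \<in> S \<Longrightarrow> \<bar>G (r y) - g y\<bar> < e" by blast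
  have qS: "q x \<in> S" for x by (simp add: S_def C_def q_def)
  show thesis
  proof (rule that[of "\<lambda>x. g (q x)"])
    show "(\<lambda>x. g (q x)) \<in> trig_span I" using g(1) by (simp add: A_def)
    show "\<bar>g (q x)\<bar> \<le> B + e" for x using g(2)[OF qS[of x]] GB[of "r (q x)"] by linarith
    fix x assume x: "\<And>i. i \<in> I \<Longrightarrow> \<bar>x i\<bar> \<le> R" "\<And>i. i \<notin> I \<Longrightarrow> x i = 0"
    have "arcsin (sin (x i / R)) = x i / R" if "i \<in> I" for i
    proof (rule arcsin_sin)
      have "\<bar>x i / R\<bar> \<le> 1" using x(1)[OF that] R by simp
      then show "- (pi / 2) \<le> x i / R" "x i / R \<le> pi / 2" using pi_ge_two by linarith+
    qed
    then have "r (q x) = x" using x(2) R by (auto simp: r_def q_def fun_eq_iff)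
    then show "\<bar>G x - g (q x)\<bar> \<le> e" using g(2)[OF qS[of x]] by simp
  qed
qed

lemma char_fun_cos_sin:
  assumes "prob_space M" and [measurable]: "(X :: 'w \<Rightarrow> real) \<in> borel_measurable M"
  shows "(CLINT w|M. iexp (X w)) = complex_of_real (LINT w|M. cos (0 + X w)) + \<i> * complex_of_real (LINT w|M. cos (- (pi / 2) + X w))"
proof -
  interpret prob_space M by fact
  have i: "integrable M (\<lambda>w. cos (b + X w))" for b by (rule integrable_const_bound[of _ 1]) auto
  have "iexp x = complex_of_real (cos (0 + x)) + \<i> * complex_of_real (cos (- (pi / 2) + x))" for x :: real
  proof -
    have "cos (- (pi / 2) + x) = sin x" using cos_add[of "- (pi / 2)" x] by simp
    then show ?thesis by (simp add: exp_Euler cos_of_real sin_of_real)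
  qed
  then have "(CLINT w|M. iexp (X w)) = (CLINT w|M. complex_of_real (cos (0 + X w)) + \<i> * complex_of_real (cos (- (pi / 2) + X w)))"
    by simp
  also have "\<dots> = (CLINT w|M. complex_of_real (cos (0 + X w))) + (CLINT w|M. \<i> * complex_of_real (cos (- (pi / 2) + X w)))"
    by (rule Bochner_Integration.integral_add[OF integrable_of_real[OF i] integrable_mult_right[OF integrable_of_real[OF i]]])
  also have "\<dots> = complex_of_real (LINT w|M. cos (0 + X w)) + \<i> * complex_of_real (LINT w|M. cos (- (pi / 2) + X w))"
    by (simp only: integral_mult_right_zero integral_complex_of_real)
  finally show ?thesis .
qed

text \<open>Real part and imaginary part of the characteristic function are the cases \<open>b = 0\<close> and
  \<open>b = - \<pi> / 2\<close> of the hypothesis, so the one-dimensional continuity theorem applies.\<close>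

lemma weak_limit_bounded_continuous:
  fixes X :: "nat \<Rightarrow> 'w \<Rightarrow> real" and X' :: "'v \<Rightarrow> real" and \<psi> :: "real \<Rightarrow> real"
  assumes M: "prob_space M" and M': "prob_space M'"
    and X: "\<And>n. X n \<in> borel_measurable M" and X': "X' \<in> borel_measurable M'"
    and conv: "\<And>b t. (\<lambda>n. LINT w|M. cos (b + t * X n w)) \<longlonglongrightarrow> (LINT w|M'. cos (b + t * X' w))"
    and \<psi>: "continuous_on UNIV \<psi>" "\<And>x. \<bar>\<psi> x\<bar> \<le> B"
  shows "(\<lambda>n. LINT w|M. \<psi> (X n w)) \<longlonglongrightarrow> (LINT w|M'. \<psi> (X' w))"
proof -
  interpret prob_space M by fact
  interpret M': prob_space M' by fact
  note [measurable] = X X'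
  have rd: "real_distribution (distr M borel (X n))" for n
    using prob_space_distr[OF X] by (simp add: real_distribution_def real_distribution_axioms_def)
  have rd': "real_distribution (distr M' borel X')"
    using M'.prob_space_distr[OF X'] by (simp add: real_distribution_def real_distribution_axioms_def)
  have ch: "char (distr M borel (X n)) t = (CLINT w|M. iexp (t * X n w))" for n t
    unfolding char_def by (rule integral_distr[OF X]) simp
  have ch': "char (distr M' borel X') t = (CLINT w|M'. iexp (t * X' w))" for t
    unfolding char_def by (rule integral_distr[OF X']) simp
  have "(\<lambda>n. char (distr M borel (X n)) t) \<longlonglongrightarrow> char (distr M' borel X') t" for t
  proof -
    have m: "(\<lambda>w. t * X n w) \<in> borel_measurable M" "(\<lambda>w. t * X' w) \<in> borel_measurable M'" for n by measurable
    show ?thesis unfolding ch ch' char_fun_cos_sin[OF M m(1)] char_fun_cos_sin[OF M' m(2)]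
      by (intro tendsto_add tendsto_mult tendsto_const tendsto_of_real conv)
  qed
  from weak_conv_imp_integral_bdd_continuous_conv[OF rd rd' levy_continuity[OF rd rd' this], of \<psi> B]
  have "(\<lambda>n. integral\<^sup>L (distr M borel (X n)) \<psi>) \<longlonglongrightarrow> integral\<^sup>L (distr M' borel X') \<psi>"
    using \<psi> by (simp add: continuous_on_eq_continuous_at)
  then show ?thesis using borel_measurable_continuous_onI[OF \<psi>(1)] by (simp add: integral_distr)
qed

lemma trig_span_expectation:
  assumes M: "prob_space M" and v: "\<And>i. (\<lambda>w. v w i) \<in> borel_measurable M" and p: "p \<in> trig_span I"
  shows "integrable M (\<lambda>w. p (v w))"
  using p
proof induction
  case (cos wt b c)
  interpret prob_space M by fact
  show ?case using v by (intro integrable_mult_right integrable_const_bound[where B = 1]) auto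
qed simp

text \<open>The pointwise error bound is meant for a \<open>\<psi>\<close> that equals one outside an interval: where some
  coordinate is large, \<open>G\<close> and \<open>p\<close> are merely bounded.\<close>

lemma trig_span_error:
  fixes G :: "('i::countable \<Rightarrow> real) \<Rightarrow> real"
  assumes G: "continuous_on UNIV G" and GB: "\<And>x. \<bar>G x\<bar> \<le> B" and p: "p \<in> trig_span I"
    and pw: "\<forall>x. (\<forall>i. i \<notin> I \<longrightarrow> x i = 0) \<longrightarrow> \<bar>G x - p x\<bar> \<le> e + C * (\<Sum>i\<in>I. \<psi> (x i))"
    and \<psi>c: "continuous_on UNIV \<psi>" and \<psi>1: "\<And>x::real. \<bar>\<psi> x\<bar> \<le> 1"
    and P: "prob_space P" and vm: "\<And>i. (\<lambda>w. v w i) \<in> borel_measurable P" and v: "\<And>w i. i \<notin> I \<Longrightarrow> v w i = 0"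
  shows "\<bar>(LINT w|P. G (v w)) - (LINT w|P. p (v w))\<bar> \<le> e + C * (\<Sum>i\<in>I. LINT w|P. \<psi> (v w i))"
proof -
  interpret P: prob_space P by fact
  have "(\<lambda>w. G (v w)) \<in> borel_measurable P"
    by (rule measurable_compose[OF measurable_coordinatewise_then_product[OF vm] borel_measurable_continuous_onI[OF G]])
  then have iG: "integrable P (\<lambda>w. G (v w))" using GB by (intro P.integrable_const_bound[where B = B]) auto
  have ip: "integrable P (\<lambda>w. p (v w))" by (rule trig_span_expectation[OF P vm p])
  have i\<psi>: "integrable P (\<lambda>w. \<psi> (v w i))" for i
    using \<psi>1 measurable_compose[OF vm borel_measurable_continuous_onI[OF \<psi>c]] by (intro P.integrable_const_bound[where B = 1]) auto
  have "\<bar>(LINT w|P. G (v w) - p (v w))\<bar> \<le> (LINT w|P. \<bar>G (v w) - p (v w)\<bar>)" by (rule integral_abs_bound)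
  also have "\<dots> \<le> (LINT w|P. e + C * (\<Sum>i\<in>I. \<psi> (v w i)))"
    using iG ip i\<psi> pw v by (intro integral_mono) auto
  also have "\<dots> = e + C * (\<Sum>i\<in>I. LINT w|P. \<psi> (v w i))" using i\<psi> by (simp add: P.prob_space)
  finally show ?thesis using iG ip by simp
qed

text \<open>Expectations of trigonometric sums converge by linearity. They approximate \<open>G\<close> uniformly on a large box, and
  the mass outside the box is controlled coordinate by coordinate by the one-dimensional theorem.\<close>

theorem multivariate_levy_continuity:
  fixes X :: "nat \<Rightarrow> 'i::countable \<Rightarrow> 'w \<Rightarrow> real" and X' :: "'i \<Rightarrow> 'v \<Rightarrow> real"
    and G :: "('i \<Rightarrow> real) \<Rightarrow> real"
  assumes M: "prob_space M" and M': "prob_space M'" and I: "finite I"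
    and X: "\<And>n i. i \<in> I \<Longrightarrow> X n i \<in> borel_measurable M"
    and X': "\<And>i. i \<in> I \<Longrightarrow> integrable M' (X' i)"
    and conv: "\<And>b c. (\<lambda>n. LINT w|M. cos (b + (\<Sum>i\<in>I. c i * X n i w))) \<longlonglongrightarrow> (LINT w|M'. cos (b + (\<Sum>i\<in>I. c i * X' i w)))"
    and G: "continuous_on UNIV G" and GB: "\<And>x. \<bar>G x\<bar> \<le> B"
  shows "(\<lambda>n. LINT w|M. G (\<lambda>i. if i \<in> I then X n i w else 0))
     \<longlonglongrightarrow> (LINT w|M'. G (\<lambda>i. if i \<in> I then X' i w else 0))"
proof (rule LIMSEQ_I)
  interpret prob_space M by fact
  interpret M': prob_space M' by fact
  fix r :: real assume r: "r > 0"
  define V where "V n w i = (if i \<in> I then X n i w else 0)" for n w i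
  define V' where "V' w i = (if i \<in> I then X' i w else 0)" for w i
  have Vm: "(\<lambda>w. V n w i) \<in> borel_measurable M" for n i by (cases "i \<in> I") (simp_all add: V_def X)
  have V'm: "(\<lambda>w. V' w i) \<in> borel_measurable M'" for i
    using borel_measurable_integrable[OF X'] by (cases "i \<in> I") (simp_all add: V'_def)
  have Vz: "V n w i = 0" and V'z: "V' w' i = 0" if "i \<notin> I" for n w w' i using that by (simp_all add: V_def V'_def)
  have B0: "B \<ge> 0" using GB[of undefined] abs_ge_zero order_trans by blast
  \<comment> \<open>The error on the box is at most \<open>e\<close>. The radius \<open>R\<close> makes the expected number of coordinates outside
    the box smaller than \<open>q\<close>; replacing \<open>G\<close> by \<open>p\<close> then costs at most \<open>r / 4\<close> on either side.\<close>
  define e where "e = min 1 (r / 8)"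
  have e: "e > 0" "e \<le> 1" "e \<le> r / 8" using r by (auto simp: e_def)
  define s where "s = (\<Sum>i\<in>I. LINT w|M'. \<bar>X' i w\<bar>)"
  have s0: "s \<ge> 0" unfolding s_def by (intro sum_nonneg Bochner_Integration.integral_nonneg) simp
  define q where "q = r / (8 * (2 * B + 1))"
  have "x * (r / (8 * x)) = r / 8" if "x > 0" for x :: real using that by simp
  from this[of "2 * B + 1"] have q: "q > 0" "(2 * B + 1) * q = r / 8" using r B0 by (simp_all add: q_def del: distrib_left_numeral)
  define R where "R = (s + 1) / q"
  have R: "R > 0" using s0 q by (simp add: R_def)
  define \<psi> :: "real \<Rightarrow> real" where "\<psi> x = min 1 (\<bar>x\<bar> / R)" for x
  have \<psi>0: "0 \<le> \<psi> x" "\<bar>\<psi> x\<bar> \<le> 1" for x using R by (auto simp: \<psi>_def)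
  have \<psi>c: "continuous_on UNIV \<psi>" unfolding \<psi>_def[abs_def] using R by (intro continuous_intros) auto
  obtain p where p: "p \<in> trig_span I" and pB: "\<And>x. \<bar>p x\<bar> \<le> B + e"
    and pG: "\<And>x. (\<And>i. i \<in> I \<Longrightarrow> \<bar>x i\<bar> \<le> R) \<Longrightarrow> (\<And>i. i \<notin> I \<Longrightarrow> x i = 0) \<Longrightarrow> \<bar>G x - p x\<bar> \<le> e"
    by (rule trig_span_approximation[OF I G GB R e(1)]) blast
  have pw: "\<bar>G x - p x\<bar> \<le> e + (2 * B + 1) * (\<Sum>i\<in>I. \<psi> (x i))" if x: "\<forall>i. i \<notin> I \<longrightarrow> x i = 0" for x
  proof (cases "\<forall>i\<in>I. \<bar>x i\<bar> \<le> R")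
    case True
    then have "\<bar>G x - p x\<bar> \<le> e" using pG[of x] x by blast
    moreover have "0 \<le> (2 * B + 1) * (\<Sum>i\<in>I. \<psi> (x i))" using B0 \<psi>0(1) by (intro mult_nonneg_nonneg sum_nonneg) auto
    ultimately show ?thesis by linarith
  next
    case False
    then obtain i where i: "i \<in> I" "\<bar>x i\<bar> > R" by auto
    have "1 = \<psi> (x i)" using i R by (simp add: \<psi>_def)
    also have "\<dots> \<le> (\<Sum>i\<in>I. \<psi> (x i))" by (rule member_le_sum[OF i(1)]) (simp_all add: \<psi>0 I)
    finally have "2 * B + 1 \<le> (2 * B + 1) * (\<Sum>i\<in>I. \<psi> (x i))" using B0 by simp
    then show ?thesis using GB[of x] pB[of x] e by linarith
  qed
  have pw': "\<forall>x. (\<forall>i. i \<notin> I \<longrightarrow> x i = 0) \<longrightarrow> \<bar>G x - p x\<bar> \<le> e + (2 * B + 1) * (\<Sum>i\<in>I. \<psi> (x i))" using pw by blast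
  note err = trig_span_error[OF G GB p pw' \<psi>c \<psi>0(2)]
  have lim\<psi>: "(\<lambda>n. LINT w|M. \<psi> (V n w i)) \<longlonglongrightarrow> (LINT w|M'. \<psi> (V' w i))" if i: "i \<in> I" for i
  proof (rule weak_limit_bounded_continuous[OF M M' Vm V'm _ \<psi>c \<psi>0(2)])
    fix b t
    have "(\<Sum>j\<in>I. (if j = i then t else 0) * x j) = t * x i" for x :: "'i \<Rightarrow> real"
    proof -
      have "(\<Sum>j\<in>I. (if j = i then t else 0) * x j) = (\<Sum>j\<in>I. if j = i then t * x j else 0)" by (intro sum.cong) auto
      then show ?thesis using I i by simp
    qed
    then show "(\<lambda>n. LINT w|M. cos (b + t * V n w i)) \<longlonglongrightarrow> (LINT w|M'. cos (b + t * V' w i))"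
      using conv[of b "\<lambda>j. if j = i then t else 0"] i by (simp add: V_def V'_def)
  qed
  have limp: "(\<lambda>n. LINT w|M. p (V n w)) \<longlonglongrightarrow> (LINT w|M'. p (V' w))"
    using p
  proof induction
    case (cos wt b c)
    have "(\<Sum>i\<in>I. c i * V n w i) = (\<Sum>i\<in>I. c i * X n i w)" "(\<Sum>i\<in>I. c i * V' w' i) = (\<Sum>i\<in>I. c i * X' i w')" for n w w'
      by (simp_all add: V_def V'_def)
    then show ?case using tendsto_mult[OF tendsto_const[of wt] conv[of b c]] by simp
  next
    case (add f g)
    then show ?case
      unfolding Bochner_Integration.integral_add[OF trig_span_expectation[OF M Vm add.hyps(1)] trig_span_expectation[OF M Vm add.hyps(2)]]
        Bochner_Integration.integral_add[OF trig_span_expectation[OF M' V'm add.hyps(1)] trig_span_expectation[OF M' V'm add.hyps(2)]]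
      by (intro tendsto_add)
  qed
  have "(\<Sum>i\<in>I. LINT w|M'. \<psi> (V' w i)) \<le> (\<Sum>i\<in>I. (LINT w|M'. \<bar>X' i w\<bar>) / R)"
  proof (rule sum_mono)
    fix i assume i: "i \<in> I"
    have "(LINT w|M'. \<psi> (V' w i)) \<le> (LINT w|M'. \<bar>X' i w\<bar> / R)"
    proof (rule integral_mono)
      show "integrable M' (\<lambda>w. \<psi> (V' w i))"
        using \<psi>0 measurable_compose[OF V'm borel_measurable_continuous_onI[OF \<psi>c]] by (intro M'.integrable_const_bound[where B = 1]) auto
      show "integrable M' (\<lambda>w. \<bar>X' i w\<bar> / R)" using X'[OF i] by simp
    qed (simp add: \<psi>_def V'_def i)
    then show "(LINT w|M'. \<psi> (V' w i)) \<le> (LINT w|M'. \<bar>X' i w\<bar>) / R" by simp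
  qed
  also have "\<dots> = s / R" by (simp add: s_def sum_divide_distrib)
  also have "\<dots> < q" using s0 q(1) by (simp add: R_def divide_simps mult.commute)
  finally have q': "(\<Sum>i\<in>I. LINT w|M'. \<psi> (V' w i)) < q" .
  have "(\<lambda>n. \<Sum>i\<in>I. LINT w|M. \<psi> (V n w i)) \<longlonglongrightarrow> (\<Sum>i\<in>I. LINT w|M'. \<psi> (V' w i))" by (intro tendsto_sum lim\<psi>)
  from order_tendstoD(2)[OF this q'] have "\<forall>\<^sub>F n in sequentially. (\<Sum>i\<in>I. LINT w|M. \<psi> (V n w i)) < q" .
  moreover have "\<forall>\<^sub>F n in sequentially. dist (LINT w|M. p (V n w)) (LINT w|M'. p (V' w)) < r / 4" using r by (intro tendstoD[OF limp]) simp
  ultimately have "\<forall>\<^sub>F n in sequentially. norm ((LINT w|M. G (V n w)) - (LINT w|M'. G (V' w))) < r"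
  proof eventually_elim
    case (elim n)
    have le: "(2 * B + 1) * x \<le> r / 8" if "x < q" for x
      unfolding q(2)[symmetric] using that B0 by (intro mult_left_mono) auto
    have "\<bar>(LINT w|M. G (V n w)) - (LINT w|M. p (V n w))\<bar> \<le> r / 8 + r / 8"
      using err[where v = "V n", OF M Vm Vz] le[OF elim(1)] e(3) by linarith
    moreover have "\<bar>(LINT w|M'. G (V' w)) - (LINT w|M'. p (V' w))\<bar> \<le> r / 8 + r / 8"
      using err[where v = V', OF M' V'm V'z] le[OF q'] e(3) by linarith
    ultimately show ?case using elim(2) r unfolding dist_real_def real_norm_def by linarith
  qed
  then show "\<exists>no. \<forall>n\<ge>no. norm ((LINT w|M. G (\<lambda>i. if i \<in> I then X n i w else 0)) - (LINT w|M'. G (\<lambda>i. if i \<in> I then X' i w else 0))) < r"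
    unfolding eventually_sequentially V_def V'_def .
qed

lemma abs_mult_cos_le: "\<bar>x\<bar> \<le> B \<Longrightarrow> \<bar>x * cos y\<bar> \<le> (B::real)"
  using mult_left_mono[OF abs_cos_le_one[of y], of "\<bar>x\<bar>"] by (simp add: abs_mult)

section \<open>Centred Gaussian variables\<close>

text \<open>The characteristic function covers degenerate laws and is stable under mean square limits.\<close>

definition cgauss :: "'w measure \<Rightarrow> ('w \<Rightarrow> real) \<Rightarrow> bool" where
  "cgauss M X \<longleftrightarrow> X \<in> borel_measurable M \<and> integrable M (\<lambda>w. (X w)\<^sup>2) \<and>
     (\<forall>u. (CLINT w|M. iexp (u * X w)) = of_real (exp (- (u\<^sup>2 * (LINT w|M. (X w)\<^sup>2)) / 2)))"

definition joint_cgauss :: "'w measure \<Rightarrow> 'i set \<Rightarrow> ('i \<Rightarrow> 'w \<Rightarrow> real) \<Rightarrow> bool" where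
  "joint_cgauss M I X \<longleftrightarrow> (\<forall>J c. finite J \<and> J \<subseteq> I \<longrightarrow> cgauss M (\<lambda>w. \<Sum>i\<in>J. c i * X i w))"

lemma cgauss_measurable [measurable_dest]: "cgauss M X \<Longrightarrow> X \<in> borel_measurable M"
  and cgauss_square_integrable: "cgauss M X \<Longrightarrow> integrable M (\<lambda>w. (X w)\<^sup>2)"
  and cgauss_char: "cgauss M X \<Longrightarrow> (CLINT w|M. iexp (u * X w)) = of_real (exp (- (u\<^sup>2 * (LINT w|M. (X w)\<^sup>2)) / 2))"
  by (auto simp: cgauss_def)

lemma integrable_mult_squares:
  fixes X Y :: "'w \<Rightarrow> real"
  assumes [measurable]: "X \<in> borel_measurable M" "Y \<in> borel_measurable M"
    and "integrable M (\<lambda>w. (X w)\<^sup>2)" "integrable M (\<lambda>w. (Y w)\<^sup>2)"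
  shows "integrable M (\<lambda>w. X w * Y w)"
proof (rule Bochner_Integration.integrable_bound)
  show "integrable M (\<lambda>w. (X w)\<^sup>2 + (Y w)\<^sup>2)" using assms(3,4) by simp
  have "\<bar>x * y\<bar> \<le> x\<^sup>2 + y\<^sup>2" for x y :: real
    using sum_squares_bound[of "\<bar>x\<bar>" "\<bar>y\<bar>"] abs_ge_zero[of "x * y"] unfolding abs_mult power2_abs by linarith
  then show "AE w in M. norm (X w * Y w) \<le> norm ((X w)\<^sup>2 + (Y w)\<^sup>2)"
    by (intro AE_I2) (simp add: abs_of_nonneg)
qed measurable

text \<open>A centred Gaussian law is the law of a multiple of a standard normal variable, which also covers the
  degenerate case.\<close>

lemma cgauss_distr:
  assumes "prob_space M" "cgauss M X"
  shows "distr M borel X = distr std_normal_distribution borel (\<lambda>x. sqrt (LINT w|M. (X w)\<^sup>2) * x)"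
proof -
  interpret prob_space M by fact
  interpret N: real_distribution std_normal_distribution by (rule real_dist_normal_dist)
  note [measurable] = cgauss_measurable[OF assms(2)]
  define s where "s = sqrt (LINT w|M. (X w)\<^sup>2)"
  have s2: "s\<^sup>2 = (LINT w|M. (X w)\<^sup>2)" unfolding s_def by (simp add: Bochner_Integration.integral_nonneg)
  have "prob_space (distr std_normal_distribution borel (\<lambda>x. s * x))"
    by (rule N.prob_space_distr) simp
  then have 1: "real_distribution (distr std_normal_distribution borel (\<lambda>x. s * x))"
    by (simp add: real_distribution_def real_distribution_axioms_def)
  have "prob_space (distr M borel X)" by (rule prob_space_distr) simp
  then have 2: "real_distribution (distr M borel X)"
    by (simp add: real_distribution_def real_distribution_axioms_def)
  have "char (distr M borel X) u = char (distr std_normal_distribution borel (\<lambda>x. s * x)) u" for u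
  proof -
    have "char (distr std_normal_distribution borel (\<lambda>x. s * x)) u = char std_normal_distribution (u * s)"
      unfolding char_def by (subst integral_distr) (auto simp: mult.assoc)
    also have "\<dots> = of_real (exp (- (u\<^sup>2 * s\<^sup>2) / 2))"
      by (simp add: char_std_normal_distribution power_mult_distrib)
    also have "\<dots> = char (distr M borel X) u"
      unfolding char_def using cgauss_char[OF assms(2), of u] by (subst integral_distr) (simp_all add: s2)
    finally show ?thesis by simp
  qed
  then show ?thesis using Levy_uniqueness[OF 2 1] unfolding s_def by blast
qed

lemma cgauss_mean_zero:
  assumes "prob_space M" "cgauss M X"
  shows "(LINT w|M. X w) = 0"
proof -
  note [measurable] = cgauss_measurable[OF assms(2)]
  have "(LINT w|M. X w) = (\<integral>x. x \<partial>distr M borel X)" by (subst integral_distr) auto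
  also have "\<dots> = sqrt (LINT w|M. (X w)\<^sup>2) * (LINT x|std_normal_distribution. x ^ (2 * 0 + 1))"
    unfolding cgauss_distr[OF assms] by (subst integral_distr) auto
  also have "\<dots> = 0" by (subst integral_std_normal_distribution_moment_odd) auto
  finally show ?thesis .
qed

lemma cgauss_fourth_moment:
  assumes "prob_space M" "cgauss M X"
  shows "integrable M (\<lambda>w. (X w) ^ 4)" "(LINT w|M. (X w) ^ 4) = 3 * (LINT w|M. (X w)\<^sup>2)\<^sup>2"
proof -
  note [measurable] = cgauss_measurable[OF assms(2)]
  define s where "s = sqrt (LINT w|M. (X w)\<^sup>2)"
  have s2: "s\<^sup>2 = (LINT w|M. (X w)\<^sup>2)" unfolding s_def by (simp add: Bochner_Integration.integral_nonneg)
  note d = cgauss_distr[OF assms, folded s_def]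
  have i: "integrable std_normal_distribution (\<lambda>x. x ^ 4)"
    by (rule integrable_std_normal_distribution_moment)
  have "integrable (distr M borel X) (\<lambda>x. x ^ 4)"
    unfolding d by (subst integrable_distr_eq) (use i in \<open>auto simp: power_mult_distrib\<close>)
  then show "integrable M (\<lambda>w. (X w) ^ 4)" by (subst (asm) integrable_distr_eq) auto
  have "(LINT w|M. (X w) ^ 4) = (\<integral>x. x ^ 4 \<partial>distr M borel X)" by (subst integral_distr) auto
  also have "\<dots> = s ^ 4 * (LINT x|std_normal_distribution. x ^ (2 * 2))"
    unfolding d by (subst integral_distr) (auto simp: power_mult_distrib)
  also have "\<dots> = 3 * s ^ 4" by (subst std_normal_distribution_even_moments(1)) (simp add: fact_numeral)
  finally show "(LINT w|M. (X w) ^ 4) = 3 * (LINT w|M. (X w)\<^sup>2)\<^sup>2" unfolding s2[symmetric] by simp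
qed

lemma cgauss_imp_gaussian_rv:
  assumes "prob_space M" "cgauss M X"
  shows "gaussian_rv M X"
proof -
  interpret prob_space M by fact
  note [measurable] = cgauss_measurable[OF assms(2)]
  define s where "s = sqrt (LINT w|M. (X w)\<^sup>2)"
  have s0: "s \<ge> 0" unfolding s_def by (simp add: Bochner_Integration.integral_nonneg)
  note d = cgauss_distr[OF assms, folded s_def]
  show ?thesis
  proof (cases "s = 0")
    case True
    have "AE x in distr M borel X. x = 0" unfolding d True by (subst AE_distr_iff) auto
    then have "AE w in M. X w = 0" by (subst (asm) AE_distr_iff) auto
    then show ?thesis unfolding gaussian_rv_def by auto
  next
    case False
    interpret N: prob_space std_normal_distribution 
      using real_dist_normal_dist by (simp add: real_distribution_def)
    have "distributed std_normal_distribution lborel (\<lambda>x. x) (\<lambda>x. ennreal (std_normal_density x))"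
      unfolding distributed_def by (auto simp: distr_id2 intro: distr_cong)
    then have "distributed std_normal_distribution lborel (\<lambda>x. 0 + s * x) (\<lambda>x. ennreal (normal_density (0 + s * 0) (\<bar>s\<bar> * 1) x))"
      using False by (intro N.normal_density_affine) auto
    then have "distr std_normal_distribution lborel (\<lambda>x. s * x) = density lborel (\<lambda>x. ennreal (normal_density 0 s x))"
      using s0 by (simp add: distributed_def)
    moreover have "distr M lborel X = distr M borel X" "distr std_normal_distribution lborel (\<lambda>x. s * x) = distr std_normal_distribution borel (\<lambda>x. s * x)"
      by (auto intro: distr_cong)
    ultimately have "distributed M lborel X (\<lambda>x. ennreal (normal_density 0 s x))"
      unfolding distributed_def using d by simp
    then show ?thesis unfolding gaussian_rv_def using False s0 
      by (intro conjI disjI2 exI[of _ "0::real"] exI[of _ s]) auto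
  qed
qed

lemma gaussian_rv_imp_cgauss:
  assumes "prob_space M" "gaussian_rv M X" "(LINT w|M. X w) = 0"
  shows "cgauss M X"
proof -
  interpret prob_space M by fact
  have [measurable]: "X \<in> borel_measurable M" using assms(2) by (simp add: gaussian_rv_def)
  from assms(2) consider (c) \<mu> where "AE w in M. X w = \<mu>"
    | (n) \<mu> \<sigma> where "\<sigma> > 0" "distributed M lborel X (\<lambda>x. ennreal (normal_density \<mu> \<sigma> x))"
    unfolding gaussian_rv_def by blast
  then show ?thesis
  proof cases
    case c
    then have "(LINT w|M. X w) = (LINT w|M. \<mu>)" by (intro integral_cong_AE) auto
    then have "\<mu> = 0" using assms(3) by (simp add: prob_space)
    with c have 0: "AE w in M. X w = 0" by simp
    have "integrable M (\<lambda>w. (X w)\<^sup>2) \<longleftrightarrow> integrable M (\<lambda>w. 0::real)"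
      by (intro integrable_cong_AE) (use 0 in auto)
    moreover have "(LINT w|M. (X w)\<^sup>2) = (LINT w|M. 0)"
      by (intro integral_cong_AE) (use 0 in auto)
    moreover have "(CLINT w|M. iexp (u * X w)) = (CLINT w|M. 1)" for u
      by (intro integral_cong_AE) (use 0 in auto)
    ultimately show ?thesis by (simp add: cgauss_def prob_space)
  next
    case n
    have mu: "\<mu> = 0" using normal_distributed_expectation[OF n] assms(3) by simp
    have var: "(LINT w|M. (X w)\<^sup>2) = \<sigma>\<^sup>2"
      using normal_distributed_variance[OF n] assms(3) by simp
    have std: "distributed M lborel (\<lambda>x. X x / \<sigma>) (\<lambda>x. ennreal (std_normal_density x))"
      using n normal_standard_normal_convert[of \<sigma> X \<mu>] mu by simp
    then have dd: "distr M borel (\<lambda>x. X x / \<sigma>) = std_normal_distribution"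
      unfolding distributed_def by (metis distr_cong sets_lborel)
    have "(CLINT w|M. iexp (u * X w)) = of_real (exp (- (u\<^sup>2 * \<sigma>\<^sup>2) / 2))" for u
    proof -
      have "(CLINT w|M. iexp (u * X w)) = (CLINT w|M. iexp ((u * \<sigma>) * (X w / \<sigma>)))"
        using n(1) by simp
      also have "\<dots> = char (distr M borel (\<lambda>x. X x / \<sigma>)) (u * \<sigma>)"
        unfolding char_def by (subst integral_distr) auto
      finally show ?thesis unfolding dd by (simp add: char_std_normal_distribution power_mult_distrib)
    qed
    moreover have "integrable M (\<lambda>w. (X w)\<^sup>2)"
      using var n(1) not_integrable_integral_eq by fastforce
    ultimately show ?thesis using var by (simp add: cgauss_def)
  qed
qed

lemma (in prob_space) integrable_iexp_real:
  assumes [measurable]: "f \<in> borel_measurable M"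
  shows "complex_integrable M (\<lambda>w. iexp (f w))"
  by (rule integrable_const_bound[where B=1]) auto

lemma iexp_lipschitz: "norm (iexp x - iexp y) \<le> \<bar>x - y\<bar>"
proof -
  have "norm (iexp (x - y) - 1) \<le> \<bar>x - y\<bar>" using iexp_approx1[of "x - y" 0] by simp
  moreover have "iexp x - iexp y = iexp y * (iexp (x - y) - 1)"
    by (simp add: right_diff_distrib exp_add[symmetric])
  ultimately show ?thesis by (simp add: norm_mult)
qed

lemma (in prob_space) expectation_abs_le_L2:
  fixes X :: "'a \<Rightarrow> real"
  assumes [measurable]: "X \<in> borel_measurable M" and i: "integrable M (\<lambda>w. (X w)\<^sup>2)"
  shows "(LINT w|M. \<bar>X w\<bar>) \<le> sqrt (LINT w|M. (X w)\<^sup>2)"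
proof -
  have ia: "integrable M (\<lambda>w. \<bar>X w\<bar>)" using square_integrable_imp_integrable[OF _ i] by simp
  have "0 \<le> variance (\<lambda>w. \<bar>X w\<bar>)" by simp
  also have "\<dots> = (LINT w|M. (X w)\<^sup>2) - (LINT w|M. \<bar>X w\<bar>)\<^sup>2"
    by (subst variance_eq[OF ia]) (use i in auto)
  finally show ?thesis by (intro real_le_rsqrt) simp
qed

lemma L2_triangle:
  fixes X Y :: "'w \<Rightarrow> real"
  assumes [measurable]: "X \<in> borel_measurable M" "Y \<in> borel_measurable M"
    and i: "integrable M (\<lambda>w. (X w)\<^sup>2)" "integrable M (\<lambda>w. (Y w)\<^sup>2)"
  shows "integrable M (\<lambda>w. (X w + Y w)\<^sup>2)"
    and "\<bar>\<integral>w. X w * Y w \<partial>M\<bar> \<le> sqrt (LINT w|M. (X w)\<^sup>2) * sqrt (LINT w|M. (Y w)\<^sup>2)"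
    and "sqrt (LINT w|M. (X w + Y w)\<^sup>2) \<le> sqrt (LINT w|M. (X w)\<^sup>2) + sqrt (LINT w|M. (Y w)\<^sup>2)"
proof -
  have ixy: "integrable M (\<lambda>w. X w * Y w)" using i by (intro integrable_mult_squares) auto
  define a b c where "a = (LINT w|M. (X w)\<^sup>2)" and "b = (LINT w|M. (Y w)\<^sup>2)" and "c = (LINT w|M. X w * Y w)"
  have ex: "(s * X w + t * Y w)\<^sup>2 = s\<^sup>2 * (X w)\<^sup>2 + 2 * s * t * (X w * Y w) + t\<^sup>2 * (Y w)\<^sup>2" for s t w
    by (simp add: power2_eq_square algebra_simps)
  have q: "0 \<le> s\<^sup>2 * a + 2 * s * t * c + t\<^sup>2 * b" for s t
  proof -
    have "0 \<le> (LINT w|M. (s * X w + t * Y w)\<^sup>2)" by (simp add: Bochner_Integration.integral_nonneg)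
    also have "\<dots> = s\<^sup>2 * a + 2 * s * t * c + t\<^sup>2 * b"
      unfolding ex a_def b_def c_def using i ixy by simp
    finally show ?thesis .
  qed
  show i2: "integrable M (\<lambda>w. (X w + Y w)\<^sup>2)"
    using i ixy ex[of 1 _ 1] by simp
  have ab: "a \<ge> 0" "b \<ge> 0" unfolding a_def b_def by (simp_all add: Bochner_Integration.integral_nonneg)
  have c2: "c\<^sup>2 \<le> a * b"
  proof (cases "a = 0")
    case True
    have "c = 0"
    proof (rule ccontr)
      assume "c \<noteq> 0"
      then show False using q[of "- (b + 1) / (2 * c)" 1] True by (simp add: field_simps)
    qed
    then show ?thesis using True by simp
  next
    case False
    then have "0 < a" using ab by simp
    have "0 \<le> c\<^sup>2 * a + 2 * (-c) * a * c + a\<^sup>2 * b" using q[of "-c" a] by simp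
    then have "0 \<le> a * (a * b - c\<^sup>2)" by (simp add: power2_eq_square algebra_simps)
    then show ?thesis using \<open>0 < a\<close> by (simp add: zero_le_mult_iff)
  qed
  have cs: "\<bar>c\<bar> \<le> sqrt a * sqrt b" using c2 by (metis real_sqrt_abs real_sqrt_le_iff real_sqrt_mult)
  then show "\<bar>\<integral>w. X w * Y w \<partial>M\<bar> \<le> sqrt (LINT w|M. (X w)\<^sup>2) * sqrt (LINT w|M. (Y w)\<^sup>2)"
    unfolding a_def b_def c_def .
  have "(LINT w|M. (X w + Y w)\<^sup>2) = a + 2 * c + b"
    using ex[of 1 _ 1] i ixy unfolding a_def b_def c_def by simp
  also have "\<dots> \<le> (sqrt a + sqrt b)\<^sup>2" using cs ab by (simp add: power2_sum)
  finally show "sqrt (LINT w|M. (X w + Y w)\<^sup>2) \<le> sqrt (LINT w|M. (X w)\<^sup>2) + sqrt (LINT w|M. (Y w)\<^sup>2)"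
    unfolding a_def[symmetric] b_def[symmetric] using ab by (intro real_le_lsqrt) auto
qed

text \<open>Characteristic functions depend on the variable in a Lipschitz way with respect to the mean distance, so they and
  the variances pass to the limit together.\<close>

lemma cgauss_L2_limit:
  assumes "prob_space M" and X: "\<And>n. cgauss M (X n)" and [measurable]: "Y \<in> borel_measurable M"
    and iY: "integrable M (\<lambda>w. (Y w)\<^sup>2)"
    and lim: "(\<lambda>n. LINT w|M. (X n w - Y w)\<^sup>2) \<longlonglongrightarrow> 0"
  shows "cgauss M Y"
proof -
  interpret prob_space M by fact
  have Xm [measurable]: "X n \<in> borel_measurable M" for n using X cgauss_measurable by blast
  have iX: "integrable M (\<lambda>w. (X n w)\<^sup>2)" for n using X cgauss_square_integrable by blast
  have iD: "integrable M (\<lambda>w. (X n w - Y w)\<^sup>2)" for n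
    using L2_triangle(1)[of "X n" M "\<lambda>w. - Y w"] iX iY by simp
  define s where "s = sqrt (LINT w|M. (Y w)\<^sup>2)"
  define d where "d n = sqrt (LINT w|M. (X n w - Y w)\<^sup>2)" for n
  define x where "x n = sqrt (LINT w|M. (X n w)\<^sup>2)" for n
  have d0: "d \<longlonglongrightarrow> 0" unfolding d_def using tendsto_real_sqrt[OF lim] by simp
  have "\<bar>x n - s\<bar> \<le> d n" for n
  proof -
    have "x n \<le> d n + s"
      using L2_triangle(3)[of "\<lambda>w. X n w - Y w" M Y] iD iY unfolding x_def d_def s_def by simp
    moreover have "s \<le> d n + x n"
      using L2_triangle(3)[of "\<lambda>w. Y w - X n w" M "X n"] iD iX unfolding x_def d_def s_def 
      by (simp add: power2_commute)
    ultimately show ?thesis by linarith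
  qed
  then have "(\<lambda>n. x n - s) \<longlonglongrightarrow> 0" by (intro Lim_null_comparison[OF _ d0]) auto
  then have xs: "x \<longlonglongrightarrow> s" by (simp add: LIM_zero_iff)
  have "(CLINT w|M. iexp (u * Y w)) = of_real (exp (- (u\<^sup>2 * s\<^sup>2) / 2))" for u
  proof -
    define A where "A = (\<lambda>n. CLINT w|M. iexp (u * X n w))"
    define B where "B = (CLINT w|M. iexp (u * Y w))"
    have 1: "(\<lambda>n. (CLINT w|M. iexp (u * X n w))) \<longlonglongrightarrow> of_real (exp (- (u\<^sup>2 * s\<^sup>2) / 2))"
    proof -
    have "(\<lambda>n. complex_of_real (exp (- (u\<^sup>2 * (x n)\<^sup>2) / 2))) \<longlonglongrightarrow> of_real (exp (- (u\<^sup>2 * s\<^sup>2) / 2))"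
      by (intro tendsto_intros xs) auto
    moreover have "complex_of_real (exp (- (u\<^sup>2 * (x n)\<^sup>2) / 2)) = (CLINT w|M. iexp (u * X n w))" for n
      using cgauss_char[OF X, of u n] unfolding x_def by (simp add: Bochner_Integration.integral_nonneg)
    ultimately show ?thesis by (simp only:)
    qed
    have nb: "norm (A n - B) \<le> \<bar>u\<bar> * d n" for n
    proof -
      have ii: "integrable M (\<lambda>w. iexp (u * X n w))" "integrable M (\<lambda>w. iexp (u * Y w))"
        by (rule integrable_iexp_real; measurable)+
      have iabs: "integrable M (\<lambda>w. \<bar>X n w - Y w\<bar>)"
        by (rule integrable_abs[OF square_integrable_imp_integrable[OF _ iD[of n]]]) measurable
      have "norm (A n - B) 
         = norm (CLINT w|M. iexp (u * X n w) - iexp (u * Y w))"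
        unfolding A_def B_def by (simp only: Bochner_Integration.integral_diff[OF ii])
      also have "\<dots> \<le> (LINT w|M. \<bar>u\<bar> * \<bar>X n w - Y w\<bar>)"
      proof (intro integral_norm_bound[THEN order_trans] integral_mono)
        fix w show "norm (iexp (u * X n w) - iexp (u * Y w)) \<le> \<bar>u\<bar> * \<bar>X n w - Y w\<bar>"
          using iexp_lipschitz[of "u * X n w" "u * Y w"] by (simp add: right_diff_distrib[symmetric] abs_mult)
        show "integrable M (\<lambda>w. norm (iexp (u * X n w) - iexp (u * Y w)))"
          by (rule integrable_norm[OF Bochner_Integration.integrable_diff[OF ii]])
        show "integrable M (\<lambda>w. \<bar>u\<bar> * \<bar>X n w - Y w\<bar>)" using iabs by (rule integrable_mult_right)
      qed
      also have "\<dots> \<le> \<bar>u\<bar> * d n"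
        unfolding d_def using expectation_abs_le_L2[OF _ iD[of n]] by (simp add: mult_left_mono)
      finally show ?thesis .
    qed
    have lim0: "(\<lambda>n. \<bar>u\<bar> * d n) \<longlonglongrightarrow> 0" using tendsto_mult_right_zero[OF d0] by simp
    have 2: "(\<lambda>n. A n - B) \<longlonglongrightarrow> 0"
      by (rule Lim_null_comparison[OF always_eventually[OF allI[OF nb]] lim0])
    have "A \<longlonglongrightarrow> B" using LIM_zero_cancel[OF 2] .
    moreover have "A \<longlonglongrightarrow> of_real (exp (- (u\<^sup>2 * s\<^sup>2) / 2))" using 1 unfolding A_def .
    ultimately have "B = of_real (exp (- (u\<^sup>2 * s\<^sup>2) / 2))" by (rule LIMSEQ_unique)
    then show ?thesis unfolding B_def .
  qed
  moreover have "s\<^sup>2 = (LINT w|M. (Y w)\<^sup>2)" unfolding s_def by (simp add: Bochner_Integration.integral_nonneg)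
  ultimately show ?thesis using iY by (simp add: cgauss_def)
qed

lemma joint_cgauss_lincomb2:
  assumes "joint_cgauss M I X" "i \<in> I" "j \<in> I"
  shows "cgauss M (\<lambda>w. a * X i w + b * X j w)"
proof (cases "i = j")
  case True
  have "cgauss M (\<lambda>w. \<Sum>k\<in>{i}. (a + b) * X k w)"
    using assms unfolding joint_cgauss_def by (elim allE[of _ "{i}"] allE[of _ "\<lambda>_. a + b"]) auto
  then show ?thesis using True by (simp add: distrib_right)
next
  case False
  have "cgauss M (\<lambda>w. \<Sum>k\<in>{i,j}. (if k = i then a else b) * X k w)"
    using assms unfolding joint_cgauss_def by (elim allE[of _ "{i,j}"] allE[of _ "\<lambda>k. if k = i then a else b"]) auto
  then show ?thesis using False by simp
qed

lemma joint_cgauss_single: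
  assumes "joint_cgauss M I X" "i \<in> I"
  shows "cgauss M (X i)"
  using joint_cgauss_lincomb2[OF assms assms(2), of 1 0] by simp

lemma quartic_polarization:
  fixes x y :: real
  shows "x\<^sup>2 * y\<^sup>2 = ((x + y) ^ 4 + (x - y) ^ 4 - 2 * x ^ 4 - 2 * y ^ 4) / 12"
proof -
  define u v where "u = x\<^sup>2 + y\<^sup>2" and "v = 2 * x * y"
  have "(x + y)\<^sup>2 = u + v" "(x - y)\<^sup>2 = u - v"
    by (simp_all add: u_def v_def power2_sum power2_diff)
  then have "(x + y) ^ 4 = (u + v)\<^sup>2" "(x - y) ^ 4 = (u - v)\<^sup>2"
    by (metis mult_2 numeral_Bit0 power2_eq_square power_add)+
  then have 1: "(x + y) ^ 4 + (x - y) ^ 4 = 2 * u\<^sup>2 + 2 * v\<^sup>2"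
    by (simp add: power2_sum power2_diff)
  have 2: "u\<^sup>2 = x ^ 4 + 2 * (x\<^sup>2 * y\<^sup>2) + y ^ 4" "v\<^sup>2 = 4 * (x\<^sup>2 * y\<^sup>2)"
    by (simp_all add: u_def v_def power2_sum power_mult_distrib)
  have "12 * (x\<^sup>2 * y\<^sup>2) = (x + y) ^ 4 + (x - y) ^ 4 - 2 * x ^ 4 - 2 * y ^ 4"
    unfolding 1 2 by (simp add: algebra_simps)
  then show ?thesis by simp
qed

text \<open>By polarisation, the fourth moments of the sum and difference of two jointly Gaussian variables give
  the covariance of their squares.\<close>

lemma cgauss_squares_covariance:
  assumes M: "prob_space M" and g: "\<And>a b. cgauss M (\<lambda>w. a * X w + b * Y w)"
  shows "integrable M (\<lambda>w. (X w)\<^sup>2 * (Y w)\<^sup>2)"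
    and "(LINT w|M. (X w)\<^sup>2 * (Y w)\<^sup>2) = (LINT w|M. (X w)\<^sup>2) * (LINT w|M. (Y w)\<^sup>2) + 2 * (LINT w|M. X w * Y w)\<^sup>2"
proof -
  have X: "cgauss M X" and Y: "cgauss M Y" and S: "cgauss M (\<lambda>w. X w + Y w)" and D: "cgauss M (\<lambda>w. X w - Y w)"
    using g[of 1 0] g[of 0 1] g[of 1 1] g[of 1 "-1"] by simp_all
  note i4 = cgauss_fourth_moment(1)[OF M X] cgauss_fourth_moment(1)[OF M Y] 
    cgauss_fourth_moment(1)[OF M S] cgauss_fourth_moment(1)[OF M D]
  note i2 = cgauss_square_integrable[OF X] cgauss_square_integrable[OF Y]
  have ixy: "integrable M (\<lambda>w. X w * Y w)"
    using X Y by (intro integrable_mult_squares) (auto simp: cgauss_def)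
  define a b c where "a = (LINT w|M. (X w)\<^sup>2)" and "b = (LINT w|M. (Y w)\<^sup>2)" and "c = (LINT w|M. X w * Y w)"
  have id: "(X w)\<^sup>2 * (Y w)\<^sup>2 = ((X w + Y w) ^ 4 + (X w - Y w) ^ 4 - 2 * (X w) ^ 4 - 2 * (Y w) ^ 4) / 12" for w
    by (rule quartic_polarization)
  show "integrable M (\<lambda>w. (X w)\<^sup>2 * (Y w)\<^sup>2)"
    unfolding id using i4 by simp
  have sq: "(LINT w|M. (X w + Y w)\<^sup>2) = a + 2 * c + b" "(LINT w|M. (X w - Y w)\<^sup>2) = a - 2 * c + b"
  proof -
    have e: "(X w + Y w)\<^sup>2 = (X w)\<^sup>2 + 2 * (X w * Y w) + (Y w)\<^sup>2"
        "(X w - Y w)\<^sup>2 = (X w)\<^sup>2 - 2 * (X w * Y w) + (Y w)\<^sup>2" for w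
      by (simp_all add: power2_sum power2_diff)
    have ixy2: "integrable M (\<lambda>w. 2 * (X w * Y w))" using ixy by (rule integrable_mult_right)
    show "(LINT w|M. (X w + Y w)\<^sup>2) = a + 2 * c + b"
      unfolding e a_def b_def c_def
      by (simp only: Bochner_Integration.integral_add Bochner_Integration.integrable_add i2 ixy2 integral_mult_right_zero)
    show "(LINT w|M. (X w - Y w)\<^sup>2) = a - 2 * c + b"
      unfolding e a_def b_def c_def
      by (simp only: Bochner_Integration.integral_add Bochner_Integration.integral_diff Bochner_Integration.integrable_diff i2 ixy2 integral_mult_right_zero)
  qed
  have "(LINT w|M. (X w)\<^sup>2 * (Y w)\<^sup>2) = ((LINT w|M. (X w + Y w) ^ 4) + (LINT w|M. (X w - Y w) ^ 4)
      - 2 * (LINT w|M. (X w) ^ 4) - 2 * (LINT w|M. (Y w) ^ 4)) / 12"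
    unfolding id using i4 by simp
  also have "\<dots> = (3 * (a + 2 * c + b)\<^sup>2 + 3 * (a - 2 * c + b)\<^sup>2 - 2 * (3 * a\<^sup>2) - 2 * (3 * b\<^sup>2)) / 12"
    unfolding cgauss_fourth_moment(2)[OF M X] cgauss_fourth_moment(2)[OF M Y]
      cgauss_fourth_moment(2)[OF M S] cgauss_fourth_moment(2)[OF M D] sq a_def[symmetric] b_def[symmetric] ..
  also have "\<dots> = a * b + 2 * c\<^sup>2"
    by (simp add: power2_eq_square) (simp add: field_simps)
  finally show "(LINT w|M. (X w)\<^sup>2 * (Y w)\<^sup>2) = (LINT w|M. (X w)\<^sup>2) * (LINT w|M. (Y w)\<^sup>2) + 2 * (LINT w|M. X w * Y w)\<^sup>2"
    unfolding a_def b_def c_def .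
qed

section \<open>Decoupling and the exponential martingale\<close>

lemma integrable_bounded_comp:
  fixes G :: "('i::countable \<Rightarrow> real) \<Rightarrow> real"
  assumes "prob_space M" and V: "\<And>i. (\<lambda>w. V w i) \<in> borel_measurable M"
    and G: "continuous_on UNIV G" "\<And>x. \<bar>G x\<bar> \<le> B"
  shows "integrable M (\<lambda>w. G (V w))"
proof -
  interpret prob_space M by fact
  have [measurable]: "G \<in> borel_measurable borel" using G(1) by (rule borel_measurable_continuous_onI)
  have [measurable]: "V \<in> borel_measurable M" using V by (rule measurable_coordinatewise_then_product)
  show ?thesis by (rule integrable_const_bound[where B=B]) (use G(2) in auto)
qed

lemma cgauss_integral_cos:
  assumes "prob_space M" "cgauss M X"
  shows "(LINT w|M. cos (s + X w)) = exp (- (LINT w|M. (X w)\<^sup>2) / 2) * cos s"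
proof -
  interpret prob_space M by fact
  note [measurable] = cgauss_measurable[OF assms(2)]
  have i: "complex_integrable M (\<lambda>w. iexp s * iexp (X w))"
    by (rule integrable_mult_right[OF integrable_iexp_real]) measurable
  have "(LINT w|M. cos (s + X w)) = (LINT w|M. Re (iexp s * iexp (X w)))"
    by (intro Bochner_Integration.integral_cong) (simp_all add: cos_add Re_exp Im_exp)
  also have "\<dots> = Re (CLINT w|M. iexp s * iexp (X w))"
    by (rule integral_Re[OF i])
  also have "\<dots> = Re (iexp s * of_real (exp (- (LINT w|M. (X w)\<^sup>2) / 2)))"
    using cgauss_char[OF assms(2), of 1] by (simp only: integral_mult_right_zero mult_1 power_one)
  finally show ?thesis by (simp add: Re_exp)
qed

text \<open>Uncorrelated blocks of a jointly Gaussian family are independent, in the form that the second block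
  may be replaced by a copy on a second factor of the sample space: linear combinations of both families have the same
  centred normal laws, so the multivariate continuity theorem, applied to a constant sequence, identifies the expectations.\<close>

lemma gaussian_decoupling:
  fixes X :: "'i::countable \<Rightarrow> 'w \<Rightarrow> real" and G :: "('i \<Rightarrow> real) \<Rightarrow> real"
  assumes M: "prob_space M" and P: "finite P" and Q: "finite Q" and PQ: "P \<inter> Q = {}"
    and X: "joint_cgauss M (P \<union> Q) X"
    and orth: "\<And>p q. p \<in> P \<Longrightarrow> q \<in> Q \<Longrightarrow> (LINT w|M. X p w * X q w) = 0"
    and G: "continuous_on UNIV G" and GB: "\<And>x. \<bar>G x\<bar> \<le> B"
  shows "(LINT w|M. G (\<lambda>i. if i \<in> P \<union> Q then X i w else 0)) =
    (LINT w1|M. (LINT w2|M. G (\<lambda>i. if i \<in> P then X i w1 else if i \<in> Q then X i w2 else 0)))"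
proof -
  interpret prob_space M by fact
  interpret MM: pair_prob_space M M ..
  have Xg: "cgauss M (X i)" if "i \<in> P \<union> Q" for i using joint_cgauss_single[OF X that] .
  have Xm: "X i \<in> borel_measurable M" if "i \<in> P \<union> Q" for i using Xg[OF that] by (rule cgauss_measurable)
  define X' where "X' i w = (if i \<in> P then X i (fst w) else X i (snd w))" for i and w :: "'w \<times> 'w"
  have X'i: "integrable (M \<Otimes>\<^sub>M M) (X' i)" if i: "i \<in> P \<union> Q" for i
  proof -
    have "integrable M (X i)" using Xm[OF i] cgauss_square_integrable[OF Xg[OF i]] by (rule square_integrable_imp_integrable)
    then have "integrable (M \<Otimes>\<^sub>M M) (\<lambda>w. X i (fst w))" "integrable (M \<Otimes>\<^sub>M M) (\<lambda>w. X i (snd w))"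
      using Xm[OF i] by (auto intro!: MM.Fubini_integrable)
    then show ?thesis unfolding X'_def[abs_def] by (cases "i \<in> P") auto
  qed
  have sumPQ: "(\<Sum>i\<in>P \<union> Q. f i) = (\<Sum>i\<in>P. f i) + (\<Sum>i\<in>Q. f i)" for f :: "'i \<Rightarrow> real"
    by (rule sum.union_disjoint[OF P Q PQ])
  have ch: "(LINT w|M. cos (b + (\<Sum>i\<in>P \<union> Q. c i * X i w))) = (\<integral>w. cos (b + (\<Sum>i\<in>P \<union> Q. c i * X' i w)) \<partial>(M \<Otimes>\<^sub>M M))" for b c
  proof -
    define U where "U w = (\<Sum>i\<in>P. c i * X i w)" for w
    define W where "W w = (\<Sum>i\<in>Q. c i * X i w)" for w
    have Ug: "cgauss M U" and Wg: "cgauss M W"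
      using X P Q unfolding joint_cgauss_def U_def[abs_def] W_def[abs_def] by blast+
    note [measurable] = cgauss_measurable[OF Ug] cgauss_measurable[OF Wg]
    have sq: "integrable M (\<lambda>w. (U w)\<^sup>2)" "integrable M (\<lambda>w. (W w)\<^sup>2)" "integrable M (\<lambda>w. U w * W w)"
      using cgauss_square_integrable[OF Ug] cgauss_square_integrable[OF Wg] by (auto intro: integrable_mult_squares)
    have UW: "(LINT w|M. U w * W w) = 0"
    proof -
      have i: "integrable M (\<lambda>w. X i w * X j w)" if "i \<in> P" "j \<in> Q" for i j
        using that Xg[of i] Xg[of j] by (intro integrable_mult_squares) (auto simp: cgauss_def)
      have "(LINT w|M. U w * W w) = (LINT w|M. (\<Sum>i\<in>P. \<Sum>j\<in>Q. c i * c j * (X i w * X j w)))"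
        unfolding U_def W_def sum_product by (simp add: mult_ac)
      also have "\<dots> = (\<Sum>i\<in>P. \<Sum>j\<in>Q. c i * c j * (LINT w|M. X i w * X j w))"
        using i by (subst Bochner_Integration.integral_sum; (intro sum.cong refl Bochner_Integration.integrable_sum integrable_mult_right)?; simp?)
      also have "\<dots> = 0" using orth by simp
      finally show ?thesis .
    qed
    have sqsum: "(LINT w|M. (U w + W w)\<^sup>2) = (LINT w|M. (U w)\<^sup>2) + (LINT w|M. (W w)\<^sup>2)"
    proof -
      have "(LINT w|M. (U w + W w)\<^sup>2) = (LINT w|M. (U w)\<^sup>2 + (W w)\<^sup>2 + 2 * (U w * W w))"
        by (simp add: power2_sum mult.assoc)
      then show ?thesis using sq UW by simp
    qed
    have UWg: "cgauss M (\<lambda>w. U w + W w)"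
      using X P Q unfolding joint_cgauss_def U_def W_def sumPQ[symmetric] by blast
    have X'UW: "(\<Sum>i\<in>P \<union> Q. c i * X' i w) = U (fst w) + W (snd w)" for w :: "'w \<times> 'w"
    proof -
      have "(\<Sum>i\<in>Q. c i * X' i w) = W (snd w)" unfolding W_def X'_def using PQ by (intro sum.cong refl) auto
      then show ?thesis unfolding sumPQ by (simp add: U_def X'_def)
    qed
    have "integrable (M \<Otimes>\<^sub>M M) (\<lambda>w. cos (b + (U (fst w) + W (snd w))))"
      by (rule MM.integrable_const_bound[where B = 1]) auto
    from MM.integral_fst'[OF this] have "(\<integral>w. cos (b + (U (fst w) + W (snd w))) \<partial>(M \<Otimes>\<^sub>M M)) =
       (LINT w1|M. (LINT w2|M. cos ((b + U w1) + W w2)))" by (simp add: add.assoc)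
    also have "\<dots> = exp (- (LINT w|M. (W w)\<^sup>2) / 2) * (exp (- (LINT w|M. (U w)\<^sup>2) / 2) * cos b)"
      unfolding cgauss_integral_cos[OF M Wg] integral_mult_right_zero cgauss_integral_cos[OF M Ug] ..
    also have "\<dots> = (LINT w|M. cos (b + (U w + W w)))"
      unfolding cgauss_integral_cos[OF M UWg] sqsum by (simp add: exp_add[symmetric] mult.assoc[symmetric] add_divide_distrib)
    finally show ?thesis unfolding X'UW by (simp add: sumPQ U_def W_def)
  qed
  have "(\<lambda>n::nat. LINT w|M. G (\<lambda>i. if i \<in> P \<union> Q then X i w else 0)) \<longlonglongrightarrow> 
     (\<integral>w. G (\<lambda>i. if i \<in> P \<union> Q then X' i w else 0) \<partial>(M \<Otimes>\<^sub>M M))"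
    by (rule multivariate_levy_continuity[OF M MM.prob_space_axioms _ Xm X'i _ G GB]) (use P Q ch in simp_all)
  then have "(LINT w|M. G (\<lambda>i. if i \<in> P \<union> Q then X i w else 0)) = (\<integral>w. G (\<lambda>i. if i \<in> P \<union> Q then X' i w else 0) \<partial>(M \<Otimes>\<^sub>M M))"
    by (rule LIMSEQ_unique[OF tendsto_const])
  also have "(\<lambda>w. G (\<lambda>i. if i \<in> P \<union> Q then X' i w else 0)) 
       = (\<lambda>w. G (\<lambda>i. if i \<in> P then X i (fst w) else if i \<in> Q then X i (snd w) else 0))"
    by (intro ext arg_cong[where f=G]) (auto simp: X'_def)
  also have "(\<integral>w. G (\<lambda>i. if i \<in> P then X i (fst w) else if i \<in> Q then X i (snd w) else 0) \<partial>(M \<Otimes>\<^sub>M M)) = 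
    (LINT w1|M. (LINT w2|M. G (\<lambda>i. if i \<in> P then X i w1 else if i \<in> Q then X i w2 else 0)))"
  proof -
    have "integrable (M \<Otimes>\<^sub>M M) (\<lambda>w. G (\<lambda>i. if i \<in> P then X i (fst w) else if i \<in> Q then X i (snd w) else 0))"
    proof (rule integrable_bounded_comp[OF MM.prob_space_axioms _ G GB])
      fix i
      have "i \<in> P \<or> i \<in> Q \<or> i \<notin> P \<union> Q" by blast
      then show "(\<lambda>w. if i \<in> P then X i (fst w) else if i \<in> Q then X i (snd w) else 0) \<in> borel_measurable (M \<Otimes>\<^sub>M M)"
        using Xm[of i] measurable_compose[OF measurable_fst[of M M], of "X i"] measurable_compose[OF measurable_snd[of M M], of "X i"]
        by auto
    qed
    from MM.integral_fst'[OF this] show ?thesis unfolding fst_conv snd_conv by (rule sym)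
  qed
  finally show ?thesis .
qed

lemma (in prob_space) integrable_cos:
  fixes f :: "'a \<Rightarrow> real"
  assumes [measurable]: "f \<in> borel_measurable M"
  shows "integrable M (\<lambda>w. cos (f w))"
  by (rule integrable_const_bound[where B=1]) (auto intro!: AE_I2)

text \<open>Conditionally on the block \<open>P\<close>, the linear combination of the block \<open>Q\<close> is Gaussian with
  the conditionally known variance, so its characteristic function is explicit.\<close>

lemma gaussian_conditional_cos:
  fixes X :: "'i::countable \<Rightarrow> 'w \<Rightarrow> real" and h s :: "('i \<Rightarrow> real) \<Rightarrow> real" and y :: "'i \<Rightarrow> ('i \<Rightarrow> real) \<Rightarrow> real"
  assumes M: "prob_space M" and P: "finite P" and Q: "finite Q" and PQ: "P \<inter> Q = {}"
    and X: "joint_cgauss M (P \<union> Q) X"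
    and orth: "\<And>p q. p \<in> P \<Longrightarrow> q \<in> Q \<Longrightarrow> (LINT w|M. X p w * X q w) = 0"
    and orthQ: "\<And>q q'. q \<in> Q \<Longrightarrow> q' \<in> Q \<Longrightarrow> (LINT w|M. X q w * X q' w) = (if q = q' then v q else 0)"
    and hc: "continuous_on UNIV h" and hB: "\<And>x. \<bar>h x\<bar> \<le> B"
    and sc: "continuous_on UNIV s" and yc: "\<And>q. continuous_on UNIV (y q)"
    and VP: "VP = (\<lambda>w i. if i \<in> P then X i w else 0)"
  shows "(LINT w|M. h (VP w) * cos (s (VP w) + (\<Sum>q\<in>Q. y q (VP w) * X q w))) =
    (LINT w|M. h (VP w) * exp (- (\<Sum>q\<in>Q. v q * (y q (VP w))\<^sup>2) / 2) * cos (s (VP w)))"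
proof -
  interpret prob_space M by fact
  define R where "R x = (\<lambda>i. if i \<in> P then x i else 0)" for x :: "'i \<Rightarrow> real"
  have Rc: "continuous_on UNIV R"
  proof (rule continuous_on_coordinatewise_then_product)
    fix i show "continuous_on UNIV (\<lambda>x. R x i)"
      unfolding R_def by (cases "i \<in> P") (auto intro: continuous_on_product_coordinates)
  qed
  have cR: "continuous_on UNIV (\<lambda>x. f (R x))" if "continuous_on UNIV f" for f :: "('i \<Rightarrow> real) \<Rightarrow> real"
    by (rule continuous_on_compose2[OF that Rc]) auto
  define G where "G x = h (R x) * cos (s (R x) + (\<Sum>q\<in>Q. y q (R x) * x q))" for x
  have Gc: "continuous_on UNIV G"
    unfolding G_def by (intro continuous_intros cR hc sc yc continuous_on_product_coordinates)
  have GB: "\<bar>G x\<bar> \<le> B" for x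
    unfolding G_def using hB by (rule abs_mult_cos_le)
  have Qg: "(LINT w|M. cos (a + (\<Sum>q\<in>Q. b q * X q w))) = exp (- (\<Sum>q\<in>Q. v q * (b q)\<^sup>2) / 2) * cos a" for a and b :: "'i \<Rightarrow> real"
  proof -
    have g: "cgauss M (\<lambda>w. \<Sum>q\<in>Q. b q * X q w)" using X Q unfolding joint_cgauss_def by blast
    have Xg: "cgauss M (X i)" if "i \<in> Q" for i using joint_cgauss_single[OF X] that by blast
    have i: "integrable M (\<lambda>w. X i w * X j w)" if "i \<in> Q" "j \<in> Q" for i j
      using that Xg[of i] Xg[of j] by (intro integrable_mult_squares) (auto simp: cgauss_def)
    have "(LINT w|M. (\<Sum>q\<in>Q. b q * X q w)\<^sup>2) = (LINT w|M. (\<Sum>i\<in>Q. \<Sum>j\<in>Q. b i * b j * (X i w * X j w)))"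
      unfolding power2_eq_square sum_product by (simp add: mult_ac)
    also have "\<dots> = (\<Sum>i\<in>Q. \<Sum>j\<in>Q. b i * b j * (LINT w|M. X i w * X j w))"
      using i by (subst Bochner_Integration.integral_sum; (intro sum.cong refl Bochner_Integration.integrable_sum integrable_mult_right)?; simp?)
    also have "\<dots> = (\<Sum>i\<in>Q. \<Sum>j\<in>Q. if i = j then b i * b i * v i else 0)"
      by (intro sum.cong refl) (simp add: orthQ)
    also have "\<dots> = (\<Sum>i\<in>Q. v i * (b i)\<^sup>2)" using Q by (simp add: power2_eq_square mult_ac)
    finally show ?thesis using cgauss_integral_cos[OF M g, of a] by simp
  qed
  have "(LINT w|M. h (VP w) * cos (s (VP w) + (\<Sum>q\<in>Q. y q (VP w) * X q w))) = 
     (LINT w|M. G (\<lambda>i. if i \<in> P \<union> Q then X i w else 0))"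
  proof (rule Bochner_Integration.integral_cong[OF refl])
    fix w
    have "R (\<lambda>i. if i \<in> P \<union> Q then X i w else 0) = VP w" by (auto simp: R_def VP)
    then show "h (VP w) * cos (s (VP w) + (\<Sum>q\<in>Q. y q (VP w) * X q w)) = G (\<lambda>i. if i \<in> P \<union> Q then X i w else 0)"
      unfolding G_def by simp
  qed
  also have "\<dots> = (LINT w1|M. (LINT w2|M. G (\<lambda>i. if i \<in> P then X i w1 else if i \<in> Q then X i w2 else 0)))"
    by (rule gaussian_decoupling[OF M P Q PQ X orth Gc GB])
  also have "\<dots> = (LINT w1|M. h (VP w1) * exp (- (\<Sum>q\<in>Q. v q * (y q (VP w1))\<^sup>2) / 2) * cos (s (VP w1)))"
  proof (rule Bochner_Integration.integral_cong[OF refl])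
    fix w1
    have R: "R (\<lambda>i. if i \<in> P then X i w1 else if i \<in> Q then X i w2 else 0) = VP w1" for w2 by (auto simp: R_def VP)
    have S: "(\<Sum>q\<in>Q. y q (VP w1) * (if q \<in> P then X q w1 else if q \<in> Q then X q w2 else 0)) = (\<Sum>q\<in>Q. y q (VP w1) * X q w2)" for w2
      using PQ by (intro sum.cong refl) auto
    show "(LINT w2|M. G (\<lambda>i. if i \<in> P then X i w1 else if i \<in> Q then X i w2 else 0)) = 
      h (VP w1) * exp (- (\<Sum>q\<in>Q. v q * (y q (VP w1))\<^sup>2) / 2) * cos (s (VP w1))"
      unfolding G_def R S integral_mult_right_zero Qg by simp
  qed
  finally show ?thesis .
qed

text \<open>The predictable multiplier \<open>trunc_factor\<close> switches the sum off, continuously, once the accumulated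
  conditional variance exceeds \<open>K\<close>; the truncated variance then never exceeds \<open>K + 1\<close>.\<close>

definition step_var :: "'a set \<Rightarrow> ('a \<Rightarrow> real) \<Rightarrow> ('a \<Rightarrow> nat \<Rightarrow> real) \<Rightarrow> nat \<Rightarrow> real" where
  "step_var A c y t = (\<Sum>\<alpha>\<in>A. c \<alpha> * (y \<alpha> t)\<^sup>2)"

definition trunc_factor :: "'a set \<Rightarrow> ('a \<Rightarrow> real) \<Rightarrow> real \<Rightarrow> ('a \<Rightarrow> nat \<Rightarrow> real) \<Rightarrow> nat \<Rightarrow> real" where
  "trunc_factor A c K y t = max 0 (min 1 (K + 1 - (\<Sum>s<Suc t. step_var A c y s)))"

definition trunc_sum :: "'a set \<Rightarrow> ('a \<Rightarrow> real) \<Rightarrow> real \<Rightarrow> ('a \<Rightarrow> nat \<Rightarrow> real) \<Rightarrow> ('a \<Rightarrow> nat \<Rightarrow> real) \<Rightarrow> nat \<Rightarrow> real" where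
  "trunc_sum A c K y e n = (\<Sum>t<n. \<Sum>\<alpha>\<in>A. trunc_factor A c K y t * y \<alpha> t * e \<alpha> t)"

definition trunc_var :: "'a set \<Rightarrow> ('a \<Rightarrow> real) \<Rightarrow> real \<Rightarrow> ('a \<Rightarrow> nat \<Rightarrow> real) \<Rightarrow> nat \<Rightarrow> real" where
  "trunc_var A c K y n = (\<Sum>t<n. (trunc_factor A c K y t)\<^sup>2 * step_var A c y t)"

lemma step_var_nonneg: "(\<And>\<alpha>. \<alpha> \<in> A \<Longrightarrow> 0 \<le> c \<alpha>) \<Longrightarrow> 0 \<le> step_var A c y t"
  unfolding step_var_def by (intro sum_nonneg) simp

lemma trunc_factor_bounds: "0 \<le> trunc_factor A c K y t" "trunc_factor A c K y t \<le> 1"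
  unfolding trunc_factor_def by auto

lemma trunc_var_bounds:
  assumes c: "\<And>\<alpha>. \<alpha> \<in> A \<Longrightarrow> 0 \<le> c \<alpha>" and K: "0 \<le> K"
  shows "0 \<le> trunc_var A c K y n" and "trunc_var A c K y n \<le> K + 1"
    and "trunc_var A c K y n \<le> (\<Sum>t<n. step_var A c y t)"
proof -
  note sv = step_var_nonneg[of A c y, OF c]
  show "0 \<le> trunc_var A c K y n" unfolding trunc_var_def using sv by (intro sum_nonneg) simp
  have "trunc_var A c K y n \<le> K + 1 \<and> trunc_var A c K y n \<le> (\<Sum>t<n. step_var A c y t)"
  proof (induction n)
    case 0
    then show ?case using K by (simp add: trunc_var_def)
  next
    case (Suc n)
    have rec: "trunc_var A c K y (Suc n) = trunc_var A c K y n + (trunc_factor A c K y n)\<^sup>2 * step_var A c y n"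
      by (simp add: trunc_var_def)
    show ?case
    proof (cases "(\<Sum>t<Suc n. step_var A c y t) \<ge> K + 1")
      case True
      then have "trunc_factor A c K y n = 0" by (simp add: trunc_factor_def)
      then show ?thesis using Suc rec sv[of n] by simp
    next
      case False
      have "(trunc_factor A c K y n)\<^sup>2 * step_var A c y n \<le> 1 * step_var A c y n"
        using trunc_factor_bounds[of A c K y n] sv[of n] by (intro mult_right_mono) (simp_all add: power_le_one)
      then show ?thesis using Suc rec False by simp
    qed
  qed
  then show "trunc_var A c K y n \<le> K + 1" and "trunc_var A c K y n \<le> (\<Sum>t<n. step_var A c y t)" by auto
qed

lemma trunc_inactive:
  assumes c: "\<And>\<alpha>. \<alpha> \<in> A \<Longrightarrow> 0 \<le> c \<alpha>" and W: "(\<Sum>t<n. step_var A c y t) \<le> K"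
  shows "trunc_var A c K y n = (\<Sum>t<n. step_var A c y t)"
    and "trunc_sum A c K y e n = (\<Sum>t<n. \<Sum>\<alpha>\<in>A. y \<alpha> t * e \<alpha> t)"
proof -
  have one: "trunc_factor A c K y t = 1" if "t < n" for t
  proof -
    have "(\<Sum>s<Suc t. step_var A c y s) \<le> (\<Sum>s<n. step_var A c y s)"
      using that step_var_nonneg[of A c y, OF c] by (intro sum_mono2) auto
    then show ?thesis using W unfolding trunc_factor_def by linarith
  qed
  show "trunc_var A c K y n = (\<Sum>t<n. step_var A c y t)"
    unfolding trunc_var_def by (intro sum.cong) (simp_all add: one)
  show "trunc_sum A c K y e n = (\<Sum>t<n. \<Sum>\<alpha>\<in>A. y \<alpha> t * e \<alpha> t)"
    unfolding trunc_sum_def by (intro sum.cong) (simp_all add: one)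
qed

lemma trunc_continuous:
  fixes y e :: "'a \<Rightarrow> nat \<Rightarrow> 'x::topological_space \<Rightarrow> real"
  assumes "\<And>\<alpha> t. continuous_on UNIV (y \<alpha> t)" "\<And>\<alpha> t. continuous_on UNIV (e \<alpha> t)"
  shows "continuous_on UNIV (\<lambda>x. trunc_factor A c K (\<lambda>\<alpha> t. y \<alpha> t x) t)"
    and "continuous_on UNIV (\<lambda>x. trunc_sum A c K (\<lambda>\<alpha> t. y \<alpha> t x) (\<lambda>\<alpha> t. e \<alpha> t x) n)"
    and "continuous_on UNIV (\<lambda>x. trunc_var A c K (\<lambda>\<alpha> t. y \<alpha> t x) n)"
  unfolding trunc_sum_def trunc_var_def trunc_factor_def step_var_def
  by (intro continuous_intros assms)+

lemma step_var_cong: "(\<And>\<alpha>. \<alpha> \<in> A \<Longrightarrow> y \<alpha> t = y' \<alpha> t) \<Longrightarrow> step_var A c y t = step_var A c y' t"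
  unfolding step_var_def by (intro sum.cong) auto

lemma trunc_factor_cong:
  "(\<And>\<alpha> s. \<alpha> \<in> A \<Longrightarrow> s \<le> t \<Longrightarrow> y \<alpha> s = y' \<alpha> s) \<Longrightarrow> trunc_factor A c K y t = trunc_factor A c K y' t"
  unfolding trunc_factor_def by (intro arg_cong[where f="\<lambda>x. max 0 (min 1 (K + 1 - x))"] sum.cong step_var_cong) auto

lemma trunc_sum_cong:
  "(\<And>\<alpha> s. \<alpha> \<in> A \<Longrightarrow> s < n \<Longrightarrow> y \<alpha> s = y' \<alpha> s) \<Longrightarrow> (\<And>\<alpha> s. \<alpha> \<in> A \<Longrightarrow> s < n \<Longrightarrow> e \<alpha> s = e' \<alpha> s) \<Longrightarrow>
    trunc_sum A c K y e n = trunc_sum A c K y' e' n"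
  unfolding trunc_sum_def 
  by (intro sum.cong refl arg_cong2[where f="(*)"] trunc_factor_cong) auto

lemma trunc_var_cong:
  "(\<And>\<alpha> s. \<alpha> \<in> A \<Longrightarrow> s < n \<Longrightarrow> y \<alpha> s = y' \<alpha> s) \<Longrightarrow> trunc_var A c K y n = trunc_var A c K y' n"
  unfolding trunc_var_def 
  by (intro sum.cong refl arg_cong2[where f="(*)"] arg_cong2[where f="power"] trunc_factor_cong step_var_cong) auto

text \<open>Because the noise of a step is Gaussian and independent of the past, compensating the phase by half the
  accumulated conditional variance gives an exact martingale.\<close>

lemma gaussian_exponential_martingale:
  fixes y e :: "'a::countable \<Rightarrow> nat \<Rightarrow> 'w \<Rightarrow> real"
  assumes M: "prob_space M" and A: "finite A"
    and J: "joint_cgauss M (UNIV \<times> A \<times> UNIV) (\<lambda>(b, \<alpha>, t). if b then e \<alpha> t else y \<alpha> t)"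
    and ee: "\<And>\<alpha> \<beta> s t. \<alpha> \<in> A \<Longrightarrow> \<beta> \<in> A \<Longrightarrow> (LINT w|M. e \<alpha> s w * e \<beta> t w) = (if \<alpha> = \<beta> \<and> s = t then c \<alpha> else 0)"
    and ye: "\<And>\<alpha> \<beta> s t. \<alpha> \<in> A \<Longrightarrow> \<beta> \<in> A \<Longrightarrow> s \<le> t \<Longrightarrow> (LINT w|M. y \<alpha> s w * e \<beta> t w) = 0"
    and c: "\<And>\<alpha>. \<alpha> \<in> A \<Longrightarrow> 0 \<le> c \<alpha>" and K: "0 \<le> K"
  shows "(LINT w|M. exp (trunc_var A c K (\<lambda>\<alpha> t. y \<alpha> t w) n / 2) *
      cos (a + trunc_sum A c K (\<lambda>\<alpha> t. y \<alpha> t w) (\<lambda>\<alpha> t. e \<alpha> t w) n)) = cos a"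
proof (induction n)
  case 0
  interpret prob_space M by fact
  show ?case by (simp add: trunc_var_def trunc_sum_def prob_space)
next
  case (Suc n)
  define X where "X = (\<lambda>(b, \<alpha>, t). if b then e \<alpha> t else y \<alpha> t)"
  define P where "P = {True} \<times> A \<times> {..<n} \<union> {False} \<times> A \<times> {..n}"
  define Q where "Q = {True} \<times> A \<times> {n}"
  define VP where "VP = (\<lambda>w i. if i \<in> P then X i w else 0)"
  define Y where "Y x = (\<lambda>\<alpha> t. x (False, \<alpha>, t))" for x :: "bool \<times> 'a \<times> nat \<Rightarrow> real"
  define E where "E x = (\<lambda>\<alpha> t. x (True, \<alpha>, t))" for x :: "bool \<times> 'a \<times> nat \<Rightarrow> real"
  define h where "h x = exp (trunc_var A c K (Y x) (Suc n) / 2)" for x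
  define s where "s x = a + trunc_sum A c K (Y x) (E x) n" for x
  define g where "g q x = trunc_factor A c K (Y x) n * Y x (fst (snd q)) n" for q :: "bool \<times> 'a \<times> nat" and x
  have P: "finite P" "finite Q" "P \<inter> Q = {}" using A by (auto simp: P_def Q_def)
  have JX: "joint_cgauss M (P \<union> Q) X"
    using J unfolding joint_cgauss_def X_def[symmetric] P_def Q_def by blast
  have tc: "continuous_on UNIV (\<lambda>x. trunc_factor A c K (Y x) t)"
     "continuous_on UNIV (\<lambda>x. trunc_sum A c K (Y x) (E x) m)"
     "continuous_on UNIV (\<lambda>x. trunc_var A c K (Y x) m)" for t m
    unfolding Y_def E_def
    by (rule trunc_continuous(1)[where e="\<lambda>\<alpha> t x. 0"] trunc_continuous(2) trunc_continuous(3)[where e="\<lambda>\<alpha> t x. 0"];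
        intro continuous_intros continuous_on_product_coordinates)+
  have hc: "continuous_on UNIV h" unfolding h_def by (intro continuous_intros tc) simp
  have hB: "\<bar>h x\<bar> \<le> exp ((K + 1) / 2)" for x
    unfolding h_def using trunc_var_bounds(2)[of A c K "Y x" "Suc n", OF c K] by simp
  have sc: "continuous_on UNIV s" unfolding s_def by (intro continuous_intros tc)
  have gc: "continuous_on UNIV (g q)" for q
    unfolding g_def Y_def by (intro continuous_intros tc[unfolded Y_def] continuous_on_product_coordinates)
  have orth: "(LINT w|M. X p w * X q w) = 0" if "p \<in> P" "q \<in> Q" for p q
  proof -
    from that(2) obtain \<beta> where q: "q = (True, \<beta>, n)" "\<beta> \<in> A" by (auto simp: Q_def)
    from that(1) consider \<alpha> t where "p = (True, \<alpha>, t)" "\<alpha> \<in> A" "t < n" | \<alpha> t where "p = (False, \<alpha>, t)" "\<alpha> \<in> A" "t \<le> n"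
      unfolding P_def by blast
    then show ?thesis
    proof cases
      case 1 then show ?thesis using q ee[of \<alpha> \<beta> t n] by (simp add: X_def)
    next
      case 2 then show ?thesis using q ye[of \<alpha> \<beta> t n] by (simp add: X_def)
    qed
  qed
  have orthQ: "(LINT w|M. X q w * X q' w) = (if q = q' then c (fst (snd q)) else 0)" if "q \<in> Q" "q' \<in> Q" for q q'
  proof -
    obtain \<alpha> \<beta> where "q = (True, \<alpha>, n)" "q' = (True, \<beta>, n)" "\<alpha> \<in> A" "\<beta> \<in> A" using \<open>q \<in> Q\<close> \<open>q' \<in> Q\<close> by (auto simp: Q_def)
    then show ?thesis using ee[of \<alpha> \<beta> n n] by (simp add: X_def)
  qed
  note cond = gaussian_conditional_cos[OF M P JX orth orthQ hc hB sc gc VP_def]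
  have YVP: "Y (VP w) \<alpha> t = y \<alpha> t w" if "\<alpha> \<in> A" "t \<le> n" for w \<alpha> t
    using that by (simp add: Y_def VP_def P_def X_def)
  have EVP: "E (VP w) \<alpha> t = e \<alpha> t w" if "\<alpha> \<in> A" "t < n" for w \<alpha> t
    using that by (simp add: E_def VP_def P_def X_def)
  have hV: "h (VP w) = exp (trunc_var A c K (\<lambda>\<alpha> t. y \<alpha> t w) (Suc n) / 2)" for w
    unfolding h_def using trunc_var_cong[of A "Suc n" "Y (VP w)" "\<lambda>\<alpha> t. y \<alpha> t w"] YVP by auto
  have sV: "s (VP w) = a + trunc_sum A c K (\<lambda>\<alpha> t. y \<alpha> t w) (\<lambda>\<alpha> t. e \<alpha> t w) n" for w
    unfolding s_def using trunc_sum_cong[of A n "Y (VP w)" "\<lambda>\<alpha> t. y \<alpha> t w" "E (VP w)" "\<lambda>\<alpha> t. e \<alpha> t w"] YVP EVP by auto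
  have gV: "g (b, \<alpha>, t) (VP w) = trunc_factor A c K (\<lambda>\<alpha> t. y \<alpha> t w) n * y \<alpha> n w" if "\<alpha> \<in> A" for b \<alpha> t w
    unfolding g_def using trunc_factor_cong[of A n "Y (VP w)" "\<lambda>\<alpha> t. y \<alpha> t w"] YVP that by auto
  have sumQ: "(\<Sum>q\<in>Q. f q) = (\<Sum>\<alpha>\<in>A. f (True, \<alpha>, n))" for f :: "bool \<times> 'a \<times> nat \<Rightarrow> real"
    unfolding Q_def by (rule sum.reindex_bij_witness[where i="\<lambda>\<alpha>. (True, \<alpha>, n)" and j="\<lambda>q. fst (snd q)"]) auto
  have 1: "(\<Sum>q\<in>Q. g q (VP w) * X q w) = (\<Sum>\<alpha>\<in>A. trunc_factor A c K (\<lambda>\<alpha> t. y \<alpha> t w) n * y \<alpha> n w * e \<alpha> n w)" for w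
    unfolding sumQ by (intro sum.cong refl) (simp add: gV X_def)
  have 2: "(\<Sum>q\<in>Q. c (fst (snd q)) * (g q (VP w))\<^sup>2) = (trunc_factor A c K (\<lambda>\<alpha> t. y \<alpha> t w) n)\<^sup>2 * step_var A c (\<lambda>\<alpha> t. y \<alpha> t w) n" for w
    unfolding sumQ step_var_def sum_distrib_left by (intro sum.cong refl) (simp add: gV power_mult_distrib)
  have "(LINT w|M. exp (trunc_var A c K (\<lambda>\<alpha> t. y \<alpha> t w) (Suc n) / 2) *
      cos (a + trunc_sum A c K (\<lambda>\<alpha> t. y \<alpha> t w) (\<lambda>\<alpha> t. e \<alpha> t w) (Suc n))) = 
     (LINT w|M. h (VP w) * cos (s (VP w) + (\<Sum>q\<in>Q. g q (VP w) * X q w)))"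
    unfolding hV sV 1 by (simp add: trunc_sum_def add.assoc)
  also have "\<dots> = (LINT w|M. h (VP w) * exp (- (\<Sum>q\<in>Q. c (fst (snd q)) * (g q (VP w))\<^sup>2) / 2) * cos (s (VP w)))"
    by (rule cond)
  also have "\<dots> = (LINT w|M. exp (trunc_var A c K (\<lambda>\<alpha> t. y \<alpha> t w) n / 2) *
      cos (a + trunc_sum A c K (\<lambda>\<alpha> t. y \<alpha> t w) (\<lambda>\<alpha> t. e \<alpha> t w) n))"
    unfolding hV sV 2 exp_add[symmetric] by (simp add: trunc_var_def add_divide_distrib)
  finally show ?case using Suc by simp
qed

lemma abs_exp_diff_le:
  fixes x y :: real
  assumes "x \<le> b" "y \<le> b"
  shows "\<bar>exp x - exp y\<bar> \<le> exp b * \<bar>x - y\<bar>"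
proof -
  have *: "exp v - exp u \<le> exp b * (v - u)" if "u \<le> v" "v \<le> b" for u v :: real
  proof -
    have "1 - exp (u - v) \<le> v - u" using exp_ge_add_one_self[of "u - v"] by linarith
    then have "exp v * (1 - exp (u - v)) \<le> exp v * (v - u)" by (intro mult_left_mono) auto
    also have "\<dots> \<le> exp b * (v - u)" using that by (intro mult_right_mono) auto
    finally show ?thesis by (simp add: right_diff_distrib exp_add[symmetric])
  qed
  show ?thesis using *[of x y] *[of y x] assms by (cases "x \<le> y") (auto simp: abs_if)
qed

text \<open>The compensator in the exponential martingale converges to the constant \<open>exp (\<sigma> / 2)\<close>, and dividing by it
  leaves the characteristic function of the sum. The truncation at level \<open>\<sigma> + 1\<close> is inactive with probability
  tending to one.\<close>

theorem gaussian_martingale_clt: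
  fixes y :: "nat \<Rightarrow> 'a::countable \<Rightarrow> nat \<Rightarrow> 'w \<Rightarrow> real" and e :: "'a \<Rightarrow> nat \<Rightarrow> 'w \<Rightarrow> real"
  assumes M: "prob_space M" and A: "finite A"
    and J: "\<And>N. joint_cgauss M (UNIV \<times> A \<times> UNIV) (\<lambda>(b, \<alpha>, t). if b then e \<alpha> t else y N \<alpha> t)"
    and ee: "\<And>\<alpha> \<beta> s t. \<alpha> \<in> A \<Longrightarrow> \<beta> \<in> A \<Longrightarrow> (LINT w|M. e \<alpha> s w * e \<beta> t w) = (if \<alpha> = \<beta> \<and> s = t then c \<alpha> else 0)"
    and ye: "\<And>N \<alpha> \<beta> s t. \<alpha> \<in> A \<Longrightarrow> \<beta> \<in> A \<Longrightarrow> s \<le> t \<Longrightarrow> (LINT w|M. y N \<alpha> s w * e \<beta> t w) = 0"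
    and c: "\<And>\<alpha>. \<alpha> \<in> A \<Longrightarrow> 0 \<le> c \<alpha>" and \<sigma>: "0 \<le> \<sigma>"
    and conv: "(\<lambda>N. LINT w|M. \<bar>(\<Sum>t<N. \<Sum>\<alpha>\<in>A. c \<alpha> * (y N \<alpha> t w)\<^sup>2) - \<sigma>\<bar>) \<longlonglongrightarrow> 0"
  shows "(\<lambda>N. LINT w|M. cos (a + (\<Sum>t<N. \<Sum>\<alpha>\<in>A. y N \<alpha> t w * e \<alpha> t w))) \<longlonglongrightarrow> exp (- \<sigma> / 2) * cos a"
proof -
  interpret prob_space M by fact
  define K where "K = \<sigma> + 1"
  have K: "0 \<le> K" using \<sigma> by (simp add: K_def)
  define Y where "Y N w = (\<lambda>\<alpha> t. y N \<alpha> t w)" for N w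
  define E where "E w = (\<lambda>\<alpha> t. e \<alpha> t w)" for w
  define W where "W N w = (\<Sum>t<N. step_var A c (Y N w) t)" for N w
  define S where "S N w = (\<Sum>t<N. \<Sum>\<alpha>\<in>A. y N \<alpha> t w * e \<alpha> t w)" for N w
  define D where "D N w = \<bar>W N w - \<sigma>\<bar>" for N w
  have Wsum: "W N w = (\<Sum>t<N. \<Sum>\<alpha>\<in>A. c \<alpha> * (y N \<alpha> t w)\<^sup>2)" for N w
    by (simp add: W_def step_var_def Y_def)
  have single: "cgauss M (e \<alpha> t)" "cgauss M (y N \<alpha> t)" if "\<alpha> \<in> A" for \<alpha> t N
    using joint_cgauss_single[OF J, of "(True, \<alpha>, t)"] joint_cgauss_single[OF J[of N], of "(False, \<alpha>, t)"] that by auto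
  have em [measurable]: "\<And>\<alpha> t. \<alpha> \<in> A \<Longrightarrow> e \<alpha> t \<in> borel_measurable M" and ym [measurable]: "\<And>N \<alpha> t. \<alpha> \<in> A \<Longrightarrow> y N \<alpha> t \<in> borel_measurable M"
    using single cgauss_measurable by blast+
  have Sm: "S N \<in> borel_measurable M" for N
    unfolding S_def[abs_def] by measurable
  have iW: "integrable M (\<lambda>w. W N w)" for N
    unfolding Wsum using single(2) cgauss_square_integrable by (intro Bochner_Integration.integrable_sum integrable_mult_right) blast
  have iD: "integrable M (D N)" for N
    unfolding D_def[abs_def] using iW by (intro integrable_abs Bochner_Integration.integrable_diff) auto
  define F where "F N w = exp (trunc_var A c K (Y N w) N / 2) * cos (a + trunc_sum A c K (Y N w) (E w) N)" for N w
  have F: "(LINT w|M. F N w) = cos a" for N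
    unfolding F_def Y_def E_def by (rule gaussian_exponential_martingale[OF M A J ee ye c K])
  have Fm: "F N \<in> borel_measurable M" for N
    unfolding F_def[abs_def] trunc_sum_def trunc_var_def trunc_factor_def step_var_def Y_def E_def by measurable
  have FB: "\<bar>F N w\<bar> \<le> exp ((K + 1) / 2)" for N w
    unfolding F_def using trunc_var_bounds(2)[of A c K "Y N w" N, OF c K] by (intro abs_mult_cos_le) simp
  have iF: "integrable M (F N)" for N
    by (rule integrable_const_bound[where B="exp ((K + 1) / 2)"]) (use FB Fm in auto)
  have icos: "integrable M (\<lambda>w. cos (a + S N w))" for N
    using Sm by (intro integrable_cos) measurable
  define C where "C = 2 * exp (K + 1)"
  have pw: "\<bar>F N w - exp (\<sigma> / 2) * cos (a + S N w)\<bar> \<le> C * D N w" for N w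
  proof (cases "D N w \<le> 1")
    case True
    then have WK: "W N w \<le> K" by (simp add: D_def K_def abs_le_iff)
    have WK': "(\<Sum>t<N. step_var A c (Y N w) t) \<le> K" using WK unfolding W_def .
    have ti: "trunc_var A c K (Y N w) N = (\<Sum>t<N. step_var A c (Y N w) t)"
      "trunc_sum A c K (Y N w) (E w) N = (\<Sum>t<N. \<Sum>\<alpha>\<in>A. Y N w \<alpha> t * E w \<alpha> t)"
      by (rule trunc_inactive, erule c, rule WK')+
    have "F N w = exp (W N w / 2) * cos (a + S N w)"
      unfolding F_def ti by (simp add: W_def S_def Y_def E_def)
    then have "\<bar>F N w - exp (\<sigma> / 2) * cos (a + S N w)\<bar> = \<bar>(exp (W N w / 2) - exp (\<sigma> / 2)) * cos (a + S N w)\<bar>"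
      by (simp add: left_diff_distrib)
    also have "\<dots> \<le> exp (K + 1) * \<bar>W N w / 2 - \<sigma> / 2\<bar>"
      using WK \<sigma> by (intro abs_mult_cos_le abs_exp_diff_le) (simp_all add: K_def)
    also have "\<dots> \<le> exp (K + 1) * (2 * D N w)"
      by (intro mult_left_mono) (auto simp: D_def abs_if field_simps)
    finally show ?thesis by (simp add: C_def)
  next
    case False
    have "\<bar>exp (\<sigma> / 2) * cos (a + S N w)\<bar> \<le> exp (K + 1)"
      using \<sigma> by (intro abs_mult_cos_le) (simp add: K_def)
    moreover have "exp ((K + 1) / 2) \<le> exp (K + 1)" using K by simp
    ultimately have "\<bar>F N w - exp (\<sigma> / 2) * cos (a + S N w)\<bar> \<le> C"
      using FB[of N w] unfolding C_def by linarith
    also have "C \<le> C * D N w" using False by (simp add: C_def)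
    finally show ?thesis .
  qed
  have bd: "norm (cos a - exp (\<sigma> / 2) * (LINT w|M. cos (a + S N w))) \<le> C * (LINT w|M. D N w)" for N
  proof -
    have "cos a - exp (\<sigma> / 2) * (LINT w|M. cos (a + S N w)) = (LINT w|M. F N w - exp (\<sigma> / 2) * cos (a + S N w))"
      using iF icos F by simp
    also have "norm \<dots> \<le> (LINT w|M. C * D N w)"
      using iF icos iD pw by (intro integral_norm_bound[THEN order_trans] integral_mono) auto
    finally show ?thesis by simp
  qed
  have D0: "(\<lambda>N. C * (LINT w|M. D N w)) \<longlonglongrightarrow> 0"
    using tendsto_mult_right_zero[OF conv, of C] unfolding D_def Wsum by simp
  have "(\<lambda>N. cos a - exp (\<sigma> / 2) * (LINT w|M. cos (a + S N w))) \<longlonglongrightarrow> 0"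
    by (rule Lim_null_comparison[OF always_eventually[OF allI[OF bd]] D0])
  then have "(\<lambda>N. exp (- \<sigma> / 2) * (cos a - (cos a - exp (\<sigma> / 2) * (LINT w|M. cos (a + S N w))))) \<longlonglongrightarrow> exp (- \<sigma> / 2) * (cos a - 0)"
    by (intro tendsto_mult tendsto_diff tendsto_const)
  then show ?thesis unfolding S_def by (simp add: mult.assoc[symmetric] exp_add[symmetric])
qed

section \<open>Legendre polynomials\<close>

definition legendre_deriv :: "nat \<Rightarrow> nat \<Rightarrow> real \<Rightarrow> real" where
  "legendre_deriv l a z = poly ((pderiv ^^ a) (legendre_poly l)) z"

lemma legendre_deriv_0: "legendre_deriv l 0 z = legendre l z"
  by (simp add: legendre_deriv_def legendre_def)

text \<open>The polynomial \<open>u = (z\<^sup>2 - 1)\<^sup>l\<close> satisfies \<open>(z\<^sup>2 - 1) u' = 2 l z u\<close>; the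
  equation for the higher derivatives arises by differentiating this one repeatedly.\<close>

lemma rodrigues_ode:
  fixes l n :: nat
  defines "D \<equiv> \<lambda>n. (pderiv ^^ n) ([:-1, 0, 1:] ^ l :: real poly)"
  shows "(z\<^sup>2 - 1) * poly (D (n + 2)) z + 2 * (real n + 1 - real l) * z * poly (D (n + 1)) z
     + (real n + 1) * (real n - 2 * real l) * poly (D n) z = 0"
proof -
  define X :: "real poly" where "X = [:-1, 0, 1:]"
  define x :: "real poly" where "x = [:0, 1:]"
  have dX: "pderiv X = smult 2 x" and dx: "pderiv x = 1"
    by (simp_all add: X_def x_def pderiv_pCons one_pCons)
  have ev: "poly X z = z\<^sup>2 - 1" "poly x z = z" for z
    by (simp_all add: X_def x_def power2_eq_square)
  have D0: "D 0 = X ^ l" by (simp add: D_def X_def)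
  have pd: "pderiv (D m) = D (Suc m)" for m by (simp add: D_def)
  have base: "X * D 1 = smult (2 * real l) (x * D 0)"
  proof (cases l)
    case 0
    then show ?thesis by (simp add: D_def)
  next
    case (Suc k)
    have "D 1 = pderiv (X ^ Suc k)" using pd[of 0] unfolding D0 Suc by (simp only: One_nat_def)
    then have "D 1 = smult (real l) (X ^ k * smult 2 x)"
      unfolding pderiv_power_Suc dX by (simp add: Suc mult.commute)
    then have "X * D 1 = smult (2 * real l) (x * (X * X ^ k))" by (simp add: mult_ac)
    then show ?thesis unfolding D0 Suc power_Suc .
  qed
  have "X * D (n + 2) + smult (2 * (real n + 1 - real l)) (x * D (n + 1))
     + smult ((real n + 1) * (real n - 2 * real l)) (D n) = 0"
  proof (induction n)
    case 0
    have "pderiv (X * D 1) = pderiv (smult (2 * real l) (x * D 0))" by (simp only: base)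
    then have "poly (X * D 2 + D 1 * smult 2 x) z = poly (smult (2 * real l) (x * D 1 + D 0)) z" for z
      by (simp only: pderiv_mult pderiv_smult pd dX dx numeral_2_eq_2 One_nat_def mult_1_right)
    then show ?case by (intro poly_ext) (simp add: ev algebra_simps numeral_2_eq_2)
  next
    case (Suc n)
    have "poly (pderiv (X * D (n + 2) + smult (2 * (real n + 1 - real l)) (x * D (n + 1))
       + smult ((real n + 1) * (real n - 2 * real l)) (D n))) z = 0" for z
      unfolding Suc by simp
    then have "poly (X * D (n + 3) + D (n + 2) * smult 2 x + smult (2 * (real n + 1 - real l)) (x * D (n + 2) + D (n + 1))
       + smult ((real n + 1) * (real n - 2 * real l)) (D (n + 1))) z = 0" for z
      by (simp only: pderiv_add pderiv_mult pderiv_smult pd dX dx mult_1_right) (simp add: numeral_3_eq_3)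
    then show ?case
      by (intro poly_ext) (simp add: ev algebra_simps numeral_3_eq_3)
  qed
  then have "poly (X * D (n + 2) + smult (2 * (real n + 1 - real l)) (x * D (n + 1))
     + smult ((real n + 1) * (real n - 2 * real l)) (D n)) z = 0" by simp
  then show ?thesis by (simp add: ev mult.assoc)
qed

lemma legendre_deriv_rodrigues:
  "legendre_deriv l a z = poly ((pderiv ^^ (l + a)) ([:-1, 0, 1:] ^ l)) z / (2 ^ l * fact l)"
proof -
  have sm: "(pderiv ^^ a) (smult c p) = smult c ((pderiv ^^ a) p)" for c and p :: "real poly"
    by (induction a) (simp_all add: pderiv_smult)
  have "(pderiv ^^ a) ((pderiv ^^ l) p) = (pderiv ^^ (l + a)) p" for p :: "real poly"
    by (metis add.commute comp_apply funpow_add)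
  then show ?thesis by (simp add: legendre_deriv_def legendre_poly_def sm)
qed

text \<open>The derivatives of Legendre's differential equation.\<close>

lemma legendre_deriv_ode:
  "(1 - z\<^sup>2) * legendre_deriv l (b + 2) z =
     2 * (real b + 1) * z * legendre_deriv l (b + 1) z - (real l + real b + 1) * (real l - real b) * legendre_deriv l b z"
proof -
  define d where "d = 2 ^ l * (fact l :: real)"
  have d: "d \<noteq> 0" by (simp add: d_def)
  define e where "e k = poly ((pderiv ^^ (l + b + k)) ([:-1, 0, 1:] ^ l)) z" for k :: nat
  have L: "legendre_deriv l (b + k) z = e k / d" for k
    by (simp add: legendre_deriv_rodrigues e_def d_def add.assoc)
  have "(z\<^sup>2 - 1) * e 2 + 2 * (real b + 1) * z * e 1 + (real l + real b + 1) * (real b - real l) * e 0 = 0"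
    using rodrigues_ode[where z=z and l=l and n="l + b"] unfolding e_def by (simp add: algebra_simps)
  then have "(1 - z\<^sup>2) * e 2 = 2 * (real b + 1) * z * e 1 - (real l + real b + 1) * (real l - real b) * e 0"
    by (simp add: algebra_simps)
  then have "(1 - z\<^sup>2) * e 2 / d = (2 * (real b + 1) * z * e 1 - (real l + real b + 1) * (real l - real b) * e 0) / d"
    by simp
  then show ?thesis using L[of 0] L[of 1] L[of 2] d by (simp add: diff_divide_distrib)
qed

lemma funpow_pderiv_eq_0: "degree (p :: real poly) < n \<Longrightarrow> (pderiv ^^ n) p = 0"
proof (induction n arbitrary: p)
  case (Suc n)
  show ?case
  proof (cases "degree p = 0")
    case True
    then have "pderiv p = 0" by (simp add: pderiv_eq_0_iff)
    moreover have "(pderiv ^^ n) (0 :: real poly) = 0" by (induction n) simp_all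
    ultimately show ?thesis by (simp add: funpow_swap1 funpow_Suc_right del: funpow.simps)
  next
    case False
    then have "(pderiv ^^ n) (pderiv p) = 0" using Suc by (intro Suc.IH) (simp add: degree_pderiv)
    then show ?thesis by (simp add: funpow_Suc_right del: funpow.simps)
  qed
qed simp

lemma legendre_deriv_eq_0: "l < a \<Longrightarrow> legendre_deriv l a z = 0"
proof -
  assume "l < a"
  have "degree ([:-1, 0, 1:] ^ l :: real poly) = 2 * l" by (simp add: degree_power_eq)
  then show ?thesis unfolding legendre_deriv_rodrigues using \<open>l < a\<close> by (subst funpow_pderiv_eq_0) auto
qed

text \<open>Differentiating \<open>(x - 1)\<^sup>l q\<close> exactly \<open>l\<close> times and evaluating at \<open>1\<close> leaves \<open>l! q(1)\<close>.\<close>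

lemma legendre_at_1: "legendre l 1 = 1"
proof -
  have *: "poly ((pderiv ^^ l) ([:-1, 1:] ^ l * q)) 1 = fact l * poly q 1" for q :: "real poly"
  proof (induction l arbitrary: q)
    case (Suc l)
    define X :: "real poly" where "X = [:-1, 1:]"
    have X: "pderiv X = 1" "poly X 1 = 0" by (simp_all add: X_def pderiv_pCons one_pCons)
    have "pderiv (X ^ Suc l * q) = X ^ l * (smult (1 + real l) q + X * pderiv q)"
      unfolding pderiv_mult pderiv_power_Suc X by (simp add: algebra_simps)
    then have "poly ((pderiv ^^ Suc l) (X ^ Suc l * q)) 1 = poly ((pderiv ^^ l) (X ^ l * (smult (1 + real l) q + X * pderiv q))) 1"
      by (simp only: funpow_Suc_right comp_apply)
    also have "\<dots> = fact l * poly (smult (1 + real l) q + X * pderiv q) 1"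
      unfolding X_def by (rule Suc.IH)
    finally show ?case by (simp add: X_def)
  qed simp
  have "[:-1, 1:] * [:1, 1:] = ([:-1, 0, 1:] :: real poly)" by simp
  then have "[:-1, 0, 1:] ^ l = ([:-1, 1:] ^ l * [:1, 1:] ^ l :: real poly)"
    by (simp only: power_mult_distrib[symmetric])
  then have "poly ((pderiv ^^ l) ([:-1, 0, 1:] ^ l)) (1::real) = poly ((pderiv ^^ l) ([:-1, 1:] ^ l * [:1, 1:] ^ l)) 1"
    by (simp only:)
  also have "\<dots> = fact l * 2 ^ l" unfolding * by simp
  finally have 1: "poly ((pderiv ^^ l) ([:-1, 0, 1:] ^ l)) (1::real) = fact l * 2 ^ l" .
  have "legendre l 1 = poly ((pderiv ^^ l) ([:-1, 0, 1:] ^ l)) 1 / (2 ^ l * fact l)"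
    using legendre_deriv_rodrigues[where l=l and a=0 and z=1] unfolding legendre_deriv_0 add_0_right .
  then show ?thesis unfolding 1 by simp
qed

lemma legendre_deriv_has_derivative:
  "(legendre_deriv l a has_real_derivative legendre_deriv l (Suc a) z) (at z)"
  unfolding legendre_deriv_def by (simp add: poly_DERIV)

lemma continuous_on_legendre_deriv [continuous_intros]:
  "continuous_on S f \<Longrightarrow> continuous_on S (\<lambda>x. legendre_deriv l a (f x))"
  unfolding legendre_deriv_def by (intro continuous_intros)

section \<open>The sphere and its surface measure\<close>

lemma S2_iff: "x \<in> S2 \<longleftrightarrow> (x $ 1)\<^sup>2 + (x $ 2)\<^sup>2 + (x $ 3)\<^sup>2 = 1"
proof -
  have "x \<in> S2 \<longleftrightarrow> x \<bullet> x = 1" by (simp add: norm_eq_1)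
  then show ?thesis by (simp add: inner_vec_def sum_3 power2_eq_square)
qed

lemma space_sphere_measure [simp]: "space sphere_measure = S2"
  and sets_sphere_measure [measurable_cong]: "sets sphere_measure = sets (restrict_space borel S2)"
  by (auto simp: sphere_measure_def space_restrict_space)

lemma radial_projection_measurable:
  "(\<lambda>x. x /\<^sub>R norm x) \<in> measurable (scale_measure 3 (restrict_space lborel (ball 0 1 - {0}))) (restrict_space borel S2)"
proof -
  have "(\<lambda>x::real^3. x /\<^sub>R norm x) \<in> borel_measurable lborel" by measurable
  then have "(\<lambda>x::real^3. x /\<^sub>R norm x) \<in> borel_measurable (restrict_space lborel (ball 0 1 - {0}))"
    by (rule measurable_restrict_space1)
  then have "(\<lambda>x::real^3. x /\<^sub>R norm x) \<in> measurable (restrict_space lborel (ball 0 1 - {0})) (restrict_space borel S2)"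
    by (intro measurable_restrict_space2) (auto simp: space_restrict_space)
  then show ?thesis by simp
qed

lemma emeasure_sphere_measure:
  assumes "A \<in> sets sphere_measure"
  shows "emeasure sphere_measure A = 3 * emeasure lborel {x \<in> ball 0 1 - {0}. x /\<^sub>R norm x \<in> A}"
proof -
  have A: "A \<in> sets (restrict_space borel S2)" using assms unfolding sets_sphere_measure .
  have sp: "space (scale_measure 3 (restrict_space lborel (ball 0 1 - {0::real^3}))) = ball 0 1 - {0}"
    by (simp add: space_scale_measure space_restrict_space)
  have "emeasure sphere_measure A = emeasure (scale_measure 3 (restrict_space lborel (ball 0 1 - {0})))
      ((\<lambda>x. x /\<^sub>R norm x) -` A \<inter> (ball 0 1 - {0}))"
    unfolding sphere_measure_def
    by (subst emeasure_distr[OF radial_projection_measurable A]) (simp only: sp)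
  also have "\<dots> = 3 * emeasure lborel ((\<lambda>x. x /\<^sub>R norm x) -` A \<inter> (ball 0 1 - {0}))"
    by (subst emeasure_scale_measure, subst emeasure_restrict_space) auto
  also have "(\<lambda>x. x /\<^sub>R norm x) -` A \<inter> (ball 0 1 - {0}) = {x \<in> ball 0 1 - {0}. x /\<^sub>R norm x \<in> A}" by auto
  finally show ?thesis .
qed

lemma emeasure_sphere_measure_space: "emeasure sphere_measure (space sphere_measure) = ennreal (4 * pi)"
proof -
  have "{x \<in> ball 0 1 - {0}. x /\<^sub>R norm x \<in> S2} = ball (0::real^3) 1 - {0}" by auto
  moreover have "emeasure lborel (ball (0::real^3) 1 - {0}) = emeasure lborel (ball (0::real^3) 1)"
    by (subst emeasure_Diff) auto
  moreover have "emeasure lborel (ball (0::real^3) 1) = ennreal (4 / 3 * pi)"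
    by (subst emeasure_ball) (simp_all add: eval_unit_ball_vol)
  ultimately have "emeasure sphere_measure (space sphere_measure) = 3 * ennreal (4 / 3 * pi)"
    using emeasure_sphere_measure[OF sets.top] by simp
  also have "\<dots> = ennreal (4 * pi)"
    by (subst ennreal_numeral[symmetric], subst ennreal_mult[symmetric]) auto
  finally show ?thesis .
qed

interpretation sphere: finite_measure sphere_measure
  by (rule finite_measureI, subst emeasure_sphere_measure_space) simp

lemma measure_sphere_measure: "measure sphere_measure S2 = 4 * pi"
  using emeasure_sphere_measure_space by (simp add: measure_def)

lemma sphere_integrable_continuous:
  fixes f :: "real^3 \<Rightarrow> 'b::euclidean_space"
  assumes "continuous_on S2 f"
  shows "integrable sphere_measure f"
proof -
  have m: "f \<in> borel_measurable sphere_measure"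
    using borel_measurable_continuous_on_restrict[OF assms] by (simp add: measurable_cong_sets[OF sets_sphere_measure refl])
  have "\<exists>B. \<forall>x\<in>S2. norm (f x) \<le> B"
    using compact_imp_bounded[OF compact_continuous_image[OF assms compact_sphere]] unfolding bounded_iff by blast
  then obtain B where "\<And>x. x \<in> S2 \<Longrightarrow> norm (f x) \<le> B" by blast
  then show ?thesis by (intro sphere.integrable_const_bound[OF _ m, of B]) auto
qed

lemma cone_borel:
  fixes A :: "(real^3) set"
  assumes "A \<in> sets borel"
  shows "{x \<in> ball 0 1 - {0}. x /\<^sub>R norm x \<in> A} \<in> sets borel"
proof -
  have "(\<lambda>x::real^3. x /\<^sub>R norm x) -` A \<inter> space borel \<in> sets borel"
    by (rule measurable_sets[OF _ assms]) measurable
  then have "(ball 0 1 - {0}) \<inter> ((\<lambda>x::real^3. x /\<^sub>R norm x) -` A \<inter> space borel) \<in> sets borel"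
    by (intro sets.Int) auto
  also have "(ball 0 1 - {0}) \<inter> ((\<lambda>x::real^3. x /\<^sub>R norm x) -` A \<inter> space borel) = {x \<in> ball 0 1 - {0}. x /\<^sub>R norm x \<in> A}"
    by auto
  finally show ?thesis .
qed

text \<open>An orthogonal map preserves Lebesgue measure and commutes with the radial projection, hence it maps the cone over
  a set to the cone over its image.\<close>

lemma sphere_measure_orthogonal_invariant:
  assumes R: "orthogonal_transformation (R :: real^3 \<Rightarrow> real^3)"
  shows "distr sphere_measure sphere_measure R = sphere_measure"
proof -
  have lin: "linear R" using R by (rule orthogonal_transformation_linear)
  have Rn: "norm (R x) = norm x" for x using R by (rule orthogonal_transformation_norm)
  have [measurable]: "R \<in> borel_measurable borel" using lin by (intro borel_measurable_continuous_onI linear_continuous_on) (rule linear_conv_bounded_linear[THEN iffD1])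
  have Rm: "R \<in> measurable sphere_measure sphere_measure"
  proof -
    have "R \<in> measurable (restrict_space borel S2) (restrict_space borel S2)"
      by (intro measurable_restrict_space3) (auto simp: Rn)
    then show ?thesis by (simp add: measurable_cong_sets[OF sets_sphere_measure sets_sphere_measure])
  qed
  show ?thesis
  proof (rule measure_eqI)
    fix A assume "A \<in> sets (distr sphere_measure sphere_measure R)"
    then have A: "A \<in> sets sphere_measure" by simp
    have "A \<in> sets (restrict_space borel S2)" using A unfolding sets_sphere_measure .
    then have Ab: "A \<in> sets borel" "A \<subseteq> S2"
      using sets_restrict_space_iff[of S2 borel A] borel_closed[OF closed_sphere[of "0::real^3" 1]] by auto
    define C where "C = {x \<in> ball 0 1 - {0}. x /\<^sub>R norm x \<in> A}"
    define C' where "C' = {x \<in> ball 0 1 - {0}. x /\<^sub>R norm x \<in> R -` A \<inter> S2}"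
    have "R -` A \<inter> space borel \<in> sets borel" by (rule measurable_sets[OF _ Ab(1)]) measurable
    then have "R -` A \<inter> S2 \<in> sets borel" 
      using borel_closed[OF closed_sphere[of "0::real^3" 1]] by auto
    then have Cb: "C \<in> sets borel" "C' \<in> sets borel" unfolding C_def C'_def using Ab(1)
      by (auto intro: cone_borel)
    have Rz: "R x = 0 \<longleftrightarrow> x = 0" for x using Rn[of x] by (metis norm_eq_zero)
    have RC: "R ` C' = C"
    proof (intro equalityI subsetI)
      fix y assume "y \<in> R ` C'"
      then obtain x where x: "x \<in> C'" "y = R x" by blast
      have "R (x /\<^sub>R norm x) = R x /\<^sub>R norm x" using lin by (simp add: linear_cmul)
      then show "y \<in> C" using x Rn[of x] Rz[of x] unfolding C_def C'_def by auto
    next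
      fix y assume y: "y \<in> C"
      obtain x where x: "y = R x" using orthogonal_transformation_surj[OF R] by (metis surjD)
      have "R (x /\<^sub>R norm x) = R x /\<^sub>R norm x" using lin by (simp add: linear_cmul)
      moreover have "x /\<^sub>R norm x \<in> S2" using y x Rn[of x] Rz[of x] unfolding C_def by auto
      ultimately have "x \<in> C'" using y x Rn[of x] Rz[of x] unfolding C_def C'_def by auto
      then show "y \<in> R ` C'" using x by blast
    qed
    have lm: "C' \<in> lmeasurable" 
      by (rule bounded_set_imp_lmeasurable) (use Cb in \<open>auto simp: C'_def intro!: bounded_subset[OF bounded_ball[of 0 1]]\<close>)
    have lmC: "C \<in> lmeasurable" 
      by (rule bounded_set_imp_lmeasurable) (use Cb in \<open>auto simp: C_def intro!: bounded_subset[OF bounded_ball[of 0 1]]\<close>)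
    have "measure lebesgue C = measure lebesgue C'"
      using measure_orthogonal_image[OF R lm] RC by simp
    then have "emeasure lebesgue C = emeasure lebesgue C'"
      using lm lmC by (simp add: emeasure_eq_measure2 fmeasurableD2)
    then have eq: "emeasure lborel C = emeasure lborel C'" using Cb by (simp add: emeasure_completion)
    have "emeasure (distr sphere_measure sphere_measure R) A = emeasure sphere_measure (R -` A \<inter> S2)"
      by (subst emeasure_distr[OF Rm A]) simp
    also have "\<dots> = 3 * emeasure lborel C'"
      unfolding C'_def using measurable_sets[OF Rm A] by (intro emeasure_sphere_measure) simp
    also have "\<dots> = emeasure sphere_measure A"
      unfolding eq[symmetric] C_def using emeasure_sphere_measure[OF A] by simp
    finally show "emeasure (distr sphere_measure sphere_measure R) A = emeasure sphere_measure A" .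
  qed simp
qed

lemma orthogonal_measurable_sphere:
  assumes R: "orthogonal_transformation (R :: real^3 \<Rightarrow> real^3)"
  shows "R \<in> measurable sphere_measure sphere_measure"
proof -
  have lin: "linear R" using R by (rule orthogonal_transformation_linear)
  have [measurable]: "R \<in> borel_measurable borel" using lin by (intro borel_measurable_continuous_onI linear_continuous_on) (rule linear_conv_bounded_linear[THEN iffD1])
  have "R \<in> measurable (restrict_space borel S2) (restrict_space borel S2)"
    by (intro measurable_restrict_space3) (auto simp: orthogonal_transformation_norm[OF R])
  then show ?thesis by (simp add: measurable_cong_sets[OF sets_sphere_measure sets_sphere_measure])
qed

lemma sphere_integral_orthogonal:
  fixes f :: "real^3 \<Rightarrow> 'b::{banach, second_countable_topology}"
  assumes R: "orthogonal_transformation R" and f: "f \<in> borel_measurable sphere_measure"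
  shows "(LINT x|sphere_measure. f (R x)) = (LINT x|sphere_measure. f x)"
  using integral_distr[OF orthogonal_measurable_sphere[OF R] f] sphere_measure_orthogonal_invariant[OF R] by simp

definition rot13 :: "real \<Rightarrow> real^3 \<Rightarrow> real^3" where
  "rot13 \<theta> x = vector [cos \<theta> * x $ 1 + sin \<theta> * x $ 3, x $ 2, - sin \<theta> * x $ 1 + cos \<theta> * x $ 3]"

definition rot12 :: "real \<Rightarrow> real^3 \<Rightarrow> real^3" where
  "rot12 \<theta> x = vector [cos \<theta> * x $ 1 - sin \<theta> * x $ 2, sin \<theta> * x $ 1 + cos \<theta> * x $ 2, x $ 3]"

lemma rot_norm_aux: "(c * a + s * b)\<^sup>2 + (c * b - s * a)\<^sup>2 = (c\<^sup>2 + s\<^sup>2) * (a\<^sup>2 + b\<^sup>2)" for a b c s :: real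
  by (simp add: power2_eq_square algebra_simps)

lemma orthogonal_rot13: "orthogonal_transformation (rot13 \<theta>)"
proof -
  have "linear (rot13 \<theta>)"
    by (rule linearI) (simp_all add: rot13_def vec_eq_iff forall_3 algebra_simps)
  moreover have "norm (rot13 \<theta> x) = norm x" for x
    unfolding norm_eq_sqrt_inner using rot_norm_aux[of "cos \<theta>" "x $ 1" "sin \<theta>" "x $ 3"]
    by (simp add: rot13_def inner_vec_def sum_3 power2_eq_square algebra_simps)
  ultimately show ?thesis by (simp add: orthogonal_transformation)
qed

lemma orthogonal_rot12: "orthogonal_transformation (rot12 \<theta>)"
proof -
  have "linear (rot12 \<theta>)"
    by (rule linearI) (simp_all add: rot12_def vec_eq_iff forall_3 algebra_simps)
  moreover have "norm (rot12 \<theta> x) = norm x" for x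
    unfolding norm_eq_sqrt_inner using rot_norm_aux[of "cos \<theta>" "x $ 2" "sin \<theta>" "x $ 1"]
    by (simp add: rot12_def inner_vec_def sum_3 power2_eq_square algebra_simps)
  ultimately show ?thesis by (simp add: orthogonal_transformation)
qed

section \<open>Ladder operators and the addition theorem\<close>

text \<open>Up to normalisation, \<open>Y\<^sub>l\<^sub>,\<^sub>\<plusminus>\<^sub>a\<close> are the real and imaginary part of this function.\<close>

definition sphH :: "nat \<Rightarrow> nat \<Rightarrow> real^3 \<Rightarrow> complex" where
  "sphH l a x = of_real (legendre_deriv l a (x $ 3)) * Complex (x $ 1) (x $ 2) ^ a"

text \<open>The derivative of \<open>sphH l a\<close> along the rotation \<open>rot13\<close>: one step down and one step up the ladder.\<close>

definition sphD :: "nat \<Rightarrow> nat \<Rightarrow> real^3 \<Rightarrow> complex" where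
  "sphD l a x = (case a of 0 \<Rightarrow> - of_real (Re (sphH l 1 x))
     | Suc b \<Rightarrow> of_real ((real l + real b + 1) * (real l - real b) / 2) * sphH l b x - sphH l (b + 2) x / 2)"

lemma sphD_Suc: "sphD l (Suc b) x = of_real ((real l + real b + 1) * (real l - real b) / 2) * sphH l b x - sphH l (b + 2) x / 2"
  by (simp add: sphD_def)

lemma rot13_S2: "x \<in> S2 \<Longrightarrow> rot13 \<theta> x \<in> S2"
  and rot12_S2: "x \<in> S2 \<Longrightarrow> rot12 \<theta> x \<in> S2"
  using orthogonal_transformation_norm[OF orthogonal_rot13] orthogonal_transformation_norm[OF orthogonal_rot12] by simp_all

lemma rot13_nth: "rot13 \<theta> x $ 1 = cos \<theta> * x $ 1 + sin \<theta> * x $ 3" "rot13 \<theta> x $ 2 = x $ 2"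
    "rot13 \<theta> x $ 3 = - sin \<theta> * x $ 1 + cos \<theta> * x $ 3"
  and rot12_nth: "rot12 \<theta> x $ 1 = cos \<theta> * x $ 1 - sin \<theta> * x $ 2" "rot12 \<theta> x $ 2 = sin \<theta> * x $ 1 + cos \<theta> * x $ 2"
    "rot12 \<theta> x $ 3 = x $ 3"
  by (simp_all add: rot13_def rot12_def)

lemma rot13_nth_deriv:
  "((\<lambda>\<theta>. rot13 \<theta> x $ 1) has_real_derivative rot13 \<theta> x $ 3) (at \<theta>)"
  "((\<lambda>\<theta>. rot13 \<theta> x $ 3) has_real_derivative - (rot13 \<theta> x $ 1)) (at \<theta>)"
  unfolding rot13_nth by (auto intro!: derivative_eq_intros)

lemma sphD_algebra:
  assumes "x \<in> S2"
  shows "of_real (- (x $ 1) * legendre_deriv l (Suc a) (x $ 3)) * Complex (x $ 1) (x $ 2) ^ a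
    + of_real (legendre_deriv l a (x $ 3)) * (of_real (x $ 3) * (of_nat a * Complex (x $ 1) (x $ 2) ^ (a - 1))) = sphD l a x"
proof -
  define w where "w = Complex (x $ 1) (x $ 2)"
  define z where "z = x $ 3"
  have cw: "w * cnj w = of_real (1 - z\<^sup>2)"
    using assms unfolding S2_iff w_def z_def
    by (simp add: complex_eq_iff power2_eq_square algebra_simps)
  have x1: "2 * of_real (x $ 1) = w + cnj w" by (simp add: w_def complex_eq_iff)
  show ?thesis
  proof (cases a)
    case 0
    then show ?thesis by (simp add: sphD_def sphH_def complex_eq_iff)
  next
    case (Suc b)
    define Q where "Q k = legendre_deriv l (b + k) z" for k
    have ode: "(1 - z\<^sup>2) * Q 2 = 2 * (real b + 1) * z * Q 1 - (real l + real b + 1) * (real l - real b) * Q 0"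
      using legendre_deriv_ode[of z l b] by (simp add: Q_def)
    have "2 * (of_real (- (x $ 1) * Q 2) * w ^ (b + 1) + of_real (Q 1) * (of_real z * (of_nat (b + 1) * w ^ b)))
       = - of_real (Q 2) * (2 * of_real (x $ 1)) * w * w ^ b + of_real (2 * Q 1 * z * (real b + 1)) * w ^ b"
      by (simp add: algebra_simps)
    also have "\<dots> = - of_real (Q 2) * (w * w) * w ^ b - of_real (Q 2) * (w * cnj w) * w ^ b + of_real (2 * Q 1 * z * (real b + 1)) * w ^ b"
      unfolding x1 by (simp add: algebra_simps)
    also have "\<dots> = - of_real (Q 2) * (w * w) * w ^ b + of_real (2 * (real b + 1) * z * Q 1 - (1 - z\<^sup>2) * Q 2) * w ^ b"
      unfolding cw by (simp add: algebra_simps)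
    also have "2 * (real b + 1) * z * Q 1 - (1 - z\<^sup>2) * Q 2 = (real l + real b + 1) * (real l - real b) * Q 0"
      using ode by simp
    also have "- of_real (Q 2) * (w * w) * w ^ b + of_real ((real l + real b + 1) * (real l - real b) * Q 0) * w ^ b = 2 * sphD l a x"
      unfolding sphD_def sphH_def Suc w_def[symmetric] z_def[symmetric] Q_def by (simp add: algebra_simps)
    finally have f: "2 * (of_real (- (x $ 1) * Q 2) * w ^ (b + 1) + of_real (Q 1) * (of_real z * (of_nat (b + 1) * w ^ b))) = 2 * sphD l a x" .
    have "of_real (- (x $ 1) * Q 2) * w ^ (b + 1) + of_real (Q 1) * (of_real z * (of_nat (b + 1) * w ^ b)) = sphD l a x"
      by (rule mult_left_cancel[THEN iffD1, OF _ f]) simp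
    then show ?thesis unfolding Suc w_def[symmetric] z_def[symmetric] Q_def by simp
  qed
qed

lemma sphH_deriv:
  assumes "x \<in> S2"
  shows "((\<lambda>\<theta>. sphH l a (rot13 \<theta> x)) has_vector_derivative sphD l a (rot13 \<theta> x)) (at \<theta>)"
proof -
  let ?w = "\<lambda>\<theta>. Complex (rot13 \<theta> x $ 1) (rot13 \<theta> x $ 2)"
  have weq: "?w = (\<lambda>\<theta>. of_real (rot13 \<theta> x $ 1) + \<i> * of_real (x $ 2))"
    by (simp add: fun_eq_iff complex_eq_iff rot13_nth)
  have dw: "(?w has_vector_derivative of_real (rot13 \<theta> x $ 3)) (at \<theta>)"
    unfolding weq
    using has_vector_derivative_add_const[of "\<lambda>\<theta>. of_real (rot13 \<theta> x $ 1)" "\<i> * of_real (x $ 2)"]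
      has_vector_derivative_of_real[OF rot13_nth_deriv(1), where 'a=complex]
    by simp
  have dwa: "((\<lambda>\<theta>. ?w \<theta> ^ a) has_vector_derivative of_real (rot13 \<theta> x $ 3) * (of_nat a * ?w \<theta> ^ (a - 1))) (at \<theta>)"
  proof -
    have "((\<lambda>z. z ^ a) has_field_derivative of_nat a * ?w \<theta> ^ (a - 1)) (at (?w \<theta>))"
      by (auto intro!: derivative_eq_intros)
    from field_vector_diff_chain_at[OF dw this] show ?thesis by (simp add: o_def)
  qed
  have dP: "((\<lambda>\<theta>. of_real (legendre_deriv l a (rot13 \<theta> x $ 3)) :: complex) has_vector_derivative
     of_real (legendre_deriv l (Suc a) (rot13 \<theta> x $ 3) * - (rot13 \<theta> x $ 1))) (at \<theta>)"
    by (intro has_vector_derivative_of_real DERIV_chain2[OF legendre_deriv_has_derivative rot13_nth_deriv(2)])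
  have "((\<lambda>\<theta>. sphH l a (rot13 \<theta> x)) has_vector_derivative 
      of_real (legendre_deriv l a (rot13 \<theta> x $ 3)) * (of_real (rot13 \<theta> x $ 3) * (of_nat a * ?w \<theta> ^ (a - 1)))
      + of_real (legendre_deriv l (Suc a) (rot13 \<theta> x $ 3) * - (rot13 \<theta> x $ 1)) * ?w \<theta> ^ a) (at \<theta>)"
    unfolding sphH_def by (rule has_vector_derivative_mult[OF dP dwa])
  then show ?thesis
    using sphD_algebra[OF rot13_S2[OF assms, of \<theta>], of l a] by (simp add: algebra_simps)
qed

lemma sphH_rot12: "sphH l a (rot12 \<theta> x) = cis (real a * \<theta>) * sphH l a x"
proof -
  have "Complex (rot12 \<theta> x $ 1) (rot12 \<theta> x $ 2) = cis \<theta> * Complex (x $ 1) (x $ 2)"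
    by (simp add: complex_eq_iff rot12_nth)
  then have "sphH l a (rot12 \<theta> x) = of_real (legendre_deriv l a (x $ 3)) * (cis \<theta> * Complex (x $ 1) (x $ 2)) ^ a"
    by (simp add: sphH_def rot12_nth)
  then show ?thesis unfolding sphH_def by (simp only: power_mult_distrib Complex.DeMoivre mult.left_commute rot12_nth)
qed

definition sph_weight :: "nat \<Rightarrow> nat \<Rightarrow> real" where
  "sph_weight l a = fact (l - a) / fact (l + a)"

lemma sph_weight_Suc: "b < l \<Longrightarrow> (real l + real b + 1) * (real l - real b) * sph_weight l (Suc b) = sph_weight l b"
proof -
  assume b: "b < l"
  then obtain k where k: "l - b = Suc k" "l - Suc b = k" by (metis Suc_diff_Suc)
  have "real l - real b = real (l - b)" using b by simp
  then have "real l - real b = real k + 1" unfolding k by simp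
  moreover have "fact (Suc k) = (real k + 1) * fact k" by simp
  moreover define A where "A = real l + real b + 1"
  moreover have "fact (l + Suc b) = A * fact (l + b)" by (simp add: A_def)
  moreover have "A \<noteq> 0" unfolding A_def by linarith
  ultimately show ?thesis
    unfolding sph_weight_def k A_def[symmetric] by (simp del: fact_Suc)
qed

text \<open>The reproducing kernel of degree \<open>l\<close>, in the form given by the ladder.\<close>

definition sph_kernel :: "nat \<Rightarrow> real^3 \<Rightarrow> real^3 \<Rightarrow> real" where
  "sph_kernel l x y = Re (sphH l 0 x * cnj (sphH l 0 y)) + (\<Sum>a=1..l. 2 * sph_weight l a * Re (sphH l a x * cnj (sphH l a y)))"

lemma sph_kernel_rot12: "sph_kernel l (rot12 \<theta> x) (rot12 \<theta> y) = sph_kernel l x y"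
proof -
  have "sphH l a (rot12 \<theta> x) * cnj (sphH l a (rot12 \<theta> y)) = sphH l a x * cnj (sphH l a y)" for a
  proof -
    have "sphH l a (rot12 \<theta> x) * cnj (sphH l a (rot12 \<theta> y)) = (cis (real a * \<theta>) * cnj (cis (real a * \<theta>))) * (sphH l a x * cnj (sphH l a y))"
      unfolding sphH_rot12 by (simp add: mult_ac)
    then show ?thesis by (simp add: cis_cnj cis_mult)
  qed
  then show ?thesis by (simp only: sph_kernel_def)
qed

text \<open>Along a simultaneous rotation of both arguments the contributions of neighbouring rungs telescope.\<close>

lemma sph_kernel_rot13:
  assumes x: "x \<in> S2" and y: "y \<in> S2"
  shows "sph_kernel l (rot13 \<theta> x) (rot13 \<theta> y) = sph_kernel l x y"
proof -
  define H where "H a \<theta> = sphH l a (rot13 \<theta> x)" for a \<theta>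
  define H' where "H' a \<theta> = sphH l a (rot13 \<theta> y)" for a \<theta>
  define DH where "DH a \<theta> = sphD l a (rot13 \<theta> x)" for a \<theta>
  define DH' where "DH' a \<theta> = sphD l a (rot13 \<theta> y)" for a \<theta>
  define G where "G a \<theta> = Re (H a \<theta> * cnj (DH' a \<theta>) + DH a \<theta> * cnj (H' a \<theta>))" for a \<theta>
  have dG: "((\<lambda>\<theta>. Re (H a \<theta> * cnj (H' a \<theta>))) has_real_derivative G a \<theta>) (at \<theta>)" for a \<theta>
  proof -
    have 1: "((\<lambda>\<theta>. H a \<theta>) has_vector_derivative DH a \<theta>) (at \<theta>)" "((\<lambda>\<theta>. H' a \<theta>) has_vector_derivative DH' a \<theta>) (at \<theta>)"
      unfolding H_def DH_def H'_def DH'_def by (rule sphH_deriv[OF x] sphH_deriv[OF y])+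
    have 2: "((\<lambda>\<theta>. cnj (H' a \<theta>)) has_vector_derivative cnj (DH' a \<theta>)) (at \<theta>)"
      by (rule bounded_linear.has_vector_derivative[OF bounded_linear_cnj 1(2)])
    have 3: "((\<lambda>\<theta>. H a \<theta> * cnj (H' a \<theta>)) has_vector_derivative (H a \<theta> * cnj (DH' a \<theta>) + DH a \<theta> * cnj (H' a \<theta>))) (at \<theta>)"
      by (rule has_vector_derivative_mult[OF 1(1) 2])
    show ?thesis unfolding G_def has_real_derivative_iff_has_vector_derivative
      by (rule bounded_linear.has_vector_derivative[OF bounded_linear_Re 3])
  qed
  define E where "E a \<theta> = sph_weight l a * Re (H a \<theta> * cnj (H' (Suc a) \<theta>) + H (Suc a) \<theta> * cnj (H' a \<theta>))" for a \<theta>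
  have G0: "G 0 \<theta> = - E 0 \<theta>" for \<theta>
    by (simp add: G_def E_def DH_def DH'_def sphD_def sph_weight_def H_def H'_def sphH_def)
  have GS: "2 * sph_weight l (Suc b) * G (Suc b) \<theta> = E b \<theta> - E (Suc b) \<theta>" if b: "b < l" for b \<theta>
  proof -
    define lam where "lam = (real l + real b + 1) * (real l - real b)"
    have lam: "lam * sph_weight l (Suc b) = sph_weight l b" unfolding lam_def using b by (rule sph_weight_Suc)
    have "2 * G (Suc b) \<theta> = lam * Re (H b \<theta> * cnj (H' (Suc b) \<theta>) + H (Suc b) \<theta> * cnj (H' b \<theta>))
        - Re (H (Suc b) \<theta> * cnj (H' (Suc (Suc b)) \<theta>) + H (Suc (Suc b)) \<theta> * cnj (H' (Suc b) \<theta>))"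
      unfolding G_def DH_def DH'_def sphD_Suc lam_def[symmetric]
      by (simp add: H_def[symmetric] H'_def[symmetric] field_simps)
    then have "2 * sph_weight l (Suc b) * G (Suc b) \<theta> = (lam * sph_weight l (Suc b)) * Re (H b \<theta> * cnj (H' (Suc b) \<theta>) + H (Suc b) \<theta> * cnj (H' b \<theta>))
        - sph_weight l (Suc b) * Re (H (Suc b) \<theta> * cnj (H' (Suc (Suc b)) \<theta>) + H (Suc (Suc b)) \<theta> * cnj (H' (Suc b) \<theta>))"
      by (simp only: mult.assoc mult.left_commute[of 2] ) (simp add: algebra_simps)
    then show ?thesis unfolding lam E_def .
  qed
  have El: "E l \<theta> = 0" for \<theta>
    by (simp add: E_def H_def H'_def sphH_def legendre_deriv_eq_0)
  have tel: "(\<Sum>a=1..n. E (a - 1) \<theta> - E a \<theta>) = E 0 \<theta> - E n \<theta>" for n \<theta>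
    by (induction n) simp_all
  have "(\<Sum>a=1..l. 2 * sph_weight l a * G a \<theta>) = (\<Sum>a=1..l. E (a - 1) \<theta> - E a \<theta>)" for \<theta>
  proof (rule sum.cong[OF refl])
    fix a assume "a \<in> {1..l}"
    then obtain b where "a = Suc b" "b < l" by (cases a) auto
    then show "2 * sph_weight l a * G a \<theta> = E (a - 1) \<theta> - E a \<theta>" using GS[of b \<theta>] by simp
  qed
  then have zero: "G 0 \<theta> + (\<Sum>a=1..l. 2 * sph_weight l a * G a \<theta>) = 0" for \<theta>
    using tel[of \<theta> l] El[of \<theta>] G0[of \<theta>] by simp
  define F where "F \<theta> = sph_kernel l (rot13 \<theta> x) (rot13 \<theta> y)" for \<theta>
  have "(F has_real_derivative G 0 \<theta> + (\<Sum>a=1..l. 2 * sph_weight l a * G a \<theta>)) (at \<theta>)" for \<theta>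
    unfolding F_def[abs_def] sph_kernel_def H_def[symmetric] H'_def[symmetric]
    by (intro DERIV_add DERIV_sum DERIV_cmult dG)
  then have "(F has_real_derivative 0) (at \<theta>)" for \<theta> unfolding zero .
  then have "F \<theta> = F 0" using DERIV_isconst_all[of F \<theta> 0] by blast
  moreover have "rot13 0 v = v" for v by (simp add: rot13_def vec_eq_iff forall_3)
  ultimately show ?thesis by (simp add: F_def)
qed

lemma polar_angle: "\<exists>\<theta>. - sin \<theta> * a + cos \<theta> * b = sqrt (a\<^sup>2 + b\<^sup>2) \<and> cos \<theta> * a + sin \<theta> * b = (0::real)"
proof (cases "a\<^sup>2 + b\<^sup>2 = 0")
  case True
  then show ?thesis by (simp add: sum_power2_eq_zero_iff)
next
  case False
  define r where "r = sqrt (a\<^sup>2 + b\<^sup>2)"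
  have r: "r > 0" "r\<^sup>2 = a\<^sup>2 + b\<^sup>2" using False by (auto simp: r_def sum_power2_gt_zero_iff sum_power2_eq_zero_iff)
  have "(b / r)\<^sup>2 + (- a / r)\<^sup>2 = (a\<^sup>2 + b\<^sup>2) / r\<^sup>2" by (simp add: power_divide add_divide_distrib)
  also have "\<dots> = 1" unfolding r(2)[symmetric] using r(1) by simp
  finally obtain \<theta> where t: "b / r = cos \<theta>" "- a / r = sin \<theta>" by (rule sincos_total_2pi) 
  have "- sin \<theta> * a + cos \<theta> * b = r\<^sup>2 / r" unfolding t[symmetric] r(2) by (simp add: add_divide_distrib power2_eq_square)
  moreover have "cos \<theta> * a + sin \<theta> * b = 0" unfolding t[symmetric] by simp
  moreover have "r\<^sup>2 / r = r" using r(1) by (simp add: power2_eq_square)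
  ultimately show ?thesis unfolding r_def[symmetric] by (intro exI[of _ \<theta>]) simp
qed

text \<open>The kernel is invariant under the rotations of two coordinate planes, which together carry \<open>y\<close> to the
  north pole. There only the zonal summand is left.\<close>

theorem sph_kernel_legendre:
  assumes x: "x \<in> S2" and y: "y \<in> S2"
  shows "sph_kernel l x y = legendre l (x \<bullet> y)"
proof -
  obtain \<theta>1 where t1: "sin \<theta>1 * y $ 1 + cos \<theta>1 * y $ 2 = 0"
    using polar_angle[of "y $ 2" "y $ 1"] by (auto simp: add.commute)
  define y1 where "y1 = rot12 \<theta>1 y"
  define x1 where "x1 = rot12 \<theta>1 x"
  have y12: "y1 $ 2 = 0" using t1 by (simp add: y1_def rot12_nth)
  have S1: "x1 \<in> S2" "y1 \<in> S2" unfolding x1_def y1_def by (rule rot12_S2[OF x] rot12_S2[OF y])+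
  obtain \<theta>2 where t2: "- sin \<theta>2 * y1 $ 1 + cos \<theta>2 * y1 $ 3 = sqrt ((y1 $ 1)\<^sup>2 + (y1 $ 3)\<^sup>2)"
     "cos \<theta>2 * y1 $ 1 + sin \<theta>2 * y1 $ 3 = 0"
    using polar_angle by blast
  define y2 where "y2 = rot13 \<theta>2 y1"
  define x2 where "x2 = rot13 \<theta>2 x1"
  have "sqrt ((y1 $ 1)\<^sup>2 + (y1 $ 3)\<^sup>2) = 1" using S1(2) y12 unfolding S2_iff by simp
  then have y2: "y2 $ 1 = 0" "y2 $ 2 = 0" "y2 $ 3 = 1"
    using t2 y12 by (simp_all add: y2_def rot13_nth)
  have "x \<bullet> y = x1 \<bullet> y1" unfolding x1_def y1_def using orthogonal_rot12[of \<theta>1] by (simp add: orthogonal_transformation_def)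
  also have "\<dots> = x2 \<bullet> y2" unfolding x2_def y2_def using orthogonal_rot13[of \<theta>2] by (simp add: orthogonal_transformation_def)
  also have "\<dots> = x2 $ 3" by (simp add: inner_vec_def sum_3 y2)
  finally have xy: "x \<bullet> y = x2 $ 3" .
  have H2: "sphH l a y2 = (if a = 0 then 1 else 0)" for a
    by (simp add: sphH_def y2 legendre_deriv_0 legendre_at_1 zero_complex.code[symmetric])
  have "sph_kernel l x y = sph_kernel l x1 y1" unfolding x1_def y1_def by (rule sph_kernel_rot12[symmetric])
  also have "\<dots> = sph_kernel l x2 y2" unfolding x2_def y2_def by (rule sph_kernel_rot13[OF S1, symmetric])
  also have "\<dots> = Re (sphH l 0 x2)" by (simp add: sph_kernel_def H2)
  also have "\<dots> = legendre l (x2 $ 3)" by (simp add: sphH_def legendre_deriv_0)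
  finally show ?thesis unfolding xy .
qed

lemma sum_symmetric_int:
  fixes f :: "int \<Rightarrow> 'b::comm_monoid_add"
  shows "(\<Sum>m=- int l..int l. f m) = f 0 + (\<Sum>a=1..l. f (int a) + f (- int a))"
proof (induction l)
  case (Suc l)
  have "{- int (Suc l)..int (Suc l)} = insert (int (Suc l)) (insert (- int (Suc l)) {- int l..int l})" by auto
  then have "(\<Sum>m=- int (Suc l)..int (Suc l). f m) = f (int (Suc l)) + (f (- int (Suc l)) + (\<Sum>m=- int l..int l. f m))"
    by simp
  then show ?case using Suc by (simp add: add_ac)
qed simp

lemma sph_harm_cases:
  shows "sph_harm l 0 x = sqrt ((2 * real l + 1) / (4 * pi)) * Re (sphH l 0 x)"
    and "a > 0 \<Longrightarrow> sph_harm l (int a) x = sqrt ((2 * real l + 1) / (4 * pi) * sph_weight l a) * sqrt 2 * Re (sphH l a x)"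
    and "a > 0 \<Longrightarrow> sph_harm l (- int a) x = sqrt ((2 * real l + 1) / (4 * pi) * sph_weight l a) * sqrt 2 * Im (sphH l a x)"
  by (simp_all add: sph_harm_def sphH_def legendre_deriv_def sph_weight_def Let_def)

theorem addition_theorem:
  assumes x: "x \<in> S2" and y: "y \<in> S2"
  shows "(\<Sum>m=- int l..int l. sph_harm l m x * sph_harm l m y) = (2 * real l + 1) / (4 * pi) * legendre l (x \<bullet> y)"
proof -
  define C where "C = (2 * real l + 1) / (4 * pi)"
  have C: "C \<ge> 0" by (simp add: C_def)
  have w: "sph_weight l a \<ge> 0" for a by (simp add: sph_weight_def)
  have pos: "sph_harm l (int a) x * sph_harm l (int a) y + sph_harm l (- int a) x * sph_harm l (- int a) y
    = C * (2 * sph_weight l a * Re (sphH l a x * cnj (sphH l a y)))" if "a \<in> {1..l}" for a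
  proof -
    have a: "a > 0" using that by simp
    have s: "sqrt (C * sph_weight l a) * sqrt (C * sph_weight l a) = C * sph_weight l a" "sqrt 2 * sqrt 2 = (2::real)"
      using C w[of a] by simp_all
    have "sph_harm l (int a) x * sph_harm l (int a) y + sph_harm l (- int a) x * sph_harm l (- int a) y
      = (sqrt (C * sph_weight l a) * sqrt (C * sph_weight l a)) * (sqrt 2 * sqrt 2) * (Re (sphH l a x) * Re (sphH l a y) + Im (sphH l a x) * Im (sphH l a y))"
      unfolding sph_harm_cases(2,3)[OF a] C_def[symmetric] by (simp only: distrib_left mult_ac)
    then show ?thesis unfolding s by simp
  qed
  have zero: "sph_harm l 0 x * sph_harm l 0 y = C * Re (sphH l 0 x * cnj (sphH l 0 y))"
  proof -
    have "sqrt C * sqrt C = C" using C by simp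
    then have "sph_harm l 0 x * sph_harm l 0 y = C * (Re (sphH l 0 x) * Re (sphH l 0 y))"
      unfolding sph_harm_cases(1) C_def[symmetric] by (metis mult.assoc mult.left_commute)
    then show ?thesis by (simp add: sphH_def)
  qed
  have "(\<Sum>m=- int l..int l. sph_harm l m x * sph_harm l m y) = C * sph_kernel l x y"
    unfolding sum_symmetric_int zero sph_kernel_def distrib_left sum_distrib_left
    by (intro arg_cong2[where f="(+)"] refl sum.cong pos)
  then show ?thesis unfolding sph_kernel_legendre[OF x y] C_def .
qed

section \<open>Orthonormality of the spherical harmonics\<close>

lemma continuous_on_sphH: "continuous_on S (sphH l a)"
proof -
  have "sphH l a = (\<lambda>x. of_real (legendre_deriv l a (x $ 3)) * (of_real (x $ 1) + \<i> * of_real (x $ 2)) ^ a)"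
    by (simp add: fun_eq_iff sphH_def complex_eq_iff) (simp add: Complex_eq)
  then show ?thesis by (simp only:) (intro continuous_intros)
qed

lemma continuous_on_sphD: "continuous_on S (sphD l a)"
proof (cases a)
  case 0
  then have "sphD l a = (\<lambda>x. - of_real (Re (sphH l 1 x)))" by (simp add: fun_eq_iff sphD_def)
  then show ?thesis by (simp only:) (intro continuous_intros continuous_on_sphH)
next
  case (Suc b)
  show ?thesis unfolding Suc sphD_Suc[abs_def] by (intro continuous_intros continuous_on_sphH) simp
qed

lemma continuous_on_sph_harm: "continuous_on S (sph_harm l m)"
proof -
  have "sph_harm l m = (\<lambda>x. sqrt ((2 * real l + 1) / (4 * pi) * fact (l - nat \<bar>m\<bar>) / fact (l + nat \<bar>m\<bar>)) *
     (if m = 0 then Re (sphH l (nat \<bar>m\<bar>) x) else if m > 0 then sqrt 2 * Re (sphH l (nat \<bar>m\<bar>) x) else sqrt 2 * Im (sphH l (nat \<bar>m\<bar>) x)))"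
    by (simp add: fun_eq_iff sph_harm_def sphH_def legendre_deriv_def Let_def)
  moreover have "continuous_on S (\<lambda>x. if m = 0 then Re (sphH l (nat \<bar>m\<bar>) x) else if m > 0 then sqrt 2 * Re (sphH l (nat \<bar>m\<bar>) x) else sqrt 2 * Im (sphH l (nat \<bar>m\<bar>) x))"
    by (cases "m = 0"; cases "m > 0"; simp del: abs_of_nonneg abs_of_pos; intro continuous_intros continuous_on_sphH)
  ultimately show ?thesis by (simp only:) (intro continuous_on_mult continuous_on_const)
qed

text \<open>Rotation invariance in infinitesimal form: derivatives along \<open>rot13\<close> integrate to zero.\<close>

lemma sphere_integral_rot13_derivative:
  fixes f Df :: "real^3 \<Rightarrow> real"
  assumes f: "continuous_on S2 f" and Df: "continuous_on S2 Df"
    and d: "\<And>x \<theta>. x \<in> S2 \<Longrightarrow> ((\<lambda>\<theta>. f (rot13 \<theta> x)) has_real_derivative Df (rot13 \<theta> x)) (at \<theta>)"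
  shows "(LINT x|sphere_measure. Df x) = 0"
proof -
  have fm: "f \<in> borel_measurable sphere_measure" and fi: "integrable sphere_measure f"
    using sphere_integrable_continuous[OF f] by auto
  have "\<exists>B. \<forall>x\<in>S2. norm (Df x) \<le> B"
    using compact_imp_bounded[OF compact_continuous_image[OF Df compact_sphere]] unfolding bounded_iff by blast
  then obtain B where B: "\<And>x. x \<in> S2 \<Longrightarrow> \<bar>Df x\<bar> \<le> B" unfolding real_norm_def by blast
  define q where "q n x = real (Suc n) * (f (rot13 (1 / real (Suc n)) x) - f x)" for n x
  have rm: "(\<lambda>x. f (rot13 \<theta> x)) \<in> borel_measurable sphere_measure" for \<theta>
    by (rule measurable_compose[OF orthogonal_measurable_sphere[OF orthogonal_rot13] fm])
  have ri: "integrable sphere_measure (\<lambda>x. f (rot13 \<theta> x))" for \<theta>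
    using integrable_distr[OF orthogonal_measurable_sphere[OF orthogonal_rot13, of \<theta>], of f]
      fi sphere_measure_orthogonal_invariant[OF orthogonal_rot13, of \<theta>] by simp
  have q0: "(LINT x|sphere_measure. q n x) = 0" for n
    unfolding q_def using ri fi sphere_integral_orthogonal[OF orthogonal_rot13 fm] by simp
  have r0: "rot13 0 x = x" for x by (simp add: rot13_def vec_eq_iff forall_3)
  have lim: "(\<lambda>n. q n x) \<longlonglongrightarrow> Df x" if x: "x \<in> S2" for x
  proof -
    have "((\<lambda>h. (f (rot13 (0 + h) x) - f (rot13 0 x)) / h) \<longlongrightarrow> Df (rot13 0 x)) (at 0)"
      using d[OF x, of 0] unfolding DERIV_def .
    moreover have "filterlim (\<lambda>n. 1 / real (Suc n)) (at 0) sequentially"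
      using LIMSEQ_Suc[OF lim_1_over_n[where 'a=real]] by (simp add: filterlim_at inverse_eq_divide)
    ultimately have "(\<lambda>n. (f (rot13 (0 + 1 / real (Suc n)) x) - f (rot13 0 x)) / (1 / real (Suc n))) \<longlonglongrightarrow> Df (rot13 0 x)"
      by (rule filterlim_compose)
    then show ?thesis unfolding q_def r0 by (simp add: mult.commute)
  qed
  have bound: "\<bar>q n x\<bar> \<le> B" if x: "x \<in> S2" for n x
  proof -
    obtain z where z: "f (rot13 (1 / real (Suc n)) x) - f (rot13 0 x) = (1 / real (Suc n) - 0) * Df (rot13 z x)"
      using MVT2[of 0 "1 / real (Suc n)" "\<lambda>\<theta>. f (rot13 \<theta> x)" "\<lambda>\<theta>. Df (rot13 \<theta> x)"] d[OF x] by auto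
    then have "q n x = Df (rot13 z x)" unfolding q_def r0 by simp
    then show ?thesis using B[OF rot13_S2[OF x]] by simp
  qed
  have "(\<lambda>n. LINT x|sphere_measure. q n x) \<longlonglongrightarrow> (LINT x|sphere_measure. Df x)"
  proof (rule integral_dominated_convergence[where w="\<lambda>_. B"])
    show "Df \<in> borel_measurable sphere_measure" using sphere_integrable_continuous[OF Df] by auto
    show "q n \<in> borel_measurable sphere_measure" for n unfolding q_def[abs_def] using rm fm by measurable
    show "AE x in sphere_measure. (\<lambda>n. q n x) \<longlonglongrightarrow> Df x" using lim by (intro AE_I2) simp
    show "AE x in sphere_measure. norm (q n x) \<le> B" for n using bound by (intro AE_I2) simp
  qed simp
  then show ?thesis unfolding q0 by (simp add: LIMSEQ_const_iff)
qed

lemma sphere_integral_rot13_derivative_complex: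
  fixes f Df :: "real^3 \<Rightarrow> complex"
  assumes f: "continuous_on S2 f" and Df: "continuous_on S2 Df"
    and d: "\<And>x \<theta>. x \<in> S2 \<Longrightarrow> ((\<lambda>\<theta>. f (rot13 \<theta> x)) has_vector_derivative Df (rot13 \<theta> x)) (at \<theta>)"
  shows "(LINT x|sphere_measure. Df x) = 0"
proof -
  note i = sphere_integrable_continuous[OF Df]
  have "(LINT x|sphere_measure. Re (Df x)) = 0"
    by (rule sphere_integral_rot13_derivative[where f="\<lambda>x. Re (f x)"])
      (auto intro!: continuous_intros f Df bounded_linear.has_vector_derivative[OF bounded_linear_Re d]
        simp: has_real_derivative_iff_has_vector_derivative)
  moreover have "(LINT x|sphere_measure. Im (Df x)) = 0"
    by (rule sphere_integral_rot13_derivative[where f="\<lambda>x. Im (f x)"])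
      (auto intro!: continuous_intros f Df bounded_linear.has_vector_derivative[OF bounded_linear_Im d]
        simp: has_real_derivative_iff_has_vector_derivative)
  ultimately show ?thesis using i by (simp add: complex_eq_iff)
qed

definition sphI :: "nat \<Rightarrow> nat \<Rightarrow> nat \<Rightarrow> nat \<Rightarrow> complex" where
  "sphI l a l' b = (LINT x|sphere_measure. sphH l a x * cnj (sphH l' b x))"

definition sphJ :: "nat \<Rightarrow> nat \<Rightarrow> nat \<Rightarrow> nat \<Rightarrow> complex" where
  "sphJ l a l' b = (LINT x|sphere_measure. sphH l a x * sphH l' b x)"

lemma sphIJ_integrable:
  "integrable sphere_measure (\<lambda>x. sphH l a x * cnj (sphH l' b x))"
  "integrable sphere_measure (\<lambda>x. sphH l a x * sphH l' b x)"
  by (intro sphere_integrable_continuous continuous_intros continuous_on_sphH)+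

lemma sphI_eq_0: assumes "a \<noteq> b" shows "sphI l a l' b = 0"
proof -
  define \<theta> where "\<theta> = pi / (real a - real b)"
  have t: "real a * \<theta> - real b * \<theta> = pi" unfolding left_diff_distrib[symmetric] using assms by (simp add: \<theta>_def)
  have "cis (real a * \<theta>) * cnj (cis (real b * \<theta>)) = cis pi"
    by (simp add: cis_cnj cis_mult t)
  then have "sphH l a (rot12 \<theta> x) * cnj (sphH l' b (rot12 \<theta> x)) = - (sphH l a x * cnj (sphH l' b x))" for x
    unfolding sphH_rot12 by (simp add: mult_ac)
  moreover have "(LINT x|sphere_measure. sphH l a (rot12 \<theta> x) * cnj (sphH l' b (rot12 \<theta> x))) = sphI l a l' b"
    unfolding sphI_def using sphIJ_integrable(1)
    by (intro sphere_integral_orthogonal[OF orthogonal_rot12, where f="\<lambda>x. sphH l a x * cnj (sphH l' b x)"]) auto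
  ultimately have "sphI l a l' b = - sphI l a l' b" by (simp add: sphI_def)
  then show ?thesis by simp
qed

lemma sphJ_eq_0: assumes "a + b > 0" shows "sphJ l a l' b = 0"
proof -
  define \<theta> where "\<theta> = pi / (real a + real b)"
  have "real a + real b \<noteq> 0" using assms by linarith
  then have t: "real a * \<theta> + real b * \<theta> = pi" unfolding distrib_right[symmetric] by (simp add: \<theta>_def)
  have "cis (real a * \<theta>) * cis (real b * \<theta>) = cis pi"
    by (simp add: cis_mult t)
  then have "sphH l a (rot12 \<theta> x) * sphH l' b (rot12 \<theta> x) = - (sphH l a x * sphH l' b x)" for x
    unfolding sphH_rot12 by (simp add: mult_ac)
  moreover have "(LINT x|sphere_measure. sphH l a (rot12 \<theta> x) * sphH l' b (rot12 \<theta> x)) = sphJ l a l' b"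
    unfolding sphJ_def using sphIJ_integrable(2)
    by (intro sphere_integral_orthogonal[OF orthogonal_rot12, where f="\<lambda>x. sphH l a x * sphH l' b x"]) auto
  ultimately have "sphJ l a l' b = - sphJ l a l' b" by (simp add: sphJ_def)
  then show ?thesis by simp
qed

text \<open>Integrating the derivative of \<open>sphH l (b + 1) * cnj (sphH l' b)\<close> links consecutive rungs.\<close>

lemma sphI_Suc: "sphI l (Suc b) l' (Suc b) = of_real ((real l + real b + 1) * (real l - real b)) * sphI l b l' b"
proof -
  let ?f = "\<lambda>x. sphH l (Suc b) x * cnj (sphH l' b x)"
  let ?Df = "\<lambda>x. sphH l (Suc b) x * cnj (sphD l' b x) + sphD l (Suc b) x * cnj (sphH l' b x)"
  have "((\<lambda>\<theta>. ?f (rot13 \<theta> x)) has_vector_derivative ?Df (rot13 \<theta> x)) (at \<theta>)" if "x \<in> S2" for x \<theta>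
    by (rule has_vector_derivative_mult[OF sphH_deriv[OF that]
        bounded_linear.has_vector_derivative[OF bounded_linear_cnj sphH_deriv[OF that]]])
  then have zero: "(LINT x|sphere_measure. ?Df x) = 0"
    by (intro sphere_integral_rot13_derivative_complex[where f="?f"])
      (auto intro!: continuous_intros continuous_on_sphH continuous_on_sphD)
  define lam where "lam = (real l + real b + 1) * (real l - real b)"
  have 1: "(LINT x|sphere_measure. sphD l (Suc b) x * cnj (sphH l' b x)) = of_real (lam / 2) * sphI l b l' b"
  proof -
    have "(LINT x|sphere_measure. sphD l (Suc b) x * cnj (sphH l' b x))
       = (LINT x|sphere_measure. of_real (lam / 2) * (sphH l b x * cnj (sphH l' b x)) - (1 / 2) * (sphH l (b + 2) x * cnj (sphH l' b x)))"
      unfolding sphD_Suc lam_def[symmetric] by (intro Bochner_Integration.integral_cong) (simp_all add: algebra_simps)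
    also have "\<dots> = of_real (lam / 2) * sphI l b l' b - (1 / 2) * sphI l (b + 2) l' b"
      unfolding sphI_def
      by (subst Bochner_Integration.integral_diff[OF integrable_mult_right[OF sphIJ_integrable(1)] integrable_mult_right[OF sphIJ_integrable(1)]])
         (simp only: integral_mult_right_zero)
    finally show ?thesis by (simp add: sphI_eq_0)
  qed
  have 2: "(LINT x|sphere_measure. sphH l (Suc b) x * cnj (sphD l' b x)) = - (1 / 2) * sphI l (Suc b) l' (Suc b)"
  proof (cases b)
    case 0
    have "- of_real (Re z) = - (1 / 2) * z - (1 / 2) * cnj z" for z by (simp add: complex_eq_iff)
    then have "(LINT x|sphere_measure. sphH l (Suc b) x * cnj (sphD l' b x))
       = (LINT x|sphere_measure. (- (1 / 2)) * (sphH l (Suc b) x * cnj (sphH l' (Suc b) x)) - (1 / 2) * (sphH l (Suc b) x * sphH l' (Suc b) x))"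
      unfolding 0 sphD_def by (intro Bochner_Integration.integral_cong) (simp_all add: complex_eq_iff field_simps)
    also have "\<dots> = (- (1 / 2)) * sphI l (Suc b) l' (Suc b) - (1 / 2) * sphJ l (Suc b) l' (Suc b)"
      unfolding sphI_def sphJ_def
      by (subst Bochner_Integration.integral_diff[OF integrable_mult_right[OF sphIJ_integrable(1)] integrable_mult_right[OF sphIJ_integrable(2)]])
         (simp only: integral_mult_right_zero)
    finally show ?thesis by (simp add: sphJ_eq_0)
  next
    case (Suc c)
    define mu where "mu = (real l' + real c + 1) * (real l' - real c)"
    have "(LINT x|sphere_measure. sphH l (Suc b) x * cnj (sphD l' b x))
       = (LINT x|sphere_measure. of_real (mu / 2) * (sphH l (Suc b) x * cnj (sphH l' c x)) - (1 / 2) * (sphH l (Suc b) x * cnj (sphH l' (Suc b) x)))"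
      unfolding Suc sphD_Suc mu_def[symmetric] by (intro Bochner_Integration.integral_cong) (simp_all add: algebra_simps)
    also have "\<dots> = of_real (mu / 2) * sphI l (Suc b) l' c - (1 / 2) * sphI l (Suc b) l' (Suc b)"
      unfolding sphI_def
      by (subst Bochner_Integration.integral_diff[OF integrable_mult_right[OF sphIJ_integrable(1)] integrable_mult_right[OF sphIJ_integrable(1)]])
         (simp only: integral_mult_right_zero)
    finally show ?thesis using Suc by (simp add: sphI_eq_0)
  qed
  have i: "integrable sphere_measure (\<lambda>x. sphH l (Suc b) x * cnj (sphD l' b x))"
     "integrable sphere_measure (\<lambda>x. sphD l (Suc b) x * cnj (sphH l' b x))"
    by (intro sphere_integrable_continuous continuous_intros continuous_on_sphH continuous_on_sphD)+
  have "- (1 / 2) * sphI l (Suc b) l' (Suc b) + of_real (lam / 2) * sphI l b l' b = 0"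
    using zero unfolding Bochner_Integration.integral_add[OF i] 1 2 .
  then show ?thesis unfolding lam_def[symmetric] by (simp add: field_simps)
qed

lemma sphI_cnj: "sphI l' b l a = cnj (sphI l a l' b)"
proof -
  have "(LINT x|sphere_measure. cnj (sphH l a x * cnj (sphH l' b x))) = cnj (sphI l a l' b)"
    unfolding sphI_def by (rule integral_bounded_linear[OF bounded_linear_cnj sphIJ_integrable(1)])
  then show ?thesis by (simp add: sphI_def mult.commute)
qed

text \<open>Comparing one step of the ladder in \<open>l\<close> with the conjugate of the same step in \<open>l'\<close> gives the
  integral two factors, \<open>l (l + 1)\<close> and \<open>l' (l' + 1)\<close>; they differ, so it vanishes at order zero, and the ladder
  carries this to all orders.\<close>

lemma sphI_degree_eq_0: assumes "l \<noteq> l'" shows "sphI l b l' b = 0"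
proof (induction b)
  case 0
  have 1: "sphI l 1 l' 1 = of_real ((real l + 1) * real l) * sphI l 0 l' 0" using sphI_Suc[of l 0 l'] by simp
  have 2: "sphI l' 1 l 1 = of_real ((real l' + 1) * real l') * sphI l' 0 l 0" using sphI_Suc[of l' 0 l] by simp
  from arg_cong[OF 2, of cnj] have "sphI l 1 l' 1 = of_real ((real l' + 1) * real l') * sphI l 0 l' 0"
    by (simp add: sphI_cnj[symmetric])
  with 1 have "of_real ((real l + 1) * real l - (real l' + 1) * real l') * sphI l 0 l' 0 = 0"
    by (simp add: algebra_simps)
  moreover have "(real l + 1) * real l - (real l' + 1) * real l' = (real l - real l') * (real l + real l' + 1)"
    by (simp add: algebra_simps)
  moreover have "real l + real l' + 1 \<noteq> 0" by linarith
  ultimately show ?case using assms by (simp only: of_real_eq_0_iff mult_eq_0_iff) auto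
qed (simp add: sphI_Suc)

lemma sphI_weight: "a \<le> l \<Longrightarrow> of_real (sph_weight l a) * sphI l a l a = sphI l 0 l 0"
proof (induction a)
  case (Suc b)
  then have "of_real (sph_weight l (Suc b)) * sphI l (Suc b) l (Suc b) = of_real ((real l + real b + 1) * (real l - real b) * sph_weight l (Suc b)) * sphI l b l b"
    by (simp add: sphI_Suc mult_ac)
  also have "\<dots> = sphI l 0 l 0" using Suc by (simp only: sph_weight_Suc)
  finally show ?case .
qed (simp add: sph_weight_def)

text \<open>The common value is found by integrating the reproducing kernel over the diagonal.\<close>

lemma sphI_norm: "a \<le> l \<Longrightarrow> of_real (sph_weight l a) * sphI l a l a = of_real (4 * pi / (2 * real l + 1))"
proof -
  assume a: "a \<le> l"
  have "4 * pi = (LINT x|sphere_measure. sph_kernel l x x)"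
  proof -
    have "(LINT x|sphere_measure. sph_kernel l x x) = (LINT x|sphere_measure. 1)"
    proof (rule Bochner_Integration.integral_cong[OF refl])
      fix x assume "x \<in> space sphere_measure"
      then have "x \<in> S2" by simp
      moreover from this have "x \<bullet> x = 1" by (simp add: norm_eq_1)
      ultimately show "sph_kernel l x x = 1" by (simp add: sph_kernel_legendre legendre_at_1 del: mem_sphere)
    qed
    then show ?thesis by (simp add: measure_sphere_measure)
  qed
  also have "\<dots> = Re (sphI l 0 l 0) + (\<Sum>a=1..l. 2 * sph_weight l a * Re (sphI l a l a))"
  proof -
    have iR: "integrable sphere_measure (\<lambda>x. Re (sphH l a x * cnj (sphH l a x)))" for a
      using sphIJ_integrable(1) by (rule integrable_Re)
    have "(LINT x|sphere_measure. sph_kernel l x x) = (LINT x|sphere_measure. Re (sphH l 0 x * cnj (sphH l 0 x)))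
       + (\<Sum>a=1..l. LINT x|sphere_measure. 2 * sph_weight l a * Re (sphH l a x * cnj (sphH l a x)))"
      unfolding sph_kernel_def
      by (subst Bochner_Integration.integral_add Bochner_Integration.integral_sum;
          (intro Bochner_Integration.integrable_sum integrable_mult_right iR)?)+ (rule refl)
    then show ?thesis unfolding sphI_def integral_mult_right_zero integral_Re[OF sphIJ_integrable(1)] .
  qed
  also have "\<dots> = Re (sphI l 0 l 0) + (\<Sum>a=1..l. 2 * Re (sphI l 0 l 0))"
  proof -
    have "2 * sph_weight l a * Re (sphI l a l a) = 2 * Re (sphI l 0 l 0)" if "a \<in> {1..l}" for a
      using arg_cong[OF sphI_weight[of a l], of Re] that by simp
    then have "(\<Sum>a=1..l. 2 * sph_weight l a * Re (sphI l a l a)) = (\<Sum>a=1..l. 2 * Re (sphI l 0 l 0))"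
      by (rule sum.cong[OF refl])
    then show ?thesis by (simp only:)
  qed
  also have "\<dots> = (2 * real l + 1) * Re (sphI l 0 l 0)" by (simp add: algebra_simps)
  finally have "Re (sphI l 0 l 0) = 4 * pi / (2 * real l + 1)" by (simp add: field_simps)
  moreover have "Im (sphI l 0 l 0) = 0" using arg_cong[OF sphI_cnj[of l 0 l 0], of Im] by simp
  ultimately have "sphI l 0 l 0 = of_real (4 * pi / (2 * real l + 1))" by (simp add: complex_eq_iff)
  then show ?thesis using sphI_weight[OF a] by simp
qed

lemma sphIJ_parts:
  "(LINT x|sphere_measure. Re (sphH l a x) * Re (sphH l' b x)) = Re (sphI l a l' b + sphJ l a l' b) / 2"
  "(LINT x|sphere_measure. Im (sphH l a x) * Im (sphH l' b x)) = Re (sphI l a l' b - sphJ l a l' b) / 2"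
  "(LINT x|sphere_measure. Re (sphH l a x) * Im (sphH l' b x)) = Im (sphJ l a l' b - sphI l a l' b) / 2"
  "(LINT x|sphere_measure. Im (sphH l a x) * Re (sphH l' b x)) = Im (sphJ l a l' b + sphI l a l' b) / 2"
proof -
  note i = sphIJ_integrable[of l a l' b]
  note R = integral_Re[OF i(1)] integral_Re[OF i(2)] and I = integral_Im[OF i(1)] integral_Im[OF i(2)]
  note iR = integrable_Re[OF i(1)] integrable_Re[OF i(2)] integrable_Im[OF i(1)] integrable_Im[OF i(2)]
  have "Re (sphI l a l' b + sphJ l a l' b) / 2 = (LINT x|sphere_measure. (Re (sphH l a x * cnj (sphH l' b x)) + Re (sphH l a x * sphH l' b x)) / 2)"
    unfolding sphI_def sphJ_def plus_complex.sel using iR R by (simp del: times_complex.sel complex_cnj)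
  then show "(LINT x|sphere_measure. Re (sphH l a x) * Re (sphH l' b x)) = Re (sphI l a l' b + sphJ l a l' b) / 2" by simp
  have "Re (sphI l a l' b - sphJ l a l' b) / 2 = (LINT x|sphere_measure. (Re (sphH l a x * cnj (sphH l' b x)) - Re (sphH l a x * sphH l' b x)) / 2)"
    unfolding sphI_def sphJ_def minus_complex.sel using iR R by (simp del: times_complex.sel complex_cnj)
  then show "(LINT x|sphere_measure. Im (sphH l a x) * Im (sphH l' b x)) = Re (sphI l a l' b - sphJ l a l' b) / 2" by simp
  have "Im (sphJ l a l' b - sphI l a l' b) / 2 = (LINT x|sphere_measure. (Im (sphH l a x * sphH l' b x) - Im (sphH l a x * cnj (sphH l' b x))) / 2)"
    unfolding sphI_def sphJ_def minus_complex.sel using iR I by (simp del: times_complex.sel complex_cnj)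
  then show "(LINT x|sphere_measure. Re (sphH l a x) * Im (sphH l' b x)) = Im (sphJ l a l' b - sphI l a l' b) / 2" by (simp add: mult.commute)
  have "Im (sphJ l a l' b + sphI l a l' b) / 2 = (LINT x|sphere_measure. (Im (sphH l a x * sphH l' b x) + Im (sphH l a x * cnj (sphH l' b x))) / 2)"
    unfolding sphI_def sphJ_def plus_complex.sel using iR I by (simp del: times_complex.sel complex_cnj)
  then show "(LINT x|sphere_measure. Im (sphH l a x) * Re (sphH l' b x)) = Im (sphJ l a l' b + sphI l a l' b) / 2" by simp
qed

lemma sphI_value: "a \<le> l \<Longrightarrow> sphI l a l' b = (if l = l' \<and> a = b then of_real (4 * pi / (2 * real l + 1) / sph_weight l a) else 0)"
proof -
  assume a: "a \<le> l"
  have w: "sph_weight l a \<noteq> 0" by (simp add: sph_weight_def)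
  have "sphI l a l a = of_real (4 * pi / (2 * real l + 1) / sph_weight l a)"
  proof -
    have "sphI l a l a = (of_real (sph_weight l a) * sphI l a l a) / of_real (sph_weight l a)" using w by simp
    then show ?thesis unfolding sphI_norm[OF a] of_real_divide[symmetric] .
  qed
  then show ?thesis using sphI_eq_0[of a b l l'] sphI_degree_eq_0[of l l' a] by auto
qed

theorem sph_harm_orthonormal:
  assumes m: "\<bar>m\<bar> \<le> int l" and m': "\<bar>m'\<bar> \<le> int l'"
  shows "(LINT x|sphere_measure. sph_harm l m x * sph_harm l' m' x) = (if l = l' \<and> m = m' then 1 else 0)"
proof -
  define C where "C l = (2 * real l + 1) / (4 * pi)" for l
  have C: "C l > 0" for l by (simp add: C_def)
  have w: "sph_weight l a > 0" for l a by (simp add: sph_weight_def)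
  have CC: "2 * real l + 1 = 4 * (C l * pi)" for l by (simp add: C_def)
  have sq: "sqrt (C l) * sqrt (C l) = C l" "sqrt 2 * sqrt 2 = (2::real)"
     "sqrt (C l * sph_weight l a) * sqrt (C l * sph_weight l a) = C l * sph_weight l a" for a
    using C[of l] w[of l a] by simp_all
  have cases: "n = 0 \<or> (\<exists>a>0. n = int a \<and> a \<le> l) \<or> (\<exists>a>0. n = - int a \<and> a \<le> l)" if "\<bar>n\<bar> \<le> int l" for n l
  proof -
    consider "n = 0" | "n > 0" | "n < 0" by linarith
    then show ?thesis
    proof cases
      case 2 then show ?thesis using that by (intro disjI2 disjI1 exI[of _ "nat n"]) auto
    next
      case 3 then show ?thesis using that by (intro disjI2 exI[of _ "nat (- n)"]) auto
    qed simp
  qed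
  have Im0: "Im (sphH l 0 x) = 0" for l x by (simp add: sphH_def)
  have J0: "sphJ l 0 l' 0 = sphI l 0 l' 0" for l l' by (simp add: sphI_def sphJ_def sphH_def)
  have pull: "(LINT x|sphere_measure. (c * F x) * (d * G x)) = c * d * (LINT x|sphere_measure. F x * G x)" for c d :: real and F G
    by (subst integral_mult_right_zero[symmetric]) (simp add: mult_ac)
  consider (z) "m = 0" | (p) a where "a > 0" "m = int a" "a \<le> l" | (n) a where "a > 0" "m = - int a" "a \<le> l" using cases[OF m] by blast
  then show ?thesis
  proof cases
    case z
    consider (zz) "m' = 0" | (pp) a where "a > 0" "m' = int a" "a \<le> l'" | (nn) a where "a > 0" "m' = - int a" "a \<le> l'" using cases[OF m'] by blast
    then show ?thesis
    proof cases
      case zz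
      show ?thesis unfolding z zz sph_harm_cases(1) C_def[symmetric] pull sphIJ_parts J0
        using sq(1) CC[of l'] C[of l'] by (auto simp: sphI_value sph_weight_def)
    next
      case pp
      show ?thesis unfolding z pp(2) sph_harm_cases(1) sph_harm_cases(2)[OF pp(1)] C_def[symmetric] pull sphIJ_parts
        using pp by (simp add: sphI_value sphJ_eq_0)
    next
      case nn
      show ?thesis unfolding z nn(2) sph_harm_cases(1) sph_harm_cases(3)[OF nn(1)] C_def[symmetric] pull sphIJ_parts
        using nn by (simp add: sphI_value sphJ_eq_0)
    qed
  next
    case p
    consider (zz) "m' = 0" | (pp) a where "a > 0" "m' = int a" "a \<le> l'" | (nn) a where "a > 0" "m' = - int a" "a \<le> l'" using cases[OF m'] by blast
    then show ?thesis
    proof cases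
      case zz
      show ?thesis unfolding zz p(2) sph_harm_cases(1) sph_harm_cases(2)[OF p(1)] C_def[symmetric] pull sphIJ_parts
        using p by (simp add: sphI_value sphJ_eq_0)
    next
      case (pp a')
      have "C l * sph_weight l a * 2 * (1 / C l / sph_weight l a) / 2 = 1" using C[of l] w[of l a] by simp
      moreover have "(sqrt (C l * sph_weight l a) * sqrt 2) * (sqrt (C l * sph_weight l a) * sqrt 2) = C l * sph_weight l a * 2"
        using sq(2) sq(3)[of a] by (metis mult.assoc mult.left_commute)
      ultimately show ?thesis unfolding p(2) pp(2) sph_harm_cases(2)[OF p(1)] sph_harm_cases(2)[OF pp(1)] C_def[symmetric] pull sphIJ_parts
        using p pp CC[of l'] w[of l' a'] C[of l'] by (cases "l = l' \<and> a = a'") (auto simp: sphI_value sphJ_eq_0)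
    next
      case nn
      show ?thesis unfolding p(2) nn(2) sph_harm_cases(2)[OF p(1)] sph_harm_cases(3)[OF nn(1)] C_def[symmetric] pull sphIJ_parts
        using p nn by (simp add: sphI_value sphJ_eq_0)
    qed
  next
    case n
    consider (zz) "m' = 0" | (pp) a where "a > 0" "m' = int a" "a \<le> l'" | (nn) a where "a > 0" "m' = - int a" "a \<le> l'" using cases[OF m'] by blast
    then show ?thesis
    proof cases
      case zz
      show ?thesis unfolding zz n(2) sph_harm_cases(1) sph_harm_cases(3)[OF n(1)] C_def[symmetric] pull sphIJ_parts
        using n by (simp add: sphI_value sphJ_eq_0)
    next
      case pp
      show ?thesis unfolding n(2) pp(2) sph_harm_cases(3)[OF n(1)] sph_harm_cases(2)[OF pp(1)] C_def[symmetric] pull sphIJ_parts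
        using n pp by (simp add: sphI_value sphJ_eq_0)
    next
      case (nn a')
      have "C l * sph_weight l a * 2 * (1 / C l / sph_weight l a) / 2 = 1" using C[of l] w[of l a] by simp
      moreover have "(sqrt (C l * sph_weight l a) * sqrt 2) * (sqrt (C l * sph_weight l a) * sqrt 2) = C l * sph_weight l a * 2"
        using sq(2) sq(3)[of a] by (metis mult.assoc mult.left_commute)
      ultimately show ?thesis unfolding n(2) nn(2) sph_harm_cases(3)[OF n(1)] sph_harm_cases(3)[OF nn(1)] C_def[symmetric] pull sphIJ_parts
        using n nn CC[of l'] w[of l' a'] C[of l'] by (cases "l = l' \<and> a = a'") (auto simp: sphI_value sphJ_eq_0)
    qed
  qed
qed

section \<open>Zonal integrals\<close>

lemma sphere_reflect_swap: "(LINT x|sphere_measure. (x $ 1)\<^sup>2 * (x $ 3) ^ n) = (LINT x|sphere_measure. (x $ 2)\<^sup>2 * (x $ 3) ^ n)"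
proof -
  have "(\<lambda>x::real^3. (x $ 1)\<^sup>2 * (x $ 3) ^ n) \<in> borel_measurable sphere_measure"
    by (intro borel_measurable_integrable[OF sphere_integrable_continuous] continuous_intros)
  from sphere_integral_orthogonal[OF orthogonal_rot12[of "pi / 2"] this] show ?thesis
    by (simp add: rot12_nth)
qed

lemma sphere_moments: "(LINT x|sphere_measure. (x $ 3) ^ n) = 2 * pi * (LINT z|lborel. z ^ n * indicator {-1..1} z)"
proof -
  define mo where "mo n = (LINT x|sphere_measure. (x $ 3) ^ n)" for n :: nat
  have i: "integrable sphere_measure (\<lambda>x::real^3. (x $ 3) ^ n)" "integrable sphere_measure (\<lambda>x::real^3. (x $ 1)\<^sup>2 * (x $ 3) ^ n)"
    "integrable sphere_measure (\<lambda>x::real^3. (x $ 2)\<^sup>2 * (x $ 3) ^ n)" for n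
    by (intro sphere_integrable_continuous continuous_intros)+
  have sq: "(LINT x|sphere_measure. (x $ 1)\<^sup>2 * (x $ 3) ^ n) = (mo n - mo (n + 2)) / 2" for n
  proof -
    have "mo n - mo (n + 2) = (LINT x|sphere_measure. (x $ 3) ^ n - (x $ 3) ^ (n + 2))"
      unfolding mo_def using i(1) by (simp only: Bochner_Integration.integral_diff)
    also have "\<dots> = (LINT x|sphere_measure. (x $ 1)\<^sup>2 * (x $ 3) ^ n + (x $ 2)\<^sup>2 * (x $ 3) ^ n)"
    proof (rule Bochner_Integration.integral_cong[OF refl])
      fix x assume "x \<in> space sphere_measure"
      then have "(x $ 1)\<^sup>2 + (x $ 2)\<^sup>2 = 1 - (x $ 3)\<^sup>2" using S2_iff[of x] by simp
      then have "((x $ 1)\<^sup>2 + (x $ 2)\<^sup>2) * (x $ 3) ^ n = (1 - (x $ 3)\<^sup>2) * (x $ 3) ^ n" by simp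
      then show "(x $ 3) ^ n - (x $ 3) ^ (n + 2) = (x $ 1)\<^sup>2 * (x $ 3) ^ n + (x $ 2)\<^sup>2 * (x $ 3) ^ n"
        by (simp add: algebra_simps power2_eq_square)
    qed
    also have "\<dots> = 2 * (LINT x|sphere_measure. (x $ 1)\<^sup>2 * (x $ 3) ^ n)"
      using i(2,3) sphere_reflect_swap[of n] by (simp only: Bochner_Integration.integral_add)
    finally show ?thesis by simp
  qed
  have dx: "((\<lambda>\<theta>. rot13 \<theta> x $ 1 * (rot13 \<theta> x $ 3) ^ n) has_real_derivative
      rot13 \<theta> x $ 3 * (rot13 \<theta> x $ 3) ^ n + real n * (rot13 \<theta> x $ 3) ^ (n - 1) * - (rot13 \<theta> x $ 1) * rot13 \<theta> x $ 1) (at \<theta>)" for x \<theta> n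
    by (rule derivative_eq_intros rot13_nth_deriv refl)+ (simp add: mult_ac)
  have zero: "(LINT x|sphere_measure. x $ 3 * (x $ 3) ^ n + real n * (x $ 3) ^ (n - 1) * - (x $ 1) * x $ 1) = 0" for n
    by (rule sphere_integral_rot13_derivative[where f="\<lambda>x. x $ 1 * (x $ 3) ^ n", OF _ _ dx]) (intro continuous_intros)+
  have rec: "mo (n + 2) = (real n + 1) / (real n + 3) * mo n" for n
  proof -
    have "0 = (LINT x|sphere_measure. (x $ 3) ^ (n + 2) - (real n + 1) * ((x $ 1)\<^sup>2 * (x $ 3) ^ n))"
      using zero[of "Suc n"] by (simp add: power2_eq_square mult_ac add.commute)
    also have "\<dots> = mo (n + 2) - (real n + 1) * (LINT x|sphere_measure. (x $ 1)\<^sup>2 * (x $ 3) ^ n)"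
      unfolding mo_def using Bochner_Integration.integral_diff[OF i(1)[of "n + 2"] integrable_mult_right[OF i(2)[of n], of "real n + 1"]]
      by (simp only: integral_mult_right_zero)
    also have "\<dots> = mo (n + 2) - (real n + 1) * ((mo n - mo (n + 2)) / 2)"
      unfolding sq ..
    finally have "mo (n + 2) * (real n + 3) = (real n + 1) * mo n" by (simp add: algebra_simps)
    moreover have "real n + 3 \<noteq> 0" by linarith
    ultimately show ?thesis by (simp add: field_simps)
  qed
  have m0: "mo 0 = 4 * pi" by (simp add: mo_def measure_sphere_measure)
  have m1: "mo 1 = 0" using zero[of 0] by (simp add: mo_def)
  have val: "mo n = 2 * pi * ((1 - (-1) ^ (n + 1)) / (real n + 1))" for n
  proof (induction n rule: nat_induct2)
    case 0 then show ?case by (simp add: m0)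
  next
    case 1 then show ?case by (simp add: m1[simplified])
  next
    case (step n)
    have "real n + 1 \<noteq> 0" "real n + 3 \<noteq> 0" by linarith+
    then show ?case unfolding rec[of n] step by (simp add: add.commute[of _ 3])
  qed
  have "(LINT z|lborel. z ^ n * indicator {-1..1} z) = (1 - (-1) ^ (n + 1)) / (real n + 1)"
  proof -
    have "(LINT z|lborel. indicator {-1..1} z *\<^sub>R z ^ n) = 1 ^ Suc n / real (Suc n) - (-1) ^ Suc n / real (Suc n)"
    proof (rule integral_FTC_atLeastAtMost[where F="\<lambda>z. z ^ Suc n / real (Suc n)"])
      fix z :: real
      have "((\<lambda>z. z ^ Suc n / real (Suc n)) has_real_derivative z ^ n) (at z within {-1..1})"
        using DERIV_cdivide[OF DERIV_pow[of "Suc n" z "{-1..1}"], of "real (Suc n)"] by simp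
      then show "((\<lambda>z. z ^ Suc n / real (Suc n)) has_vector_derivative z ^ n) (at z within {-1..1})"
        by (simp add: has_real_derivative_iff_has_vector_derivative)
    qed (auto intro!: continuous_intros)
    then show ?thesis by (simp add: diff_divide_distrib add_divide_distrib mult.commute add.commute)
  qed
  then show ?thesis using val[of n] unfolding mo_def by simp
qed

text \<open>By Archimedes' hat-box theorem the height on the sphere is uniformly distributed. A law on a bounded
  interval is determined by its moments, through Weierstrass approximation of the characteristic function.\<close>

lemma sphere_height_continuous:
  fixes f :: "real \<Rightarrow> real"
  assumes f: "continuous_on UNIV f"
  shows "(LINT x|sphere_measure. f (x $ 3)) = 2 * pi * (LINT z|lborel. f z * indicator {-1..1} z)"
proof -
  define U :: "(real \<Rightarrow> real) \<Rightarrow> real" where "U = (\<lambda>f. 2 * pi * (LINT z|lborel. f z * indicator {-1..1} z))"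
  define V :: "(real \<Rightarrow> real) \<Rightarrow> real" where "V = (\<lambda>f. LINT x|sphere_measure. f (x $ 3))"
  have iU: "integrable lborel (\<lambda>z. g z * indicator {-1..1} z)" if "continuous_on UNIV g" for g :: "real \<Rightarrow> real"
    using borel_integrable_atLeastAtMost'[of "-1" 1 g] continuous_on_subset[OF that]
    by (simp add: set_integrable_def mult.commute)
  have iV: "integrable sphere_measure (\<lambda>x. g (x $ 3))" if "continuous_on UNIV g" for g :: "real \<Rightarrow> real"
    by (intro sphere_integrable_continuous continuous_on_compose2[OF that]) (auto intro!: continuous_intros)
  have h: "x $ 3 \<in> {-1..1}" if "x \<in> S2" for x :: "real^3"
    using that component_le_norm_cart[of x 3] by (auto simp: abs_le_iff)
  have poly: "V p = U p" if "p = (\<lambda>z. \<Sum>i\<le>n. a i * z ^ i)" for p a and n :: nat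
  proof -
    have "V p = (\<Sum>i\<le>n. a i * (LINT x|sphere_measure. (x $ 3) ^ i))"
      unfolding V_def that using iV[of "\<lambda>z. z ^ _"] by (simp add: continuous_intros)
    also have "\<dots> = (\<Sum>i\<le>n. a i * (2 * pi * (LINT z|lborel. z ^ i * indicator {-1..1} z)))"
      unfolding sphere_moments ..
    also have "\<dots> = 2 * pi * (LINT z|lborel. (\<Sum>i\<le>n. a i * (z ^ i * indicator {-1..1} z)))"
      using iU[of "\<lambda>z. z ^ _"] by (simp add: continuous_intros sum_distrib_left mult_ac)
    also have "\<dots> = U p" unfolding U_def that by (simp add: sum_distrib_right mult.assoc)
    finally show ?thesis .
  qed
  have "\<bar>V f - U f\<bar> \<le> 8 * pi * e" if e: "e > 0" for e
  proof -
    obtain p where p: "real_polynomial_function p" "\<And>x. x \<in> {-1..1} \<Longrightarrow> \<bar>f x - p x\<bar> < e"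
      using Stone_Weierstrass_real_polynomial_function[of "{-1..1}" f e] f e continuous_on_subset by (metis compact_Icc subset_UNIV)
    then obtain a n where pa: "p = (\<lambda>z. \<Sum>i\<le>n. a i * z ^ i)" using real_polynomial_function_iff_sum[of p] by blast
    have pc: "continuous_on UNIV p" unfolding pa by (intro continuous_intros)
    have "\<bar>V f - V p\<bar> \<le> 4 * pi * e"
    proof -
      have "V f - V p = (LINT x|sphere_measure. f (x $ 3) - p (x $ 3))" unfolding V_def using iV[OF f] iV[OF pc] by simp
      also have "norm \<dots> \<le> (LINT x|sphere_measure. e)"
        using iV[OF f] iV[OF pc] p(2) h by (intro integral_norm_bound[THEN order_trans] integral_mono) (auto simp del: mem_sphere intro: less_imp_le)
      finally show ?thesis by (simp add: measure_sphere_measure)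
    qed
    moreover have "\<bar>U f - U p\<bar> \<le> 4 * pi * e"
    proof -
      have "(LINT z|lborel. f z * indicator {-1..1::real} z) - (LINT z|lborel. p z * indicator {-1..1} z) = (LINT z|lborel. f z * indicator {-1..1} z - p z * indicator {-1..1} z)"
        using iU[OF f] iU[OF pc] by simp
      also have "norm \<dots> \<le> (LINT z|lborel. e * indicator {-1..1::real} z)"
      proof (rule order_trans[OF integral_norm_bound integral_mono])
        fix z :: real show "norm (f z * indicator {-1..1} z - p z * indicator {-1..1} z) \<le> e * indicator {-1..1} z"
          using p(2)[of z] by (cases "z \<in> {-1..1}") (auto intro: less_imp_le)
      qed (use iU[OF f] iU[OF pc] iU[of "\<lambda>_. e"] in auto)
      also have "\<dots> = 2 * e" using content_real[of "-1" 1] by simp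
      finally have "\<bar>(LINT z|lborel. f z * indicator {-1..1} z) - (LINT z|lborel. p z * indicator {-1..1} z)\<bar> \<le> 2 * e" by simp
      from mult_left_mono[OF this, of "2 * pi"] show ?thesis unfolding U_def by (simp add: right_diff_distrib[symmetric] abs_mult)
    qed
    ultimately show ?thesis using poly[OF pa] by linarith
  qed
  then have "\<bar>V f - U f\<bar> \<le> 0 + e" if "e > 0" for e
    using that[THEN divide_pos_pos, of "8 * pi"] by (metis add_0 mult.commute nonzero_divide_eq_eq pi_gt_zero mult_pos_pos zero_less_numeral less_irrefl)
  then have "\<bar>V f - U f\<bar> \<le> 0" by (rule field_le_epsilon)
  then show ?thesis unfolding U_def V_def by simp
qed

lemma sphere_height_distribution:
  "distr sphere_measure borel (\<lambda>x. x $ 3) = density lborel (\<lambda>z. ennreal (2 * pi * indicator {-1..1} z))"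
proof -
  define M1 where "M1 = distr sphere_measure borel (\<lambda>x::real^3. x $ 3)"
  define M2 where "M2 = density lborel (\<lambda>z::real. ennreal (2 * pi * indicator {-1..1} z))"
  have hm [measurable]: "(\<lambda>x::real^3. x $ 3) \<in> borel_measurable sphere_measure"
    by (intro borel_measurable_integrable[OF sphere_integrable_continuous] continuous_intros)
  have 1: "finite_borel_measure M1"
    unfolding finite_borel_measure_def finite_borel_measure_axioms_def M1_def
    by (auto intro!: sphere.finite_measure_distr)
  have 2: "finite_borel_measure M2"
  proof -
    have "emeasure M2 (space M2) = (\<integral>\<^sup>+z. ennreal (2 * pi) * indicator {-1..1::real} z \<partial>lborel)"
      unfolding M2_def by (subst emeasure_density) (auto intro!: nn_integral_cong simp: indicator_def)
    also have "\<dots> = ennreal (2 * pi) * 2" by (subst nn_integral_cmult_indicator) auto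
    finally have "emeasure M2 (space M2) \<noteq> \<infinity>" by (simp add: ennreal_mult_eq_top_iff)
    then have "finite_measure M2" by (rule finite_measureI)
    then show ?thesis unfolding finite_borel_measure_def finite_borel_measure_axioms_def by (simp add: M2_def)
  qed
  interpret M1: finite_borel_measure M1 by fact
  interpret M2: finite_borel_measure M2 by fact
  have eq: "(LINT z|M1. f z) = (LINT z|M2. f z)" if f: "continuous_on UNIV f" for f :: "real \<Rightarrow> real"
  proof -
    have [measurable]: "f \<in> borel_measurable borel" using f by (rule borel_measurable_continuous_onI)
    have "(LINT z|M1. f z) = (LINT x|sphere_measure. f (x $ 3))" unfolding M1_def by (subst integral_distr) auto
    also have "\<dots> = (LINT z|lborel. (2 * pi * indicator {-1..1} z) *\<^sub>R f z)"
      unfolding sphere_height_continuous[OF f] by (subst integral_mult_right_zero[symmetric]) (simp add: mult_ac)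
    also have "\<dots> = (LINT z|M2. f z)" unfolding M2_def by (subst integral_density) auto
    finally show ?thesis .
  qed
  have "measure M1 {..a} = measure M2 {..a}" for a
  proof -
    define f where "f j z = max 0 (min 1 (1 - real j * (z - a)))" for j :: nat and z
    have fc: "continuous_on UNIV (f j)" for j unfolding f_def by (intro continuous_intros)
    have fm: "f j \<in> borel_measurable borel" for j using fc by (rule borel_measurable_continuous_onI)
    have lim: "(\<lambda>j. f j z) \<longlonglongrightarrow> indicator {..a} z" for z
    proof (cases "z \<le> a")
      case True
      then have "f j z = 1" for j unfolding f_def by (simp add: mult_nonneg_nonpos)
      then show ?thesis using True by simp
    next
      case False
      obtain N where N: "1 / (z - a) < real N" using reals_Archimedean2 by blast
      have "f j z = 0" if "j \<ge> N" for j
      proof -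
        have "1 / (z - a) < real j" using N that by (meson less_le_trans of_nat_le_iff)
        then have "1 < real j * (z - a)" using False by (simp add: divide_less_eq)
        then show ?thesis unfolding f_def by simp
      qed
      then have "\<forall>\<^sub>F j in sequentially. f j z = 0" unfolding eventually_sequentially by blast
      then show ?thesis using False by (simp add: tendsto_eventually)
    qed
    have fB: "\<bar>f j z\<bar> \<le> 1" for j z unfolding f_def by auto
    have fm1: "f j \<in> borel_measurable M1" "indicator {..a} \<in> borel_measurable M1" for j
      using fm by (simp_all add: measurable_cong_sets[OF M1.M_is_borel refl])
    have fm2: "f j \<in> borel_measurable M2" "indicator {..a} \<in> borel_measurable M2" for j
      using fm by (simp_all add: measurable_cong_sets[OF M2.M_is_borel refl])
    have l1: "(\<lambda>j. LINT z|M1. f j z) \<longlonglongrightarrow> (LINT z|M1. indicator {..a} z)"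
      by (rule integral_dominated_convergence[where w="\<lambda>_. 1"])
        (use lim fm1 fB in \<open>auto intro!: AE_I2\<close>)
    have l2: "(\<lambda>j. LINT z|M2. f j z) \<longlonglongrightarrow> (LINT z|M2. indicator {..a} z)"
      by (rule integral_dominated_convergence[where w="\<lambda>_. 1"])
        (use lim fm2 fB in \<open>auto intro!: AE_I2\<close>)
    have "(LINT z|M1. indicator {..a} z) = (\<integral>z. indicator {..a} z \<partial>M2 :: real)"
      by (rule LIMSEQ_unique[OF l1]) (use l2 eq[OF fc] in simp)
    then show ?thesis using sets_eq_imp_space_eq[OF M1.M_is_borel] sets_eq_imp_space_eq[OF M2.M_is_borel] by simp
  qed
  then have "cdf M1 = cdf M2" by (simp add: cdf_def fun_eq_iff)
  then show ?thesis using cdf_unique'[OF 1 2] unfolding M1_def M2_def by blast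
qed

lemma orthogonal_to_pole:
  fixes y :: "real^3"
  assumes "y \<in> S2"
  obtains R :: "real^3 \<Rightarrow> real^3" where "orthogonal_transformation R" "\<And>x. x \<bullet> y = R x $ 3"
proof -
  have "norm y = norm (axis 3 1 :: real^3)" using assms by simp
  then obtain R :: "real^3 \<Rightarrow> real^3" where R: "orthogonal_transformation R" "R y = axis 3 1"
    by (rule orthogonal_transformation_exists)
  have "x \<bullet> y = R x $ 3" for x
  proof -
    have "x \<bullet> y = R x \<bullet> R y" using R(1) by (simp add: orthogonal_transformation_def)
    then show ?thesis unfolding R(2) by (simp add: inner_axis)
  qed
  with R(1) show ?thesis by (rule that)
qed

lemma sphere_zonal_nn_integral:
  fixes g :: "real \<Rightarrow> ennreal"
  assumes y: "y \<in> S2" and [measurable]: "g \<in> borel_measurable borel"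
  shows "(\<integral>\<^sup>+x. g (x \<bullet> y) \<partial>sphere_measure) = (\<integral>\<^sup>+z. ennreal (2 * pi * indicator {-1..1} z) * g z \<partial>lborel)"
proof -
  obtain R :: "real^3 \<Rightarrow> real^3" where R: "orthogonal_transformation R" "\<And>x. x \<bullet> y = R x $ 3" using orthogonal_to_pole[OF y] by blast
  have hm [measurable]: "(\<lambda>x::real^3. x $ 3) \<in> borel_measurable sphere_measure"
    by (intro borel_measurable_integrable[OF sphere_integrable_continuous] continuous_intros)
  have "(\<integral>\<^sup>+x. g (x \<bullet> y) \<partial>sphere_measure) = (\<integral>\<^sup>+x. g (x $ 3) \<partial>distr sphere_measure sphere_measure R)"
    unfolding R(2) by (subst nn_integral_distr[OF orthogonal_measurable_sphere[OF R(1)]]) auto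
  also have "\<dots> = (\<integral>\<^sup>+z. g z \<partial>distr sphere_measure borel (\<lambda>x. x $ 3))"
    unfolding sphere_measure_orthogonal_invariant[OF R(1)] by (subst nn_integral_distr) auto
  also have "\<dots> = (\<integral>\<^sup>+z. ennreal (2 * pi * indicator {-1..1} z) * g z \<partial>lborel)"
    unfolding sphere_height_distribution by (subst nn_integral_density) auto
  finally show ?thesis .
qed

lemma inner_S2_range: "x \<in> S2 \<Longrightarrow> y \<in> S2 \<Longrightarrow> x \<bullet> y \<in> {-1..1}"
  using Cauchy_Schwarz_ineq2[of x y] by (auto simp: abs_le_iff)

lemma inner_measurable_sphere:
  "(\<lambda>(x, y). x \<bullet> y) \<in> measurable (sphere_measure \<Otimes>\<^sub>M sphere_measure) (restrict_space lborel {-1..1})"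
proof -
  have id: "(\<lambda>x. x) \<in> borel_measurable sphere_measure"
    by (intro borel_measurable_integrable[OF sphere_integrable_continuous] continuous_intros)
  have "(\<lambda>z. fst z \<bullet> snd z) \<in> borel_measurable (sphere_measure \<Otimes>\<^sub>M sphere_measure)"
    using measurable_compose[OF measurable_fst id] measurable_compose[OF measurable_snd id] by (intro borel_measurable_inner) auto
  then have "(\<lambda>z. fst z \<bullet> snd z) \<in> measurable (sphere_measure \<Otimes>\<^sub>M sphere_measure) lborel" by simp
  then have "(\<lambda>z. fst z \<bullet> snd z) \<in> measurable (sphere_measure \<Otimes>\<^sub>M sphere_measure) (restrict_space lborel {-1..1})"
    by (rule measurable_restrict_space2[rotated]) (auto simp: space_pair_measure simp del: mem_sphere intro: inner_S2_range)
  then show ?thesis by (simp add: case_prod_beta')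
qed

lemma kernel_measurable:
  fixes \<kappa> :: "real \<Rightarrow> real"
  assumes "\<kappa> \<in> borel_measurable (restrict_space lborel {-1..1})"
  shows "(\<lambda>(x, y). \<kappa> (x \<bullet> y)) \<in> borel_measurable (sphere_measure \<Otimes>\<^sub>M sphere_measure)"
  using measurable_compose[OF inner_measurable_sphere assms] by (simp add: case_prod_beta')

text \<open>By rotation invariance all sections have the same integral, that of \<open>\<bar>\<kappa>\<bar>\<close> against the uniform law of the height.\<close>

lemma kernel_sections_bounded:
  assumes \<kappa>: "in_L2 (restrict_space lborel {-1..1}) \<kappa>"
  shows "\<exists>C. \<forall>y\<in>S2. (\<integral>\<^sup>+x. ennreal \<bar>\<kappa> (x \<bullet> y)\<bar> \<partial>sphere_measure) \<le> ennreal C"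
proof -
  have m: "\<kappa> \<in> borel_measurable (restrict_space lborel {-1..1})" and i: "integrable (restrict_space lborel {-1..1}) (\<lambda>z. (\<kappa> z)\<^sup>2)"
    using \<kappa> by (auto simp: in_L2_def)
  have fin: "finite_measure (restrict_space lborel {-1..1::real})"
    by (rule finite_measureI) (simp add: emeasure_restrict_space space_restrict_space)
  interpret fin: finite_measure "restrict_space lborel {-1..1::real}" by fact
  have "integrable (restrict_space lborel {-1..1}) \<kappa>"
    by (rule fin.square_integrable_imp_integrable[OF m i])
  then have fi: "(\<integral>\<^sup>+z. ennreal \<bar>\<kappa> z\<bar> \<partial>restrict_space lborel {-1..1}) < \<infinity>"
    by (simp add: integrable_iff_bounded)
  define g where "g z = ennreal \<bar>\<kappa> z\<bar> * indicator {-1..1} z" for z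
  have gm [measurable]: "g \<in> borel_measurable borel"
    unfolding g_def using m by (subst borel_measurable_restrict_space_iff_ennreal[symmetric]) (auto simp: lborel_def)
  show ?thesis
  proof (intro exI ballI)
    fix y :: "real^3" assume y: "y \<in> S2"
    have "(\<integral>\<^sup>+x. ennreal \<bar>\<kappa> (x \<bullet> y)\<bar> \<partial>sphere_measure) = (\<integral>\<^sup>+x. g (x \<bullet> y) \<partial>sphere_measure)"
      using y inner_S2_range[OF _ y] by (intro nn_integral_cong) (simp add: g_def)
    also have "\<dots> = (\<integral>\<^sup>+z. ennreal (2 * pi * indicator {-1..1} z) * g z \<partial>lborel)"
      by (rule sphere_zonal_nn_integral[OF y gm])
    also have "\<dots> = (\<integral>\<^sup>+z. ennreal (2 * pi) * (ennreal \<bar>\<kappa> z\<bar> * indicator {-1..1} z) \<partial>lborel)"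
      by (intro nn_integral_cong) (simp add: g_def indicator_def)
    also have "\<dots> = ennreal (2 * pi) * (\<integral>\<^sup>+z. ennreal \<bar>\<kappa> z\<bar> \<partial>restrict_space lborel {-1..1})"
      using gm unfolding g_def by (subst nn_integral_cmult) (auto simp: nn_integral_restrict_space)
    also have "\<dots> = ennreal (2 * pi * enn2real (\<integral>\<^sup>+z. ennreal \<bar>\<kappa> z\<bar> \<partial>restrict_space lborel {-1..1}))"
      using fi by (simp add: ennreal_mult)
    finally show "(\<integral>\<^sup>+x. ennreal \<bar>\<kappa> (x \<bullet> y)\<bar> \<partial>sphere_measure) 
       \<le> ennreal (2 * pi * enn2real (\<integral>\<^sup>+z. ennreal \<bar>\<kappa> z\<bar> \<partial>restrict_space lborel {-1..1}))" by simp
  qed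
qed

lemma legendre_abs_le_1:
  assumes x: "x \<in> S2" and y: "y \<in> S2"
  shows "\<bar>legendre l (x \<bullet> y)\<bar> \<le> 1"
proof -
  define C where "C = (2 * real l + 1) / (4 * pi)"
  have C: "C > 0" by (simp add: C_def)
  have n: "v \<bullet> v = 1" if "v \<in> S2" for v :: "real^3" using that by (simp add: norm_eq_1)
  have "(C * legendre l (x \<bullet> y))\<^sup>2 \<le> (\<Sum>m=- int l..int l. (sph_harm l m x)\<^sup>2) * (\<Sum>m=- int l..int l. (sph_harm l m y)\<^sup>2)"
    unfolding C_def addition_theorem[OF x y, symmetric] by (rule Cauchy_Schwarz_ineq_sum)
  also have "\<dots> = C * C"
    unfolding power2_eq_square addition_theorem[OF x x] addition_theorem[OF y y] n[OF x] n[OF y] legendre_at_1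
    by (simp add: C_def)
  finally have "C\<^sup>2 * (legendre l (x \<bullet> y))\<^sup>2 \<le> C\<^sup>2 * 1" by (simp add: power2_eq_square mult_ac)
  then have "(legendre l (x \<bullet> y))\<^sup>2 \<le> 1" using C by (subst (asm) mult_le_cancel_left_pos) auto
  then show ?thesis by (simp add: abs_square_le_1)
qed

section \<open>Zonal kernels acting on functions\<close>

lemma sph_harm_measurable [measurable]: "sph_harm l m \<in> borel_measurable sphere_measure"
  by (rule borel_measurable_integrable[OF sphere_integrable_continuous[OF continuous_on_sph_harm]])

lemma sph_harm_bounded: "\<exists>B>0. \<forall>x\<in>S2. \<bar>sph_harm l m x\<bar> \<le> B"
proof -
  have "\<exists>B. \<forall>x\<in>S2. norm (sph_harm l m x) \<le> B"
    using compact_imp_bounded[OF compact_continuous_image[OF continuous_on_sph_harm compact_sphere]] unfolding bounded_iff by blast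
  then obtain B where B: "\<forall>x\<in>S2. norm (sph_harm l m x) \<le> B" by blast
  then have "\<forall>x\<in>S2. \<bar>sph_harm l m x\<bar> \<le> \<bar>B\<bar> + 1" by fastforce
  then show ?thesis by (intro exI[of _ "\<bar>B\<bar> + 1"]) auto
qed

lemma integrable_mult_sph_harm:
  assumes f: "integrable sphere_measure f"
  shows "integrable sphere_measure (\<lambda>x. f x * sph_harm l m x)"
proof -
  obtain B where B: "B > 0" "\<forall>x\<in>S2. \<bar>sph_harm l m x\<bar> \<le> B" using sph_harm_bounded by blast
  have [measurable]: "f \<in> borel_measurable sphere_measure" using f by auto
  show ?thesis
  proof (rule Bochner_Integration.integrable_bound)
    show "integrable sphere_measure (\<lambda>x. B * \<bar>f x\<bar>)" using f by (intro integrable_mult_right integrable_abs)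
    show "AE x in sphere_measure. norm (f x * sph_harm l m x) \<le> norm (B * \<bar>f x\<bar>)"
    proof (rule AE_I2)
      fix x assume "x \<in> space sphere_measure"
      then have "\<bar>sph_harm l m x\<bar> \<le> B" using B(2) by simp
      then have "\<bar>f x\<bar> * \<bar>sph_harm l m x\<bar> \<le> \<bar>f x\<bar> * B" by (intro mult_left_mono) auto
      then show "norm (f x * sph_harm l m x) \<le> norm (B * \<bar>f x\<bar>)" using B(1) by (simp add: abs_mult mult.commute)
    qed
  qed measurable
qed

lemma in_L2_sphere_integrable: "in_L2 sphere_measure f \<Longrightarrow> integrable sphere_measure f"
  unfolding in_L2_def by (rule sphere.square_integrable_imp_integrable) auto

text \<open>By the addition theorem a finite Legendre expansion acts diagonally on the spherical harmonics.\<close>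

lemma kernel_op_legendre_sum:
  assumes f: "integrable sphere_measure f" and x: "x \<in> S2"
  shows "kernel_op (\<lambda>z. \<Sum>l\<le>L. c l * ((2 * real l + 1) / (4 * pi) * legendre l z)) f x =
    (\<Sum>l\<le>L. \<Sum>m=- int l..int l. c l * sph_coeff f l m * sph_harm l m x)"
proof -
  have "kernel_op (\<lambda>z. \<Sum>l\<le>L. c l * ((2 * real l + 1) / (4 * pi) * legendre l z)) f x =
     (LINT y|sphere_measure. (\<Sum>l\<le>L. \<Sum>m=- int l..int l. (c l * sph_harm l m x) * (f y * sph_harm l m y)))"
    unfolding kernel_op_def
  proof (rule Bochner_Integration.integral_cong[OF refl])
    fix y assume "y \<in> space sphere_measure"
    then have y: "y \<in> S2" by simp
    show "(\<Sum>l\<le>L. c l * ((2 * real l + 1) / (4 * pi) * legendre l (x \<bullet> y))) * f y =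
       (\<Sum>l\<le>L. \<Sum>m=- int l..int l. (c l * sph_harm l m x) * (f y * sph_harm l m y))"
      unfolding addition_theorem[OF x y, symmetric] sum_distrib_right sum_distrib_left
      by (intro sum.cong refl) simp
  qed
  also have "\<dots> = (\<Sum>l\<le>L. \<Sum>m=- int l..int l. (c l * sph_harm l m x) * sph_coeff f l m)"
    unfolding sph_coeff_def
    by (simp add: integrable_mult_sph_harm[OF f])
  finally show ?thesis by (simp add: mult_ac)
qed

interpretation SS: pair_sigma_finite sphere_measure sphere_measure ..

text \<open>Fubini's theorem and the symmetry of \<open>\<langle>x, y\<rangle>\<close> make the kernel operator self-adjoint.\<close>

lemma kernel_op_coeff:
  assumes \<kappa>: "in_L2 (restrict_space lborel {-1..1}) \<kappa>" and f: "integrable sphere_measure f"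
    and eig: "AE x in sphere_measure. kernel_op \<kappa> (sph_harm l m) x = \<phi> * sph_harm l m x"
  shows "integrable sphere_measure (kernel_op \<kappa> f)" and "sph_coeff (kernel_op \<kappa> f) l m = \<phi> * sph_coeff f l m"
proof -
  have km: "(\<lambda>(x, y). \<kappa> (x \<bullet> y)) \<in> borel_measurable (sphere_measure \<Otimes>\<^sub>M sphere_measure)"
    using \<kappa> by (intro kernel_measurable) (simp add: in_L2_def)
  have fm [measurable]: "f \<in> borel_measurable sphere_measure" using f by auto
  obtain C where C: "\<And>y. y \<in> S2 \<Longrightarrow> (\<integral>\<^sup>+x. ennreal \<bar>\<kappa> (x \<bullet> y)\<bar> \<partial>sphere_measure) \<le> ennreal C"
    using kernel_sections_bounded[OF \<kappa>] by blast
  have integ: "integrable (sphere_measure \<Otimes>\<^sub>M sphere_measure) (\<lambda>(x, y). \<kappa> (x \<bullet> y) * f y * g x)"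
    if gm: "g \<in> borel_measurable sphere_measure" and B: "B > 0" "\<forall>x\<in>S2. \<bar>g x\<bar> \<le> B" for g :: "real^3 \<Rightarrow> real" and B
  proof (rule integrableI_bounded)
    show m: "(\<lambda>(x, y). \<kappa> (x \<bullet> y) * f y * g x) \<in> borel_measurable (sphere_measure \<Otimes>\<^sub>M sphere_measure)"
      using km gm by (simp add: case_prod_beta') measurable
    have "(\<integral>\<^sup>+z. ennreal (norm (case z of (x, y) \<Rightarrow> \<kappa> (x \<bullet> y) * f y * g x)) \<partial>(sphere_measure \<Otimes>\<^sub>M sphere_measure))
       = (\<integral>\<^sup>+y. \<integral>\<^sup>+x. ennreal (norm (\<kappa> (x \<bullet> y) * f y * g x)) \<partial>sphere_measure \<partial>sphere_measure)"
      using SS.nn_integral_snd[of "\<lambda>z. ennreal (norm (case z of (x, y) \<Rightarrow> \<kappa> (x \<bullet> y) * f y * g x))"] m by simp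
    also have "\<dots> \<le> (\<integral>\<^sup>+y. ennreal (B * \<bar>f y\<bar>) * ennreal C \<partial>sphere_measure)"
    proof (rule nn_integral_mono)
      fix y assume "y \<in> space sphere_measure"
      then have y: "y \<in> S2" by simp
      have sec: "(\<lambda>x. \<kappa> (x \<bullet> y)) \<in> borel_measurable sphere_measure"
        using measurable_Pair2[OF km, of y] y by (simp add: inner_commute)
      have "(\<integral>\<^sup>+x. ennreal (norm (\<kappa> (x \<bullet> y) * f y * g x)) \<partial>sphere_measure) \<le> (\<integral>\<^sup>+x. ennreal (B * \<bar>f y\<bar>) * ennreal \<bar>\<kappa> (x \<bullet> y)\<bar> \<partial>sphere_measure)"
      proof (rule nn_integral_mono)
        fix x assume "x \<in> space sphere_measure"
        then have "\<bar>g x\<bar> \<le> B" using B by simp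
        then have "\<bar>\<kappa> (x \<bullet> y) * f y\<bar> * \<bar>g x\<bar> \<le> \<bar>\<kappa> (x \<bullet> y) * f y\<bar> * B" by (intro mult_left_mono) auto
        then show "ennreal (norm (\<kappa> (x \<bullet> y) * f y * g x)) \<le> ennreal (B * \<bar>f y\<bar>) * ennreal \<bar>\<kappa> (x \<bullet> y)\<bar>"
          using B by (subst ennreal_mult[symmetric]) (auto simp: abs_mult mult_ac intro!: ennreal_leI)
      qed
      also have "\<dots> = ennreal (B * \<bar>f y\<bar>) * (\<integral>\<^sup>+x. ennreal \<bar>\<kappa> (x \<bullet> y)\<bar> \<partial>sphere_measure)"
        by (rule nn_integral_cmult[OF measurable_compose[OF sec, of "\<lambda>t. ennreal \<bar>t\<bar>" borel]]) measurable
      also have "\<dots> \<le> ennreal (B * \<bar>f y\<bar>) * ennreal C" using C[OF y] by (intro mult_left_mono) auto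
      finally show "(\<integral>\<^sup>+x. ennreal (norm (\<kappa> (x \<bullet> y) * f y * g x)) \<partial>sphere_measure) \<le> ennreal (B * \<bar>f y\<bar>) * ennreal C" .
    qed
    also have "\<dots> = (\<integral>\<^sup>+y. ennreal (B * \<bar>f y\<bar>) \<partial>sphere_measure) * ennreal C"
      by (intro nn_integral_multc) measurable
    also have "\<dots> < \<infinity>"
    proof -
      have "integrable sphere_measure (\<lambda>y. B * \<bar>f y\<bar>)" using f by (intro integrable_mult_right integrable_abs)
      then have "(\<integral>\<^sup>+y. ennreal (norm (B * \<bar>f y\<bar>)) \<partial>sphere_measure) < \<infinity>"
        unfolding integrable_iff_bounded by blast
      moreover have "norm (B * \<bar>f y\<bar>) = B * \<bar>f y\<bar>" for y using B by simp
      ultimately have "(\<integral>\<^sup>+y. ennreal (B * \<bar>f y\<bar>) \<partial>sphere_measure) < \<infinity>" by (simp only:)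
      then show ?thesis by (simp add: ennreal_mult_less_top)
    qed
    finally show "(\<integral>\<^sup>+z. ennreal (norm (case z of (x, y) \<Rightarrow> \<kappa> (x \<bullet> y) * f y * g x)) \<partial>(sphere_measure \<Otimes>\<^sub>M sphere_measure)) < \<infinity>" .
  qed
  have "integrable sphere_measure (\<lambda>x. LINT y|sphere_measure. \<kappa> (x \<bullet> y) * f y * 1)"
    using SS.integrable_fst'[OF integ[of "\<lambda>_. 1" 1]] by simp
  then show "integrable sphere_measure (kernel_op \<kappa> f)" unfolding kernel_op_def[abs_def] by simp
  obtain B where B: "B > 0" "\<forall>x\<in>S2. \<bar>sph_harm l m x\<bar> \<le> B" using sph_harm_bounded by blast
  have int: "integrable (sphere_measure \<Otimes>\<^sub>M sphere_measure) (\<lambda>(x, y). \<kappa> (x \<bullet> y) * f y * sph_harm l m x)"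
    by (rule integ[OF sph_harm_measurable B])
  have "sph_coeff (kernel_op \<kappa> f) l m = (LINT x|sphere_measure. (LINT y|sphere_measure. \<kappa> (x \<bullet> y) * f y * sph_harm l m x))"
    unfolding sph_coeff_def kernel_op_def by simp
  also have "\<dots> = (LINT y|sphere_measure. (LINT x|sphere_measure. \<kappa> (x \<bullet> y) * f y * sph_harm l m x))"
    by (rule SS.Fubini_integral[OF int, symmetric])
  also have "\<dots> = (LINT y|sphere_measure. f y * kernel_op \<kappa> (sph_harm l m) y)"
  proof (rule Bochner_Integration.integral_cong[OF refl])
    fix y
    have "(LINT x|sphere_measure. \<kappa> (x \<bullet> y) * f y * sph_harm l m x) = (LINT x|sphere_measure. f y * (\<kappa> (y \<bullet> x) * sph_harm l m x))"
      by (simp add: inner_commute mult_ac)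
    then show "(LINT x|sphere_measure. \<kappa> (x \<bullet> y) * f y * sph_harm l m x) = f y * kernel_op \<kappa> (sph_harm l m) y"
      by (simp add: kernel_op_def)
  qed
  also have "\<dots> = (LINT y|sphere_measure. \<phi> * (f y * sph_harm l m y))"
  proof (rule integral_cong_AE)
    have "(\<lambda>y. LINT x|sphere_measure. (\<lambda>(x, y). \<kappa> (x \<bullet> y) * f y * sph_harm l m x) (x, y)) \<in> borel_measurable sphere_measure"
      using SS.integrable_snd[OF int] by simp
    moreover have "(LINT x|sphere_measure. \<kappa> (x \<bullet> y) * f y * sph_harm l m x) = f y * kernel_op \<kappa> (sph_harm l m) y" for y
    proof -
      have "(LINT x|sphere_measure. \<kappa> (x \<bullet> y) * f y * sph_harm l m x) = (LINT x|sphere_measure. f y * (\<kappa> (y \<bullet> x) * sph_harm l m x))"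
        by (simp add: inner_commute mult_ac)
      then show ?thesis by (simp add: kernel_op_def)
    qed
    ultimately show "(\<lambda>y. f y * kernel_op \<kappa> (sph_harm l m) y) \<in> borel_measurable sphere_measure" by simp
    show "AE y in sphere_measure. f y * kernel_op \<kappa> (sph_harm l m) y = \<phi> * (f y * sph_harm l m y)"
      using eig by eventually_elim simp
  qed measurable
  also have "\<dots> = \<phi> * sph_coeff f l m" by (simp add: sph_coeff_def)
  finally show "sph_coeff (kernel_op \<kappa> f) l m = \<phi> * sph_coeff f l m" .
qed

lemma sphere_pythagoras:
  assumes f: "in_L2 sphere_measure f" and A: "finite A" and valid: "\<And>l m. (l, m) \<in> A \<Longrightarrow> \<bar>m\<bar> \<le> int l"
  shows "(LINT x|sphere_measure. (f x - (\<Sum>(l, m)\<in>A. b l m * sph_harm l m x))\<^sup>2) =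
    (LINT x|sphere_measure. (f x)\<^sup>2) - (\<Sum>(l, m)\<in>A. (sph_coeff f l m)\<^sup>2) + (\<Sum>(l, m)\<in>A. (sph_coeff f l m - b l m)\<^sup>2)"
proof -
  have fi: "integrable sphere_measure f" using f by (rule in_L2_sphere_integrable)
  define Y where "Y p = sph_harm (fst p) (snd p)" for p :: "nat \<times> int"
  define b' where "b' p = b (fst p) (snd p)" for p
  define a where "a p = sph_coeff f (fst p) (snd p)" for p
  have YY: "integrable sphere_measure (\<lambda>x. Y p x * Y q x)" for p q
    unfolding Y_def by (intro sphere_integrable_continuous continuous_intros continuous_on_sph_harm)
  have fY: "integrable sphere_measure (\<lambda>x. f x * Y p x)" for p
    unfolding Y_def by (rule integrable_mult_sph_harm[OF fi])
  have f2: "integrable sphere_measure (\<lambda>x. (f x)\<^sup>2)" using f by (simp add: in_L2_def)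
  have iY: "(LINT x|sphere_measure. Y p x * Y q x) = (if p = q then 1 else 0)" if "p \<in> A" "q \<in> A" for p q
    unfolding Y_def using that valid[of "fst p" "snd p"] valid[of "fst q" "snd q"]
    by (subst sph_harm_orthonormal) (auto simp: prod_eq_iff)
  have "(LINT x|sphere_measure. (f x - (\<Sum>p\<in>A. b' p * Y p x))\<^sup>2) =
     (LINT x|sphere_measure. (f x)\<^sup>2 - (\<Sum>p\<in>A. 2 * b' p * (f x * Y p x)) + (\<Sum>p\<in>A. \<Sum>q\<in>A. (b' p * b' q) * (Y p x * Y q x)))"
  proof (rule Bochner_Integration.integral_cong[OF refl])
    fix x
    define s where "s = (\<Sum>p\<in>A. b' p * Y p x)"
    have "(\<Sum>p\<in>A. 2 * b' p * (f x * Y p x)) = 2 * f x * s" unfolding s_def sum_distrib_left by (intro sum.cong) auto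
    moreover have "(\<Sum>p\<in>A. \<Sum>q\<in>A. (b' p * b' q) * (Y p x * Y q x)) = s * s"
      unfolding s_def sum_product by (intro sum.cong) auto
    ultimately show "(f x - (\<Sum>p\<in>A. b' p * Y p x))\<^sup>2 = (f x)\<^sup>2 - (\<Sum>p\<in>A. 2 * b' p * (f x * Y p x)) + (\<Sum>p\<in>A. \<Sum>q\<in>A. (b' p * b' q) * (Y p x * Y q x))"
      unfolding s_def[symmetric] by (simp add: power2_eq_square algebra_simps)
  qed
  also have "\<dots> = (LINT x|sphere_measure. (f x)\<^sup>2) - (\<Sum>p\<in>A. 2 * b' p * a p) + (\<Sum>p\<in>A. \<Sum>q\<in>A. (b' p * b' q) * (LINT x|sphere_measure. Y p x * Y q x))"
    using YY fY f2 by (simp add: a_def sph_coeff_def Y_def)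
  also have "(\<Sum>p\<in>A. \<Sum>q\<in>A. (b' p * b' q) * (LINT x|sphere_measure. Y p x * Y q x)) = (\<Sum>p\<in>A. \<Sum>q\<in>A. if p = q then b' p * b' p else 0)"
    by (intro sum.cong refl) (simp add: iY)
  also have "\<dots> = (\<Sum>p\<in>A. (b' p)\<^sup>2)" using A by (simp add: power2_eq_square)
  also have "(LINT x|sphere_measure. (f x)\<^sup>2) - (\<Sum>p\<in>A. 2 * b' p * a p) + (\<Sum>p\<in>A. (b' p)\<^sup>2) 
     = (LINT x|sphere_measure. (f x)\<^sup>2) - (\<Sum>p\<in>A. (a p)\<^sup>2) + (\<Sum>p\<in>A. (a p - b' p)\<^sup>2)"
    by (simp add: power2_diff sum.distrib sum_subtractf sum_distrib_left mult_ac)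
  finally show ?thesis unfolding Y_def b'_def a_def by (simp add: case_prod_beta')
qed

section \<open>Causal representation of stable autoregressions\<close>

lemma lag_ge_1: "1 \<le> lag j"
proof -
  have "{j} \<subseteq> {..j}" by simp
  from card_mono[OF _ this] show ?thesis by (simp add: lag_def)
qed

lemma lag_less: "i < j \<Longrightarrow> lag i < lag j"
  unfolding lag_def by (intro psubset_card_mono) auto

definition ar_poly :: "('p::{finite,linorder} \<Rightarrow> real) \<Rightarrow> complex poly" where
  "ar_poly ph = 1 - (\<Sum>j\<in>UNIV. monom (of_real (ph j)) (lag j))"

text \<open>Coefficients of the reciprocal power series, extended by zero to negative indices.\<close>

definition ar_psi :: "('p::{finite,linorder} \<Rightarrow> real) \<Rightarrow> int \<Rightarrow> real" where
  "ar_psi ph n = (if n < 0 then 0 else Re (fps_nth (inverse (fps_of_poly (ar_poly ph))) (nat n)))"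

lemma ar_poly_fps: "fps_of_poly (ar_poly ph) = 1 - (\<Sum>j\<in>UNIV. fps_const (of_real (ph j)) * fps_X ^ lag j)"
  by (simp add: ar_poly_def fps_of_poly_diff fps_of_poly_sum fps_of_poly_monom)

lemma ar_poly_eval: "poly (ar_poly ph) z = 1 - (\<Sum>j\<in>UNIV. of_real (ph j) * z ^ lag j)"
  by (simp add: ar_poly_def poly_sum poly_monom)

lemma ar_psi_rec: "ar_psi ph n = (if n = 0 then 1 else 0) + (\<Sum>j\<in>UNIV. ph j * ar_psi ph (n - int (lag j)))"
proof (cases "n < 0")
  case True
  then show ?thesis by (simp add: ar_psi_def)
next
  case False
  define F where "F = fps_of_poly (ar_poly ph)"
  define g where "g = inverse F"
  have l0: "lag j \<noteq> 0" for j :: 'a using lag_ge_1[of j] by simp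
  have F0: "fps_nth F 0 = 1"
    unfolding F_def ar_poly_fps by (simp add: fps_sum_nth l0)
  then have "F * g = 1" unfolding g_def by (intro inverse_mult_eq_1') simp
  then have "g - (\<Sum>j\<in>UNIV. fps_const (of_real (ph j)) * (fps_X ^ lag j * g)) = 1"
    unfolding F_def ar_poly_fps by (simp add: left_diff_distrib sum_distrib_right mult.assoc)
  then have X: "fps_nth (g - (\<Sum>j\<in>UNIV. fps_const (of_real (ph j)) * (fps_X ^ lag j * g))) (nat n) = fps_nth 1 (nat n)"
    by (rule arg_cong)
  define d1 where "d1 = fps_nth (1 :: complex fps) (nat n)"
  have "fps_nth g (nat n) = d1 + (\<Sum>j\<in>UNIV. of_real (ph j) * (if nat n < lag j then 0 else fps_nth g (nat n - lag j)))"
    using X unfolding d1_def[symmetric]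
    by (simp only: fps_sub_nth fps_sum_nth fps_mult_left_const_nth fps_X_power_mult_nth diff_eq_eq)
  then have "Re (fps_nth g (nat n)) = Re d1 + (\<Sum>j\<in>UNIV. Re (of_real (ph j) * (if nat n < lag j then 0 else fps_nth g (nat n - lag j))))"
    by (simp only: plus_complex.sel Re_sum)
  moreover have "(\<Sum>j\<in>UNIV. Re (of_real (ph j) * (if nat n < lag j then 0 else fps_nth g (nat n - lag j)))) = (\<Sum>j\<in>UNIV. ph j * ar_psi ph (n - int (lag j)))"
  proof (rule sum.cong[OF refl])
    fix j :: 'a
    show "Re (of_real (ph j) * (if nat n < lag j then 0 else fps_nth g (nat n - lag j))) = ph j * ar_psi ph (n - int (lag j))"
    proof (cases "nat n < lag j")
    case True
    then have "n - int (lag j) < 0" using False by linarith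
    then show ?thesis using True by (simp add: ar_psi_def)
  next
    case f: False
    then have "\<not> n - int (lag j) < 0" "nat (n - int (lag j)) = nat n - lag j" using False by linarith+
    then show ?thesis using f by (simp add: ar_psi_def g_def F_def)
    qed
  qed
  moreover have "Re d1 = (if n = 0 then 1 else 0)" using False by (simp add: d1_def)
  ultimately show ?thesis using False unfolding ar_psi_def[of ph n] g_def F_def by simp
qed

lemma ar_psi_nonpos: "n \<le> 0 \<Longrightarrow> ar_psi ph n = (if n = 0 then 1 else 0)"
proof (cases "n = 0")
  case True
  have "ar_psi ph (- int (lag j)) = 0" for j :: 'a
    using lag_ge_1[of j] by (simp add: ar_psi_def)
  then show ?thesis using True ar_psi_rec[of ph 0] by simp
qed (simp add: ar_psi_def)

text \<open>If the autoregressive polynomial has no zero in a disc of radius larger than one, its reciprocal is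
  holomorphic there, so its power series converges at one.\<close>

lemma ar_psi_tendsto_0:
  assumes "\<delta> > 0" and root: "\<And>z::complex. norm z \<le> 1 + \<delta> \<Longrightarrow> 1 - (\<Sum>j\<in>UNIV. of_real (ph j) * z ^ lag j) \<noteq> 0"
  shows "(\<lambda>n. ar_psi ph (int n)) \<longlonglongrightarrow> 0"
proof -
  define F where "F = fps_of_poly (ar_poly ph)"
  have nz: "eval_fps F z \<noteq> 0" if "ereal (norm z) < ereal (1 + \<delta>)" for z
    unfolding F_def eval_fps_of_poly ar_poly_eval using that root[of z] by simp
  have "min (ereal (1 + \<delta>)) (fps_conv_radius F) \<le> fps_conv_radius (inverse F)"
    by (rule fps_conv_radius_inverse) (use nz in auto)
  moreover have "ereal (norm (1::complex)) < min (ereal (1 + \<delta>)) (fps_conv_radius F)"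
    using assms(1) by (simp add: F_def)
  ultimately have "ereal (norm (1::complex)) < fps_conv_radius (inverse F)" by (rule less_le_trans[rotated])
  then have "summable (\<lambda>n. fps_nth (inverse F) n * 1 ^ n)" by (rule summable_fps)
  then have "fps_nth (inverse F) \<longlonglongrightarrow> 0" using summable_LIMSEQ_zero by force
  then have "(\<lambda>n. Re (fps_nth (inverse F) n)) \<longlonglongrightarrow> Re 0" by (rule tendsto_Re)
  then show ?thesis by (simp add: ar_psi_def F_def)
qed

definition L2norm :: "'w measure \<Rightarrow> ('w \<Rightarrow> real) \<Rightarrow> real" where
  "L2norm M X = sqrt (LINT w|M. (X w)\<^sup>2)"

lemma L2norm_nonneg: "0 \<le> L2norm M X"
  unfolding L2norm_def by (simp add: Bochner_Integration.integral_nonneg)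

lemma in_L2_lincomb:
  assumes "finite K" "\<And>k. k \<in> K \<Longrightarrow> in_L2 M (X k)"
  shows "in_L2 M (\<lambda>w. \<Sum>k\<in>K. c k * X k w)"
    and "L2norm M (\<lambda>w. \<Sum>k\<in>K. c k * X k w) \<le> (\<Sum>k\<in>K. \<bar>c k\<bar> * L2norm M (X k))"
proof -
  have "in_L2 M (\<lambda>w. \<Sum>k\<in>K. c k * X k w) \<and> L2norm M (\<lambda>w. \<Sum>k\<in>K. c k * X k w) \<le> (\<Sum>k\<in>K. \<bar>c k\<bar> * L2norm M (X k))"
    using assms
  proof (induction K rule: finite_induct)
    case empty
    then show ?case by (simp add: in_L2_def L2norm_def)
  next
    case (insert k K)
    then have Xk: "in_L2 M (X k)" and IH: "in_L2 M (\<lambda>w. \<Sum>k\<in>K. c k * X k w)"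
      "L2norm M (\<lambda>w. \<Sum>k\<in>K. c k * X k w) \<le> (\<Sum>k\<in>K. \<bar>c k\<bar> * L2norm M (X k))" by auto
    have ck: "in_L2 M (\<lambda>w. c k * X k w)" using Xk by (auto simp: in_L2_def power_mult_distrib)
    have nk: "L2norm M (\<lambda>w. c k * X k w) = \<bar>c k\<bar> * L2norm M (X k)"
      by (simp add: L2norm_def power_mult_distrib real_sqrt_mult)
    note tri = L2_triangle[of "\<lambda>w. c k * X k w" M "\<lambda>w. \<Sum>k\<in>K. c k * X k w"]
    have "in_L2 M (\<lambda>w. c k * X k w + (\<Sum>k\<in>K. c k * X k w))"
      using ck IH(1) tri(1) by (auto simp: in_L2_def)
    moreover have "L2norm M (\<lambda>w. c k * X k w + (\<Sum>k\<in>K. c k * X k w)) \<le> \<bar>c k\<bar> * L2norm M (X k) + (\<Sum>k\<in>K. \<bar>c k\<bar> * L2norm M (X k))"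
      using ck IH tri(3) nk[unfolded L2norm_def] unfolding L2norm_def in_L2_def by force
    ultimately show ?case using insert.hyps by simp
  qed
  then show "in_L2 M (\<lambda>w. \<Sum>k\<in>K. c k * X k w)"
    and "L2norm M (\<lambda>w. \<Sum>k\<in>K. c k * X k w) \<le> (\<Sum>k\<in>K. \<bar>c k\<bar> * L2norm M (X k))" by blast+
qed

lemma in_L2_mult_integrable: "in_L2 M X \<Longrightarrow> in_L2 M Y \<Longrightarrow> integrable M (\<lambda>w. X w * Y w)"
  unfolding in_L2_def by (intro integrable_mult_squares) auto

lemma in_L2_cauchy_schwarz: "in_L2 M X \<Longrightarrow> in_L2 M Y \<Longrightarrow> \<bar>\<integral>w. X w * Y w \<partial>M\<bar> \<le> L2norm M X * L2norm M Y"
  unfolding in_L2_def L2norm_def by (intro L2_triangle(2)) auto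

lemma in_L2_diff: "in_L2 M X \<Longrightarrow> in_L2 M Y \<Longrightarrow> in_L2 M (\<lambda>w. X w - Y w)"
  using L2_triangle(1)[of X M "\<lambda>w. - Y w"] unfolding in_L2_def by auto

lemma cgauss_in_L2: "cgauss M X \<Longrightarrow> in_L2 M X"
  by (simp add: cgauss_def in_L2_def)

definition lin_span :: "'i set \<Rightarrow> ('i \<Rightarrow> 'w \<Rightarrow> real) \<Rightarrow> ('w \<Rightarrow> real) set" where
  "lin_span I X = {\<lambda>w. \<Sum>i\<in>S. wt i * X i w | S wt. finite S \<and> S \<subseteq> I}"

lemma lin_spanI: "finite S \<Longrightarrow> S \<subseteq> I \<Longrightarrow> Y = (\<lambda>w. \<Sum>i\<in>S. wt i * X i w) \<Longrightarrow> Y \<in> lin_span I X"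
  unfolding lin_span_def by (rule CollectI, rule exI[of _ S], rule exI[of _ wt]) simp

lemma lin_spanE:
  assumes "Y \<in> lin_span I X"
  obtains S wt where "finite S" "S \<subseteq> I" "Y = (\<lambda>w. \<Sum>i\<in>S. wt i * X i w)"
proof -
  from assms obtain S wt where 1: "Y = (\<lambda>w. \<Sum>i\<in>S. wt i * X i w)" "finite S \<and> S \<subseteq> I"
    unfolding lin_span_def by (elim CollectE exE conjE) simp
  then show thesis using that[of S wt] by simp
qed

lemma lin_span_base: "i \<in> I \<Longrightarrow> X i \<in> lin_span I X"
  unfolding lin_span_def by (rule CollectI, rule exI[of _ "{i}"], rule exI[of _ "\<lambda>_. 1"]) simp

lemma lin_span_scale: "Y \<in> lin_span I X \<Longrightarrow> (\<lambda>w. b * Y w) \<in> lin_span I X"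
proof -
  assume "Y \<in> lin_span I X"
  then obtain S wt where S: "finite S" "S \<subseteq> I" "Y = (\<lambda>w. \<Sum>i\<in>S. wt i * X i w)" by (rule lin_spanE)
  then have "(\<lambda>w. b * Y w) = (\<lambda>w. \<Sum>i\<in>S. (b * wt i) * X i w)" by (simp add: sum_distrib_left mult.assoc)
  then show ?thesis by (rule lin_spanI[OF S(1,2)])
qed

lemma lin_span_add: "Y \<in> lin_span I X \<Longrightarrow> Z \<in> lin_span I X \<Longrightarrow> (\<lambda>w. Y w + Z w) \<in> lin_span I X"
proof -
  assume "Y \<in> lin_span I X" and Z: "Z \<in> lin_span I X"
  from this(1) obtain S wt where S: "finite S" "S \<subseteq> I" "Y = (\<lambda>w. \<Sum>i\<in>S. wt i * X i w)" by (rule lin_spanE)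
  from Z obtain S' wt' where S': "finite S'" "S' \<subseteq> I" "Z = (\<lambda>w. \<Sum>i\<in>S'. wt' i * X i w)" by (rule lin_spanE)
  define v where "v i = (if i \<in> S then wt i else 0) + (if i \<in> S' then wt' i else 0)" for i
  have 1: "(\<Sum>i\<in>S. wt i * X i w) = (\<Sum>i\<in>S \<union> S'. (if i \<in> S then wt i else 0) * X i w)" for w
    using S(1) S'(1) by (intro sum.mono_neutral_cong_left) auto
  have 2: "(\<Sum>i\<in>S'. wt' i * X i w) = (\<Sum>i\<in>S \<union> S'. (if i \<in> S' then wt' i else 0) * X i w)" for w
    using S(1) S'(1) by (intro sum.mono_neutral_cong_left) auto
  have "(\<lambda>w. Y w + Z w) = (\<lambda>w. \<Sum>i\<in>S \<union> S'. v i * X i w)"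
    unfolding S(3) S'(3) 1 2 v_def distrib_right sum.distrib ..
  moreover have "finite (S \<union> S')" "S \<union> S' \<subseteq> I" using S S' by auto
  ultimately show ?thesis by (intro lin_spanI[of "S \<union> S'" I _ v]) simp_all
qed

lemma lin_span_sum:
  assumes "finite K" "\<And>k. k \<in> K \<Longrightarrow> Y k \<in> lin_span I X"
  shows "(\<lambda>w. \<Sum>k\<in>K. Y k w) \<in> lin_span I X"
  using assms
proof (induction K rule: finite_induct)
  case empty
  show ?case unfolding lin_span_def by (rule CollectI, rule exI[of _ "{}"]) simp
next
  case (insert k K)
  then show ?case using lin_span_add[of "Y k" I X "\<lambda>w. \<Sum>k\<in>K. Y k w"] by simp
qed

lemma lin_span_diff: "Y \<in> lin_span I X \<Longrightarrow> Z \<in> lin_span I X \<Longrightarrow> (\<lambda>w. Y w - Z w) \<in> lin_span I X"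
  using lin_span_add[OF _ lin_span_scale[of Z I X "-1"], of Y] by simp

lemma joint_cgauss_lin_span:
  assumes X: "joint_cgauss M I X" and Y: "\<And>k. k \<in> K \<Longrightarrow> Y k \<in> lin_span I X"
  shows "joint_cgauss M K Y"
  unfolding joint_cgauss_def
proof (intro allI impI)
  fix J c assume J: "finite J \<and> J \<subseteq> K"
  then have "(\<lambda>w. \<Sum>k\<in>J. c k * Y k w) \<in> lin_span I X"
    using Y by (intro lin_span_sum lin_span_scale) auto
  then obtain S wt where S: "finite S" "S \<subseteq> I" and eq: "(\<lambda>w. \<Sum>k\<in>J. c k * Y k w) = (\<lambda>w. \<Sum>i\<in>S. wt i * X i w)"
    by (rule lin_spanE)
  show "cgauss M (\<lambda>w. \<Sum>k\<in>J. c k * Y k w)"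
    unfolding eq using X S unfolding joint_cgauss_def by simp
qed

lemma sum_shift_telescope: "(\<Sum>i=1..m. f (i - 1)) = (\<Sum>i=1..m. f i) + f 0 - (f m :: real)" for m :: nat
  by (induction m) simp_all

text \<open>Jointly Gaussian stationary solutions of autoregressive equations with mutually uncorrelated noises. The
  solutions are causal because of \<open>psi_0\<close>: back substitution expresses each value by present and past noise, up to
  a remainder whose coefficients tend to zero while stationarity keeps the variances constant.\<close>

locale gaussian_ar = prob_space M for M :: "'w measure" +
  fixes A :: "'a::countable set" and a e :: "'a \<Rightarrow> int \<Rightarrow> 'w \<Rightarrow> real"
    and ph :: "'a \<Rightarrow> 'p::{finite,linorder} \<Rightarrow> real" and c :: "'a \<Rightarrow> real"
  assumes finA: "finite A"
    and joint: "joint_cgauss M (A \<times> UNIV) (\<lambda>(\<alpha>, t). a \<alpha> t)"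
    and e_eq: "e = (\<lambda>\<alpha> t w. a \<alpha> t w - (\<Sum>j\<in>UNIV. ph \<alpha> j * a \<alpha> (t - int (lag j)) w))"
    and ee: "\<And>\<alpha> \<beta> s t. \<alpha> \<in> A \<Longrightarrow> \<beta> \<in> A \<Longrightarrow> (LINT w|M. e \<alpha> s w * e \<beta> t w) = (if \<alpha> = \<beta> \<and> s = t then c \<alpha> else 0)"
    and c_pos: "\<And>\<alpha>. \<alpha> \<in> A \<Longrightarrow> 0 < c \<alpha>"
    and stationary: "\<And>\<alpha> s t h. \<alpha> \<in> A \<Longrightarrow> (LINT w|M. a \<alpha> (s + h) w * a \<alpha> (t + h) w) = (LINT w|M. a \<alpha> s w * a \<alpha> t w)"
    and psi_0: "\<And>\<alpha>. \<alpha> \<in> A \<Longrightarrow> (\<lambda>n. ar_psi (ph \<alpha>) (int n)) \<longlonglongrightarrow> 0"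
begin

lemma e_app: "e \<alpha> t w = a \<alpha> t w - (\<Sum>j\<in>UNIV. ph \<alpha> j * a \<alpha> (t - int (lag j)) w)"
  by (subst e_eq) (rule refl)

definition acov :: "'a \<Rightarrow> int \<Rightarrow> real" where
  "acov \<alpha> h = (LINT w|M. a \<alpha> 0 w * a \<alpha> h w)"

lemma cov_acov: "\<alpha> \<in> A \<Longrightarrow> (LINT w|M. a \<alpha> s w * a \<alpha> t w) = acov \<alpha> (t - s)"
  using stationary[of \<alpha> 0 s "t - s"] by (simp add: acov_def)

lemma acov_minus: "\<alpha> \<in> A \<Longrightarrow> acov \<alpha> (- h) = acov \<alpha> h"
  using cov_acov[of \<alpha> h 0] cov_acov[of \<alpha> 0 h] by (simp add: mult.commute)

lemma a_gauss: "\<alpha> \<in> A \<Longrightarrow> cgauss M (a \<alpha> t)"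
  using joint_cgauss_single[OF joint, of "(\<alpha>, t)"] by simp

lemma a_L2: "\<alpha> \<in> A \<Longrightarrow> in_L2 M (a \<alpha> t)"
  using a_gauss by (rule cgauss_in_L2)

lemma e_L2: "\<alpha> \<in> A \<Longrightarrow> in_L2 M (e \<alpha> t)"
  unfolding e_eq by (intro in_L2_diff in_L2_lincomb a_L2) auto

lemma a_L2norm: "\<alpha> \<in> A \<Longrightarrow> L2norm M (a \<alpha> t) = L2norm M (a \<alpha> 0)"
  using cov_acov[of \<alpha> t t] cov_acov[of \<alpha> 0 0] by (simp add: L2norm_def power2_eq_square)

definition ma :: "nat \<Rightarrow> 'a \<Rightarrow> int \<Rightarrow> 'w \<Rightarrow> real" where
  "ma n \<alpha> t w = (\<Sum>k<n. ar_psi (ph \<alpha>) (int k) * e \<alpha> (t - int k) w)"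

lemma ma_L2: "\<alpha> \<in> A \<Longrightarrow> in_L2 M (ma n \<alpha> t)"
  unfolding ma_def[abs_def] by (intro in_L2_lincomb e_L2) auto

text \<open>After \<open>n\<close> steps of back substitution only the last coefficients \<open>\<psi>\<close> enter the remainder.\<close>

lemma ma_remainder:
  "a \<alpha> t w - ma (Suc n) \<alpha> t w =
    (\<Sum>j\<in>UNIV. \<Sum>i=1..lag j. (ph \<alpha> j * ar_psi (ph \<alpha>) (int (Suc n) - int i)) * a \<alpha> (t - int (Suc n) + int i - int (lag j)) w)"
proof (induction n)
  case 0
  note psi = ar_psi_nonpos[of _ "ph \<alpha>"]
  have "(\<Sum>i=1..lag j. (ph \<alpha> j * ar_psi (ph \<alpha>) (1 - int i)) * a \<alpha> (t - 1 + int i - int (lag j)) w) = ph \<alpha> j * a \<alpha> (t - int (lag j)) w" for j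
  proof -
    have "(\<Sum>i=1..lag j. (ph \<alpha> j * ar_psi (ph \<alpha>) (1 - int i)) * a \<alpha> (t - 1 + int i - int (lag j)) w)
       = (\<Sum>i=1..lag j. if i = 1 then ph \<alpha> j * a \<alpha> (t - int (lag j)) w else 0)"
      by (intro sum.cong refl) (auto simp: psi)
    then show ?thesis using lag_ge_1[of j] by simp
  qed
  moreover have "a \<alpha> t w - ma (Suc 0) \<alpha> t w = (\<Sum>j\<in>UNIV. ph \<alpha> j * a \<alpha> (t - int (lag j)) w)"
    by (simp add: ma_def e_app psi)
  ultimately show ?case by simp
next
  case (Suc n)
  define N where "N = int (Suc n)"
  have N1: "int (Suc (Suc n)) = N + 1" by (simp add: N_def)
  define f where "f j i = (ph \<alpha> j * ar_psi (ph \<alpha>) (N - int i)) * a \<alpha> (t - N + int i - int (lag j)) w" for j i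
  have sh: "(\<Sum>i=1..lag j. (ph \<alpha> j * ar_psi (ph \<alpha>) (N + 1 - int i)) * a \<alpha> (t - (N + 1) + int i - int (lag j)) w)
     = (\<Sum>i=1..lag j. f j i) + f j 0 - f j (lag j)" for j
  proof -
    have "(\<Sum>i=1..lag j. (ph \<alpha> j * ar_psi (ph \<alpha>) (N + 1 - int i)) * a \<alpha> (t - (N + 1) + int i - int (lag j)) w)
       = (\<Sum>i=1..lag j. f j (i - 1))"
    proof (rule sum.cong[OF refl])
      fix i assume "i \<in> {1..lag j}"
      then have "int (i - 1) = int i - 1" by auto
      then show "(ph \<alpha> j * ar_psi (ph \<alpha>) (N + 1 - int i)) * a \<alpha> (t - (N + 1) + int i - int (lag j)) w = f j (i - 1)"
        unfolding f_def by (simp add: algebra_simps)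
    qed
    then show ?thesis unfolding sum_shift_telescope .
  qed
  have "(\<Sum>j\<in>UNIV. f j 0) = ar_psi (ph \<alpha>) N * (\<Sum>j\<in>UNIV. ph \<alpha> j * a \<alpha> (t - N - int (lag j)) w)"
    unfolding f_def sum_distrib_left by (intro sum.cong refl) simp
  moreover have "(\<Sum>j\<in>UNIV. f j (lag j)) = ar_psi (ph \<alpha>) N * a \<alpha> (t - N) w"
  proof -
    have "(\<Sum>j\<in>UNIV. f j (lag j)) = (\<Sum>j\<in>UNIV. ph \<alpha> j * ar_psi (ph \<alpha>) (N - int (lag j))) * a \<alpha> (t - N) w"
      unfolding f_def sum_distrib_right by (intro sum.cong refl) simp
    also have "(\<Sum>j\<in>UNIV. ph \<alpha> j * ar_psi (ph \<alpha>) (N - int (lag j))) = ar_psi (ph \<alpha>) N"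
      using ar_psi_rec[of "ph \<alpha>" N] by (simp add: N_def)
    finally show ?thesis .
  qed
  moreover have "ma (Suc (Suc n)) \<alpha> t w = ma (Suc n) \<alpha> t w + ar_psi (ph \<alpha>) N * e \<alpha> (t - N) w"
    by (simp add: ma_def N_def)
  moreover have "a \<alpha> t w - ma (Suc n) \<alpha> t w = (\<Sum>j\<in>UNIV. \<Sum>i=1..lag j. f j i)"
    using Suc unfolding N_def[symmetric] f_def .
  ultimately show ?case
    unfolding N1 sh sum_subtractf sum.distrib by (simp add: e_app[of \<alpha> "t - N" w] right_diff_distrib)
qed

text \<open>The remainder is a sum of a fixed number of terms of constant norm with coefficients tending to zero.\<close>

lemma ma_approx: "\<alpha> \<in> A \<Longrightarrow> (\<lambda>n. L2norm M (\<lambda>w. a \<alpha> t w - ma n \<alpha> t w)) \<longlonglongrightarrow> 0"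
proof -
  assume \<alpha>: "\<alpha> \<in> A"
  define S where "S = (SIGMA j:(UNIV::'p set). {1..lag j})"
  have S: "finite S" by (simp add: S_def)
  define b where "b n p = ph \<alpha> (fst p) * ar_psi (ph \<alpha>) (int (Suc n) - int (snd p))" for n and p :: "'p \<times> nat"
  define X where "X n p = a \<alpha> (t - int (Suc n) + int (snd p) - int (lag (fst p)))" for n and p :: "'p \<times> nat"
  have rem: "a \<alpha> t w - ma (Suc n) \<alpha> t w = (\<Sum>p\<in>S. b n p * X n p w)" for n w
    unfolding ma_remainder S_def b_def X_def by (subst sum.Sigma) (auto simp: case_prod_beta')
  have bound: "L2norm M (\<lambda>w. a \<alpha> t w - ma (Suc n) \<alpha> t w) \<le> (\<Sum>p\<in>S. \<bar>b n p\<bar> * L2norm M (a \<alpha> 0))" for n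
  proof -
    have X: "in_L2 M (X n p)" "L2norm M (X n p) = L2norm M (a \<alpha> 0)" for p
      unfolding X_def by (rule a_L2[OF \<alpha>] a_L2norm[OF \<alpha>])+
    show ?thesis unfolding rem using in_L2_lincomb(2)[OF S, of M "X n" "b n"] X by simp
  qed
  have "(\<lambda>n. b n p) \<longlonglongrightarrow> ph \<alpha> (fst p) * 0" for p
  proof -
    have "(\<lambda>n. ar_psi (ph \<alpha>) (int (Suc n) - int (snd p))) \<longlonglongrightarrow> 0"
    proof (rule LIMSEQ_offset[where k="snd p"])
      have "int (Suc (n + snd p)) - int (snd p) = int (Suc n)" for n by simp
      then show "(\<lambda>n. ar_psi (ph \<alpha>) (int (Suc (n + snd p)) - int (snd p))) \<longlonglongrightarrow> 0"
        using LIMSEQ_Suc[OF psi_0[OF \<alpha>]] by (simp only:)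
    qed
    then show ?thesis unfolding b_def by (intro tendsto_mult tendsto_const)
  qed
  then have "(\<lambda>n. \<Sum>p\<in>S. \<bar>b n p\<bar> * L2norm M (a \<alpha> 0)) \<longlonglongrightarrow> (\<Sum>p\<in>S. \<bar>ph \<alpha> (fst p) * 0\<bar> * L2norm M (a \<alpha> 0))"
    by (intro tendsto_intros)
  then have "(\<lambda>n. \<Sum>p\<in>S. \<bar>b n p\<bar> * L2norm M (a \<alpha> 0)) \<longlonglongrightarrow> 0" by simp
  then have "(\<lambda>n. L2norm M (\<lambda>w. a \<alpha> t w - ma (Suc n) \<alpha> t w)) \<longlonglongrightarrow> 0"
    by (rule tendsto_sandwich[OF _ _ tendsto_const, rotated 2]) (use bound L2norm_nonneg in \<open>auto intro!: always_eventually\<close>)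
  then show ?thesis by (rule LIMSEQ_imp_Suc)
qed

lemma ma_inner_limit:
  assumes \<alpha>: "\<alpha> \<in> A" and Y: "in_L2 M Y"
  shows "(\<lambda>n. LINT w|M. ma n \<alpha> t w * Y w) \<longlonglongrightarrow> (LINT w|M. a \<alpha> t w * Y w)"
proof -
  have nb: "norm ((LINT w|M. a \<alpha> t w * Y w) - (LINT w|M. ma n \<alpha> t w * Y w)) \<le> L2norm M (\<lambda>w. a \<alpha> t w - ma n \<alpha> t w) * L2norm M Y" for n
  proof -
    have "(LINT w|M. a \<alpha> t w * Y w) - (LINT w|M. ma n \<alpha> t w * Y w) = (LINT w|M. (a \<alpha> t w - ma n \<alpha> t w) * Y w)"
      using in_L2_mult_integrable[OF a_L2[OF \<alpha>] Y] in_L2_mult_integrable[OF ma_L2[OF \<alpha>] Y] by (simp add: left_diff_distrib)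
    then show ?thesis using in_L2_cauchy_schwarz[OF in_L2_diff[OF a_L2[OF \<alpha>] ma_L2[OF \<alpha>]] Y] by simp
  qed
  have lim: "(\<lambda>n. L2norm M (\<lambda>w. a \<alpha> t w - ma n \<alpha> t w) * L2norm M Y) \<longlonglongrightarrow> 0"
    by (rule tendsto_mult_left_zero[OF ma_approx[OF \<alpha>]])
  have "(\<lambda>n. (LINT w|M. a \<alpha> t w * Y w) - (LINT w|M. ma n \<alpha> t w * Y w)) \<longlonglongrightarrow> 0"
    by (rule Lim_null_comparison[OF always_eventually[OF allI[OF nb]] lim])
  from tendsto_diff[OF tendsto_const[of "LINT w|M. a \<alpha> t w * Y w"] this] show ?thesis by simp
qed

lemma ma_inner:
  assumes "\<alpha> \<in> A" "in_L2 M Y"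
  shows "(LINT w|M. ma n \<alpha> t w * Y w) = (\<Sum>k<n. ar_psi (ph \<alpha>) (int k) * (LINT w|M. e \<alpha> (t - int k) w * Y w))"
proof -
  have "integrable M (\<lambda>w. e \<alpha> s w * Y w)" for s using assms e_L2 in_L2_mult_integrable by blast
  then show ?thesis unfolding ma_def sum_distrib_right mult.assoc by simp
qed

lemma a_orthogonal:
  assumes "\<alpha> \<in> A" "in_L2 M Y" "\<And>k::nat. (LINT w|M. e \<alpha> (t - int k) w * Y w) = 0"
  shows "(LINT w|M. a \<alpha> t w * Y w) = 0"
  using LIMSEQ_unique[OF ma_inner_limit[OF assms(1,2), of t]] ma_inner[OF assms(1,2)] assms(3) by simp

lemma past_noise_orthogonal:
  assumes "\<alpha> \<in> A" "\<beta> \<in> A" "s < t"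
  shows "(LINT w|M. a \<alpha> s w * e \<beta> t w) = 0"
  using assms by (intro a_orthogonal e_L2) (simp_all add: ee)

lemma acov_cross:
  assumes "\<alpha> \<in> A" "\<beta> \<in> A" "\<alpha> \<noteq> \<beta>"
  shows "(LINT w|M. a \<alpha> s w * a \<beta> t w) = 0"
proof -
  have "(LINT w|M. a \<beta> t w * e \<alpha> u w) = 0" for u
    using assms by (intro a_orthogonal e_L2) (simp_all add: ee)
  then show ?thesis using assms by (intro a_orthogonal a_L2) (simp_all add: mult.commute)
qed

text \<open>First the covariances with the noise and then the autocovariances are limits of the same expressions in the
  coefficients \<open>\<psi>\<close> and the noise variance.\<close>

lemma acov_determined:
  assumes \<alpha>: "\<alpha> \<in> A" and \<beta>: "\<beta> \<in> A" and eq: "ph \<alpha> = ph \<beta>" "c \<alpha> = c \<beta>"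
  shows "acov \<alpha> = acov \<beta>"
proof
  fix h
  have ea: "(LINT w|M. a \<alpha> t w * e \<alpha> s w) = (LINT w|M. a \<beta> t w * e \<beta> s w)" for s t
  proof (rule LIMSEQ_unique[OF ma_inner_limit[OF \<alpha> e_L2[OF \<alpha>]]])
    have "(LINT w|M. ma n \<alpha> t w * e \<alpha> s w) = (LINT w|M. ma n \<beta> t w * e \<beta> s w)" for n
      unfolding ma_inner[OF \<alpha> e_L2[OF \<alpha>]] ma_inner[OF \<beta> e_L2[OF \<beta>]] using \<alpha> \<beta> eq by (simp add: ee cong: if_cong)
    then show "(\<lambda>n. LINT w|M. ma n \<alpha> t w * e \<alpha> s w) \<longlonglongrightarrow> (LINT w|M. a \<beta> t w * e \<beta> s w)"
      using ma_inner_limit[OF \<beta> e_L2[OF \<beta>]] by simp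
  qed
  show "acov \<alpha> h = acov \<beta> h" unfolding acov_def
  proof (rule LIMSEQ_unique[OF ma_inner_limit[OF \<alpha> a_L2[OF \<alpha>]]])
    have "(LINT w|M. ma n \<alpha> 0 w * a \<alpha> h w) = (LINT w|M. ma n \<beta> 0 w * a \<beta> h w)" for n
      unfolding ma_inner[OF \<alpha> a_L2[OF \<alpha>]] ma_inner[OF \<beta> a_L2[OF \<beta>]] using ea eq by (simp add: mult.commute)
    then show "(\<lambda>n. LINT w|M. ma n \<alpha> 0 w * a \<alpha> h w) \<longlonglongrightarrow> (LINT w|M. a \<beta> 0 w * a \<beta> h w)"
      using ma_inner_limit[OF \<beta> a_L2[OF \<beta>]] by simp
  qed
qed

text \<open>The moving average of length \<open>n\<close> is orthogonal to the value \<open>n\<close> steps earlier, so the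
  autocovariance is bounded by the norm of the remainder.\<close>

lemma acov_tendsto_0:
  assumes \<alpha>: "\<alpha> \<in> A"
  shows "(\<lambda>n. acov \<alpha> (int n)) \<longlonglongrightarrow> 0"
proof -
  have bound: "\<bar>acov \<alpha> (int n)\<bar> \<le> L2norm M (\<lambda>w. a \<alpha> 0 w - ma n \<alpha> 0 w) * L2norm M (a \<alpha> 0)" for n
  proof -
    have z: "(LINT w|M. ma n \<alpha> 0 w * a \<alpha> (- int n) w) = 0"
      unfolding ma_inner[OF \<alpha> a_L2[OF \<alpha>]]
      using past_noise_orthogonal[OF \<alpha> \<alpha>] by (intro sum.neutral) (simp add: mult.commute)
    have "acov \<alpha> (int n) = (LINT w|M. a \<alpha> 0 w * a \<alpha> (- int n) w)"
      using cov_acov[OF \<alpha>, of "- int n" 0] by (simp add: mult.commute)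
    also have "\<dots> = (LINT w|M. (a \<alpha> 0 w - ma n \<alpha> 0 w) * a \<alpha> (- int n) w)"
      using in_L2_mult_integrable[OF a_L2[OF \<alpha>] a_L2[OF \<alpha>]] in_L2_mult_integrable[OF ma_L2[OF \<alpha>] a_L2[OF \<alpha>]] z
      by (simp add: left_diff_distrib)
    finally show ?thesis
      using in_L2_cauchy_schwarz[OF in_L2_diff[OF a_L2[OF \<alpha>] ma_L2[OF \<alpha>]] a_L2[OF \<alpha>], of 0 n 0 "- int n"]
      unfolding a_L2norm[OF \<alpha>, of "- int n"] by simp
  qed
  have "(\<lambda>n. L2norm M (\<lambda>w. a \<alpha> 0 w - ma n \<alpha> 0 w) * L2norm M (a \<alpha> 0)) \<longlonglongrightarrow> 0"
    using tendsto_mult_left_zero[OF ma_approx[OF \<alpha>]] by simp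
  note lim = this
  have "norm (acov \<alpha> (int n)) \<le> L2norm M (\<lambda>w. a \<alpha> 0 w - ma n \<alpha> 0 w) * L2norm M (a \<alpha> 0)" for n
    using bound[of n] by simp
  from Lim_null_comparison[OF always_eventually[OF allI[OF this]] lim] show ?thesis .
qed

subsection \<open>Regressors\<close>

definition regr :: "('p \<Rightarrow> real) \<Rightarrow> 'a \<Rightarrow> int \<Rightarrow> 'w \<Rightarrow> real" where
  "regr u \<alpha> t w = (\<Sum>j\<in>UNIV. u j * a \<alpha> (t - int (lag j)) w)"

definition qcov :: "('p \<Rightarrow> real) \<Rightarrow> ('p \<Rightarrow> real) \<Rightarrow> 'a \<Rightarrow> int \<Rightarrow> real" where
  "qcov u v \<alpha> h = (\<Sum>i\<in>UNIV. \<Sum>j\<in>UNIV. u i * v j * acov \<alpha> (h + int (lag i) - int (lag j)))"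

lemma a_span: "\<alpha> \<in> A \<Longrightarrow> a \<alpha> t \<in> lin_span (A \<times> UNIV) (\<lambda>(\<alpha>, t). a \<alpha> t)"
  using lin_span_base[of "(\<alpha>, t)" "A \<times> UNIV" "\<lambda>(\<alpha>, t). a \<alpha> t"] by simp

lemma regr_span: "\<alpha> \<in> A \<Longrightarrow> regr u \<alpha> t \<in> lin_span (A \<times> UNIV) (\<lambda>(\<alpha>, t). a \<alpha> t)"
  unfolding regr_def[abs_def] by (intro lin_span_sum lin_span_scale a_span) simp_all

lemma e_span: "\<alpha> \<in> A \<Longrightarrow> e \<alpha> t \<in> lin_span (A \<times> UNIV) (\<lambda>(\<alpha>, t). a \<alpha> t)"
  unfolding e_eq by (intro lin_span_diff lin_span_sum lin_span_scale a_span) simp_all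

lemma regr_gauss: "\<alpha> \<in> A \<Longrightarrow> joint_cgauss M UNIV (\<lambda>(u, t). regr u \<alpha> t)"
  by (rule joint_cgauss_lin_span[OF joint]) (auto intro: regr_span)

lemma regr_cgauss: "\<alpha> \<in> A \<Longrightarrow> cgauss M (regr u \<alpha> t)"
  using joint_cgauss_single[OF regr_gauss, of \<alpha> "(u, t)"] by simp

lemma regr_cov: "\<alpha> \<in> A \<Longrightarrow> (LINT w|M. regr u \<alpha> s w * regr v \<alpha> t w) = qcov u v \<alpha> (t - s)"
proof -
  assume \<alpha>: "\<alpha> \<in> A"
  have "(LINT w|M. regr u \<alpha> s w * regr v \<alpha> t w) = (LINT w|M. (\<Sum>i\<in>UNIV. \<Sum>j\<in>UNIV. (u i * v j) * (a \<alpha> (s - int (lag i)) w * a \<alpha> (t - int (lag j)) w)))"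
    unfolding regr_def sum_product by (simp add: mult_ac)
  also have "\<dots> = (\<Sum>i\<in>UNIV. \<Sum>j\<in>UNIV. (u i * v j) * (LINT w|M. a \<alpha> (s - int (lag i)) w * a \<alpha> (t - int (lag j)) w))"
    using in_L2_mult_integrable[OF a_L2[OF \<alpha>] a_L2[OF \<alpha>]] by simp
  also have "\<dots> = qcov u v \<alpha> (t - s)"
    unfolding qcov_def cov_acov[OF \<alpha>] by (intro sum.cong refl arg_cong2[where f="(*)"] arg_cong[where f="acov \<alpha>"]) simp
  finally show ?thesis .
qed

lemma qcov_tendsto_0: "\<alpha> \<in> A \<Longrightarrow> (\<lambda>n. qcov u u \<alpha> (int n)) \<longlonglongrightarrow> 0"
proof -
  assume \<alpha>: "\<alpha> \<in> A"
  have "(\<lambda>n. acov \<alpha> (int n + d)) \<longlonglongrightarrow> 0" for d :: int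
  proof (rule LIMSEQ_offset[where k="nat \<bar>d\<bar>"])
    have "filterlim (\<lambda>n. n + nat (\<bar>d\<bar> + d)) sequentially sequentially" by (rule filterlim_add_const_nat_at_top)
    then have "(\<lambda>n. acov \<alpha> (int (n + nat (\<bar>d\<bar> + d)))) \<longlonglongrightarrow> 0" by (rule filterlim_compose[OF acov_tendsto_0[OF \<alpha>]])
    moreover have "int (n + nat (\<bar>d\<bar> + d)) = int (n + nat \<bar>d\<bar>) + d" for n by simp
    ultimately show "(\<lambda>n. acov \<alpha> (int (n + nat \<bar>d\<bar>) + d)) \<longlonglongrightarrow> 0" by (simp only:)
  qed
  then have "(\<lambda>n. acov \<alpha> (int n + (int (lag i) - int (lag j)))) \<longlonglongrightarrow> 0" for i j :: 'p .
  then have "(\<lambda>n. \<Sum>i\<in>UNIV. \<Sum>j\<in>UNIV. u i * u j * acov \<alpha> (int n + (int (lag i) - int (lag j)))) \<longlonglongrightarrow> (\<Sum>i\<in>UNIV. \<Sum>j\<in>UNIV. u i * u j * 0)"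
    by (intro tendsto_sum tendsto_mult tendsto_const)
  then show ?thesis unfolding qcov_def add_diff_eq by simp
qed

lemma regr_noise_orthogonal:
  assumes "\<alpha> \<in> A" "\<beta> \<in> A" "s \<le> t"
  shows "(LINT w|M. regr u \<alpha> s w * e \<beta> t w) = 0"
proof -
  have "(LINT w|M. regr u \<alpha> s w * e \<beta> t w) = (LINT w|M. (\<Sum>j\<in>UNIV. u j * (a \<alpha> (s - int (lag j)) w * e \<beta> t w)))"
    unfolding regr_def sum_distrib_right by (simp add: mult.assoc)
  also have "\<dots> = (\<Sum>j\<in>UNIV. u j * (LINT w|M. a \<alpha> (s - int (lag j)) w * e \<beta> t w))"
    using in_L2_mult_integrable[OF a_L2[OF assms(1)] e_L2[OF assms(2)]] by simp
  also have "\<dots> = 0"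
  proof (intro sum.neutral ballI)
    fix j :: 'p
    have "s - int (lag j) < t" using assms(3) lag_ge_1[of j] by linarith
    then show "u j * (LINT w|M. a \<alpha> (s - int (lag j)) w * e \<beta> t w) = 0"
      using past_noise_orthogonal[OF assms(1,2)] by simp
  qed
  finally show ?thesis .
qed

text \<open>The most recent value with nonzero coefficient contributes its own noise, which nothing else in the
  combination can cancel.\<close>

lemma qcov_pos:
  assumes \<alpha>: "\<alpha> \<in> A" and u: "u j \<noteq> 0"
  shows "0 < qcov u u \<alpha> 0"
proof -
  define i where "i = Min {j. u j \<noteq> 0}"
  have ne: "{j. u j \<noteq> 0} \<noteq> {}" using u by auto
  have ui: "u i \<noteq> 0" using Min_in[OF _ ne] by (simp add: i_def)
  have u0: "u k = 0" if "k < i" for k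
    using that Min_le[of "{j. u j \<noteq> 0}" k] unfolding i_def by fastforce
  define t where "t = - int (lag i)"
  define Y where "Y w = regr u \<alpha> 0 w - u i * e \<alpha> t w" for w
  define v where "v k = (if k = i then 0 else u k)" for k
  have "Y w = (\<Sum>k\<in>UNIV. v k * a \<alpha> (0 - int (lag k)) w) + u i * (\<Sum>k\<in>UNIV. ph \<alpha> k * a \<alpha> (t - int (lag k)) w)" for w
  proof -
    have "regr u \<alpha> 0 w = u i * a \<alpha> t w + (\<Sum>k\<in>UNIV. v k * a \<alpha> (0 - int (lag k)) w)"
    proof -
      have "(\<Sum>k\<in>UNIV. u k * a \<alpha> (0 - int (lag k)) w) = (\<Sum>k\<in>UNIV. (if k = i then u i * a \<alpha> t w else 0) + v k * a \<alpha> (0 - int (lag k)) w)"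
        by (intro sum.cong refl) (auto simp: v_def t_def)
      then show ?thesis unfolding regr_def by (simp add: sum.distrib)
    qed
    then show ?thesis unfolding Y_def e_app by (simp add: right_diff_distrib)
  qed
  then have Yr: "Y w = regr v \<alpha> 0 w + u i * regr (ph \<alpha>) \<alpha> t w" for w
    by (simp add: regr_def)
  have L: "in_L2 M (regr wt \<alpha> s)" for wt s using regr_cgauss[OF \<alpha>] by (rule cgauss_in_L2)
  note iv = in_L2_mult_integrable[OF L e_L2[OF \<alpha>]]
  have o1: "(LINT w|M. regr v \<alpha> 0 w * e \<alpha> t w) = 0"
  proof -
    have "(LINT w|M. regr v \<alpha> 0 w * e \<alpha> t w) = (LINT w|M. (\<Sum>j\<in>UNIV. v j * (a \<alpha> (0 - int (lag j)) w * e \<alpha> t w)))"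
      unfolding regr_def sum_distrib_right by (simp add: mult.assoc)
    also have "\<dots> = (\<Sum>j\<in>UNIV. v j * (LINT w|M. a \<alpha> (0 - int (lag j)) w * e \<alpha> t w))"
      using in_L2_mult_integrable[OF a_L2[OF \<alpha>] e_L2[OF \<alpha>]] by simp
    also have "\<dots> = 0"
    proof (intro sum.neutral ballI)
      fix k :: 'p
      show "v k * (LINT w|M. a \<alpha> (0 - int (lag k)) w * e \<alpha> t w) = 0"
      proof (cases "i < k")
        case True
        then have "0 - int (lag k) < t" using lag_less[OF True] by (simp add: t_def)
        then show ?thesis using past_noise_orthogonal[OF \<alpha> \<alpha>] by simp
      next
        case False
        then have "v k = 0" using u0[of k] by (cases "k = i") (auto simp: v_def)
        then show ?thesis by simp
      qed
    qed
    finally show ?thesis .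
  qed
  have o2: "(LINT w|M. regr (ph \<alpha>) \<alpha> t w * e \<alpha> t w) = 0"
    by (rule regr_noise_orthogonal[OF \<alpha> \<alpha>]) simp
  have YL: "in_L2 M Y"
    unfolding Y_def[abs_def] using in_L2_lincomb(1)[of "{()}" M "\<lambda>_. e \<alpha> t" "\<lambda>_. u i"] e_L2[OF \<alpha>] L
    by (intro in_L2_diff) simp_all
  have Ye: "(LINT w|M. Y w * e \<alpha> t w) = 0"
    unfolding Yr distrib_right using iv o1 o2 by (simp add: mult.assoc)
  have eL: "in_L2 M (e \<alpha> t)" by (rule e_L2[OF \<alpha>])
  have "qcov u u \<alpha> 0 = (LINT w|M. regr u \<alpha> 0 w * regr u \<alpha> 0 w)" using regr_cov[OF \<alpha>, of u 0 u 0] by simp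
  also have "\<dots> = (LINT w|M. Y w * Y w + (2 * u i) * (Y w * e \<alpha> t w) + (u i * u i) * (e \<alpha> t w * e \<alpha> t w))"
    by (intro Bochner_Integration.integral_cong refl) (simp add: Y_def algebra_simps)
  also have "\<dots> = (LINT w|M. Y w * Y w) + (2 * u i) * (LINT w|M. Y w * e \<alpha> t w) + (u i * u i) * (LINT w|M. e \<alpha> t w * e \<alpha> t w)"
    using in_L2_mult_integrable[OF YL YL] in_L2_mult_integrable[OF YL eL] in_L2_mult_integrable[OF eL eL] by simp
  also have "\<dots> = (LINT w|M. Y w * Y w) + u i * u i * c \<alpha>" using Ye ee[OF \<alpha> \<alpha>, of t t] by simp
  also have "\<dots> > 0"
  proof -
    have "0 \<le> (LINT w|M. Y w * Y w)" by (simp add: Bochner_Integration.integral_nonneg)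
    moreover have "0 < u i * u i * c \<alpha>" using ui c_pos[OF \<alpha>] by (simp add: zero_less_mult_iff) (metis linorder_neqE_linordered_idom)
    ultimately show ?thesis by linarith
  qed
  finally show ?thesis .
qed

end

lemma double_cesaro_null:
  fixes r :: "nat \<Rightarrow> real"
  assumes r: "r \<longlonglongrightarrow> 0" and r0: "\<And>n. 0 \<le> r n"
  shows "(\<lambda>N. (\<Sum>s<N. \<Sum>t<N. r (nat \<bar>int t - int s\<bar>)) / (real N)\<^sup>2) \<longlonglongrightarrow> 0"
proof (rule LIMSEQ_I)
  fix \<epsilon> :: real assume \<epsilon>: "\<epsilon> > 0"
  obtain H where H: "\<And>n. n \<ge> H \<Longrightarrow> r n < \<epsilon> / 2" using LIMSEQ_D[OF r, of "\<epsilon> / 2"] \<epsilon> r0 by auto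
  obtain B where B': "B > 0" "\<forall>n. norm (r n) \<le> B"
    by (rule BseqE[OF convergent_imp_Bseq[OF convergentI[OF r]]])
  have B: "r n \<le> B" "B > 0" for n using B'(1) B'(2)[rule_format, of n] by auto
  have row: "(\<Sum>t<N. r (nat \<bar>int t - int s\<bar>)) \<le> real N * (\<epsilon> / 2) + (2 * real H + 1) * B" for N s
  proof -
    have "(\<Sum>t<N. r (nat \<bar>int t - int s\<bar>)) \<le> (\<Sum>t<N. \<epsilon> / 2 + (if t \<in> {s - H..s + H} then B else 0))"
    proof (rule sum_mono)
      fix t assume "t \<in> {..<N}"
      show "r (nat \<bar>int t - int s\<bar>) \<le> \<epsilon> / 2 + (if t \<in> {s - H..s + H} then B else 0)"
      proof (cases "t \<in> {s - H..s + H}")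
        case True then show ?thesis using B(1)[of "nat \<bar>int t - int s\<bar>"] \<epsilon> by simp
      next
        case False
        then have "H \<le> nat \<bar>int t - int s\<bar>" by auto
        then show ?thesis using H[of "nat \<bar>int t - int s\<bar>"] unfolding if_not_P[OF False] by linarith
      qed
    qed
    also have "\<dots> = real N * (\<epsilon> / 2) + real (card ({..<N} \<inter> {s - H..s + H})) * B"
      by (simp add: sum.distrib sum.If_cases Int_def)
    also have "real (card ({..<N} \<inter> {s - H..s + H})) * B \<le> (2 * real H + 1) * B"
    proof -
      have "card ({..<N} \<inter> {s - H..s + H}) \<le> card {s - H..s + H}" by (intro card_mono) auto
      also have "\<dots> \<le> 2 * H + 1" by simp
      finally have "real (card ({..<N} \<inter> {s - H..s + H})) \<le> real (2 * H + 1)" by (rule of_nat_mono)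
      also have "real (2 * H + 1) = 2 * real H + 1" by simp
      finally show ?thesis using B(2) by (intro mult_right_mono) simp_all
    qed
    finally show ?thesis by simp
  qed
  obtain N0 where N0: "(2 * real H + 1) * B / (\<epsilon> / 2) < real N0"
    using reals_Archimedean2[of "(2 * real H + 1) * B / (\<epsilon> / 2)"] by blast
  show "\<exists>no. \<forall>n\<ge>no. norm ((\<Sum>s<n. \<Sum>t<n. r (nat \<bar>int t - int s\<bar>)) / (real n)\<^sup>2 - 0) < \<epsilon>"
  proof (intro exI allI impI)
    fix n assume n: "n \<ge> Suc N0"
    then have n0: "real n > 0" by simp
    have "(2 * real H + 1) * B / (\<epsilon> / 2) < real n" using N0 n by linarith
    then have small: "(2 * real H + 1) * B < real n * (\<epsilon> / 2)" using \<epsilon> by (simp add: divide_less_eq mult.commute)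
    have "(\<Sum>s<n. \<Sum>t<n. r (nat \<bar>int t - int s\<bar>)) \<le> (\<Sum>s<n. real n * (\<epsilon> / 2) + (2 * real H + 1) * B)"
      by (intro sum_mono row)
    also have "\<dots> = real n * (real n * (\<epsilon> / 2) + (2 * real H + 1) * B)" by simp
    also have "\<dots> < real n * (real n * (\<epsilon> / 2) + real n * (\<epsilon> / 2))"
      by (intro mult_strict_left_mono add_strict_left_mono small n0)
    also have "\<dots> = \<epsilon> * (real n)\<^sup>2" by (simp add: power2_eq_square)
    finally have "(\<Sum>s<n. \<Sum>t<n. r (nat \<bar>int t - int s\<bar>)) / (real n)\<^sup>2 < \<epsilon>"
      using n0 by (simp add: divide_less_eq)
    moreover have "0 \<le> (\<Sum>s<n. \<Sum>t<n. r (nat \<bar>int t - int s\<bar>)) / (real n)\<^sup>2"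
      by (intro divide_nonneg_nonneg sum_nonneg r0) auto
    ultimately show "norm ((\<Sum>s<n. \<Sum>t<n. r (nat \<bar>int t - int s\<bar>)) / (real n)\<^sup>2 - 0) < \<epsilon>" by simp
  qed
qed

text \<open>The covariance of the squares of two centred Gaussian variables is twice the square of their covariance, so the
  variance of the average is a double Cesaro mean of a null sequence.\<close>

lemma gaussian_squares_lln:
  fixes x :: "nat \<Rightarrow> 'w \<Rightarrow> real"
  assumes M: "prob_space M" and g: "joint_cgauss M UNIV x"
    and cov: "\<And>s t. (LINT w|M. x s w * x t w) = r (nat \<bar>int t - int s\<bar>)" and r: "r \<longlonglongrightarrow> 0"
  shows "(\<lambda>N. LINT w|M. \<bar>(\<Sum>t<N. (x t w)\<^sup>2) / real N - r 0\<bar>) \<longlonglongrightarrow> 0"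
proof -
  interpret prob_space M by fact
  have xg: "cgauss M (x t)" for t using joint_cgauss_single[OF g, of t] by simp
  note x2 = cgauss_square_integrable[OF xg]
  have xm [measurable]: "x t \<in> borel_measurable M" for t using xg by (rule cgauss_measurable)
  note cc = cgauss_squares_covariance[OF M joint_cgauss_lincomb2[OF g UNIV_I UNIV_I]]
  have Ex2: "(LINT w|M. (x t w)\<^sup>2) = r 0" for t using cov[of t t] by (simp add: power2_eq_square)
  define D where "D N w = (\<Sum>t<N. (x t w)\<^sup>2 - r 0)" for N w
  have Dm [measurable]: "D N \<in> borel_measurable M" for N unfolding D_def[abs_def] by measurable
  have pr: "integrable M (\<lambda>w. ((x s w)\<^sup>2 - r 0) * ((x t w)\<^sup>2 - r 0))"
    "(LINT w|M. ((x s w)\<^sup>2 - r 0) * ((x t w)\<^sup>2 - r 0)) = 2 * (r (nat \<bar>int t - int s\<bar>))\<^sup>2" for s t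
  proof -
    have e: "((x s w)\<^sup>2 - r 0) * ((x t w)\<^sup>2 - r 0) = (x s w)\<^sup>2 * (x t w)\<^sup>2 - r 0 * (x s w)\<^sup>2 - r 0 * (x t w)\<^sup>2 + r 0 * r 0" for w
      by (simp add: algebra_simps)
    note i = cc(1)[of s t] x2[of s] x2[of t]
    show "integrable M (\<lambda>w. ((x s w)\<^sup>2 - r 0) * ((x t w)\<^sup>2 - r 0))" unfolding e using i by simp
    show "(LINT w|M. ((x s w)\<^sup>2 - r 0) * ((x t w)\<^sup>2 - r 0)) = 2 * (r (nat \<bar>int t - int s\<bar>))\<^sup>2"
      unfolding e using i cc(2)[of s t] by (simp add: Ex2 cov prob_space)
  qed
  have D2: "integrable M (\<lambda>w. (D N w)\<^sup>2)" "(LINT w|M. (D N w)\<^sup>2) = (\<Sum>s<N. \<Sum>t<N. 2 * (r (nat \<bar>int t - int s\<bar>))\<^sup>2)" for N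
    unfolding D_def power2_eq_square[of "sum _ _"] sum_product using pr by simp_all
  have le: "(LINT w|M. \<bar>(\<Sum>t<N. (x t w)\<^sup>2) / real N - r 0\<bar>) \<le> sqrt ((\<Sum>s<N. \<Sum>t<N. 2 * (r (nat \<bar>int t - int s\<bar>))\<^sup>2) / (real N)\<^sup>2)" if N: "N > 0" for N
  proof -
    have eq: "(\<Sum>t<N. (x t w)\<^sup>2) / real N - r 0 = D N w / real N" for w
      using N by (simp add: D_def sum_subtractf diff_divide_distrib)
    have "integrable M (\<lambda>w. (D N w / real N)\<^sup>2)" using D2(1)[of N] by (simp add: power_divide)
    then have "(LINT w|M. \<bar>D N w / real N\<bar>) \<le> sqrt (LINT w|M. (D N w / real N)\<^sup>2)"
      by (intro expectation_abs_le_L2) measurable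
    then show ?thesis unfolding eq by (simp add: power_divide D2(2))
  qed
  have "(\<lambda>N. (\<Sum>s<N. \<Sum>t<N. (\<lambda>n. 2 * (r n)\<^sup>2) (nat \<bar>int t - int s\<bar>)) / (real N)\<^sup>2) \<longlonglongrightarrow> 0"
    by (rule double_cesaro_null) (use tendsto_mult[OF tendsto_const[of 2] tendsto_power[OF r, of 2]] in auto)
  from tendsto_real_sqrt[OF this] have lim: "(\<lambda>N. sqrt ((\<Sum>s<N. \<Sum>t<N. 2 * (r (nat \<bar>int t - int s\<bar>))\<^sup>2) / (real N)\<^sup>2)) \<longlonglongrightarrow> 0"
    by simp
  show ?thesis
  proof (rule Lim_null_comparison[OF _ lim])
    show "\<forall>\<^sub>F N in sequentially. norm (LINT w|M. \<bar>(\<Sum>t<N. (x t w)\<^sup>2) / real N - r 0\<bar>) \<le> sqrt ((\<Sum>s<N. \<Sum>t<N. 2 * (r (nat \<bar>int t - int s\<bar>))\<^sup>2) / (real N)\<^sup>2)"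
      using eventually_gt_at_top[of 0] by eventually_elim (use le in \<open>simp add: Bochner_Integration.integral_nonneg\<close>)
  qed
qed

context gaussian_ar
begin

lemma qcov_lln:
  assumes \<alpha>: "\<alpha> \<in> A"
  shows "(\<lambda>N. LINT w|M. \<bar>(\<Sum>t<N. (regr u \<alpha> (int t + d) w)\<^sup>2) / real N - qcov u u \<alpha> 0\<bar>) \<longlonglongrightarrow> 0"
proof -
  have sym: "qcov u u \<alpha> (- h) = qcov u u \<alpha> h" for h
    using regr_cov[OF \<alpha>, of u h u 0] regr_cov[OF \<alpha>, of u 0 u h] by (simp add: mult.commute)
  have cov: "(LINT w|M. regr u \<alpha> (int s + d) w * regr u \<alpha> (int t + d) w) = qcov u u \<alpha> (int (nat \<bar>int t - int s\<bar>))" for s t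
    using regr_cov[OF \<alpha>, of u "int s + d" u "int t + d"] sym[of "int t - int s"] by (simp add: abs_if)
  have g: "joint_cgauss M UNIV (\<lambda>t::nat. regr u \<alpha> (int t + d))"
    by (rule joint_cgauss_lin_span[OF joint]) (rule regr_span[OF \<alpha>])
  show ?thesis
    using gaussian_squares_lln[OF prob_space_axioms g cov qcov_tendsto_0[OF \<alpha>]] by simp
qed

text \<open>Regressors are functions of the past, hence uncorrelated with present and future noise, and their averaged squares
  converge in mean by \<open>qcov_lln\<close>. All indices are treated in one sum, which gives the joint limit law.\<close>

lemma regr_noise_clt:
  "(\<lambda>N. LINT w|M. cos (b + (\<Sum>t<N. \<Sum>\<alpha>\<in>A. regr (u \<alpha>) \<alpha> (int t + d) w * e \<alpha> (int t + d) w) / sqrt (real N)))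
    \<longlonglongrightarrow> exp (- (\<Sum>\<alpha>\<in>A. c \<alpha> * qcov (u \<alpha>) (u \<alpha>) \<alpha> 0) / 2) * cos b"
proof -
  define y where "y N \<alpha> t w = (1 / sqrt (real N)) * regr (u \<alpha>) \<alpha> (int t + d) w" for N :: nat and \<alpha> and t :: nat and w
  define e' where "e' \<alpha> t = e \<alpha> (int t + d)" for \<alpha> and t :: nat
  define \<sigma> where "\<sigma> = (\<Sum>\<alpha>\<in>A. c \<alpha> * qcov (u \<alpha>) (u \<alpha>) \<alpha> 0)"
  have J: "joint_cgauss M (UNIV \<times> A \<times> UNIV) (\<lambda>(b, \<alpha>, t). if b then e' \<alpha> t else y N \<alpha> t)" for N
  proof (rule joint_cgauss_lin_span[OF joint])
    fix k :: "bool \<times> 'a \<times> nat" assume "k \<in> UNIV \<times> A \<times> UNIV"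
    then obtain b \<alpha> t where k: "k = (b, \<alpha>, t)" "\<alpha> \<in> A" by auto
    show "(case k of (b, \<alpha>, t) \<Rightarrow> if b then e' \<alpha> t else y N \<alpha> t) \<in> lin_span (A \<times> UNIV) (\<lambda>(\<alpha>, t). a \<alpha> t)"
    proof (cases b)
      case True
      then show ?thesis using e_span[OF k(2)] unfolding k(1) e'_def by simp
    next
      case False
      have "y N \<alpha> t \<in> lin_span (A \<times> UNIV) (\<lambda>(\<alpha>, t). a \<alpha> t)"
        unfolding y_def[abs_def] by (rule lin_span_scale[OF regr_span[OF k(2)]])
      then show ?thesis using False unfolding k(1) by (simp add: case_prod_unfold)
    qed
  qed
  have ee': "(LINT w|M. e' \<alpha> s w * e' \<beta> t w) = (if \<alpha> = \<beta> \<and> s = t then c \<alpha> else 0)" if "\<alpha> \<in> A" "\<beta> \<in> A" for \<alpha> \<beta> s t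
    unfolding e'_def using ee[OF that, of "int s + d" "int t + d"] by simp
  have ye: "(LINT w|M. y N \<alpha> s w * e' \<beta> t w) = 0" if "\<alpha> \<in> A" "\<beta> \<in> A" "s \<le> t" for N \<alpha> \<beta> s t
    unfolding y_def e'_def using regr_noise_orthogonal[OF that(1,2), of "int s + d" "int t + d"] that(3) by (simp add: mult.assoc)
  have q0: "0 \<le> qcov (u \<alpha>) (u \<alpha>) \<alpha> 0" if "\<alpha> \<in> A" for \<alpha>
    using regr_cov[OF that, of "u \<alpha>" 0 "u \<alpha>" 0] Bochner_Integration.integral_nonneg[of M "\<lambda>w. regr (u \<alpha>) \<alpha> 0 w * regr (u \<alpha>) \<alpha> 0 w"] by simp
  have s0: "0 \<le> \<sigma>" unfolding \<sigma>_def using c_pos q0 by (intro sum_nonneg mult_nonneg_nonneg) (auto intro: less_imp_le)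
  define D where "D N \<alpha> w = (\<Sum>t<N. (regr (u \<alpha>) \<alpha> (int t + d) w)\<^sup>2) / real N - qcov (u \<alpha>) (u \<alpha>) \<alpha> 0" for N \<alpha> w
  have iD: "integrable M (D N \<alpha>)" if "\<alpha> \<in> A" for N \<alpha>
    unfolding D_def[abs_def] using cgauss_square_integrable[OF regr_cgauss[OF that]] by simp
  have split: "(\<Sum>t<N. \<Sum>\<alpha>\<in>A. c \<alpha> * (y N \<alpha> t w)\<^sup>2) - \<sigma> = (\<Sum>\<alpha>\<in>A. c \<alpha> * D N \<alpha> w)" if "N > 0" for N w
  proof -
    have "(\<Sum>t<N. \<Sum>\<alpha>\<in>A. c \<alpha> * (y N \<alpha> t w)\<^sup>2) = (\<Sum>\<alpha>\<in>A. \<Sum>t<N. c \<alpha> * (y N \<alpha> t w)\<^sup>2)" by (rule sum.swap)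
    also have "\<dots> = (\<Sum>\<alpha>\<in>A. c \<alpha> * ((\<Sum>t<N. (regr (u \<alpha>) \<alpha> (int t + d) w)\<^sup>2) / real N))"
      unfolding sum_distrib_left sum_divide_distrib by (intro sum.cong refl) (simp add: y_def power_mult_distrib power_divide)
    finally show ?thesis unfolding \<sigma>_def D_def by (simp add: sum_subtractf right_diff_distrib)
  qed
  have "(\<lambda>N. \<Sum>\<alpha>\<in>A. c \<alpha> * (LINT w|M. \<bar>D N \<alpha> w\<bar>)) \<longlonglongrightarrow> (\<Sum>\<alpha>\<in>A. c \<alpha> * 0)"
    unfolding D_def by (intro tendsto_sum tendsto_mult tendsto_const qcov_lln)
  then have lim: "(\<lambda>N. \<Sum>\<alpha>\<in>A. c \<alpha> * (LINT w|M. \<bar>D N \<alpha> w\<bar>)) \<longlonglongrightarrow> 0" by simp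
  have bd: "norm (LINT w|M. \<bar>(\<Sum>t<N. \<Sum>\<alpha>\<in>A. c \<alpha> * (y N \<alpha> t w)\<^sup>2) - \<sigma>\<bar>) \<le> (\<Sum>\<alpha>\<in>A. c \<alpha> * (LINT w|M. \<bar>D N \<alpha> w\<bar>))" if N: "N > 0" for N
  proof -
    have "(LINT w|M. \<bar>\<Sum>\<alpha>\<in>A. c \<alpha> * D N \<alpha> w\<bar>) \<le> (LINT w|M. (\<Sum>\<alpha>\<in>A. c \<alpha> * \<bar>D N \<alpha> w\<bar>))"
    proof (rule integral_mono)
      show "integrable M (\<lambda>w. \<bar>\<Sum>\<alpha>\<in>A. c \<alpha> * D N \<alpha> w\<bar>)"
        by (intro integrable_abs Bochner_Integration.integrable_sum integrable_mult_right iD)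
      show "integrable M (\<lambda>w. \<Sum>\<alpha>\<in>A. c \<alpha> * \<bar>D N \<alpha> w\<bar>)"
        by (intro Bochner_Integration.integrable_sum integrable_mult_right integrable_abs iD)
      fix w
      have "\<bar>\<Sum>\<alpha>\<in>A. c \<alpha> * D N \<alpha> w\<bar> \<le> (\<Sum>\<alpha>\<in>A. \<bar>c \<alpha> * D N \<alpha> w\<bar>)" by (rule sum_abs)
      also have "\<dots> = (\<Sum>\<alpha>\<in>A. c \<alpha> * \<bar>D N \<alpha> w\<bar>)" using c_pos by (intro sum.cong refl) (simp add: abs_mult less_imp_le)
      finally show "\<bar>\<Sum>\<alpha>\<in>A. c \<alpha> * D N \<alpha> w\<bar> \<le> (\<Sum>\<alpha>\<in>A. c \<alpha> * \<bar>D N \<alpha> w\<bar>)" .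
    qed
    also have "\<dots> = (\<Sum>\<alpha>\<in>A. c \<alpha> * (LINT w|M. \<bar>D N \<alpha> w\<bar>))" using iD by simp
    finally show ?thesis unfolding split[OF N] by (simp add: Bochner_Integration.integral_nonneg)
  qed
  have conv: "(\<lambda>N. LINT w|M. \<bar>(\<Sum>t<N. \<Sum>\<alpha>\<in>A. c \<alpha> * (y N \<alpha> t w)\<^sup>2) - \<sigma>\<bar>) \<longlonglongrightarrow> 0"
  proof (rule Lim_null_comparison[OF _ lim])
    show "\<forall>\<^sub>F N in sequentially. norm (LINT w|M. \<bar>(\<Sum>t<N. \<Sum>\<alpha>\<in>A. c \<alpha> * (y N \<alpha> t w)\<^sup>2) - \<sigma>\<bar>) \<le> (\<Sum>\<alpha>\<in>A. c \<alpha> * (LINT w|M. \<bar>D N \<alpha> w\<bar>))"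
      using eventually_gt_at_top[of 0] by eventually_elim (rule bd)
  qed
  have "(\<lambda>N. LINT w|M. cos (b + (\<Sum>t<N. \<Sum>\<alpha>\<in>A. y N \<alpha> t w * e' \<alpha> t w))) \<longlonglongrightarrow> exp (- \<sigma> / 2) * cos b"
    by (rule gaussian_martingale_clt[OF prob_space_axioms finA J ee' ye less_imp_le[OF c_pos] s0 conv])
  moreover have "(\<Sum>t<N. \<Sum>\<alpha>\<in>A. y N \<alpha> t w * e' \<alpha> t w) = (\<Sum>t<N. \<Sum>\<alpha>\<in>A. regr (u \<alpha>) \<alpha> (int t + d) w * e \<alpha> (int t + d) w) / sqrt (real N)" for N w
    unfolding sum_divide_distrib y_def e'_def by (intro sum.cong refl) simp
  ultimately show ?thesis unfolding \<sigma>_def by simp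
qed

end

section \<open>Integrals of random fields with bounded second moments\<close>

text \<open>The uniform bound on the second moments makes the field square integrable on the product space, so that
  Fubini's theorem applies to products of the field with square integrable variables.\<close>

definition msq_field :: "'w measure \<Rightarrow> 'b measure \<Rightarrow> ('b \<Rightarrow> 'w \<Rightarrow> real) \<Rightarrow> bool" where
  "msq_field M P X \<longleftrightarrow> (\<lambda>(w, x). X x w) \<in> borel_measurable (M \<Otimes>\<^sub>M P) \<and>
     (\<exists>B. \<forall>x\<in>space P. in_L2 M (X x) \<and> L2norm M (X x) \<le> B)"

lemma msq_const: "in_L2 M A \<Longrightarrow> msq_field M P (\<lambda>x. A)"
proof -
  assume A: "in_L2 M A"
  then have [measurable]: "A \<in> borel_measurable M" by (simp add: in_L2_def)
  have "(\<lambda>(w, x). A w) \<in> borel_measurable (M \<Otimes>\<^sub>M P)" by measurable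
  then show ?thesis using A unfolding msq_field_def by (intro conjI exI[of _ "L2norm M A"]) auto
qed

lemma msq_lincomb:
  assumes K: "finite K" and X: "\<And>k. k \<in> K \<Longrightarrow> msq_field M P (X k)"
    and g: "\<And>k. k \<in> K \<Longrightarrow> g k \<in> borel_measurable P" and b: "\<And>k. k \<in> K \<Longrightarrow> \<exists>B. \<forall>x\<in>space P. \<bar>g k x\<bar> \<le> B"
  shows "msq_field M P (\<lambda>x w. \<Sum>k\<in>K. g k x * X k x w)"
proof -
  have m: "(\<lambda>(w, x). \<Sum>k\<in>K. g k x * X k x w) \<in> borel_measurable (M \<Otimes>\<^sub>M P)"
  proof -
    have "(\<lambda>z. g k (snd z) * (case z of (w, x) \<Rightarrow> X k x w)) \<in> borel_measurable (M \<Otimes>\<^sub>M P)" if "k \<in> K" for k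
    proof -
      have [measurable]: "(\<lambda>(w, x). X k x w) \<in> borel_measurable (M \<Otimes>\<^sub>M P)" "g k \<in> borel_measurable P"
        using X[OF that] g[OF that] by (simp_all add: msq_field_def)
      show ?thesis by measurable
    qed
    then have "(\<lambda>z. \<Sum>k\<in>K. g k (snd z) * (case z of (w, x) \<Rightarrow> X k x w)) \<in> borel_measurable (M \<Otimes>\<^sub>M P)" by (rule borel_measurable_sum)
    then show ?thesis by (simp add: case_prod_unfold)
  qed
  obtain B where B: "\<And>k x. k \<in> K \<Longrightarrow> x \<in> space P \<Longrightarrow> \<bar>g k x\<bar> \<le> B k" using b by metis
  have "\<exists>D. \<forall>x\<in>space P. in_L2 M (X k x) \<and> L2norm M (X k x) \<le> D" if "k \<in> K" for k
    using X[OF that] by (simp add: msq_field_def)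
  then obtain D where D: "\<And>k x. k \<in> K \<Longrightarrow> x \<in> space P \<Longrightarrow> in_L2 M (X k x) \<and> L2norm M (X k x) \<le> D k" by metis
  have "in_L2 M (\<lambda>w. \<Sum>k\<in>K. g k x * X k x w) \<and> L2norm M (\<lambda>w. \<Sum>k\<in>K. g k x * X k x w) \<le> (\<Sum>k\<in>K. B k * D k)"
    if x: "x \<in> space P" for x
  proof
    show "in_L2 M (\<lambda>w. \<Sum>k\<in>K. g k x * X k x w)" by (rule in_L2_lincomb(1)[OF K]) (simp add: D x)
    have "L2norm M (\<lambda>w. \<Sum>k\<in>K. g k x * X k x w) \<le> (\<Sum>k\<in>K. \<bar>g k x\<bar> * L2norm M (X k x))"
      by (rule in_L2_lincomb(2)[OF K]) (simp add: D x)
    also have "\<dots> \<le> (\<Sum>k\<in>K. B k * D k)"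
      using B D x by (intro sum_mono mult_mono) (auto intro: order_trans[OF abs_ge_zero] L2norm_nonneg)
    finally show "L2norm M (\<lambda>w. \<Sum>k\<in>K. g k x * X k x w) \<le> (\<Sum>k\<in>K. B k * D k)" .
  qed
  then show ?thesis using m unfolding msq_field_def by (intro conjI exI[of _ "\<Sum>k\<in>K. B k * D k"]) auto
qed

lemma msq_mult:
  assumes "msq_field M P X" "g \<in> borel_measurable P" "\<exists>B. \<forall>x\<in>space P. \<bar>g x\<bar> \<le> B"
  shows "msq_field M P (\<lambda>x w. g x * X x w)"
  using msq_lincomb[of "{()}" M P "\<lambda>_. X" "\<lambda>_. g"] assms by simp

locale msq = M: prob_space M + Q: finite_measure P for M :: "'w measure" and P :: "'b measure"
begin

sublocale pair_sigma_finite M P ..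

lemma msq_square_integrable:
  assumes X: "msq_field M P X"
  shows "integrable (M \<Otimes>\<^sub>M P) (\<lambda>(w, x). (X x w)\<^sup>2)"
proof (rule integrableI_bounded)
  have [measurable]: "(\<lambda>(w, x). X x w) \<in> borel_measurable (M \<Otimes>\<^sub>M P)" using X by (simp add: msq_field_def)
  have "(\<lambda>z. (case z of (w, x) \<Rightarrow> X x w)\<^sup>2) \<in> borel_measurable (M \<Otimes>\<^sub>M P)" by measurable
  then show m: "(\<lambda>(w, x). (X x w)\<^sup>2) \<in> borel_measurable (M \<Otimes>\<^sub>M P)" by (simp add: case_prod_unfold)
  obtain B where B: "\<And>x. x \<in> space P \<Longrightarrow> in_L2 M (X x) \<and> L2norm M (X x) \<le> B" using X by (auto simp: msq_field_def)
  have "(\<integral>\<^sup>+z. ennreal (norm (case z of (w, x) \<Rightarrow> (X x w)\<^sup>2)) \<partial>(M \<Otimes>\<^sub>M P)) =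
     (\<integral>\<^sup>+x. (\<integral>\<^sup>+w. ennreal (norm (case (w, x) of (w, x) \<Rightarrow> (X x w)\<^sup>2)) \<partial>M) \<partial>P)"
    by (rule nn_integral_snd[symmetric]) (use m in measurable)
  also have "\<dots> \<le> (\<integral>\<^sup>+x. ennreal (B\<^sup>2) \<partial>P)"
  proof (rule nn_integral_mono)
    fix x assume x: "x \<in> space P"
    have "(\<integral>\<^sup>+w. ennreal ((X x w)\<^sup>2) \<partial>M) = ennreal (LINT w|M. (X x w)\<^sup>2)"
      using B[OF x] by (intro nn_integral_eq_integral) (auto simp: in_L2_def)
    also have "\<dots> = ennreal ((L2norm M (X x))\<^sup>2)" by (simp add: L2norm_def Bochner_Integration.integral_nonneg)
    also have "\<dots> \<le> ennreal (B\<^sup>2)" using B[OF x] L2norm_nonneg[of M "X x"] by (intro ennreal_leI power_mono) auto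
    finally show "(\<integral>\<^sup>+w. ennreal (norm (case (w, x) of (w, x) \<Rightarrow> (X x w)\<^sup>2)) \<partial>M) \<le> ennreal (B\<^sup>2)" by simp
  qed
  also have "\<dots> = ennreal (B\<^sup>2) * emeasure P (space P)" by simp
  also have "\<dots> < \<infinity>" by (simp add: ennreal_mult_less_top Q.emeasure_eq_measure)
  finally show "(\<integral>\<^sup>+z. ennreal (norm (case z of (w, x) \<Rightarrow> (X x w)\<^sup>2)) \<partial>(M \<Otimes>\<^sub>M P)) < \<infinity>" .
qed

lemma msq_paths: 
  assumes X: "msq_field M P X"
  shows "AE w in M. in_L2 P (\<lambda>x. X x w)" and "(\<lambda>w. LINT x|P. X x w) \<in> borel_measurable M"
    and "integrable M (\<lambda>w. LINT x|P. (X x w)\<^sup>2)"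
proof -
  have m [measurable]: "(\<lambda>(w, x). X x w) \<in> borel_measurable (M \<Otimes>\<^sub>M P)" using X by (simp add: msq_field_def)
  have "AE w in M. integrable P (\<lambda>x. (X x w)\<^sup>2)" using AE_integrable_fst'[OF msq_square_integrable[OF X]] by simp
  with AE_space show "AE w in M. in_L2 P (\<lambda>x. X x w)"
  proof eventually_elim
    case (elim w)
    have "(\<lambda>x. X x w) \<in> borel_measurable P" using measurable_Pair2[OF m elim(1)] by simp
    then show ?case using elim by (simp add: in_L2_def)
  qed
  show "(\<lambda>w. LINT x|P. X x w) \<in> borel_measurable M"
    using Q.borel_measurable_lebesgue_integral[OF m] by simp
  show "integrable M (\<lambda>w. LINT x|P. (X x w)\<^sup>2)" using integrable_fst'[OF msq_square_integrable[OF X]] by simp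
qed

lemma msq_integral_L2:
  assumes X: "msq_field M P X"
  shows "in_L2 M (\<lambda>w. LINT x|P. X x w)"
proof -
  note p = msq_paths[OF X]
  have [measurable]: "(\<lambda>w. LINT x|P. X x w) \<in> borel_measurable M" by (rule p(2))
  have "AE w in M. (LINT x|P. X x w)\<^sup>2 \<le> measure P (space P) * (LINT x|P. (X x w)\<^sup>2)"
    using p(1)
  proof eventually_elim
    case (elim w)
    have "in_L2 P (\<lambda>_. 1)" by (simp add: in_L2_def)
    from in_L2_cauchy_schwarz[OF elim this]
    have "\<bar>\<integral>x. X x w \<partial>P\<bar> \<le> L2norm P (\<lambda>x. X x w) * L2norm P (\<lambda>_. 1)" by simp
    from power_mono[OF this, of 2] have "(LINT x|P. X x w)\<^sup>2 \<le> (L2norm P (\<lambda>x. X x w))\<^sup>2 * (L2norm P (\<lambda>_. 1))\<^sup>2"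
      by (simp add: power_mult_distrib)
    then show ?case by (simp add: L2norm_def Bochner_Integration.integral_nonneg mult.commute)
  qed
  then have "AE w in M. norm ((LINT x|P. X x w)\<^sup>2) \<le> norm (measure P (space P) * (LINT x|P. (X x w)\<^sup>2))"
    by eventually_elim (simp add: abs_mult Bochner_Integration.integral_nonneg)
  then have "integrable M (\<lambda>w. (LINT x|P. X x w)\<^sup>2)"
    by (intro Bochner_Integration.integrable_bound[OF integrable_mult_right[OF p(3)]]) measurable
  then show ?thesis by (simp add: in_L2_def)
qed

lemma msq_integrable_mult:
  assumes A: "in_L2 M A" and X: "msq_field M P X"
  shows "integrable (M \<Otimes>\<^sub>M P) (\<lambda>(w, x). A w * X x w)"
proof -
  have [measurable]: "(\<lambda>(w, x). X x w) \<in> borel_measurable (M \<Otimes>\<^sub>M P)" "A \<in> borel_measurable M"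
    using X A by (simp_all add: msq_field_def in_L2_def)
  have i: "integrable (M \<Otimes>\<^sub>M P) (\<lambda>z. (A (fst z))\<^sup>2)" "integrable (M \<Otimes>\<^sub>M P) (\<lambda>z. (X (snd z) (fst z))\<^sup>2)"
    using msq_square_integrable[OF msq_const[OF A]] msq_square_integrable[OF X] by (simp_all add: case_prod_unfold)
  have m: "(\<lambda>z. X (snd z) (fst z)) \<in> borel_measurable (M \<Otimes>\<^sub>M P)"
    using X by (simp add: msq_field_def case_prod_unfold)
  have "integrable (M \<Otimes>\<^sub>M P) (\<lambda>z. A (fst z) * X (snd z) (fst z))"
    by (rule integrable_mult_squares[OF _ m i]) measurable
  then show ?thesis by (simp add: case_prod_unfold)
qed

lemma msq_fubini:
  assumes A: "in_L2 M A" and X: "msq_field M P X"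
  shows "(LINT w|M. A w * (LINT x|P. X x w)) = (LINT x|P. (LINT w|M. A w * X x w))"
    and "integrable P (\<lambda>x. LINT w|M. A w * X x w)"
proof -
  note i = msq_integrable_mult[OF A X]
  show "(LINT w|M. A w * (LINT x|P. X x w)) = (LINT x|P. (LINT w|M. A w * X x w))"
    using Fubini_integral[of "\<lambda>w x. A w * X x w"] i by simp
  show "integrable P (\<lambda>x. LINT w|M. A w * X x w)"
    using integrable_snd[of "\<lambda>w x. A w * X x w"] i by simp
qed

lemma msq_inner:
  assumes X: "msq_field M P X" and Y: "msq_field M P Y"
  shows "(LINT w|M. (LINT x|P. X x w) * (LINT y|P. Y y w)) = (LINT x|P. (LINT y|P. (LINT w|M. X x w * Y y w)))"
proof -
  have "(LINT w|M. (LINT x|P. X x w) * (LINT y|P. Y y w)) = (LINT w|M. (LINT y|P. Y y w) * (LINT x|P. X x w))"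
    by (simp add: mult.commute)
  also have "\<dots> = (LINT x|P. (LINT w|M. (LINT y|P. Y y w) * X x w))" by (rule msq_fubini(1)[OF msq_integral_L2[OF Y] X])
  also have "\<dots> = (LINT x|P. (LINT y|P. (LINT w|M. X x w * Y y w)))"
  proof (rule Bochner_Integration.integral_cong[OF refl])
    fix x assume "x \<in> space P"
    then have x: "in_L2 M (X x)" using X by (auto simp: msq_field_def)
    show "(LINT w|M. (LINT y|P. Y y w) * X x w) = (LINT y|P. (LINT w|M. X x w * Y y w))"
      using msq_fubini(1)[OF x Y] by (simp add: mult.commute)
  qed
  finally show ?thesis .
qed

text \<open>A Monte Carlo argument without randomness: the points are chosen one after another. On average over the next
  point the cross term with the error accumulated so far vanishes, so some point increases the mean squared error by no
  more than a constant.\<close>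

lemma msq_sampling:
  assumes X: "msq_field M P X" and m0: "measure P (space P) > 0"
  shows "\<exists>C. \<forall>n. \<exists>xs. length xs = n \<and> set xs \<subseteq> space P \<and>
    (LINT w|M. ((\<Sum>x\<leftarrow>xs. measure P (space P) * X x w) - real n * (LINT x|P. X x w))\<^sup>2) \<le> real n * C"
proof -
  define m where "m = measure P (space P)"
  define J where "J w = (LINT x|P. X x w)" for w
  have J: "in_L2 M J" unfolding J_def by (rule msq_integral_L2[OF X])
  obtain B where B: "\<And>x. x \<in> space P \<Longrightarrow> in_L2 M (X x) \<and> L2norm M (X x) \<le> B" using X by (auto simp: msq_field_def)
  define d where "d x w = m * X x w - J w" for x w
  have dL: "in_L2 M (d x)" if "x \<in> space P" for x
  proof -
    have "in_L2 M (\<lambda>w. m * X x w)" using B[OF that] by (auto simp: in_L2_def power_mult_distrib)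
    then show ?thesis using in_L2_diff[OF _ J] unfolding d_def[abs_def] by blast
  qed
  define K where "K = 2 * m\<^sup>2 * B\<^sup>2 + 2 * (LINT w|M. (J w)\<^sup>2)"
  have dK: "(LINT w|M. (d x w)\<^sup>2) \<le> K" if x: "x \<in> space P" for x
  proof -
    have "(LINT w|M. (d x w)\<^sup>2) \<le> (LINT w|M. 2 * m\<^sup>2 * (X x w)\<^sup>2 + 2 * (J w)\<^sup>2)"
    proof (rule integral_mono)
      show "integrable M (\<lambda>w. (d x w)\<^sup>2)" using dL[OF x] by (simp add: in_L2_def)
      show "integrable M (\<lambda>w. 2 * m\<^sup>2 * (X x w)\<^sup>2 + 2 * (J w)\<^sup>2)" using B[OF x] J by (simp add: in_L2_def)
      fix w
      have "0 \<le> (m * X x w + J w)\<^sup>2" by simp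
      then show "(d x w)\<^sup>2 \<le> 2 * m\<^sup>2 * (X x w)\<^sup>2 + 2 * (J w)\<^sup>2" unfolding d_def by (simp add: power2_eq_square algebra_simps)
    qed
    also have "\<dots> = 2 * m\<^sup>2 * (L2norm M (X x))\<^sup>2 + 2 * (LINT w|M. (J w)\<^sup>2)"
      using B[OF x] J by (simp add: in_L2_def L2norm_def Bochner_Integration.integral_nonneg)
    also have "\<dots> \<le> K" unfolding K_def using B[OF x] L2norm_nonneg[of M "X x"] by (intro add_mono mult_left_mono power_mono) auto
    finally show ?thesis .
  qed
  \<comment> \<open>The additional \<open>1\<close> makes room for a strict inequality, to be contradicted by averaging.\<close>
  have step: "\<exists>x\<in>space P. (LINT w|M. (R w + d x w)\<^sup>2) \<le> (LINT w|M. (R w)\<^sup>2) + (K + 1)" if R: "in_L2 M R" for R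
  proof (rule ccontr)
    assume neg: "\<not> ?thesis"
    have ex: "(LINT w|M. (R w + d x w)\<^sup>2) = (LINT w|M. (R w)\<^sup>2) + 2 * (LINT w|M. R w * d x w) + (LINT w|M. (d x w)\<^sup>2)"
      if x: "x \<in> space P" for x
      using R dL[OF x] in_L2_mult_integrable[OF R dL[OF x]] by (simp add: in_L2_def power2_sum mult.assoc)
    have ed: "(LINT w|M. R w * d x w) = m * (LINT w|M. R w * X x w) - (LINT w|M. R w * J w)" if x: "x \<in> space P" for x
      using in_L2_mult_integrable[OF R J] in_L2_mult_integrable[OF R, of "X x"] B[OF x]
      by (simp add: d_def right_diff_distrib mult.left_commute[of _ m])
    have pos: "1 / 2 < (LINT w|M. R w * d x w)" if x: "x \<in> space P" for x
    proof -
      have "\<not> (LINT w|M. (R w + d x w)\<^sup>2) \<le> (LINT w|M. (R w)\<^sup>2) + (K + 1)" using neg x by blast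
      then show ?thesis using ex[OF x] dK[OF x] by linarith
    qed
    have "(LINT x|P. m * (LINT w|M. R w * X x w) - (LINT w|M. R w * J w)) \<ge> (LINT x|P. 1 / 2)"
      using pos ed msq_fubini(2)[OF R X] by (intro integral_mono) (auto intro: less_imp_le)
    then have "m / 2 \<le> m * (LINT x|P. (LINT w|M. R w * X x w)) - m * (LINT w|M. R w * J w)"
      using msq_fubini(2)[OF R X] by (simp add: m_def)
    then have "m / 2 \<le> 0" using msq_fubini(1)[OF R X] by (simp add: J_def)
    then show False using m0 by (simp add: m_def)
  qed
  have "\<exists>xs. length xs = n \<and> set xs \<subseteq> space P \<and> (LINT w|M. ((\<Sum>x\<leftarrow>xs. m * X x w) - real n * J w)\<^sup>2) \<le> real n * (K + 1)
     \<and> in_L2 M (\<lambda>w. (\<Sum>x\<leftarrow>xs. m * X x w) - real n * J w)" for n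
  proof (induction n)
    case 0
    show ?case by (simp add: in_L2_def)
  next
    case (Suc n)
    then obtain xs where xs: "length xs = n" "set xs \<subseteq> space P" and le: "(LINT w|M. ((\<Sum>x\<leftarrow>xs. m * X x w) - real n * J w)\<^sup>2) \<le> real n * (K + 1)"
      and L: "in_L2 M (\<lambda>w. (\<Sum>x\<leftarrow>xs. m * X x w) - real n * J w)" by blast
    obtain x where x: "x \<in> space P" and lx: "(LINT w|M. (((\<Sum>x\<leftarrow>xs. m * X x w) - real n * J w) + d x w)\<^sup>2) \<le> (LINT w|M. ((\<Sum>x\<leftarrow>xs. m * X x w) - real n * J w)\<^sup>2) + (K + 1)"
      using step[OF L] by blast
    have eq: "(\<lambda>w. (\<Sum>x\<leftarrow>x # xs. m * X x w) - real (Suc n) * J w) = (\<lambda>w. ((\<Sum>x\<leftarrow>xs. m * X x w) - real n * J w) + d x w)"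
      by (simp add: d_def algebra_simps fun_eq_iff)
    have "in_L2 M (\<lambda>w. (\<Sum>x\<leftarrow>x # xs. m * X x w) - real (Suc n) * J w)"
      unfolding eq using in_L2_diff[OF L, of "\<lambda>w. - d x w"] dL[OF x] by (simp add: in_L2_def)
    moreover have "(LINT w|M. ((\<Sum>x\<leftarrow>x # xs. m * X x w) - real (Suc n) * J w)\<^sup>2) \<le> real (Suc n) * (K + 1)"
      using lx le unfolding fun_cong[OF eq] by (simp add: algebra_simps)
    ultimately show ?case using xs x by (intro exI[of _ "x # xs"]) auto
  qed
  then show ?thesis unfolding m_def J_def by (intro exI[of _ "K + 1"]) blast
qed

text \<open>The integral is the mean square limit of averages over sampled points, which are finite linear combinations of the
  given Gaussian family.\<close>

lemma msq_integral_cgauss: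
  assumes X: "msq_field M P X" and m0: "measure P (space P) > 0"
    and span: "\<And>x. x \<in> space P \<Longrightarrow> X x \<in> lin_span I T" and T: "joint_cgauss M I T"
  shows "cgauss M (\<lambda>w. LINT x|P. X x w)"
proof -
  define m where "m = measure P (space P)"
  define J where "J w = (LINT x|P. X x w)" for w
  have J: "in_L2 M J" unfolding J_def by (rule msq_integral_L2[OF X])
  from msq_sampling[OF X m0] obtain C where C: "\<And>n. \<exists>xs. length xs = n \<and> set xs \<subseteq> space P \<and>
    (LINT w|M. ((\<Sum>x\<leftarrow>xs. m * X x w) - real n * J w)\<^sup>2) \<le> real n * C" unfolding m_def J_def by blast
  define xs where "xs n = (SOME xs. length xs = n \<and> set xs \<subseteq> space P \<and>
    (LINT w|M. ((\<Sum>x\<leftarrow>xs. m * X x w) - real n * J w)\<^sup>2) \<le> real n * C)" for n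
  have xs: "\<And>n. set (xs n) \<subseteq> space P" 
    and le: "\<And>n. (LINT w|M. ((\<Sum>x\<leftarrow>xs n. m * X x w) - real n * J w)\<^sup>2) \<le> real n * C" 
    using someI_ex[OF C] unfolding xs_def by (simp_all only: simp_thms)
  define Y where "Y n w = (1 / real (Suc n)) * (\<Sum>x\<leftarrow>xs (Suc n). m * X x w)" for n w
  have span': "(\<lambda>w. \<Sum>x\<leftarrow>ys. m * X x w) \<in> lin_span I T" if "set ys \<subseteq> space P" for ys
    using that
  proof (induction ys)
    case Nil
    show ?case using lin_span_sum[of "{}" _ I T] by simp
  next
    case (Cons y ys)
    then show ?case using lin_span_add[OF lin_span_scale[OF span[of y], of m]] by simp
  qed
  have Yg: "cgauss M (Y n)" for n
  proof -
    have "joint_cgauss M UNIV (\<lambda>_::unit. Y n)"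
      unfolding Y_def[abs_def] by (rule joint_cgauss_lin_span[OF T]) (intro lin_span_scale span' xs)
    then show ?thesis using joint_cgauss_single[of M UNIV "\<lambda>_::unit. Y n" "()"] by simp
  qed
  have bd: "norm (LINT w|M. (Y n w - J w)\<^sup>2) \<le> C / real (Suc n)" for n
  proof -
    have eq: "(Y n w - J w)\<^sup>2 = (1 / (real (Suc n))\<^sup>2) * ((\<Sum>x\<leftarrow>xs (Suc n). m * X x w) - real (Suc n) * J w)\<^sup>2" for w
    proof -
      have "Y n w - J w = (1 / real (Suc n)) * ((\<Sum>x\<leftarrow>xs (Suc n). m * X x w) - real (Suc n) * J w)"
        unfolding Y_def right_diff_distrib by simp
      then show ?thesis by (simp only: power_mult_distrib power_one_over)
    qed
    have "(LINT w|M. (Y n w - J w)\<^sup>2) \<le> (1 / (real (Suc n))\<^sup>2) * (real (Suc n) * C)"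
      unfolding eq integral_mult_right_zero by (rule mult_left_mono[OF le]) simp
    also have "\<dots> = C / real (Suc n)" by (simp add: power2_eq_square)
    finally show ?thesis by (simp add: Bochner_Integration.integral_nonneg)
  qed
  have lim: "(\<lambda>n. C / real (Suc n)) \<longlonglongrightarrow> 0" using tendsto_mult[OF tendsto_const[of C] LIMSEQ_inverse_real_of_nat] by (simp add: divide_inverse)
  have "cgauss M J"
  proof (rule cgauss_L2_limit[of M Y])
    show "prob_space M" by unfold_locales
    show "cgauss M (Y n)" for n by (rule Yg)
    show "J \<in> borel_measurable M" "integrable M (\<lambda>w. (J w)\<^sup>2)" using J by (auto simp: in_L2_def)
    show "(\<lambda>n. LINT w|M. (Y n w - J w)\<^sup>2) \<longlonglongrightarrow> 0"
      by (rule Lim_null_comparison[OF always_eventually[OF allI[OF bd]] lim])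
  qed
  then show ?thesis unfolding J_def .
qed

end

section \<open>Harmonic coefficients of a spherical autoregressive process\<close>

lemma cgauss_AE:
  assumes X: "cgauss M X" and [measurable]: "Y \<in> borel_measurable M" and eq: "AE w in M. X w = Y w"
  shows "cgauss M Y"
proof -
  have [measurable]: "X \<in> borel_measurable M" using X by (rule cgauss_measurable)
  have 1: "integrable M (\<lambda>w. (Y w)\<^sup>2)"
    by (rule integrable_cong_AE_imp[OF cgauss_square_integrable[OF X]]) (use eq in auto)
  have 2: "(LINT w|M. (X w)\<^sup>2) = (LINT w|M. (Y w)\<^sup>2)" by (rule integral_cong_AE) (use eq in auto)
  have 3: "(CLINT w|M. iexp (u * X w)) = (CLINT w|M. iexp (u * Y w))" for u
    by (rule integral_cong_AE) (use eq in auto)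
  show ?thesis using 1 cgauss_char[OF X] unfolding cgauss_def 2 3 by simp
qed

lemma process_law_product_moment:
  assumes eq: "process_law M I X = process_law M I X'" and ij: "i \<in> I" "j \<in> I"
    and X: "\<And>i. i \<in> I \<Longrightarrow> X i \<in> borel_measurable M" and X': "\<And>i. i \<in> I \<Longrightarrow> X' i \<in> borel_measurable M"
  shows "(LINT w|M. X i w * X j w) = (LINT w|M. X' i w * X' j w)"
proof -
  have f: "(\<lambda>f. f i * f j) \<in> borel_measurable (PiM I (\<lambda>_. borel :: real measure))" using ij by measurable
  have m: "(\<lambda>w. \<lambda>i\<in>I. X i w) \<in> measurable M (PiM I (\<lambda>_. borel))" "(\<lambda>w. \<lambda>i\<in>I. X' i w) \<in> measurable M (PiM I (\<lambda>_. borel))"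
    using X X' by (auto intro!: measurable_restrict)
  have "(LINT w|M. X i w * X j w) = (\<integral>f. f i * f j \<partial>process_law M I X)"
    unfolding process_law_def by (subst integral_distr[OF m(1) f]) (simp add: ij)
  also have "\<dots> = (LINT w|M. X' i w * X' j w)"
    unfolding eq unfolding process_law_def by (subst integral_distr[OF m(2) f]) (simp add: ij)
  finally show ?thesis .
qed

text \<open>The hypotheses of the theorem that concern the process itself.\<close>

locale sphar = prob_space M for M :: "'w measure" +
  fixes T Z :: "int \<Rightarrow> real^3 \<Rightarrow> 'w \<Rightarrow> real" and CZ :: "nat \<Rightarrow> real"
    and k :: "real \<Rightarrow> real^'p::{finite,linorder}" and \<phi> :: "nat \<Rightarrow> real^'p::{finite,linorder}" and L :: nat
  assumes sphar: "gaussian_sphar M Z CZ k \<phi> T"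
    and stationarity: "\<exists>\<delta>>0. \<forall>l. \<forall>z::complex. norm z \<le> 1 + \<delta> \<longrightarrow>
      1 - (\<Sum>j\<in>UNIV. of_real (\<phi> l $ j) * z ^ lag j) \<noteq> 0"
    and identifiability: "\<forall>l. CZ l > 0"
begin

sublocale msq M sphere_measure ..

lemma T_field: "centered_field M (T t)" and Z_field: "centered_field M (Z t)"
  using sphar by (auto simp: gaussian_sphar_def gaussian_white_noise_def)

lemma T_L2: "x \<in> S2 \<Longrightarrow> in_L2 M (T t x)" and T_mean: "x \<in> S2 \<Longrightarrow> (LINT w|M. T t x w) = 0"
  and Z_L2: "x \<in> S2 \<Longrightarrow> in_L2 M (Z t x)" and Z_mean: "x \<in> S2 \<Longrightarrow> (LINT w|M. Z t x w) = 0"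
  using T_field[of t] Z_field[of t] by (auto simp: centered_field_def)

lemma T_meas: "x \<in> S2 \<Longrightarrow> T t x \<in> borel_measurable M" and Z_meas: "x \<in> S2 \<Longrightarrow> Z t x \<in> borel_measurable M"
  using T_L2 Z_L2 by (auto simp: in_L2_def)

lemma T_cov_shift:
  assumes "x \<in> S2" "y \<in> S2"
  shows "(LINT w|M. T (s + h) x w * T (t + h) y w) = (LINT w|M. T s x w * T t y w)"
proof -
  have "rotation_matrix (mat 1 :: real^3^3)" by (simp add: rotation_matrix_def orthogonal_matrix_id)
  then have "process_law M (S2 \<times> UNIV) (\<lambda>(x, t). T (t + h) (mat 1 *v x)) = process_law M (S2 \<times> UNIV) (\<lambda>(x, t). T t x)"
    using sphar by (simp only: gaussian_sphar_def isotropic_stationary_def)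
  then have "process_law M (S2 \<times> UNIV) (\<lambda>(x, t). T (t + h) x) = process_law M (S2 \<times> UNIV) (\<lambda>(x, t). T t x)" by simp
  from process_law_product_moment[OF this, of "(x, s)" "(y, t)"] show ?thesis
    using assms T_meas by auto
qed

text \<open>Every point of the sphere is the image of any other one under a rotation.\<close>

lemma T_variance_const:
  assumes x: "x \<in> S2" and y: "y \<in> S2"
  shows "(LINT w|M. (T t x w)\<^sup>2) = (LINT w|M. (T t y w)\<^sup>2)"
proof -
  obtain f where f: "orthogonal_transformation f" "det (matrix f) = 1" "f y = x"
    using rotation_exists[of y x] x y by auto
  define R where "R = matrix f"
  have lin: "linear f" using f(1) by (rule orthogonal_transformation_linear)
  have Rf: "R *v v = f v" for v unfolding R_def using fun_cong[OF matrix_vector_mul(2)[OF lin], of v] by simp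
  have "rotation_matrix R" using f unfolding rotation_matrix_def R_def orthogonal_transformation_matrix by simp
  then have "process_law M (S2 \<times> UNIV) (\<lambda>(x, t). T (t + 0) (R *v x)) = process_law M (S2 \<times> UNIV) (\<lambda>(x, t). T t x)"
    using sphar unfolding gaussian_sphar_def isotropic_stationary_def by blast
  then have eq: "process_law M (S2 \<times> UNIV) (\<lambda>(x, t). T t (f x)) = process_law M (S2 \<times> UNIV) (\<lambda>(x, t). T t x)"
    by (simp add: Rf)
  have S: "f v \<in> S2" if "v \<in> S2" for v using that orthogonal_transformation_norm[OF f(1), of v] by simp
  have "(LINT w|M. T t (f y) w * T t (f y) w) = (LINT w|M. T t y w * T t y w)"
    using process_law_product_moment[OF eq, of "(y, t)" "(y, t)"] y T_meas S by auto
  then show ?thesis unfolding f(3) power2_eq_square .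
qed

lemma T_msq: "msq_field M sphere_measure (T t)"
proof -
  have "L2norm M (T t x) \<le> L2norm M (T t (axis 3 1))" if "x \<in> S2" for x
    using T_variance_const[OF that, of "axis 3 1" t] by (simp add: L2norm_def)
  then show ?thesis using T_field[of t] T_L2 unfolding msq_field_def centered_field_def
    by (intro conjI exI[of _ "L2norm M (T t (axis 3 1))"]) auto
qed

lemma Z_cov: "x \<in> S2 \<Longrightarrow> y \<in> S2 \<Longrightarrow> (LINT w|M. Z t x w * Z t y w) =
    (\<Sum>l. (2 * real l + 1) / (4 * pi) * CZ l * legendre l (x \<bullet> y))"
  and CZ_summable: "summable (\<lambda>l. (2 * real l + 1) / (4 * pi) * CZ l)"
  using sphar unfolding gaussian_sphar_def gaussian_white_noise_def by blast+

lemma Z_msq: "msq_field M sphere_measure (Z t)"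
proof -
  have "(LINT w|M. (Z t x w)\<^sup>2) = (\<Sum>l. (2 * real l + 1) / (4 * pi) * CZ l)" if "x \<in> S2" for x
    using Z_cov[OF that that, of t] that by (simp add: power2_eq_square legendre_at_1 norm_eq_1)
  then show ?thesis using Z_field[of t] Z_L2 unfolding msq_field_def centered_field_def
    by (intro conjI exI[of _ "sqrt (\<Sum>l. (2 * real l + 1) / (4 * pi) * CZ l)"]) (auto simp: L2norm_def)
qed

lemma Z_indep:
  assumes x: "x \<in> S2" and y: "y \<in> S2" and st: "s \<noteq> t"
  shows "(LINT w|M. Z s x w * Z t y w) = 0"
proof -
  have "indep_vars (\<lambda>_. PiM S2 (\<lambda>_. borel)) (\<lambda>t w. \<lambda>x\<in>S2. Z t x w) UNIV"
    using sphar unfolding gaussian_sphar_def gaussian_white_noise_def by blast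
  then have "indep_vars (\<lambda>_. borel) (\<lambda>i w. (\<lambda>x\<in>S2. Z i x w) (if i = s then x else y)) UNIV"
    by (rule indep_vars_compose2[where Y = "\<lambda>i f. f (if i = s then x else y)"])
      (rule measurable_component_singleton, use x y in simp)
  then have "indep_vars (\<lambda>_. borel) (\<lambda>i w. Z i (if i = s then x else y) w) UNIV"
    by (rule indep_vars_cong[THEN iffD1, rotated 3]) (use x y in auto)
  then have ind: "indep_vars (\<lambda>_. borel) (\<lambda>i w. Z i (if i = s then x else y) w) {s, t}"
    by (rule indep_vars_subset) simp
  have int: "integrable M (Z i (if i = s then x else y))" for i
  proof -
    have "(if i = s then x else y) \<in> S2" using x y by simp
    from Z_L2[OF this, of i] have "Z i (if i = s then x else y) \<in> borel_measurable M" "integrable M (\<lambda>w. (Z i (if i = s then x else y) w)\<^sup>2)"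
      unfolding in_L2_def by blast+
    then show ?thesis by (rule square_integrable_imp_integrable)
  qed
  from indep_vars_lebesgue_integral[OF finite.insertI[OF finite.insertI[OF finite.emptyI]] ind int] have "(LINT w|M. (\<Prod>i\<in>{s, t}. Z i (if i = s then x else y) w)) =
    (\<Prod>i\<in>{s, t}. LINT w|M. Z i (if i = s then x else y) w)" .
  then show ?thesis using st Z_mean[OF x] by simp
qed

lemma T_joint: "joint_cgauss M (S2 \<times> UNIV) (\<lambda>(x, t). T t x)"
  unfolding joint_cgauss_def
proof (intro allI impI)
  fix J :: "((real^3) \<times> int) set" and c assume J: "finite J \<and> J \<subseteq> S2 \<times> UNIV"
  have g: "gaussian_rv M (\<lambda>w. \<Sum>i\<in>J. c i * (case i of (x, t) \<Rightarrow> T t x) w)"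
    using sphar J unfolding gaussian_sphar_def gaussian_process_def by blast
  have m: "integrable M (case i of (x, t) \<Rightarrow> T t x)" "(LINT w|M. (case i of (x, t) \<Rightarrow> T t x) w) = 0" if "i \<in> J" for i
  proof -
    have "fst i \<in> S2" using J that by auto
    then show "integrable M (case i of (x, t) \<Rightarrow> T t x)" "(LINT w|M. (case i of (x, t) \<Rightarrow> T t x) w) = 0"
      using T_L2[of "fst i" "snd i"] T_mean[of "fst i" "snd i"]
      by (auto simp: in_L2_def case_prod_unfold intro!: square_integrable_imp_integrable)
  qed
  have "(LINT w|M. (\<Sum>i\<in>J. c i * (case i of (x, t) \<Rightarrow> T t x) w)) = 0"
    using m by (subst Bochner_Integration.integral_sum) (auto intro!: sum.neutral)
  then show "cgauss M (\<lambda>w. \<Sum>i\<in>J. c i * (case i of (x, t) \<Rightarrow> T t x) w)"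
    by (rule gaussian_rv_imp_cgauss[OF prob_space_axioms g])
qed

definition a :: "nat \<times> int \<Rightarrow> int \<Rightarrow> 'w \<Rightarrow> real" where
  "a \<alpha> t w = sph_coeff (\<lambda>x. T t x w) (fst \<alpha>) (snd \<alpha>)"

definition aZ :: "nat \<times> int \<Rightarrow> int \<Rightarrow> 'w \<Rightarrow> real" where
  "aZ \<alpha> t w = sph_coeff (\<lambda>x. Z t x w) (fst \<alpha>) (snd \<alpha>)"

definition noise :: "nat \<times> int \<Rightarrow> int \<Rightarrow> 'w \<Rightarrow> real" where
  "noise \<alpha> t w = a \<alpha> t w - (\<Sum>j\<in>UNIV. \<phi> (fst \<alpha>) $ j * a \<alpha> (t - int (lag j)) w)"

definition modes :: "(nat \<times> int) set" where
  "modes = (SIGMA l:{..L}. {-int l..int l})"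

lemma sph_harm_space_bounded: "\<exists>B. \<forall>x\<in>space sphere_measure. \<bar>c * sph_harm l m x\<bar> \<le> B"
proof -
  obtain B where "\<forall>x\<in>S2. \<bar>sph_harm l m x\<bar> \<le> B" using sph_harm_bounded by blast
  then show ?thesis by (intro exI[of _ "\<bar>c\<bar> * B"]) (auto simp: abs_mult intro!: mult_left_mono)
qed

lemma msq_harm: "msq_field M sphere_measure X \<Longrightarrow> msq_field M sphere_measure (\<lambda>x w. sph_harm l m x * X x w)"
  using sph_harm_space_bounded[of 1 l m] by (intro msq_mult) simp_all

lemma a_eq: "a \<alpha> t w = (LINT x|sphere_measure. sph_harm (fst \<alpha>) (snd \<alpha>) x * T t x w)"
  and aZ_eq: "aZ \<alpha> t w = (LINT x|sphere_measure. sph_harm (fst \<alpha>) (snd \<alpha>) x * Z t x w)"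
  by (simp_all add: a_def aZ_def sph_coeff_def mult.commute)

lemma coeff_L2: "in_L2 M (a \<alpha> t)" "in_L2 M (aZ \<alpha> t)"
  unfolding a_eq[abs_def] aZ_eq[abs_def] by (intro msq_integral_L2 msq_harm T_msq Z_msq)+

lemma a_measurable [measurable]: "a \<alpha> t \<in> borel_measurable M" and aZ_measurable [measurable]: "aZ \<alpha> t \<in> borel_measurable M"
  using coeff_L2 by (auto simp: in_L2_def)

lemma noise_measurable [measurable]: "noise \<alpha> t \<in> borel_measurable M"
  unfolding noise_def[abs_def] by measurable

lemma T_paths: "AE w in M. in_L2 sphere_measure (\<lambda>x. T t x w)"
  by (rule msq_paths(1)[OF T_msq])

text \<open>Linear combinations of coefficients are integrals over the sphere of linear combinations of values of the field,
  for almost every sample point.\<close>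

lemma a_joint: "joint_cgauss M (A \<times> UNIV) (\<lambda>(\<alpha>, t). a \<alpha> t)"
  unfolding joint_cgauss_def
proof (intro allI impI)
  fix J :: "((nat \<times> int) \<times> int) set" and c assume J: "finite J \<and> J \<subseteq> A \<times> UNIV"
  define X where "X x w = (\<Sum>i\<in>J. (c i * sph_harm (fst (fst i)) (snd (fst i)) x) * T (snd i) x w)" for x w
  have Xf: "msq_field M sphere_measure X"
    unfolding X_def[abs_def] using J by (intro msq_lincomb T_msq sph_harm_space_bounded) auto
  have g: "cgauss M (\<lambda>w. LINT x|sphere_measure. X x w)"
  proof (rule msq_integral_cgauss[OF Xf _ _ T_joint])
    show "measure sphere_measure (space sphere_measure) > 0" using measure_sphere_measure by simp
    fix x assume "x \<in> space sphere_measure"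
    then have "T t x \<in> lin_span (S2 \<times> UNIV) (\<lambda>(x, t). T t x)" for t
      using lin_span_base[of "(x, t)" "S2 \<times> UNIV" "\<lambda>(x, t). T t x"] by simp
    then show "X x \<in> lin_span (S2 \<times> UNIV) (\<lambda>(x, t). T t x)"
      unfolding X_def[abs_def] using J by (intro lin_span_sum lin_span_scale) auto
  qed
  have eq: "AE w in M. (LINT x|sphere_measure. X x w) = (\<Sum>i\<in>J. c i * (case i of (\<alpha>, t) \<Rightarrow> a \<alpha> t) w)"
  proof -
    have "AE w in M. \<forall>t. in_L2 sphere_measure (\<lambda>x. T t x w)" using T_paths by (simp add: AE_all_countable)
    then show ?thesis
    proof eventually_elim
      case (elim w)
      have "integrable sphere_measure (\<lambda>x. (c i * sph_harm (fst (fst i)) (snd (fst i)) x) * T (snd i) x w)" for i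
      proof -
        have "integrable sphere_measure (\<lambda>x. T (snd i) x w)" using elim by (intro in_L2_sphere_integrable) simp
        from integrable_mult_right[OF integrable_mult_sph_harm[OF this], of "c i" "fst (fst i)" "snd (fst i)"]
        show ?thesis by (simp add: mult_ac)
      qed
      then show ?case unfolding X_def
        by (simp add: case_prod_unfold a_eq mult.assoc)
    qed
  qed
  show "cgauss M (\<lambda>w. \<Sum>i\<in>J. c i * (case i of (\<alpha>, t) \<Rightarrow> a \<alpha> t) w)"
    by (rule cgauss_AE[OF g _ eq]) (simp add: case_prod_unfold)
qed

lemma a_cov_shift: "(LINT w|M. a \<alpha> (s + h) w * a \<alpha> (t + h) w) = (LINT w|M. a \<alpha> s w * a \<alpha> t w)"
  unfolding a_eq msq_inner[OF msq_harm[OF T_msq] msq_harm[OF T_msq]]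
proof (rule Bochner_Integration.integral_cong[OF refl], rule Bochner_Integration.integral_cong[OF refl])
  fix x y assume xy: "x \<in> space sphere_measure" "y \<in> space sphere_measure"
  have "(LINT w|M. u * T s x w * (v * T t y w)) = u * v * (LINT w|M. T s x w * T t y w)" for u v s t
    by (subst integral_mult_right_zero[symmetric]) (simp add: mult_ac)
  then show "(LINT w|M. sph_harm (fst \<alpha>) (snd \<alpha>) x * T (s + h) x w * (sph_harm (fst \<alpha>) (snd \<alpha>) y * T (t + h) y w)) =
     (LINT w|M. sph_harm (fst \<alpha>) (snd \<alpha>) x * T s x w * (sph_harm (fst \<alpha>) (snd \<alpha>) y * T t y w))"
    using T_cov_shift[of x y s h t] xy by simp
qed

text \<open>The kernel operators multiply coefficients by their eigenvalues, so the coefficient of the residual is the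
  autoregressive residual of the coefficients.\<close>

lemma noise_eq_aZ:
  assumes valid: "\<bar>snd \<alpha>\<bar> \<le> int (fst \<alpha>)"
  shows "AE w in M. noise \<alpha> t w = aZ \<alpha> t w"
proof -
  obtain l m where \<alpha>: "\<alpha> = (l, m)" by (cases \<alpha>)
  have "AE z in M \<Otimes>\<^sub>M sphere_measure. case z of (w, x) \<Rightarrow> ar_residual T k t x w - Z t x w = 0"
    using sphar unfolding gaussian_sphar_def by blast
  from AE_pair[OF this] have res: "AE w in M. AE x in sphere_measure. ar_residual T k t x w - Z t x w = 0" by simp
  have "AE w in M. \<forall>t. in_L2 sphere_measure (\<lambda>x. T t x w)" using T_paths by (simp add: AE_all_countable)
  moreover have "AE w in M. in_L2 sphere_measure (\<lambda>x. Z t x w)" by (rule msq_paths(1)[OF Z_msq])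
  ultimately show ?thesis using res
  proof eventually_elim
    case (elim w)
    have iT: "integrable sphere_measure (\<lambda>x. T s x w)" for s using elim(1) by (intro in_L2_sphere_integrable) simp
    have iZ: "integrable sphere_measure (\<lambda>x. Z t x w)" using elim(2) by (intro in_L2_sphere_integrable) simp
    have \<kappa>: "in_L2 (restrict_space lborel {-1..1}) (\<lambda>z. k z $ j)" for j
      using sphar by (simp add: gaussian_sphar_def kernel_L2_def)
    have eig: "AE x in sphere_measure. kernel_op (\<lambda>z. k z $ j) (sph_harm l m) x = \<phi> l $ j * sph_harm l m x" for j
      using sphar valid by (simp add: gaussian_sphar_def kernel_eigenvalues_def \<alpha>)
    define K where "K j = kernel_op (\<lambda>z. k z $ j) (\<lambda>y. T (t - int (lag j)) y w)" for j
    have K: "integrable sphere_measure (K j)" "sph_coeff (K j) l m = \<phi> l $ j * sph_coeff (\<lambda>y. T (t - int (lag j)) y w) l m" for j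
      unfolding K_def using kernel_op_coeff[OF \<kappa> iT eig] by auto
    note ih = integrable_mult_sph_harm[of _ l m]
    have [measurable]: "(\<lambda>x. Z t x w) \<in> borel_measurable sphere_measure" "(\<lambda>x. T t x w) \<in> borel_measurable sphere_measure"
      "\<And>j. K j \<in> borel_measurable sphere_measure" using iT iZ K(1) by auto
    have "sph_coeff (\<lambda>x. Z t x w) l m = (LINT x|sphere_measure. (T t x w - (\<Sum>j\<in>UNIV. K j x)) * sph_harm l m x)"
      unfolding sph_coeff_def
    proof (rule integral_cong_AE)
      show "AE x in sphere_measure. Z t x w * sph_harm l m x = (T t x w - (\<Sum>j\<in>UNIV. K j x)) * sph_harm l m x"
        using elim(3) by eventually_elim (simp add: ar_residual_def K_def)
    qed measurable
    also have "\<dots> = sph_coeff (\<lambda>x. T t x w) l m - (\<Sum>j\<in>UNIV. sph_coeff (K j) l m)"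
      unfolding left_diff_distrib sum_distrib_right sph_coeff_def using ih[OF iT] ih[OF K(1)] by simp
    finally show ?case by (simp add: noise_def a_def aZ_def \<alpha> K(2))
  qed
qed

text \<open>The covariance series, dominated by the summable series of its values on the diagonal, is integrated term by term.
  By the addition theorem and orthonormality only the summand of the same degree is left.\<close>

lemma Z_coeff_same_time:
  assumes valid: "\<bar>snd \<alpha>\<bar> \<le> int (fst \<alpha>)" "\<bar>snd \<beta>\<bar> \<le> int (fst \<beta>)" and x: "x \<in> S2"
  shows "(LINT y|sphere_measure. sph_harm (fst \<beta>) (snd \<beta>) y * (LINT w|M. Z t x w * Z t y w)) = CZ (fst \<beta>) * sph_harm (fst \<beta>) (snd \<beta>) x"
proof -
  obtain l m where \<beta>: "\<beta> = (l, m)" by (cases \<beta>)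
  define wt where "wt i = (2 * real i + 1) / (4 * pi) * CZ i" for i
  have wt0: "wt i \<ge> 0" for i using identifiability by (simp add: wt_def less_imp_le)
  have ws: "summable wt" using CZ_summable by (simp add: wt_def[abs_def])
  obtain B where B: "\<And>y. y \<in> S2 \<Longrightarrow> \<bar>sph_harm l m y\<bar> \<le> B" "B > 0" using sph_harm_bounded by blast
  have iY: "integrable sphere_measure (\<lambda>y. sph_harm i n y * sph_harm l m y)" for i n
    by (intro integrable_mult_sph_harm sphere_integrable_continuous continuous_on_sph_harm)
  have expand: "sph_harm l m y * (wt i * legendre i (x \<bullet> y)) = (\<Sum>n=-int i..int i. (CZ i * sph_harm i n x) * (sph_harm i n y * sph_harm l m y))"
    if y: "y \<in> S2" for i y
  proof -
    have "wt i * legendre i (x \<bullet> y) = CZ i * (\<Sum>n=-int i..int i. sph_harm i n x * sph_harm i n y)"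
      unfolding addition_theorem[OF x y] wt_def by simp
    then show ?thesis by (simp add: sum_distrib_left mult_ac)
  qed
  define f where "f i y = sph_harm l m y * (wt i * legendre i (x \<bullet> y))" for i y
  have fi: "integrable sphere_measure (f i)" for i
  proof -
    have "integrable sphere_measure (\<lambda>y. \<Sum>n=-int i..int i. (CZ i * sph_harm i n x) * (sph_harm i n y * sph_harm l m y))"
      by (intro Bochner_Integration.integrable_sum integrable_mult_right iY)
    then show ?thesis unfolding f_def[abs_def]
      by (subst Bochner_Integration.integrable_cong[OF refl]) (rule expand, simp)
  qed
  have fI: "(LINT y|sphere_measure. f i y) = (if i = l then CZ l * sph_harm l m x else 0)" for i
  proof -
    have "(LINT y|sphere_measure. f i y) = (LINT y|sphere_measure. (\<Sum>n=-int i..int i. (CZ i * sph_harm i n x) * (sph_harm i n y * sph_harm l m y)))"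
      unfolding f_def by (rule Bochner_Integration.integral_cong[OF refl]) (rule expand, simp)
    also have "\<dots> = (\<Sum>n=-int i..int i. (CZ i * sph_harm i n x) * (LINT y|sphere_measure. sph_harm i n y * sph_harm l m y))"
      using iY by simp
    also have "\<dots> = (\<Sum>n=-int i..int i. if n = m then (if i = l then CZ l * sph_harm l m x else 0) else 0)"
      using valid(2) by (intro sum.cong refl) (auto simp: sph_harm_orthonormal \<beta>)
    also have "\<dots> = (if i = l then CZ l * sph_harm l m x else 0)" using valid(2) by (auto simp: \<beta>)
    finally show ?thesis .
  qed
  have bd: "\<bar>f i y\<bar> \<le> B * wt i" if y: "y \<in> S2" for i y
  proof -
    have "\<bar>f i y\<bar> = \<bar>sph_harm l m y\<bar> * (wt i * \<bar>legendre i (x \<bullet> y)\<bar>)" by (simp add: f_def abs_mult wt0)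
    also have "\<dots> \<le> B * (wt i * 1)"
      using B y wt0[of i] legendre_abs_le_1[OF x y, of i] by (intro mult_mono mult_left_mono) auto
    finally show ?thesis by simp
  qed
  have s1: "summable (\<lambda>i. norm (f i y))" if "y \<in> S2" for y
    using bd[OF that] by (intro summable_comparison_test'[OF summable_mult[OF ws, of B]]) auto
  have s2: "summable (\<lambda>i. LINT y|sphere_measure. norm (f i y))"
  proof (rule summable_comparison_test'[OF summable_mult[OF ws, of "B * measure sphere_measure (space sphere_measure)"]])
    fix i assume "(0::nat) \<le> i"
    have "(LINT y|sphere_measure. norm (f i y)) \<le> (LINT y|sphere_measure. B * wt i)"
      using fi bd by (intro integral_mono) auto
    then show "norm (LINT y|sphere_measure. norm (f i y)) \<le> B * measure sphere_measure (space sphere_measure) * wt i"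
      by (simp add: Bochner_Integration.integral_nonneg mult_ac)
  qed
  have "(LINT y|sphere_measure. sph_harm l m y * (LINT w|M. Z t x w * Z t y w)) = (LINT y|sphere_measure. (\<Sum>i. f i y))"
  proof (rule Bochner_Integration.integral_cong[OF refl])
    fix y assume "y \<in> space sphere_measure"
    then have y: "y \<in> S2" by simp
    have "summable (\<lambda>i. wt i * legendre i (x \<bullet> y))"
    proof (rule summable_comparison_test'[OF ws])
      fix i show "norm (wt i * legendre i (x \<bullet> y)) \<le> wt i"
        using mult_left_mono[OF legendre_abs_le_1[OF x y, of i] wt0[of i]] by (simp add: abs_mult wt0)
    qed
    from suminf_mult[OF this, of "sph_harm l m y"]
    show "sph_harm l m y * (LINT w|M. Z t x w * Z t y w) = (\<Sum>i. f i y)" by (simp add: Z_cov[OF x y] f_def wt_def)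
  qed
  also have "\<dots> = (\<Sum>i. LINT y|sphere_measure. f i y)"
    by (rule integral_suminf[OF fi]) (use s1 s2 in auto)
  also have "\<dots> = CZ l * sph_harm l m x" unfolding fI by (subst suminf_finite[of "{l}"]) auto
  finally show ?thesis by (simp add: \<beta>)
qed

lemma aZ_cov:
  assumes valid: "\<bar>snd \<alpha>\<bar> \<le> int (fst \<alpha>)" "\<bar>snd \<beta>\<bar> \<le> int (fst \<beta>)"
  shows "(LINT w|M. aZ \<alpha> s w * aZ \<beta> t w) = (if \<alpha> = \<beta> \<and> s = t then CZ (fst \<alpha>) else 0)"
proof -
  have pull: "(LINT w|M. u * Z s x w * (v * Z t y w)) = u * (v * (LINT w|M. Z s x w * Z t y w))" for u v x y
    unfolding integral_mult_right_zero[symmetric] by (simp add: mult_ac)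
  have eq: "(LINT w|M. aZ \<alpha> s w * aZ \<beta> t w) = (LINT x|sphere_measure. sph_harm (fst \<alpha>) (snd \<alpha>) x *
    (LINT y|sphere_measure. sph_harm (fst \<beta>) (snd \<beta>) y * (LINT w|M. Z s x w * Z t y w)))"
    unfolding aZ_eq msq_inner[OF msq_harm[OF Z_msq] msq_harm[OF Z_msq]] pull integral_mult_right_zero ..
  show ?thesis
  proof (cases "s = t")
    case True
    have "(LINT w|M. aZ \<alpha> s w * aZ \<beta> t w) = (LINT x|sphere_measure. CZ (fst \<beta>) * (sph_harm (fst \<alpha>) (snd \<alpha>) x * sph_harm (fst \<beta>) (snd \<beta>) x))"
      unfolding eq unfolding True
      by (rule Bochner_Integration.integral_cong[OF refl]) (simp add: Z_coeff_same_time[OF valid])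
    then show ?thesis using valid by (cases \<alpha>; cases \<beta>) (auto simp: sph_harm_orthonormal True)
  next
    case False
    have "(LINT w|M. aZ \<alpha> s w * aZ \<beta> t w) = (LINT x|sphere_measure. 0)"
      unfolding eq
    proof (rule Bochner_Integration.integral_cong[OF refl])
      fix x assume x: "x \<in> space sphere_measure"
      have "(LINT y|sphere_measure. sph_harm (fst \<beta>) (snd \<beta>) y * (LINT w|M. Z s x w * Z t y w)) = (LINT y|sphere_measure. 0)"
        using x by (intro Bochner_Integration.integral_cong[OF refl]) (simp add: Z_indep[OF _ _ False])
      then show "sph_harm (fst \<alpha>) (snd \<alpha>) x * (LINT y|sphere_measure. sph_harm (fst \<beta>) (snd \<beta>) y * (LINT w|M. Z s x w * Z t y w)) = 0" by simp
    qed
    then show ?thesis using False by simp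
  qed
qed

lemma modes_valid: "\<alpha> \<in> modes \<Longrightarrow> \<bar>snd \<alpha>\<bar> \<le> int (fst \<alpha>)"
  by (auto simp: modes_def)

lemma finite_modes: "finite modes" unfolding modes_def by simp

text \<open>Truncation to the degrees \<open>l \<le> L\<close> makes the set of modes finite; all modes of one degree share the
  coefficients \<open>\<phi> l\<close> and the noise variance \<open>CZ l\<close>.\<close>

sublocale ar: gaussian_ar M modes a noise "\<lambda>\<alpha> j. \<phi> (fst \<alpha>) $ j" "\<lambda>\<alpha>. CZ (fst \<alpha>)"
proof
  show "finite modes" by (rule finite_modes)
  show "joint_cgauss M (modes \<times> UNIV) (\<lambda>(\<alpha>, t). a \<alpha> t)" by (rule a_joint)
  show "noise = (\<lambda>\<alpha> t w. a \<alpha> t w - (\<Sum>j\<in>UNIV. \<phi> (fst \<alpha>) $ j * a \<alpha> (t - int (lag j)) w))"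
    unfolding noise_def[abs_def] ..
  show "0 < CZ (fst \<alpha>)" for \<alpha> :: "nat \<times> int" using identifiability by blast
  show "(LINT w|M. a \<alpha> (s + h) w * a \<alpha> (t + h) w) = (LINT w|M. a \<alpha> s w * a \<alpha> t w)" for \<alpha> s t h by (rule a_cov_shift)
  show "(\<lambda>n. ar_psi (\<lambda>j. \<phi> (fst \<alpha>) $ j) (int n)) \<longlonglongrightarrow> 0" for \<alpha> :: "nat \<times> int"
  proof -
    obtain \<delta> where "\<delta> > 0" "\<forall>l. \<forall>z::complex. norm z \<le> 1 + \<delta> \<longrightarrow> 1 - (\<Sum>j\<in>UNIV. of_real (\<phi> l $ j) * z ^ lag j) \<noteq> 0"
      using stationarity by blast
    then show ?thesis by (intro ar_psi_tendsto_0[of \<delta>]) auto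
  qed
  fix \<alpha> \<beta> s t assume "\<alpha> \<in> modes" "\<beta> \<in> modes"
  then have v: "\<bar>snd \<alpha>\<bar> \<le> int (fst \<alpha>)" "\<bar>snd \<beta>\<bar> \<le> int (fst \<beta>)" by (auto dest: modes_valid)
  have "(LINT w|M. noise \<alpha> s w * noise \<beta> t w) = (LINT w|M. aZ \<alpha> s w * aZ \<beta> t w)"
  proof (rule integral_cong_AE)
    show "AE w in M. noise \<alpha> s w * noise \<beta> t w = aZ \<alpha> s w * aZ \<beta> t w"
      using noise_eq_aZ[OF v(1), of s] noise_eq_aZ[OF v(2), of t] by eventually_elim simp
  qed measurable
  then show "(LINT w|M. noise \<alpha> s w * noise \<beta> t w) = (if \<alpha> = \<beta> \<and> s = t then CZ (fst \<alpha>) else 0)"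
    using aZ_cov[OF v] by simp
qed

end

section \<open>Random linear equations with convergent coefficients\<close>

lemma box_uniform_continuity:
  fixes G :: "('i::countable \<Rightarrow> real) \<Rightarrow> real"
  assumes G: "continuous_on UNIV G" and \<epsilon>: "\<epsilon> > 0"
  obtains \<rho> where "\<rho> > 0" "\<And>x y :: 'i \<Rightarrow> real. (\<And>i. \<bar>x i\<bar> \<le> R) \<Longrightarrow> (\<And>i. \<bar>y i\<bar> \<le> R) \<Longrightarrow> (\<And>i. \<bar>x i - y i\<bar> \<le> \<rho>) \<Longrightarrow> \<bar>G x - G y\<bar> \<le> \<epsilon>"
proof -
  define S where "S = {x :: 'i \<Rightarrow> real. \<forall>i. x i \<in> {- R..R}}"
  have "compact S" unfolding S_def by (rule compact_product) simp
  then have "uniformly_continuous_on S G" using continuous_on_subset[OF G subset_UNIV] by (intro compact_uniformly_continuous)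
  then obtain d where d: "d > 0" "\<And>x y. x \<in> S \<Longrightarrow> y \<in> S \<Longrightarrow> dist x y < d \<Longrightarrow> dist (G x) (G y) < \<epsilon>"
    using \<epsilon> unfolding uniformly_continuous_on_def by (metis dist_commute)
  have dist_le: "dist x y \<le> 2 * \<rho>" if "\<And>i. \<bar>x i - y i\<bar> \<le> \<rho>" for x y :: "'i \<Rightarrow> real" and \<rho>
  proof -
    have s: "summable (\<lambda>n. (1/2)^n * min (dist (x (from_nat n)) (y (from_nat n))) (1::real))"
      by (rule summable_comparison_test'[of "\<lambda>n. (1/2)^n"]) (auto simp: summable_geometric mult_left_le abs_mult)
    have "dist x y \<le> (\<Sum>n. (1/2)^n * \<rho>)" unfolding dist_fun_def
    proof (rule suminf_le[OF _ s])
      show "(1/2)^n * min (dist (x (from_nat n)) (y (from_nat n))) (1::real) \<le> (1/2)^n * \<rho>" for n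
        using that[of "from_nat n"] by (intro mult_left_mono) (auto simp: dist_real_def)
      show "summable (\<lambda>n. (1/2)^n * \<rho>)" by (intro summable_mult2 summable_geometric) simp
    qed
    also have "\<dots> = 2 * \<rho>" using suminf_mult2[of "\<lambda>n. (1/2::real)^n" \<rho>] by (simp add: suminf_geometric summable_geometric)
    finally show ?thesis .
  qed
  show thesis
  proof (rule that[of "d / 4"])
    show "d / 4 > 0" using d by simp
    fix x y :: "'i \<Rightarrow> real" assume xy: "\<And>i. \<bar>x i\<bar> \<le> R" "\<And>i. \<bar>y i\<bar> \<le> R" "\<And>i. \<bar>x i - y i\<bar> \<le> d / 4"
    have "x \<in> S" "y \<in> S" using xy by (auto simp: S_def abs_le_iff minus_le_iff)
    moreover have "dist x y < d" using dist_le[of x y "d / 4"] xy(3) d(1) by simp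
    ultimately show "\<bar>G x - G y\<bar> \<le> \<epsilon>" using d(2) by (force simp: dist_real_def less_imp_le)
  qed
qed

text \<open>Slutsky's argument. The comparison of \<open>f N\<close> with \<open>G\<close> is available where \<open>U N\<close> is bounded and
  \<open>D N\<close> is small. The first event has probability close to one uniformly in \<open>N\<close>, since \<open>U N\<close> converges
  weakly, the second one by Markov's inequality.\<close>

lemma weak_conv_perturbation:
  fixes U :: "nat \<Rightarrow> 'i::countable \<Rightarrow> 'w \<Rightarrow> real" and U' :: "'i \<Rightarrow> 'w \<Rightarrow> real"
    and G :: "('i \<Rightarrow> real) \<Rightarrow> real" and f D :: "nat \<Rightarrow> 'w \<Rightarrow> real" and B :: real
  assumes M: "prob_space M" and I: "finite I"
    and U: "\<And>N i. i \<in> I \<Longrightarrow> U N i \<in> borel_measurable M"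
    and U': "\<And>i. i \<in> I \<Longrightarrow> integrable M (U' i)"
    and conv: "\<And>b c. (\<lambda>N. LINT w|M. cos (b + (\<Sum>i\<in>I. c i * U N i w))) \<longlonglongrightarrow> (LINT w|M. cos (b + (\<Sum>i\<in>I. c i * U' i w)))"
    and G: "continuous_on UNIV G" and GB: "\<And>x. \<bar>G x\<bar> \<le> B"
    and f: "\<And>N. N \<ge> N0 \<Longrightarrow> f N \<in> borel_measurable M" and fB: "\<And>N. N \<ge> N0 \<Longrightarrow> AE w in M. \<bar>f N w\<bar> \<le> B"
    and D: "\<And>N. integrable M (D N)" and D0: "(\<lambda>N. LINT w|M. \<bar>D N w\<bar>) \<longlonglongrightarrow> 0"
    and close: "\<And>K \<epsilon> :: real. \<epsilon> > 0 \<Longrightarrow> \<exists>\<eta>>0. \<forall>N\<ge>N0. AE w in M. (\<Sum>i\<in>I. \<bar>U N i w\<bar>) \<le> K \<longrightarrow> \<bar>D N w\<bar> \<le> \<eta> \<longrightarrow>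
       \<bar>f N w - G (\<lambda>i. if i \<in> I then U N i w else 0)\<bar> \<le> \<epsilon>"
  shows "(\<lambda>N. LINT w|M. f N w) \<longlonglongrightarrow> (LINT w|M. G (\<lambda>i. if i \<in> I then U' i w else 0))"
proof (rule LIMSEQ_I)
  interpret prob_space M by fact
  fix r :: real assume r: "r > 0"
  have B0: "B \<ge> 0" using GB[of undefined] abs_ge_zero order_trans by blast
  have U'm: "U' i \<in> borel_measurable M" if "i \<in> I" for i using U'[OF that] by auto
  have levy: "(\<lambda>N. LINT w|M. h (\<lambda>i. if i \<in> I then U N i w else 0)) \<longlonglongrightarrow> (LINT w|M. h (\<lambda>i. if i \<in> I then U' i w else 0))"
    if "continuous_on UNIV h" "\<And>x. \<bar>h x\<bar> \<le> b" for h :: "('i \<Rightarrow> real) \<Rightarrow> real" and b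
    by (rule multivariate_levy_continuity[OF M M I _ _ conv that]) (erule U, erule U')
  define S where "S = (\<Sum>i\<in>I. LINT w|M. \<bar>U' i w\<bar>)"
  have S0: "S \<ge> 0" unfolding S_def by (intro sum_nonneg Bochner_Integration.integral_nonneg) simp
  \<comment> \<open>For large \<open>N\<close> the two exceptional events have probability at most \<open>q\<close>, and each contributes at most
    \<open>2 B q \<le> r / 8\<close>.\<close>
  define q where "q = r / (16 * (B + 1))"
  have q0: "q > 0" using r B0 by (simp add: q_def)
  define K where "K = (S + 1) / q"
  have K0: "K > 0" using S0 q0 by (simp add: K_def)
  define g :: "('i \<Rightarrow> real) \<Rightarrow> real" where "g u = min 1 ((\<Sum>i\<in>I. \<bar>u i\<bar>) / K)" for u
  have g0: "0 \<le> g u" "g u \<le> 1" for u using K0 by (auto simp: g_def intro!: divide_nonneg_pos sum_nonneg)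
  have gc: "continuous_on UNIV g" unfolding g_def[abs_def] using K0
    by (intro continuous_intros) auto
  define Uv where "Uv N w i = (if i \<in> I then U N i w else 0)" for N w i
  define Uv' where "Uv' w i = (if i \<in> I then U' i w else 0)" for w i
  have Uvm: "Uv N \<in> borel_measurable M" for N
  proof (rule measurable_coordinatewise_then_product)
    show "(\<lambda>w. Uv N w i) \<in> borel_measurable M" for i by (cases "i \<in> I") (simp_all add: Uv_def U)
  qed
  have Uvm': "Uv' \<in> borel_measurable M"
  proof (rule measurable_coordinatewise_then_product)
    show "(\<lambda>w. Uv' w i) \<in> borel_measurable M" for i by (cases "i \<in> I") (simp_all add: Uv'_def U'm)
  qed
  have gm: "(\<lambda>w. g (Uv N w)) \<in> borel_measurable M" "(\<lambda>w. g (Uv' w)) \<in> borel_measurable M" "(\<lambda>w. G (Uv N w)) \<in> borel_measurable M" for N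
    using measurable_compose[OF Uvm borel_measurable_continuous_onI[OF gc]] measurable_compose[OF Uvm' borel_measurable_continuous_onI[OF gc]]
      measurable_compose[OF Uvm borel_measurable_continuous_onI[OF G]] by auto
  have ig3: "integrable M (\<lambda>w. G (Uv N w))" for N by (rule integrable_const_bound[of _ B]) (simp_all add: GB gm)
  have ig: "integrable M (\<lambda>w. g (Uv N w))" "integrable M (\<lambda>w. g (Uv' w))" "integrable M (\<lambda>w. G (Uv N w))" for N
    using g0 by (auto intro!: AE_I2 integrable_const_bound[where B = 1] gm(1,2) ig3)
  have lg: "(\<lambda>N. LINT w|M. g (Uv N w)) \<longlonglongrightarrow> (LINT w|M. g (Uv' w))"
    unfolding Uv_def Uv'_def by (rule levy[OF gc, of 1]) (simp add: g0)
  have lG: "(\<lambda>N. LINT w|M. G (Uv N w)) \<longlonglongrightarrow> (LINT w|M. G (Uv' w))"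
    unfolding Uv_def Uv'_def by (rule levy[OF G GB])
  have "(LINT w|M. g (Uv' w)) \<le> (LINT w|M. (\<Sum>i\<in>I. \<bar>U' i w\<bar>) / K)"
  proof (rule integral_mono[OF ig(2)])
    show "integrable M (\<lambda>w. (\<Sum>i\<in>I. \<bar>U' i w\<bar>) / K)" using U' by auto
    show "g (Uv' w) \<le> (\<Sum>i\<in>I. \<bar>U' i w\<bar>) / K" for w by (simp add: g_def Uv'_def)
  qed
  also have "\<dots> = S / K" using U' by (simp add: S_def)
  also have "\<dots> < q" using S0 q0 by (simp add: K_def divide_simps mult.commute) 
  finally have gq: "(LINT w|M. g (Uv' w)) < q" .
  have "r / 4 > 0" using r by simp
  from close[OF this, of K] obtain \<eta> where \<eta>: "\<eta> > 0" and cl: "\<And>N. N \<ge> N0 \<Longrightarrow> AE w in M. (\<Sum>i\<in>I. \<bar>U N i w\<bar>) \<le> K \<longrightarrow> \<bar>D N w\<bar> \<le> \<eta> \<longrightarrow>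
       \<bar>f N w - G (Uv N w)\<bar> \<le> r / 4" unfolding Uv_def by blast
  have e1: "\<forall>\<^sub>F N in sequentially. (LINT w|M. g (Uv N w)) < q" using lg gq by (rule order_tendstoD)
  have e2: "\<forall>\<^sub>F N in sequentially. (LINT w|M. \<bar>D N w\<bar>) < \<eta> * q" using \<eta> q0 by (intro order_tendstoD(2)[OF D0]) simp
  have e3: "\<forall>\<^sub>F N in sequentially. dist (LINT w|M. G (Uv N w)) (LINT w|M. G (Uv' w)) < r / 4" using r by (intro tendstoD[OF lG]) simp
  have "\<forall>\<^sub>F N in sequentially. norm ((LINT w|M. f N w) - (LINT w|M. G (Uv' w))) < r"
    using e1 e2 e3 eventually_ge_at_top[of N0]
  proof eventually_elim
    case (elim N)
    have iff: "integrable M (f N)" using fB[OF elim(4)] by (intro integrable_const_bound[of _ B]) (auto intro: f[OF elim(4)])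
    have "AE w in M. norm (f N w - G (Uv N w)) \<le> r / 4 + 2 * B * g (Uv N w) + 2 * B / \<eta> * \<bar>D N w\<bar>"
      using cl[OF elim(4)] fB[OF elim(4)]
    proof eventually_elim
      case (elim w)
      have tr: "\<bar>f N w - G (Uv N w)\<bar> \<le> 2 * B" using elim(2) GB[of "Uv N w"] by linarith
      have p1: "0 \<le> 2 * B * g (Uv N w)" using B0 g0(1) by simp
      have p2: "0 \<le> 2 * B / \<eta> * \<bar>D N w\<bar>" using B0 \<eta> by simp
      consider "(\<Sum>i\<in>I. \<bar>U N i w\<bar>) \<le> K" "\<bar>D N w\<bar> \<le> \<eta>" | "(\<Sum>i\<in>I. \<bar>U N i w\<bar>) > K" | "\<bar>D N w\<bar> > \<eta>" by linarith
      then show ?case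
      proof cases
        case 1
        then have "\<bar>f N w - G (Uv N w)\<bar> \<le> r / 4" using elim(1) by blast
        then show ?thesis using p1 p2 unfolding real_norm_def by linarith
      next
        case 2
        have "(\<Sum>i\<in>I. \<bar>Uv N w i\<bar>) = (\<Sum>i\<in>I. \<bar>U N i w\<bar>)" by (simp add: Uv_def)
        then have "g (Uv N w) = 1" using 2 K0 by (simp add: g_def)
        then show ?thesis using tr p2 r unfolding real_norm_def by simp
      next
        case 3
        have "2 * B = 2 * B / \<eta> * \<eta>" using \<eta> by simp
        also have "\<dots> \<le> 2 * B / \<eta> * \<bar>D N w\<bar>" using 3 B0 \<eta> by (intro mult_left_mono) auto
        finally show ?thesis using tr p1 r unfolding real_norm_def by linarith
      qed
    qed
    then have "(LINT w|M. norm (f N w - G (Uv N w))) \<le> (LINT w|M. r / 4 + 2 * B * g (Uv N w) + 2 * B / \<eta> * \<bar>D N w\<bar>)"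
      using iff ig D by (intro integral_mono_AE) auto
    also have "\<dots> = r / 4 + 2 * B * (LINT w|M. g (Uv N w)) + 2 * B / \<eta> * (LINT w|M. \<bar>D N w\<bar>)"
      using ig D by (simp add: prob_space)
    also have "\<dots> \<le> r / 4 + 2 * B * q + 2 * B / \<eta> * (\<eta> * q)"
      using less_imp_le[OF elim(1)] less_imp_le[OF elim(2)] B0 \<eta> by (intro add_mono mult_left_mono order_refl) auto
    also have "\<dots> = r / 4 + 4 * (B * q)" using \<eta> by simp
    also have "\<dots> \<le> r / 4 + r / 4"
    proof -
      have "B * q \<le> (B + 1) * q" using q0 by simp
      also have "\<dots> = r / 16" using B0 unfolding q_def by (simp add: divide_simps)
      finally show ?thesis by simp
    qed
    finally have 1: "(LINT w|M. norm (f N w - G (Uv N w))) \<le> r / 2" by simp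
    have "norm ((LINT w|M. f N w) - (LINT w|M. G (Uv N w))) \<le> (LINT w|M. norm (f N w - G (Uv N w)))"
      using integral_norm_bound[of M "\<lambda>w. f N w - G (Uv N w)"] iff ig(3) by simp
    then show ?case using 1 elim(3) r unfolding dist_real_def real_norm_def by linarith
  qed
  then show "\<exists>no. \<forall>N\<ge>no. norm ((LINT w|M. f N w) - (LINT w|M. G (\<lambda>i. if i \<in> I then U' i w else 0))) < r"
    unfolding eventually_sequentially Uv'_def .
qed

lemma norm_matrix_vector_le:
  fixes A :: "real^'n^'m"
  shows "norm (A *v x) \<le> (\<Sum>i\<in>UNIV. \<Sum>j\<in>UNIV. \<bar>A $ i $ j\<bar>) * norm x"
proof -
  have "norm (A *v x) \<le> (\<Sum>i\<in>UNIV. \<bar>(A *v x) $ i\<bar>)" by (rule norm_le_l1_cart)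
  also have "\<dots> \<le> (\<Sum>i\<in>UNIV. \<Sum>j\<in>UNIV. \<bar>A $ i $ j\<bar> * norm x)"
  proof (rule sum_mono)
    fix i
    have "\<bar>(A *v x) $ i\<bar> \<le> (\<Sum>j\<in>UNIV. \<bar>A $ i $ j * x $ j\<bar>)"
      unfolding matrix_vector_mult_def by simp
    also have "\<dots> \<le> (\<Sum>j\<in>UNIV. \<bar>A $ i $ j\<bar> * norm x)"
      by (intro sum_mono) (auto simp: abs_mult intro!: mult_left_mono component_le_norm_cart)
    finally show "\<bar>(A *v x) $ i\<bar> \<le> (\<Sum>j\<in>UNIV. \<bar>A $ i $ j\<bar> * norm x)" .
  qed
  finally show ?thesis by (simp add: sum_distrib_right)
qed

text \<open>Here \<open>v - B u = - B (A' - A) v\<close>, and by \<open>b d \<le> 1 / 2\<close> at most half of the norm of \<open>v\<close>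
  comes from this difference.\<close>

lemma linear_solve_perturbation:
  fixes A A' B :: "real^'n^'n"
  assumes BA: "B ** A = mat 1" and eq: "A' *v v = u"
    and b: "(\<Sum>i\<in>UNIV. \<Sum>j\<in>UNIV. \<bar>B $ i $ j\<bar>) \<le> b" and d: "(\<Sum>i\<in>UNIV. \<Sum>j\<in>UNIV. \<bar>(A' - A) $ i $ j\<bar>) \<le> d" and bd: "b * d \<le> 1 / 2"
  shows "norm v \<le> 2 * b * norm u" and "norm (v - B *v u) \<le> b * d * (2 * b * norm u)"
proof -
  have b0: "b \<ge> 0" by (rule order_trans[OF _ b]) (intro sum_nonneg abs_ge_zero)
  have d0: "d \<ge> 0" by (rule order_trans[OF _ d]) (intro sum_nonneg abs_ge_zero)
  have bn: "norm (B *v w) \<le> b * norm w" for w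
    by (rule order_trans[OF norm_matrix_vector_le mult_right_mono[OF b norm_ge_zero]])
  have "B *v u = B *v (A *v v + (A' - A) *v v)" by (simp add: eq[symmetric] matrix_vector_mult_diff_rdistrib)
  also have "\<dots> = v + B *v ((A' - A) *v v)"
    by (simp add: matrix_vector_right_distrib matrix_vector_mul_assoc BA)
  finally have e: "v - B *v u = - (B *v ((A' - A) *v v))" by simp
  have "norm (v - B *v u) \<le> b * norm ((A' - A) *v v)" unfolding e norm_minus_cancel by (rule bn)
  also have "\<dots> \<le> b * (d * norm v)"
    by (intro mult_left_mono[OF _ b0] order_trans[OF norm_matrix_vector_le mult_right_mono[OF d norm_ge_zero]])
  finally have 1: "norm (v - B *v u) \<le> b * d * norm v" by (simp add: mult.assoc)
  have "norm v \<le> norm (v - B *v u) + norm (B *v u)" using norm_triangle_ineq[of "v - B *v u" "B *v u"] by simp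
  also have "\<dots> \<le> 1 / 2 * norm v + b * norm u" using 1 mult_right_mono[OF bd norm_ge_zero[of v]] bn[of u] by linarith
  finally show 2: "norm v \<le> 2 * b * norm u" by simp
  show "norm (v - B *v u) \<le> b * d * (2 * b * norm u)"
    by (rule order_trans[OF 1 mult_left_mono[OF 2]]) (use b0 d0 in simp)
qed

text \<open>A family of vectors as a function on one countable index type, the format of the multivariate continuity theorem.
  Coordinates of degree above \<open>L\<close> get the value zero.\<close>

definition block_vec :: "nat \<Rightarrow> (nat \<Rightarrow> real^'p) \<Rightarrow> nat \<times> 'p \<Rightarrow> real" where
  "block_vec L v i = (if fst i \<le> L then v (fst i) $ snd i else 0)"

text \<open>Solutions of \<open>A' N l v = U N l\<close> behave like \<open>B l U N l\<close> when the matrices tend to \<open>A l\<close>. The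
  solutions enter pointwise, through the random variable \<open>f N\<close>.\<close>

lemma linear_equations_weak_limit:
  fixes U :: "nat \<Rightarrow> nat \<times> 'p::finite \<Rightarrow> 'w \<Rightarrow> real" and A B :: "nat \<Rightarrow> real^'p^'p" and A' :: "nat \<Rightarrow> nat \<Rightarrow> 'w \<Rightarrow> real^'p^'p"
    and U' :: "nat \<times> 'p \<Rightarrow> 'w \<Rightarrow> real" and G :: "(nat \<times> 'p \<Rightarrow> real) \<Rightarrow> real" and f :: "nat \<Rightarrow> 'w \<Rightarrow> real" and b :: real
  assumes M: "prob_space M"
    and U: "\<And>N i. U N i \<in> borel_measurable M"
    and U': "\<And>i. integrable M (U' i)"
    and conv: "\<And>d c. (\<lambda>N. LINT w|M. cos (d + (\<Sum>i\<in>{..L} \<times> UNIV. c i * U N i w))) \<longlonglongrightarrow> (LINT w|M. cos (d + (\<Sum>i\<in>{..L} \<times> UNIV. c i * U' i w)))"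
    and BA: "\<And>l. l \<le> L \<Longrightarrow> B l ** A l = mat 1"
    and A': "\<And>N l i j. l \<le> L \<Longrightarrow> integrable M (\<lambda>w. A' N l w $ i $ j)"
    and A'lim: "\<And>l i j. l \<le> L \<Longrightarrow> (\<lambda>N. LINT w|M. \<bar>A' N l w $ i $ j - A l $ i $ j\<bar>) \<longlonglongrightarrow> 0"
    and G: "continuous_on UNIV G" and GB: "\<And>x. \<bar>G x\<bar> \<le> b"
    and f: "\<And>N. N \<ge> N0 \<Longrightarrow> f N \<in> borel_measurable M"
    and sol: "\<And>N. N \<ge> N0 \<Longrightarrow> AE w in M. \<exists>v. (\<forall>l\<le>L. A' N l w *v v l = (\<chi> j. U N (l, j) w)) \<and> f N w = G (block_vec L v)"
  shows "(\<lambda>N. LINT w|M. f N w) \<longlonglongrightarrow> (LINT w|M. G (block_vec L (\<lambda>l. B l *v (\<chi> j. U' (l, j) w))))"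
proof -
  interpret prob_space M by fact
  define I :: "(nat \<times> 'p) set" where "I = {..L} \<times> UNIV"
  define H :: "(nat \<times> 'p \<Rightarrow> real) \<Rightarrow> nat \<times> 'p \<Rightarrow> real" where "H u = block_vec L (\<lambda>l. B l *v (\<chi> j. u (l, j)))" for u
  have Hc: "continuous_on UNIV H"
  proof (rule continuous_on_coordinatewise_then_product)
    fix i :: "nat \<times> 'p"
    have eq: "(\<lambda>u. H u i) = (\<lambda>u. if fst i \<le> L then \<Sum>j\<in>UNIV. B (fst i) $ snd i $ j * u (fst i, j) else 0)"
      by (auto simp: H_def block_vec_def matrix_vector_mult_def fun_eq_iff)
    show "continuous_on UNIV (\<lambda>u. H u i)" unfolding eq by (cases "fst i \<le> L") (auto intro!: continuous_intros)
  qed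
  have H_cong: "H (\<lambda>i. if i \<in> I then u i else 0) = H u" for u
    by (auto simp: H_def block_vec_def I_def fun_eq_iff matrix_vector_mult_def)
  define D where "D N w = (\<Sum>l\<le>L. \<Sum>i\<in>UNIV. \<Sum>j\<in>UNIV. \<bar>A' N l w $ i $ j - A l $ i $ j\<bar>)" for N w
  have D_nn: "D N w \<ge> 0" for N w unfolding D_def by (intro sum_nonneg abs_ge_zero)
  have iA: "integrable M (\<lambda>w. \<bar>A' N l w $ i $ j - A l $ i $ j\<bar>)" if "l \<le> L" for N l i j
    using A'[OF that] by auto
  have iD: "integrable M (D N)" for N unfolding D_def[abs_def] by (intro Bochner_Integration.integrable_sum iA) simp
  have "(\<lambda>N. \<Sum>l\<le>L. \<Sum>i\<in>UNIV. \<Sum>j\<in>UNIV. LINT w|M. \<bar>A' N l w $ i $ j - A l $ i $ j\<bar>) \<longlonglongrightarrow> (\<Sum>l\<le>L. \<Sum>i\<in>(UNIV::'p set). \<Sum>j\<in>(UNIV::'p set). 0)"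
    by (intro tendsto_sum A'lim) simp
  moreover have "(LINT w|M. \<bar>D N w\<bar>) = (\<Sum>l\<le>L. \<Sum>i\<in>UNIV. \<Sum>j\<in>UNIV. LINT w|M. \<bar>A' N l w $ i $ j - A l $ i $ j\<bar>)" for N
  proof -
    have "(LINT w|M. \<bar>D N w\<bar>) = (LINT w|M. D N w)" using D_nn by simp
    also have "\<dots> = (\<Sum>l\<le>L. \<Sum>i\<in>UNIV. \<Sum>j\<in>UNIV. LINT w|M. \<bar>A' N l w $ i $ j - A l $ i $ j\<bar>)"
      unfolding D_def using iA
      by (subst Bochner_Integration.integral_sum, simp, intro sum.cong refl)
        (subst Bochner_Integration.integral_sum, simp, intro sum.cong refl, subst Bochner_Integration.integral_sum, simp_all)
    finally show ?thesis .
  qed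
  ultimately have D0: "(\<lambda>N. LINT w|M. \<bar>D N w\<bar>) \<longlonglongrightarrow> 0" by simp
  define \<beta> where "\<beta> = 1 + (\<Sum>l\<le>L. \<Sum>i\<in>UNIV. \<Sum>j\<in>UNIV. \<bar>B l $ i $ j\<bar>)"
  have \<beta>1: "\<beta> \<ge> 1" unfolding \<beta>_def by (simp add: sum_nonneg)
  have \<beta>: "(\<Sum>i\<in>UNIV. \<Sum>j\<in>UNIV. \<bar>B l $ i $ j\<bar>) \<le> \<beta>" if "l \<le> L" for l
  proof -
    have "(\<Sum>i\<in>UNIV. \<Sum>j\<in>UNIV. \<bar>B l $ i $ j\<bar>) \<le> (\<Sum>l\<le>L. \<Sum>i\<in>UNIV. \<Sum>j\<in>UNIV. \<bar>B l $ i $ j\<bar>)"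
      by (rule member_le_sum) (use that in \<open>auto intro!: sum_nonneg\<close>)
    then show ?thesis by (simp add: \<beta>_def)
  qed
  have close: "\<exists>\<eta>>0. \<forall>N\<ge>N0. AE w in M. (\<Sum>i\<in>I. \<bar>U N i w\<bar>) \<le> K \<longrightarrow> \<bar>D N w\<bar> \<le> \<eta> \<longrightarrow>
       \<bar>f N w - (G \<circ> H) (\<lambda>i. if i \<in> I then U N i w else 0)\<bar> \<le> \<epsilon>" if \<epsilon>: "\<epsilon> > 0" for K \<epsilon> :: real
  proof -
    define R where "R = 2 * \<beta> * \<bar>K\<bar>"
    have R0: "R \<ge> 0" using \<beta>1 by (simp add: R_def)
    obtain \<rho> where \<rho>: "\<rho> > 0" "\<And>x y. (\<And>i. \<bar>x i\<bar> \<le> R) \<Longrightarrow> (\<And>i. \<bar>y i\<bar> \<le> R) \<Longrightarrow> (\<And>i. \<bar>x i - y i\<bar> \<le> \<rho>) \<Longrightarrow> \<bar>G x - G y\<bar> \<le> \<epsilon>"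
      using box_uniform_continuity[OF G \<epsilon>, of R] by blast
    \<comment> \<open>The first bound serves \<open>linear_solve_perturbation\<close>; the second one keeps the solutions within \<open>\<rho>\<close>.\<close>
    define \<eta> where "\<eta> = min (1 / (2 * \<beta>)) (\<rho> / (\<beta> * (R + 1)))"
    have \<eta>0: "\<eta> > 0" using \<beta>1 \<rho>(1) R0 by (simp add: \<eta>_def)
    have \<eta>1: "\<beta> * \<eta> \<le> 1 / 2"
    proof -
      have "\<beta> * \<eta> \<le> \<beta> * (1 / (2 * \<beta>))" using \<beta>1 by (intro mult_left_mono) (auto simp: \<eta>_def)
      then show ?thesis using \<beta>1 by simp
    qed
    have \<eta>2: "\<beta> * \<eta> * R \<le> \<rho>"
    proof -
      have "\<beta> * \<eta> * R \<le> \<beta> * (\<rho> / (\<beta> * (R + 1))) * (R + 1)" using \<beta>1 R0 \<rho>(1) by (intro mult_mono mult_left_mono) (auto simp: \<eta>_def)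
      also have "\<dots> = \<rho>"
      proof -
        have "\<beta> \<noteq> 0" "R + 1 \<noteq> 0" using \<beta>1 R0 by auto
        then show ?thesis by simp
      qed
      finally show ?thesis .
    qed
    have "AE w in M. (\<Sum>i\<in>I. \<bar>U N i w\<bar>) \<le> K \<longrightarrow> \<bar>D N w\<bar> \<le> \<eta> \<longrightarrow>
       \<bar>f N w - (G \<circ> H) (\<lambda>i. if i \<in> I then U N i w else 0)\<bar> \<le> \<epsilon>" if N: "N \<ge> N0" for N
      using sol[OF N]
    proof eventually_elim
      case (elim w)
      then obtain v where v: "\<And>l. l \<le> L \<Longrightarrow> A' N l w *v v l = (\<chi> j. U N (l, j) w)" "f N w = G (block_vec L v)" by blast
      show ?case
      proof (intro impI)
        assume K: "(\<Sum>i\<in>I. \<bar>U N i w\<bar>) \<le> K" and Dle: "\<bar>D N w\<bar> \<le> \<eta>"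
        define wt where "wt l = B l *v (\<chi> j. U N (l, j) w)" for l
        have un: "norm (\<chi> j. U N (l, j) w) \<le> \<bar>K\<bar>" if "l \<le> L" for l
        proof -
          have "norm (\<chi> j. U N (l, j) w) \<le> (\<Sum>j\<in>UNIV. \<bar>U N (l, j) w\<bar>)" using norm_le_l1_cart[of "\<chi> j. U N (l, j) w"] by simp
          also have "\<dots> = (\<Sum>i\<in>Pair l ` UNIV. \<bar>U N i w\<bar>)" by (simp add: sum.reindex inj_on_def)
          also have "\<dots> \<le> (\<Sum>i\<in>I. \<bar>U N i w\<bar>)" using that by (intro sum_mono2) (auto simp: I_def)
          finally show ?thesis using K by linarith
        qed
        have bounds: "norm (v l) \<le> R" "norm (wt l) \<le> R" "norm (v l - wt l) \<le> \<rho>" if l: "l \<le> L" for l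
        proof -
          have "(\<Sum>i\<in>UNIV. \<Sum>j\<in>UNIV. \<bar>(A' N l w - A l) $ i $ j\<bar>) \<le> D N w"
            unfolding D_def vector_minus_component by (rule member_le_sum) (use l in \<open>auto intro!: sum_nonneg\<close>)
          then have d: "(\<Sum>i\<in>UNIV. \<Sum>j\<in>UNIV. \<bar>(A' N l w - A l) $ i $ j\<bar>) \<le> \<eta>" using Dle by linarith
          note p = linear_solve_perturbation[OF BA[OF l] v(1)[OF l] \<beta>[OF l] d \<eta>1]
          have uR: "2 * \<beta> * norm (\<chi> j. U N (l, j) w) \<le> R" unfolding R_def using un[OF l] \<beta>1 by (intro mult_left_mono) auto
          show "norm (v l) \<le> R" using p(1) uR by linarith
          have "norm (wt l) \<le> \<beta> * norm (\<chi> j. U N (l, j) w)"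
            unfolding wt_def by (rule order_trans[OF norm_matrix_vector_le mult_right_mono[OF \<beta>[OF l] norm_ge_zero]])
          moreover have "0 \<le> \<beta> * norm (\<chi> j. U N (l, j) w)" using \<beta>1 by simp
          ultimately show "norm (wt l) \<le> R" using uR by linarith
          have "\<beta> * \<eta> * (2 * \<beta> * norm (\<chi> j. U N (l, j) w)) \<le> \<beta> * \<eta> * R" using uR \<beta>1 \<eta>0 by (intro mult_left_mono) auto
          then show "norm (v l - wt l) \<le> \<rho>" using p(2) \<eta>2 unfolding wt_def by linarith
        qed
        have comp: "\<bar>x $ j\<bar> \<le> norm x" for x :: "real^'p" and j by (rule component_le_norm_cart)
        have "\<bar>G (block_vec L v) - G (block_vec L wt)\<bar> \<le> \<epsilon>"
        proof (rule \<rho>(2))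
          fix i :: "nat \<times> 'p"
          show "\<bar>block_vec L v i\<bar> \<le> R" "\<bar>block_vec L wt i\<bar> \<le> R"
            using order_trans[OF comp bounds(1)] order_trans[OF comp bounds(2)] R0 by (auto simp: block_vec_def)
          have "\<bar>v (fst i) $ snd i - wt (fst i) $ snd i\<bar> \<le> norm (v (fst i) - wt (fst i))" using comp[of "v (fst i) - wt (fst i)" "snd i"] by simp
          then show "\<bar>block_vec L v i - block_vec L wt i\<bar> \<le> \<rho>"
            using bounds(3)[of "fst i"] \<rho>(1) by (auto simp: block_vec_def)
        qed
        moreover have "H (\<lambda>i. if i \<in> I then U N i w else 0) = block_vec L wt" unfolding H_cong unfolding H_def wt_def ..
        ultimately show "\<bar>f N w - (G \<circ> H) (\<lambda>i. if i \<in> I then U N i w else 0)\<bar> \<le> \<epsilon>" by (simp add: v(2))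
      qed
    qed
    then show ?thesis using \<eta>0 by blast
  qed
  have fB: "AE w in M. \<bar>f N w\<bar> \<le> b" if "N \<ge> N0" for N using sol[OF that] by eventually_elim (use GB in auto)
  have "(\<lambda>N. LINT w|M. f N w) \<longlonglongrightarrow> (LINT w|M. (G \<circ> H) (\<lambda>i. if i \<in> I then U' i w else 0))"
  proof (rule weak_conv_perturbation[OF M _ U U' conv[folded I_def] _ _ f fB iD D0 close])
    show "finite I" by (simp add: I_def)
    show "continuous_on UNIV (G \<circ> H)" by (rule continuous_on_compose[OF Hc continuous_on_subset[OF G subset_UNIV]])
    show "\<bar>(G \<circ> H) x\<bar> \<le> b" for x using GB by simp
  qed
  then show ?thesis unfolding comp_def H_cong unfolding H_def .
qed

section \<open>Normal equations of the least squares estimator\<close>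

text \<open>The derivative in \<open>h\<close> of the right-hand side vanishes at the minimum \<open>h = 0\<close>.\<close>

lemma least_squares_normal_equation:
  fixes r x :: "'k \<Rightarrow> real"
  assumes min: "\<And>h. (\<Sum>k\<in>K. (r k)\<^sup>2) \<le> (\<Sum>k\<in>K. (r k - h * x k)\<^sup>2)"
  shows "(\<Sum>k\<in>K. r k * x k) = 0"
proof -
  define S where "S = (\<Sum>k\<in>K. r k * x k)"
  define X where "X = (\<Sum>k\<in>K. (x k)\<^sup>2)"
  have X0: "X \<ge> 0" unfolding X_def by (simp add: sum_nonneg)
  have ex: "(\<Sum>k\<in>K. (r k - h * x k)\<^sup>2) = (\<Sum>k\<in>K. (r k)\<^sup>2) - 2 * h * S + h\<^sup>2 * X" for h
    unfolding S_def X_def sum_distrib_left sum_subtractf[symmetric] sum.distrib[symmetric]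
    by (intro sum.cong refl) (simp add: power2_eq_square algebra_simps)
  define h where "h = S / (X + 1)"
  have hX: "h * (X + 1) = S" using X0 by (simp add: h_def)
  have "0 \<le> h\<^sup>2 * X - 2 * h * S" using min[of h] unfolding ex by linarith
  also have "\<dots> = - (h\<^sup>2 * (X + 2))" unfolding hX[symmetric] by (simp add: power2_eq_square algebra_simps)
  finally have "h\<^sup>2 * (X + 2) \<le> 0" by linarith
  moreover have "0 < X + 2" using X0 by simp
  ultimately have "h = 0" by (metis mult_le_0_iff not_less power2_less_eq_zero_iff)
  then show ?thesis using hX by (simp add: S_def)
qed

context sphar
begin

text \<open>The times of the terms of the loss, numbered from zero: its sum over \<open>t = 1, \<dots>, N\<close> becomes one over
  \<open>t < N\<close>.\<close>

definition obs :: "nat \<Rightarrow> int" where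
  "obs t = int t + (1 + int CARD('p))"

definition kern :: "(nat \<Rightarrow> 'p::{finite,linorder} \<Rightarrow> real) \<Rightarrow> real \<Rightarrow> real^'p::{finite,linorder}" where
  "kern c z = (\<chi> j. \<Sum>l\<le>L. c l j * ((2 * real l + 1) / (4 * pi) * legendre l z))"

lemma sum_modes: "(\<Sum>\<alpha>\<in>modes. g \<alpha>) = (\<Sum>l\<le>L. \<Sum>m=-int l..int l. g (l, m))"
  unfolding modes_def by (subst sum.Sigma) (auto simp: case_prod_unfold)

lemma sum_modes_degree:
  assumes "l \<le> L"
  shows "(\<Sum>\<alpha>\<in>modes. if fst \<alpha> = l then g \<alpha> else 0) = (\<Sum>m=-int l..int l. (g (l, m) :: real))"
proof -
  have "(\<Sum>\<alpha>\<in>modes. if fst \<alpha> = l then g \<alpha> else 0) = (\<Sum>i\<le>L. if i = l then (\<Sum>m=-int l..int l. g (l, m)) else 0)"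
    unfolding sum_modes by (intro sum.cong refl) auto
  then show ?thesis using assms by simp
qed

lemma kern_in_space: "(\<lambda>z. kern c z $ j) \<in> kernel_space L"
  unfolding kernel_space_def kern_def by (rule CollectI, rule exI[of _ "\<lambda>l. c l j"]) simp

lemma in_space_kern:
  fixes \<kappa> :: "real \<Rightarrow> real^'p::{finite,linorder}"
  assumes "\<forall>j. (\<lambda>z. \<kappa> z $ j) \<in> kernel_space L"
  obtains c where "\<kappa> = kern c"
proof -
  have "\<forall>j. \<exists>c. (\<lambda>z. \<kappa> z $ j) = (\<lambda>z. \<Sum>l\<le>L. c l * ((2 * real l + 1) / (4 * pi) * legendre l z))"
    using assms unfolding kernel_space_def by simp
  from choice[OF this] obtain c where c: "\<forall>j. (\<lambda>z. \<kappa> z $ j) = (\<lambda>z. \<Sum>l\<le>L. c j l * ((2 * real l + 1) / (4 * pi) * legendre l z))" by (rule exE)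
  have "\<kappa> z = kern (\<lambda>l j. c j l) z" for z
    unfolding vec_eq_iff
  proof
    fix i
    show "\<kappa> z $ i = kern (\<lambda>l j. c j l) z $ i"
      using fun_cong[OF spec[OF c, of i], of z] by (simp only: kern_def vec_lambda_beta)
  qed
  then show thesis by (intro that[of "\<lambda>l j. c j l"] ext)
qed

text \<open>A kernel in the span of the Legendre polynomials up to degree \<open>L\<close> maps the field to a finite combination of
  spherical harmonics. Pythagoras separates the part of the residual beyond these harmonics, which does not depend on
  \<open>c\<close>, from the autoregressive residuals of the coefficients.\<close>

lemma ls_loss_modes:
  assumes paths: "\<forall>t. in_L2 sphere_measure (\<lambda>x. T t x w)"
  shows "ls_loss T N w (kern c) =
    (\<Sum>t<N. (LINT x|sphere_measure. (T (obs t) x w)\<^sup>2) - (\<Sum>\<alpha>\<in>modes. (a \<alpha> (obs t) w)\<^sup>2)) +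
    (\<Sum>t<N. \<Sum>\<alpha>\<in>modes. (a \<alpha> (obs t) w - ar.regr (c (fst \<alpha>)) \<alpha> (obs t) w)\<^sup>2)"
proof -
  have step: "(LINT x|sphere_measure. (ar_residual T (kern c) s x w)\<^sup>2) =
     (LINT x|sphere_measure. (T s x w)\<^sup>2) - (\<Sum>\<alpha>\<in>modes. (a \<alpha> s w)\<^sup>2) + (\<Sum>\<alpha>\<in>modes. (a \<alpha> s w - ar.regr (c (fst \<alpha>)) \<alpha> s w)\<^sup>2)" for s
  proof -
    define b where "b l m = ar.regr (c l) (l, m) s w" for l m
    have "(LINT x|sphere_measure. (ar_residual T (kern c) s x w)\<^sup>2) = (LINT x|sphere_measure. (T s x w - (\<Sum>(l, m)\<in>modes. b l m * sph_harm l m x))\<^sup>2)"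
    proof (rule Bochner_Integration.integral_cong[OF refl])
      fix x assume "x \<in> space sphere_measure"
      then have x: "x \<in> S2" by simp
      have i: "integrable sphere_measure (\<lambda>y. T (s - int (lag j)) y w)" for j :: 'p
        by (rule in_L2_sphere_integrable) (use paths in blast)
      have "(\<Sum>j\<in>UNIV. kernel_op (\<lambda>z. kern c z $ j) (\<lambda>y. T (s - int (lag j)) y w) x) =
         (\<Sum>j\<in>UNIV. \<Sum>\<alpha>\<in>modes. c (fst \<alpha>) j * a \<alpha> (s - int (lag j)) w * sph_harm (fst \<alpha>) (snd \<alpha>) x)"
      proof (intro sum.cong refl)
        fix j :: 'p
        have "kernel_op (\<lambda>z. kern c z $ j) (\<lambda>y. T (s - int (lag j)) y w) x =
           (\<Sum>l\<le>L. \<Sum>m=- int l..int l. c l j * sph_coeff (\<lambda>y. T (s - int (lag j)) y w) l m * sph_harm l m x)"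
          unfolding kern_def vec_lambda_beta by (rule kernel_op_legendre_sum[OF i x])
        then show "kernel_op (\<lambda>z. kern c z $ j) (\<lambda>y. T (s - int (lag j)) y w) x =
           (\<Sum>\<alpha>\<in>modes. c (fst \<alpha>) j * a \<alpha> (s - int (lag j)) w * sph_harm (fst \<alpha>) (snd \<alpha>) x)"
          unfolding sum_modes by (simp add: a_def)
      qed
      also have "\<dots> = (\<Sum>\<alpha>\<in>modes. ar.regr (c (fst \<alpha>)) \<alpha> s w * sph_harm (fst \<alpha>) (snd \<alpha>) x)"
        unfolding ar.regr_def sum_distrib_right by (rule sum.swap)
      also have "\<dots> = (\<Sum>(l, m)\<in>modes. b l m * sph_harm l m x)" by (simp add: case_prod_unfold b_def)
      finally show "(ar_residual T (kern c) s x w)\<^sup>2 = (T s x w - (\<Sum>(l, m)\<in>modes. b l m * sph_harm l m x))\<^sup>2"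
        by (simp add: ar_residual_def)
    qed
    also have "\<dots> = (LINT x|sphere_measure. (T s x w)\<^sup>2) - (\<Sum>(l, m)\<in>modes. (sph_coeff (\<lambda>x. T s x w) l m)\<^sup>2)
       + (\<Sum>(l, m)\<in>modes. (sph_coeff (\<lambda>x. T s x w) l m - b l m)\<^sup>2)"
      using paths finite_modes by (intro sphere_pythagoras) (auto dest: modes_valid)
    finally show ?thesis by (simp add: case_prod_unfold b_def a_def)
  qed
  have "ls_loss T N w (kern c) = (\<Sum>t<N. LINT x|sphere_measure. (ar_residual T (kern c) (obs t) x w)\<^sup>2)"
    unfolding ls_loss_def One_nat_def sum.atLeast1_atMost_eq by (simp add: obs_def add.commute add.left_commute)
  then show ?thesis unfolding step by (simp add: sum.distrib)
qed

text \<open>The minimizer is compared with kernels that differ from it in the coefficients of degree \<open>l\<close> only.\<close>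

lemma ls_normal_equations:
  assumes paths: "\<forall>t. in_L2 sphere_measure (\<lambda>x. T t x w)"
    and min: "is_arg_min (ls_loss T N w) (\<lambda>\<kappa>. \<forall>j. (\<lambda>z. \<kappa> z $ j) \<in> kernel_space L) (kern c)"
    and l: "l \<le> L"
  shows "(\<Sum>t<N. \<Sum>m=-int l..int l. ar.regr (\<lambda>j. c l j - \<phi> l $ j) (l, m) (obs t) w * ar.regr u (l, m) (obs t) w) =
    (\<Sum>t<N. \<Sum>m=-int l..int l. noise (l, m) (obs t) w * ar.regr u (l, m) (obs t) w)"
proof -
  define r where "r k = a (snd k) (obs (fst k)) w - ar.regr (c (fst (snd k))) (snd k) (obs (fst k)) w" for k :: "nat \<times> nat \<times> int"
  define x where "x k = (if fst (snd k) = l then ar.regr u (snd k) (obs (fst k)) w else 0)" for k :: "nat \<times> nat \<times> int"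
  have prod: "(\<Sum>k\<in>{..<N} \<times> modes. g k) = (\<Sum>t<N. \<Sum>\<alpha>\<in>modes. g (t, \<alpha>))" for g :: "_ \<Rightarrow> real"
    by (simp add: sum.cartesian_product)
  have "(\<Sum>k\<in>{..<N} \<times> modes. (r k)\<^sup>2) \<le> (\<Sum>k\<in>{..<N} \<times> modes. (r k - h * x k)\<^sup>2)" for h
  proof -
    define c' where "c' i j = c i j + (if i = l then h * u j else 0)" for i j
    have "\<not> ls_loss T N w (kern c') < ls_loss T N w (kern c)"
      using min kern_in_space unfolding is_arg_min_def by blast
    then have "(\<Sum>t<N. \<Sum>\<alpha>\<in>modes. (a \<alpha> (obs t) w - ar.regr (c (fst \<alpha>)) \<alpha> (obs t) w)\<^sup>2) \<le>
       (\<Sum>t<N. \<Sum>\<alpha>\<in>modes. (a \<alpha> (obs t) w - ar.regr (c' (fst \<alpha>)) \<alpha> (obs t) w)\<^sup>2)"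
      unfolding ls_loss_modes[OF paths] by simp
    moreover have "a \<alpha> (obs t) w - ar.regr (c' (fst \<alpha>)) \<alpha> (obs t) w = r (t, \<alpha>) - h * x (t, \<alpha>)" for t \<alpha>
      by (simp add: r_def x_def c'_def ar.regr_def distrib_right sum.distrib sum_distrib_left mult.assoc)
    ultimately show ?thesis unfolding prod by (simp add: r_def)
  qed
  then have "(\<Sum>k\<in>{..<N} \<times> modes. r k * x k) = 0" by (rule least_squares_normal_equation)
  then have "(\<Sum>t<N. \<Sum>\<alpha>\<in>modes. if fst \<alpha> = l then r (t, \<alpha>) * ar.regr u \<alpha> (obs t) w else 0) = 0"
    unfolding prod x_def by (simp add: if_distrib cong: if_cong)
  then have "(\<Sum>t<N. \<Sum>m=-int l..int l. r (t, (l, m)) * ar.regr u (l, m) (obs t) w) = 0"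
    unfolding sum_modes_degree[OF l] .
  moreover have "r (t, (l, m)) * ar.regr u (l, m) (obs t) w = noise (l, m) (obs t) w * ar.regr u (l, m) (obs t) w
     - ar.regr (\<lambda>j. c l j - \<phi> l $ j) (l, m) (obs t) w * ar.regr u (l, m) (obs t) w" for t m
    unfolding r_def noise_def by (simp add: ar.regr_def left_diff_distrib sum_subtractf)
  ultimately show ?thesis by (simp add: sum_subtractf)
qed

text \<open>The right-hand side and the matrix of the normal equations of degree \<open>l\<close>, normalised so that both converge.\<close>

definition score :: "nat \<Rightarrow> nat \<times> 'p \<Rightarrow> 'w \<Rightarrow> real" where
  "score N i w = (\<Sum>t<N. \<Sum>m=-int (fst i)..int (fst i).
     noise (fst i, m) (obs t) w * a (fst i, m) (obs t - int (lag (snd i))) w) / sqrt (real N)"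

definition gram :: "nat \<Rightarrow> nat \<Rightarrow> 'w \<Rightarrow> real^'p::{finite,linorder}^'p::{finite,linorder}" where
  "gram N l w = (\<chi> i j. (\<Sum>t<N. \<Sum>m=-int l..int l. a (l, m) (obs t - int (lag i)) w * a (l, m) (obs t - int (lag j)) w) / real N)"

lemma regr_unit: "ar.regr (\<lambda>j. if j = i then 1 else 0) \<alpha> t w = a \<alpha> (t - int (lag i)) w"
proof -
  have "ar.regr (\<lambda>j. if j = i then 1 else 0) \<alpha> t w = (\<Sum>j\<in>UNIV. if j = i then a \<alpha> (t - int (lag j)) w else 0)"
    unfolding ar.regr_def by (intro sum.cong refl) simp
  then show ?thesis by simp
qed

lemma gram_score:
  assumes paths: "\<forall>t. in_L2 sphere_measure (\<lambda>x. T t x w)" and N: "N > 0"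
    and min: "is_arg_min (ls_loss T N w) (\<lambda>\<kappa>. \<forall>j. (\<lambda>z. \<kappa> z $ j) \<in> kernel_space L) (kern c)"
    and l: "l \<le> L"
  shows "gram N l w *v (sqrt (real N) *\<^sub>R (\<chi> j. c l j - \<phi> l $ j)) = (\<chi> j. score N (l, j) w)"
proof -
  have "(\<Sum>j\<in>UNIV. gram N l w $ i $ j * (sqrt (real N) * (c l j - \<phi> l $ j))) = score N (l, i) w" for i
  proof -
    define q where "q = sqrt (real N)"
    have q: "q > 0" "real N = q * q" using N by (simp_all add: q_def)
    have "(\<Sum>j\<in>UNIV. gram N l w $ i $ j * (q * (c l j - \<phi> l $ j))) =
       (\<Sum>j\<in>UNIV. (\<Sum>t<N. \<Sum>m=-int l..int l. (c l j - \<phi> l $ j) * a (l, m) (obs t - int (lag j)) w * a (l, m) (obs t - int (lag i)) w)) / q"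
    proof -
      have "gram N l w $ i $ j * (q * (c l j - \<phi> l $ j)) = (\<Sum>t<N. \<Sum>m=-int l..int l. (c l j - \<phi> l $ j) * a (l, m) (obs t - int (lag j)) w * a (l, m) (obs t - int (lag i)) w) / q" for j
      proof -
        have "(\<Sum>t<N. \<Sum>m=-int l..int l. (c l j - \<phi> l $ j) * a (l, m) (obs t - int (lag j)) w * a (l, m) (obs t - int (lag i)) w)
          = (c l j - \<phi> l $ j) * (\<Sum>t<N. \<Sum>m=-int l..int l. a (l, m) (obs t - int (lag i)) w * a (l, m) (obs t - int (lag j)) w)"
          unfolding sum_distrib_left by (intro sum.cong refl) simp
        then show ?thesis using q by (simp add: gram_def)
      qed
      then show ?thesis by (simp add: sum_divide_distrib)
    qed
    also have "(\<Sum>j\<in>UNIV. (\<Sum>t<N. \<Sum>m=-int l..int l. (c l j - \<phi> l $ j) * a (l, m) (obs t - int (lag j)) w * a (l, m) (obs t - int (lag i)) w))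
      = (\<Sum>t<N. \<Sum>m=-int l..int l. ar.regr (\<lambda>j. c l j - \<phi> l $ j) (l, m) (obs t) w * ar.regr (\<lambda>j. if j = i then 1 else 0) (l, m) (obs t) w)"
      unfolding regr_unit unfolding ar.regr_def sum_distrib_right
      by (subst sum.swap, rule sum.cong[OF refl], rule sum.swap)
    also have "\<dots> = (\<Sum>t<N. \<Sum>m=-int l..int l. noise (l, m) (obs t) w * ar.regr (\<lambda>j. if j = i then 1 else 0) (l, m) (obs t) w)"
      by (rule ls_normal_equations[OF paths min l])
    finally show ?thesis unfolding regr_unit score_def q_def by simp
  qed
  then show ?thesis by (simp add: vec_eq_iff matrix_vector_mult_def)
qed

lemma estimator_solves:
  fixes khat :: "'w \<Rightarrow> real \<Rightarrow> real^'p::{finite,linorder}"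
  assumes est: "ls_estimator M T L N khat" and N: "N > 0"
  shows "AE w in M. \<exists>v. (\<forall>l\<le>L. gram N l w *v v l = (\<chi> j. score N (l, j) w)) \<and>
    (\<forall>z. sqrt (real N) *\<^sub>R (khat w z - kernel_expansion \<phi> L z) = (\<Sum>l\<le>L. ((2 * real l + 1) / (4 * pi) * legendre l z) *\<^sub>R v l))"
proof -
  have "AE w in M. \<forall>t. in_L2 sphere_measure (\<lambda>x. T t x w)" using T_paths by (simp add: AE_all_countable)
  moreover have "AE w in M. is_arg_min (ls_loss T N w) (\<lambda>\<kappa>. \<forall>j. (\<lambda>z. \<kappa> z $ j) \<in> kernel_space L) (khat w)"
    using est by (simp add: ls_estimator_def)
  ultimately show ?thesis
  proof eventually_elim
    case (elim w)
    have "\<forall>j. (\<lambda>z. khat w z $ j) \<in> kernel_space L" using elim(2) unfolding is_arg_min_def by blast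
    then obtain c where c: "khat w = kern c" by (rule in_space_kern)
    define v where "v l = sqrt (real N) *\<^sub>R (\<chi> j. c l j - \<phi> l $ j)" for l
    have "gram N l w *v v l = (\<chi> j. score N (l, j) w)" if "l \<le> L" for l
      unfolding v_def by (rule gram_score[OF elim(1) N elim(2)[unfolded c] that])
    moreover have "sqrt (real N) *\<^sub>R (khat w z - kernel_expansion \<phi> L z) = (\<Sum>l\<le>L. ((2 * real l + 1) / (4 * pi) * legendre l z) *\<^sub>R v l)" for z
    proof -
      have "sqrt (real N) * ((\<Sum>l\<le>L. c l j * ((2 * real l + 1) / (4 * pi) * legendre l z)) - (\<Sum>l\<le>L. (2 * real l + 1) / (4 * pi) * legendre l z * \<phi> l $ j)) =
         (\<Sum>l\<le>L. (2 * real l + 1) / (4 * pi) * legendre l z * (sqrt (real N) * (c l j - \<phi> l $ j)))" for j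
        unfolding sum_subtractf[symmetric] sum_distrib_left
        by (rule sum.cong[OF refl]) (simp only: right_diff_distrib mult_ac)
      then show ?thesis unfolding c kern_def kernel_expansion_def v_def vec_eq_iff
        by (simp add: sum_component mult_ac)
    qed
    ultimately show ?case by (intro exI[of _ v]) blast
  qed
qed

subsection \<open>Limits of the score and of the Gram matrices\<close>

text \<open>The values of one stationary coefficient process at \<open>p\<close> consecutive times have covariance matrix
  \<open>\<Gamma>\<^sub>l\<close>. Multiples of them, which are uncorrelated for different degrees, realise the limit law of the
  scores on the original sample space.\<close>

definition limit_score :: "nat \<times> 'p \<Rightarrow> 'w \<Rightarrow> real" where
  "limit_score i w = sqrt ((2 * real (fst i) + 1) * CZ (fst i)) * a (fst i, 0) (- int (lag (snd i))) w"

lemma modes_zero: "l \<le> L \<Longrightarrow> (l, 0) \<in> modes"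
  by (simp add: modes_def)

lemma qcov_degree: "(l, m) \<in> modes \<Longrightarrow> ar.qcov u v (l, m) h = ar.qcov u v (l, 0) h"
proof -
  assume 1: "(l, m) \<in> modes"
  then have "(l, 0) \<in> modes" by (simp add: modes_def)
  from ar.acov_determined[OF 1 this] show ?thesis by (simp add: ar.qcov_def)
qed

text \<open>The linear combination of scores is a sum of noise against regressors over all modes, to which \<open>regr_noise_clt\<close>
  applies. Its asymptotic variance counts every degree \<open>2 l + 1\<close> times, because the modes of one degree have equal
  autocovariances.\<close>

lemma score_weak_limit:
  "(\<lambda>N. LINT w|M. cos (b + (\<Sum>i\<in>{..L} \<times> UNIV. c i * score N i w))) \<longlonglongrightarrow>
   (LINT w|M. cos (b + (\<Sum>i\<in>{..L} \<times> UNIV. c i * limit_score i w)))"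
proof -
  define u where "u \<alpha> j = c (fst \<alpha>, j)" for \<alpha> :: "nat \<times> int" and j
  define V where "V = (\<Sum>\<alpha>\<in>modes. CZ (fst \<alpha>) * ar.qcov (u \<alpha>) (u \<alpha>) \<alpha> 0)"
  have ud: "u (l, m) = u (l, 0)" for l m by (simp add: u_def fun_eq_iff)
  have "V = (\<Sum>l\<le>L. \<Sum>m=-int l..int l. CZ l * ar.qcov (u (l, 0)) (u (l, 0)) (l, 0) 0)"
    unfolding V_def sum_modes
  proof (intro sum.cong refl)
    fix l m assume "l \<in> {..L}" "m \<in> {-int l..int l}"
    then have "(l, m) \<in> modes" by (simp add: modes_def)
    then show "CZ (fst (l, m)) * ar.qcov (u (l, m)) (u (l, m)) (l, m) 0 = CZ l * ar.qcov (u (l, 0)) (u (l, 0)) (l, 0) 0"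
      using qcov_degree[of l m] ud[of l m] by simp
  qed
  then have V: "V = (\<Sum>l\<le>L. (2 * real l + 1) * CZ l * ar.qcov (u (l, 0)) (u (l, 0)) (l, 0) 0)" by (simp add: algebra_simps)
  define X where "X N w = (\<Sum>t<N. \<Sum>\<alpha>\<in>modes. ar.regr (u \<alpha>) \<alpha> (int t + (1 + int CARD('p))) w * noise \<alpha> (int t + (1 + int CARD('p))) w) / sqrt (real N)" for N w
  have X: "(\<Sum>i\<in>{..L} \<times> UNIV. c i * score N i w) = X N w" for N w
  proof -
    have "(\<Sum>i\<in>{..L} \<times> UNIV. c i * score N i w) = (\<Sum>l\<le>L. \<Sum>j\<in>UNIV. c (l, j) * score N (l, j) w)"
      by (simp add: sum.cartesian_product case_prod_unfold)
    also have "\<dots> = (\<Sum>l\<le>L. \<Sum>j\<in>UNIV. \<Sum>t<N. \<Sum>m=-int l..int l. c (l, j) * a (l, m) (obs t - int (lag j)) w * noise (l, m) (obs t) w / sqrt (real N))"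
      unfolding score_def sum_divide_distrib sum_distrib_left by (intro sum.cong refl) (simp_all add: mult_ac)
    also have "\<dots> = (\<Sum>l\<le>L. \<Sum>t<N. \<Sum>m=-int l..int l. \<Sum>j\<in>UNIV. c (l, j) * a (l, m) (obs t - int (lag j)) w * noise (l, m) (obs t) w / sqrt (real N))"
      by (rule sum.cong[OF refl], subst sum.swap, rule sum.cong[OF refl], rule sum.swap)
    also have "\<dots> = (\<Sum>t<N. \<Sum>l\<le>L. \<Sum>m=-int l..int l. \<Sum>j\<in>UNIV. c (l, j) * a (l, m) (obs t - int (lag j)) w * noise (l, m) (obs t) w / sqrt (real N))"
      by (rule sum.swap)
    also have "\<dots> = X N w"
      unfolding X_def sum_modes ar.regr_def sum_divide_distrib sum_distrib_right by (simp add: u_def obs_def)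
    finally show ?thesis .
  qed
  have c0: "(\<lambda>N. LINT w|M. cos (b + X N w)) \<longlonglongrightarrow> exp (- V / 2) * cos b"
    unfolding X_def V_def by (rule ar.regr_noise_clt)
  define Y where "Y w = (\<Sum>l\<le>L. sqrt ((2 * real l + 1) * CZ l) * ar.regr (u (l, 0)) (l, 0) 0 w)" for w
  have Y: "(\<Sum>i\<in>{..L} \<times> UNIV. c i * limit_score i w) = Y w" for w
  proof -
    have "(\<Sum>i\<in>{..L} \<times> UNIV. c i * limit_score i w) = (\<Sum>l\<le>L. \<Sum>j\<in>UNIV. c (l, j) * limit_score (l, j) w)"
      by (simp add: sum.cartesian_product case_prod_unfold)
    then show ?thesis unfolding Y_def limit_score_def ar.regr_def sum_distrib_left by (simp add: u_def mult_ac)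
  qed
  have Yg: "cgauss M Y"
  proof -
    have "joint_cgauss M UNIV (\<lambda>_::unit. Y)"
      unfolding Y_def[abs_def]
      by (rule joint_cgauss_lin_span[OF ar.joint]) (intro lin_span_sum lin_span_scale ar.regr_span modes_zero, simp_all)
    then show ?thesis using joint_cgauss_single[of M UNIV "\<lambda>_::unit. Y" "()"] by simp
  qed
  have reg_orth: "(LINT w|M. ar.regr (u (l, 0)) (l, 0) 0 w * ar.regr (u (l', 0)) (l', 0) 0 w) = (if l = l' then ar.qcov (u (l, 0)) (u (l, 0)) (l, 0) 0 else 0)"
    if "l \<le> L" "l' \<le> L" for l l'
  proof (cases "l = l'")
    case True
    then show ?thesis using ar.regr_cov[OF modes_zero[OF that(1)], of "u (l, 0)" 0 "u (l, 0)" 0] by simp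
  next
    case False
    have i: "integrable M (\<lambda>w. a (l, 0) s w * a (l', 0) t w)" for s t
      by (rule in_L2_mult_integrable[OF coeff_L2(1) coeff_L2(1)])
    have z: "(LINT w|M. a (l, 0) s w * a (l', 0) t w) = 0" for s t
      by (rule ar.acov_cross[OF modes_zero[OF that(1)] modes_zero[OF that(2)]]) (use False in simp)
    have "(LINT w|M. ar.regr (u (l, 0)) (l, 0) 0 w * ar.regr (u (l', 0)) (l', 0) 0 w) =
       (LINT w|M. (\<Sum>i\<in>UNIV. \<Sum>j\<in>UNIV. (u (l, 0) i * u (l', 0) j) * (a (l, 0) (0 - int (lag i)) w * a (l', 0) (0 - int (lag j)) w)))"
      unfolding ar.regr_def sum_product by (simp add: mult_ac)
    also have "\<dots> = 0" using i by (simp add: z)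
    finally show ?thesis using False by simp
  qed
  have "(LINT w|M. (Y w)\<^sup>2) = (LINT w|M. (\<Sum>l\<le>L. \<Sum>l'\<le>L. (sqrt ((2 * real l + 1) * CZ l) * sqrt ((2 * real l' + 1) * CZ l')) *
      (ar.regr (u (l, 0)) (l, 0) 0 w * ar.regr (u (l', 0)) (l', 0) 0 w)))"
    unfolding Y_def power2_eq_square sum_product by (simp add: mult_ac)
  also have "\<dots> = (\<Sum>l\<le>L. \<Sum>l'\<le>L. (sqrt ((2 * real l + 1) * CZ l) * sqrt ((2 * real l' + 1) * CZ l')) *
      (if l = l' then ar.qcov (u (l, 0)) (u (l, 0)) (l, 0) 0 else 0))"
  proof -
    have ri: "integrable M (\<lambda>w. ar.regr (u (l, 0)) (l, 0) 0 w * ar.regr (u (l', 0)) (l', 0) 0 w)" if "l \<le> L" "l' \<le> L" for l l'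
      by (rule in_L2_mult_integrable) (intro cgauss_in_L2 ar.regr_cgauss modes_zero that)+
    show ?thesis using ri reg_orth
      by (subst Bochner_Integration.integral_sum, force intro!: Bochner_Integration.integrable_sum)
        (intro sum.cong refl, subst Bochner_Integration.integral_sum, force, simp)
  qed
  also have "\<dots> = V" unfolding V using identifiability
    by (intro sum.cong refl) (simp add: if_distrib less_imp_le cong: if_cong)
  finally have "(LINT w|M. cos (b + Y w)) = exp (- V / 2) * cos b"
    using cgauss_integral_cos[OF prob_space_axioms Yg, of b] by simp
  then show ?thesis using c0 unfolding X Y by simp
qed

text \<open>Polarisation writes a product of two lagged values as a difference of squares of regressors, for which the law of
  large numbers is known.\<close>

lemma gram_limit:
  assumes l: "l \<le> L"
  shows "(\<lambda>N. LINT w|M. \<bar>gram N l w $ i $ j - ((2 * real l + 1) *\<^sub>R autocov_matrix M T l) $ i $ j\<bar>) \<longlonglongrightarrow> 0"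
proof -
  define u where "u s k = (if k = i then 1 else 0) + s * (if k = j then 1 else (0::real))" for s :: real and k
  have reg: "ar.regr (u s) \<alpha> t w = a \<alpha> (t - int (lag i)) w + s * a \<alpha> (t - int (lag j)) w" for s \<alpha> t w
  proof -
    have "ar.regr (u s) \<alpha> t w = ar.regr (\<lambda>k. if k = i then 1 else 0) \<alpha> t w + s * ar.regr (\<lambda>k. if k = j then 1 else 0) \<alpha> t w"
      unfolding ar.regr_def u_def sum_distrib_left by (simp add: distrib_right sum.distrib mult.assoc)
    then show ?thesis by (simp add: regr_unit)
  qed
  have polar: "x * y = ((x + 1 * y)\<^sup>2 - (x + (-1) * y)\<^sup>2) / 4" for x y :: real by (simp add: power2_eq_square algebra_simps)
  define E where "E s m N w = (\<Sum>t<N. (ar.regr (u s) (l, m) (int t + (1 + int CARD('p))) w)\<^sup>2) / real N - ar.qcov (u s) (u s) (l, m) 0" for s m N w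
  have mode: "(l, m) \<in> modes" if "m \<in> {-int l..int l}" for m using that l by (simp add: modes_def)
  have E: "(\<lambda>N. LINT w|M. \<bar>E s m N w\<bar>) \<longlonglongrightarrow> 0" if "m \<in> {-int l..int l}" for s m
    unfolding E_def by (rule ar.qcov_lln[OF mode[OF that]])
  have Ei: "integrable M (E s m N)" if "m \<in> {-int l..int l}" for s m N
    unfolding E_def[abs_def] using cgauss_square_integrable[OF ar.regr_cgauss[OF mode[OF that]]] by simp
  have q: "autocov_matrix M T l $ i $ j = (ar.qcov (u 1) (u 1) (l, m) 0 - ar.qcov (u (-1)) (u (-1)) (l, m) 0) / 4" if m: "m \<in> {-int l..int l}" for m
  proof -
    have i0: "integrable M (\<lambda>w. (ar.regr (u s) (l, 0) 0 w)\<^sup>2)" for s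
      by (rule cgauss_square_integrable[OF ar.regr_cgauss[OF modes_zero[OF l]]])
    have "autocov_matrix M T l $ i $ j = (LINT w|M. a (l, 0) (- int (lag i)) w * a (l, 0) (- int (lag j)) w)"
      using ar.cov_acov[OF modes_zero[OF l], of "- int (lag i)" "- int (lag j)"]
      by (simp add: autocov_matrix_def autocov_def ar.acov_def a_def)
    also have "\<dots> = (LINT w|M. ((ar.regr (u 1) (l, 0) 0 w)\<^sup>2 - (ar.regr (u (-1)) (l, 0) 0 w)\<^sup>2) / 4)"
      unfolding reg by (subst polar) simp
    also have "\<dots> = (ar.qcov (u 1) (u 1) (l, 0) 0 - ar.qcov (u (-1)) (u (-1)) (l, 0) 0) / 4"
      using i0 ar.regr_cov[OF modes_zero[OF l], of "u 1" 0 "u 1" 0] ar.regr_cov[OF modes_zero[OF l], of "u (-1)" 0 "u (-1)" 0]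
      by (simp add: power2_eq_square)
    finally show ?thesis using qcov_degree[OF mode[OF m]] by simp
  qed
  have eq: "gram N l w $ i $ j - ((2 * real l + 1) *\<^sub>R autocov_matrix M T l) $ i $ j = (\<Sum>m=-int l..int l. (E 1 m N w - E (-1) m N w) / 4)" for N w
  proof -
    have "gram N l w $ i $ j = (\<Sum>m=-int l..int l. (\<Sum>t<N. ((ar.regr (u 1) (l, m) (obs t) w)\<^sup>2 - (ar.regr (u (-1)) (l, m) (obs t) w)\<^sup>2) / 4) / real N)"
      unfolding gram_def reg by (subst polar) (simp add: sum_divide_distrib sum.swap[of _ _ "{..<N}"])
    moreover have "((2 * real l + 1) *\<^sub>R autocov_matrix M T l) $ i $ j = (\<Sum>m=-int l..int l. (ar.qcov (u 1) (u 1) (l, m) 0 - ar.qcov (u (-1)) (u (-1)) (l, m) 0) / 4)"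
    proof -
      have "(\<Sum>m=-int l..int l. (ar.qcov (u 1) (u 1) (l, m) 0 - ar.qcov (u (-1)) (u (-1)) (l, m) 0) / 4) = (\<Sum>m=-int l..int l. autocov_matrix M T l $ i $ j)"
        by (rule sum.cong[OF refl], rule q[symmetric])
      then show ?thesis by simp
    qed
    ultimately show ?thesis unfolding sum_subtractf[symmetric] E_def obs_def
      by (simp add: sum_subtractf sum_divide_distrib[symmetric] diff_divide_distrib)
  qed
  have lim: "(\<lambda>N. \<Sum>m=-int l..int l. ((LINT w|M. \<bar>E 1 m N w\<bar>) + (LINT w|M. \<bar>E (-1) m N w\<bar>)) / 4) \<longlonglongrightarrow> 0"
  proof -
    have "(\<lambda>N. \<Sum>m=-int l..int l. ((LINT w|M. \<bar>E 1 m N w\<bar>) + (LINT w|M. \<bar>E (-1) m N w\<bar>)) / 4) \<longlonglongrightarrow> (\<Sum>m=-int l..int l. (0 + 0) / 4)"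
      by (rule tendsto_sum, rule tendsto_divide[OF tendsto_add[OF E E] tendsto_const]) simp_all
    then show ?thesis by simp
  qed
  show ?thesis
  proof (rule Lim_null_comparison[OF always_eventually[OF allI] lim])
    fix N
    have "(LINT w|M. \<bar>\<Sum>m=-int l..int l. (E 1 m N w - E (-1) m N w) / 4\<bar>) \<le> (LINT w|M. (\<Sum>m=-int l..int l. (\<bar>E 1 m N w\<bar> + \<bar>E (-1) m N w\<bar>) / 4))"
    proof (rule integral_mono)
      show "integrable M (\<lambda>w. \<bar>\<Sum>m=-int l..int l. (E 1 m N w - E (-1) m N w) / 4\<bar>)"
        "integrable M (\<lambda>w. \<Sum>m=-int l..int l. (\<bar>E 1 m N w\<bar> + \<bar>E (-1) m N w\<bar>) / 4)"
        by (intro integrable_abs Bochner_Integration.integrable_sum integrable_divide Bochner_Integration.integrable_diff Bochner_Integration.integrable_add Ei; assumption)+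
      fix w
      have "\<bar>\<Sum>m=-int l..int l. (E 1 m N w - E (-1) m N w) / 4\<bar> \<le> (\<Sum>m=-int l..int l. \<bar>(E 1 m N w - E (-1) m N w) / 4\<bar>)" by (rule sum_abs)
      also have "\<dots> \<le> (\<Sum>m=-int l..int l. (\<bar>E 1 m N w\<bar> + \<bar>E (-1) m N w\<bar>) / 4)" by (rule sum_mono) (simp add: abs_triangle_ineq4 divide_right_mono)
      finally show "\<bar>\<Sum>m=-int l..int l. (E 1 m N w - E (-1) m N w) / 4\<bar> \<le> (\<Sum>m=-int l..int l. (\<bar>E 1 m N w\<bar> + \<bar>E (-1) m N w\<bar>) / 4)" .
    qed
    also have "\<dots> = (\<Sum>m=-int l..int l. ((LINT w|M. \<bar>E 1 m N w\<bar>) + (LINT w|M. \<bar>E (-1) m N w\<bar>)) / 4)" using Ei by simp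
    finally show "norm (LINT w|M. \<bar>gram N l w $ i $ j - ((2 * real l + 1) *\<^sub>R autocov_matrix M T l) $ i $ j\<bar>)
       \<le> (\<Sum>m=-int l..int l. ((LINT w|M. \<bar>E 1 m N w\<bar>) + (LINT w|M. \<bar>E (-1) m N w\<bar>)) / 4)"
      unfolding eq by (simp add: Bochner_Integration.integral_nonneg)
  qed
qed

lemma gram_integrable: "integrable M (\<lambda>w. gram N l w $ i $ j)"
  unfolding gram_def using in_L2_mult_integrable[OF coeff_L2(1) coeff_L2(1)] by simp

text \<open>The quadratic form of the matrix is the variance of a regressor, which is positive for nonzero coefficients.\<close>

lemma autocov_matrix_invertible:
  assumes l: "l \<le> L"
  shows "matrix_inv (autocov_matrix M T l) ** autocov_matrix M T l = (mat 1 :: real^'p::{finite,linorder}^'p::{finite,linorder})"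
    and "autocov_matrix M T l ** matrix_inv (autocov_matrix M T l) = (mat 1 :: real^'p::{finite,linorder}^'p::{finite,linorder})"
proof -
  let ?\<Gamma> = "autocov_matrix M T l :: real^'p::{finite,linorder}^'p::{finite,linorder}"
  have "v = 0" if v: "?\<Gamma> *v v = 0" for v
  proof (rule ccontr)
    assume "v \<noteq> 0"
    then obtain j where "v $ j \<noteq> 0" by (auto simp: vec_eq_iff)
    then have "0 < ar.qcov (\<lambda>j. v $ j) (\<lambda>j. v $ j) (l, 0) 0" using ar.qcov_pos[OF modes_zero[OF l], of "\<lambda>j. v $ j" j] by simp
    also have "ar.qcov (\<lambda>j. v $ j) (\<lambda>j. v $ j) (l, 0) 0 = (\<Sum>i\<in>UNIV. v $ i * (?\<Gamma> *v v) $ i)"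
      unfolding ar.qcov_def matrix_vector_mult_def
      by (simp add: sum_distrib_left autocov_matrix_def autocov_def ar.acov_def a_def mult_ac)
    also have "\<dots> = 0" by (simp add: v)
    finally show False by simp
  qed
  then have "invertible ?\<Gamma>" unfolding invertible_left_inverse matrix_left_invertible_ker by blast
  then have "?\<Gamma> ** matrix_inv ?\<Gamma> = mat 1 \<and> matrix_inv ?\<Gamma> ** ?\<Gamma> = mat 1"
    unfolding invertible_def matrix_inv_def by (rule someI_ex)
  then show "matrix_inv ?\<Gamma> ** ?\<Gamma> = mat 1" "?\<Gamma> ** matrix_inv ?\<Gamma> = mat 1" by blast+
qed

end

section \<open>Random elements of the space of continuous functions\<close>

lemma space_metric_borel: "space (metric_borel m) = mspace m"
  and sets_metric_borel_openin: "openin (mtopology_of m) V \<Longrightarrow> V \<in> sets (metric_borel m)"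
proof -
  have sub: "{U. openin (mtopology_of m) U} \<subseteq> Pow (mspace m)"
    using openin_subset[of "mtopology_of m"] by auto
  show "space (metric_borel m) = mspace m" unfolding metric_borel_def by (rule space_measure_of[OF sub])
  show "openin (mtopology_of m) V \<Longrightarrow> V \<in> sets (metric_borel m)"
    unfolding metric_borel_def sets_measure_of[OF sub] by (intro sigma_sets.Basic) simp
qed

lemma measurable_metric_borelI:
  assumes "\<And>w. w \<in> space N \<Longrightarrow> f w \<in> mspace m" and "\<And>U. openin (mtopology_of m) U \<Longrightarrow> f -` U \<inter> space N \<in> sets N"
  shows "f \<in> measurable N (metric_borel m)"
  unfolding metric_borel_def
proof (rule measurable_measure_of)
  show "{U. openin (mtopology_of m) U} \<subseteq> Pow (mspace m)" using openin_subset[of "mtopology_of m"] by auto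
qed (use assms in auto)

lemma measurable_from_euclidean_metric_borel:
  fixes f :: "'b::topological_space \<Rightarrow> 'a"
  assumes f: "continuous_map euclidean (mtopology_of m) f"
  shows "f \<in> measurable borel (metric_borel m)"
proof (rule measurable_metric_borelI)
  show "f w \<in> mspace m" for w using continuous_map_funspace[OF f] by auto
  fix U assume "openin (mtopology_of m) U"
  from openin_continuous_map_preimage[OF f this] have "open {x. f x \<in> U}" by simp
  then show "f -` U \<inter> space borel \<in> sets borel" by (simp add: vimage_def borel_open)
qed

lemma measurable_metric_borel_metric_borel:
  assumes f: "continuous_map (mtopology_of m) (mtopology_of m') f"
  shows "f \<in> measurable (metric_borel m) (metric_borel m')"
proof (rule measurable_metric_borelI)
  show "f w \<in> mspace m'" if "w \<in> space (metric_borel m)" for w using continuous_map_funspace[OF f] that by (auto simp: space_metric_borel)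
  fix U assume "openin (mtopology_of m') U"
  from openin_continuous_map_preimage[OF f this] have "{x \<in> mspace m. f x \<in> U} \<in> sets (metric_borel m)" by (intro sets_metric_borel_openin) simp
  moreover have "f -` U \<inter> space (metric_borel m) = {x \<in> mspace m. f x \<in> U}" by (auto simp: space_metric_borel)
  ultimately show "f -` U \<inter> space (metric_borel m) \<in> sets (metric_borel m)" by simp
qed

lemma measurable_metric_borel_real:
  assumes f: "continuous_map (mtopology_of m) euclideanreal f"
  shows "f \<in> borel_measurable (metric_borel m)"
proof (rule borel_measurableI)
  fix U :: "real set" assume "open U"
  then have "openin euclideanreal U" by simp
  from openin_continuous_map_preimage[OF f this] have "{x \<in> mspace m. f x \<in> U} \<in> sets (metric_borel m)" by (intro sets_metric_borel_openin) simp
  moreover have "f -` U \<inter> space (metric_borel m) = {x \<in> mspace m. f x \<in> U}" by (auto simp: space_metric_borel)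
  ultimately show "f -` U \<inter> space (metric_borel m) \<in> sets (metric_borel m)" by simp
qed

lemma restrict_in_C_metric:
  fixes f :: "real \<Rightarrow> real^'p"
  assumes f: "continuous_on {-1..1} f"
  shows "restrict f {-1..1} \<in> mspace C_metric"
proof -
  have "continuous_on {-1..1} (restrict f {-1..1})" using f by (rule continuous_on_eq) simp
  then have c: "continuous_map (top_of_set {-1..1}) euclidean (restrict f {-1..1})" by (simp add: continuous_map_iff_continuous)
  have "bounded (f ` {-1..1})" by (rule compact_imp_bounded[OF compact_continuous_image[OF f compact_Icc]])
  then obtain x e where e: "\<forall>y\<in>f ` {-1..1}. dist x y \<le> e" unfolding bounded_def by blast
  have "Metric_space.mbounded UNIV dist (restrict f {-1..1} ` {-1..1})"
    unfolding Met_TC.mbounded_def Met_TC.mcball_def using e by (intro exI[of _ x] exI[of _ e]) auto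
  then show ?thesis using c unfolding C_metric_def by simp
qed

lemma C_metric_continuous: "f \<in> mspace (C_metric :: (real \<Rightarrow> real^'p) metric) \<Longrightarrow> continuous_on {-1..1} f"
  unfolding C_metric_def by (simp add: continuous_map_iff_continuous)

lemma mdist_C_metric_le:
  "0 \<le> B \<Longrightarrow> (\<And>z. z \<in> {-1..1} \<Longrightarrow> dist (f z) (g z) \<le> B) \<Longrightarrow> mdist C_metric f g \<le> B"
  unfolding C_metric_def by (rule mdist_cfunspace_le) simp_all

lemma dist_le_mdist_C_metric:
  assumes "f \<in> mspace C_metric" "g \<in> mspace C_metric" "z \<in> {-1..1}"
  shows "dist (f z) (g z) \<le> mdist C_metric f g"
  using mdist_cfunspace_imp_mdist_le[OF assms(1,2)[unfolded C_metric_def] order_refl, of z] assms(3)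
  by (simp add: C_metric_def)

lemma C_metric_eval_measurable:
  assumes z: "z \<in> {-1..1}"
  shows "(\<lambda>f. f z $ j) \<in> borel_measurable (metric_borel (C_metric :: (real \<Rightarrow> real^'p) metric))"
proof (rule measurable_metric_borel_real)
  have "Lipschitz_continuous_map (C_metric :: (real \<Rightarrow> real^'p) metric) euclidean_metric (\<lambda>f. f z $ j)"
    unfolding Lipschitz_continuous_map_def
  proof (intro conjI exI[of _ 1] ballI)
    fix f g :: "real \<Rightarrow> real^'p" assume fg: "f \<in> mspace C_metric" "g \<in> mspace C_metric"
    have "dist (f z $ j) (g z $ j) \<le> dist (f z) (g z)" by (rule dist_vec_nth_le)
    then show "mdist euclidean_metric (f z $ j) (g z $ j) \<le> 1 * mdist C_metric f g"
      using dist_le_mdist_C_metric[OF fg z] by simp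
  qed simp
  from Lipschitz_continuous_imp_continuous_map[OF this]
  show "continuous_map (mtopology_of (C_metric :: (real \<Rightarrow> real^'p) metric)) euclideanreal (\<lambda>f. f z $ j)" by simp
qed

text \<open>Centring and scaling is Lipschitz for the uniform metric, so it preserves the measurability of the estimator.\<close>

lemma C_metric_affine_measurable:
  fixes h :: "real \<Rightarrow> real^'p"
  assumes h: "continuous_on {-1..1} h"
  shows "(\<lambda>f. \<lambda>z\<in>{-1..1}. s *\<^sub>R (f z - h z)) \<in> measurable (metric_borel C_metric) (metric_borel C_metric)"
proof (rule measurable_metric_borel_metric_borel, rule Lipschitz_continuous_imp_continuous_map)
  show "Lipschitz_continuous_map C_metric C_metric (\<lambda>f. \<lambda>z\<in>{-1..1}. s *\<^sub>R (f z - h z))"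
    unfolding Lipschitz_continuous_map_def
  proof (intro conjI exI[of _ "\<bar>s\<bar>"] ballI)
    show "(\<lambda>f. \<lambda>z\<in>{-1..1}. s *\<^sub>R (f z - h z)) \<in> mspace C_metric \<rightarrow> mspace C_metric"
      using h C_metric_continuous by (intro Pi_I restrict_in_C_metric continuous_intros) auto
    fix f g :: "real \<Rightarrow> real^'p" assume fg: "f \<in> mspace C_metric" "g \<in> mspace C_metric"
    have nn: "0 \<le> mdist C_metric f g" by simp
    show "mdist C_metric (\<lambda>z\<in>{-1..1}. s *\<^sub>R (f z - h z)) (\<lambda>z\<in>{-1..1}. s *\<^sub>R (g z - h z)) \<le> \<bar>s\<bar> * mdist C_metric f g"
    proof (rule mdist_C_metric_le)
      show "0 \<le> \<bar>s\<bar> * mdist C_metric f g" using nn by simp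
      fix z :: real assume z: "z \<in> {-1..1}"
      have "dist (s *\<^sub>R (f z - h z)) (s *\<^sub>R (g z - h z)) = \<bar>s\<bar> * dist (f z) (g z)"
        by (simp add: dist_norm flip: scaleR_diff_right)
      then show "dist ((\<lambda>z\<in>{-1..1}. s *\<^sub>R (f z - h z)) z) ((\<lambda>z\<in>{-1..1}. s *\<^sub>R (g z - h z)) z) \<le> \<bar>s\<bar> * mdist C_metric f g"
        using z dist_le_mdist_C_metric[OF fg z] by (simp add: mult_left_mono)
    qed
  qed
qed

lemma continuous_on_legendre: "continuous_on S (legendre l)"
  unfolding legendre_def[abs_def] by (intro continuous_intros)

definition legendre_path :: "nat \<Rightarrow> (nat \<times> 'p::finite \<Rightarrow> real) \<Rightarrow> real \<Rightarrow> real^'p" where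
  "legendre_path L v = (\<lambda>z\<in>{-1..1}. \<Sum>l\<le>L. ((2 * real l + 1) / (4 * pi) * legendre l z) *\<^sub>R (\<chi> j. v (l, j)))"

lemma legendre_path_in: "legendre_path L v \<in> mspace C_metric"
  unfolding legendre_path_def by (intro restrict_in_C_metric continuous_intros continuous_on_legendre)

text \<open>Finitely many Legendre polynomials are bounded on the interval, so the uniform distance of two paths is at most a
  multiple of the sum of the differences of their coefficients.\<close>

lemma legendre_path_continuous: "continuous_map euclidean (mtopology_of C_metric) (legendre_path L :: (nat \<times> 'p::finite \<Rightarrow> real) \<Rightarrow> _)"
proof -
  interpret C: Metric_space "mspace (C_metric :: (real \<Rightarrow> real^'p) metric)" "mdist C_metric" by simp
  define w where "w l z = (2 * real l + 1) / (4 * pi) * legendre l z" for l z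
  have "\<exists>B. \<forall>z\<in>{-1..1}. \<bar>w l z\<bar> \<le> B" for l
  proof -
    have "continuous_on {-1..1} (w l)" unfolding w_def[abs_def] by (intro continuous_intros continuous_on_legendre)
    from compact_imp_bounded[OF compact_continuous_image[OF this compact_Icc]] show ?thesis unfolding bounded_iff by auto
  qed
  then obtain B where B: "\<And>l z. z \<in> {-1..1} \<Longrightarrow> \<bar>w l z\<bar> \<le> B l" by metis
  have "continuous_map euclidean C.mtopology (legendre_path L :: (nat \<times> 'p \<Rightarrow> real) \<Rightarrow> _)"
    unfolding C.continuous_map_to_metric
  proof (intro ballI allI impI)
    fix v :: "nat \<times> 'p \<Rightarrow> real" and \<epsilon> :: real assume "\<epsilon> > 0"
    define D where "D v' = (\<Sum>l\<le>L. B l * (\<Sum>j\<in>UNIV. \<bar>v (l, j) - v' (l, j)\<bar>))" for v'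
    have "continuous_on UNIV D" unfolding D_def[abs_def] by (intro continuous_intros continuous_on_product_then_coordinatewise[OF continuous_on_id])
    then have "open {v'. D v' < \<epsilon>}" by (intro open_Collect_less continuous_intros)
    moreover have "v \<in> {v'. D v' < \<epsilon>}" using \<open>\<epsilon> > 0\<close> by (simp add: D_def)
    moreover have "legendre_path L v' \<in> C.mball (legendre_path L v) \<epsilon>" if "v' \<in> {v'. D v' < \<epsilon>}" for v'
    proof -
      have B0: "B l \<ge> 0" for l using B[of 0 l] abs_ge_zero[of "w l 0"] by simp
      have "mdist C_metric (legendre_path L v) (legendre_path L v') \<le> D v'"
      proof (rule mdist_C_metric_le)
        show "0 \<le> D v'" unfolding D_def using B0 by (intro sum_nonneg mult_nonneg_nonneg) auto
        fix z :: real assume z: "z \<in> {-1..1}"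
        have "dist (legendre_path L v z) (legendre_path L v' z) = norm (\<Sum>l\<le>L. w l z *\<^sub>R ((\<chi> j. v (l, j)) - (\<chi> j. v' (l, j))))"
          using z by (simp add: legendre_path_def dist_norm w_def sum_subtractf scaleR_diff_right)
        also have "\<dots> \<le> (\<Sum>l\<le>L. norm (w l z *\<^sub>R ((\<chi> j. v (l, j)) - (\<chi> j. v' (l, j)))))" by (rule norm_sum)
        also have "\<dots> \<le> D v'" unfolding D_def norm_scaleR
        proof (intro sum_mono mult_mono B z B0)
          fix l
          show "norm ((\<chi> j. v (l, j)) - (\<chi> j. v' (l, j))) \<le> (\<Sum>j\<in>UNIV. \<bar>v (l, j) - v' (l, j)\<bar>)"
            using norm_le_l1_cart[of "(\<chi> j. v (l, j)) - (\<chi> j. v' (l, j))"] by simp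
        qed simp
        finally show "dist (legendre_path L v z) (legendre_path L v' z) \<le> D v'" .
      qed
      then show ?thesis using that by (simp add: C.in_mball legendre_path_in)
    qed
    ultimately show "\<exists>U. openin euclidean U \<and> v \<in> U \<and> (\<forall>y\<in>U. legendre_path L y \<in> C.mball (legendre_path L v) \<epsilon>)"
      by (intro exI[of _ "{v'. D v' < \<epsilon>}"]) simp
  qed
  then show ?thesis by (simp add: mtopology_of_def)
qed

lemma cgauss_push_forward:
  assumes g: "g \<in> measurable M K" and X: "X \<in> borel_measurable K" and c: "cgauss M (\<lambda>w. X (g w))"
  shows "cgauss (distr M K g) X"
proof -
  have [measurable]: "X \<in> borel_measurable K" by fact
  have 1: "integrable (distr M K g) (\<lambda>f. (X f)\<^sup>2)"
    using cgauss_square_integrable[OF c] by (subst integrable_distr_eq[OF g]) measurable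
  have 2: "(\<integral>f. (X f)\<^sup>2 \<partial>distr M K g) = (LINT w|M. (X (g w))\<^sup>2)" by (rule integral_distr[OF g]) measurable
  have 3: "(CLINT f|distr M K g. iexp (u * X f)) = (CLINT w|M. iexp (u * X (g w)))" for u by (rule integral_distr[OF g]) measurable
  show ?thesis unfolding cgauss_def 2 3 using 1 cgauss_char[OF c] X by simp
qed

section \<open>The limit law\<close>

context sphar
begin

text \<open>The inverse of the limit \<open>(2 l + 1) \<Gamma>\<^sub>l\<close> of the Gram matrices of degree \<open>l\<close>.\<close>

definition inv_gram :: "nat \<Rightarrow> real^'p::{finite,linorder}^'p::{finite,linorder}" where
  "inv_gram l = (1 / (2 * real l + 1)) *\<^sub>R matrix_inv (autocov_matrix M T l)"

lemma inv_gram_inverse: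
  assumes "l \<le> L"
  shows "inv_gram l ** ((2 * real l + 1) *\<^sub>R autocov_matrix M T l) = mat 1"
proof -
  have "2 * real l + 1 \<noteq> 0" by linarith
  then have "inv_gram l ** ((2 * real l + 1) *\<^sub>R autocov_matrix M T l) = matrix_inv (autocov_matrix M T l) ** autocov_matrix M T l"
    unfolding inv_gram_def matrix_matrix_mult_def vec_eq_iff by simp
  then show ?thesis using autocov_matrix_invertible(1)[OF assms] by simp
qed

definition limit_vec :: "'w \<Rightarrow> nat \<times> 'p \<Rightarrow> real" where
  "limit_vec w = block_vec L (\<lambda>l. inv_gram l *v (\<chi> j. limit_score (l, j) w))"

definition limit_law :: "(real \<Rightarrow> real^'p::{finite,linorder}) measure" where
  "limit_law = distr M (metric_borel C_metric) (\<lambda>w. legendre_path L (limit_vec w))"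

lemma limit_score_measurable [measurable]: "limit_score i \<in> borel_measurable M"
  unfolding limit_score_def[abs_def] by measurable

lemma limit_vec_comp: "l \<le> L \<Longrightarrow> limit_vec w (l, j) = (\<Sum>k\<in>UNIV. inv_gram l $ j $ k * limit_score (l, k) w)"
  by (simp add: limit_vec_def block_vec_def matrix_vector_mult_def)

lemma limit_path_measurable: "(\<lambda>w. legendre_path L (limit_vec w)) \<in> measurable M (metric_borel C_metric)"
proof (rule measurable_compose[OF _ measurable_from_euclidean_metric_borel[OF legendre_path_continuous]])
  show "limit_vec \<in> borel_measurable M"
  proof (rule measurable_coordinatewise_then_product)
    fix i :: "nat \<times> 'p"
    obtain l j where i: "i = (l, j)" by (cases i)
    show "(\<lambda>w. limit_vec w i) \<in> borel_measurable M"
    proof (cases "l \<le> L")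
      case True
      then show ?thesis unfolding i limit_vec_comp[OF True] by measurable
    next
      case False
      then show ?thesis by (simp add: i limit_vec_def block_vec_def)
    qed
  qed
qed

definition limit_value :: "'p \<Rightarrow> real \<Rightarrow> 'w \<Rightarrow> real" where
  "limit_value j z w = (\<Sum>l\<le>L. ((2 * real l + 1) / (4 * pi) * legendre l z) * (\<Sum>k\<in>UNIV. inv_gram l $ j $ k * limit_score (l, k) w))"

lemma limit_value_eq: "z \<in> {-1..1} \<Longrightarrow> legendre_path L (limit_vec w) z $ j = limit_value j z w"
  by (simp add: legendre_path_def limit_value_def limit_vec_comp sum_component)

lemma limit_value_span: "limit_value j z \<in> lin_span (modes \<times> UNIV) (\<lambda>(\<alpha>, t). a \<alpha> t)"
  unfolding limit_value_def[abs_def] limit_score_def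
  by (intro lin_span_sum lin_span_scale ar.a_span modes_zero) simp_all

lemma limit_score_cov:
  assumes "l \<le> L" "l' \<le> L"
  shows "(LINT w|M. limit_score (l, r) w * limit_score (l', r') w) =
    (if l = l' then (2 * real l + 1) * CZ l * autocov_matrix M T l $ r $ r' else 0)"
proof -
  have eq: "(LINT w|M. limit_score (l, r) w * limit_score (l', r') w) =
    sqrt ((2 * real l + 1) * CZ l) * sqrt ((2 * real l' + 1) * CZ l') * (LINT w|M. a (l, 0) (- int (lag r)) w * a (l', 0) (- int (lag r')) w)"
    unfolding integral_mult_right_zero[symmetric] by (simp add: limit_score_def mult_ac)
  show ?thesis
  proof (cases "l = l'")
    case True
    have "(LINT w|M. a (l, 0) (- int (lag r)) w * a (l, 0) (- int (lag r')) w) = autocov_matrix M T l $ r $ r'"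
      using ar.cov_acov[OF modes_zero[OF assms(1)], of "- int (lag r)" "- int (lag r')"]
      by (simp add: autocov_matrix_def autocov_def ar.acov_def a_def)
    moreover have "sqrt ((2 * real l + 1) * CZ l) * sqrt ((2 * real l + 1) * CZ l) = (2 * real l + 1) * CZ l"
      using identifiability by (simp add: less_imp_le)
    ultimately show ?thesis unfolding eq using True by simp
  next
    case False
    have "(LINT w|M. a (l, 0) (- int (lag r)) w * a (l', 0) (- int (lag r')) w) = 0"
      by (rule ar.acov_cross[OF modes_zero[OF assms(1)] modes_zero[OF assms(2)]]) (use False in simp)
    then show ?thesis unfolding eq using False by simp
  qed
qed

lemma autocov_matrix_sym:
  assumes "l \<le> L"
  shows "autocov_matrix M T l $ r $ r' = autocov_matrix M T l $ r' $ (r :: 'p::{finite,linorder})"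
  using ar.acov_minus[OF modes_zero[OF assms], of "int (lag r) - int (lag r')"]
  by (simp add: autocov_matrix_def autocov_def ar.acov_def a_def)

text \<open>This is \<open>\<Gamma>\<^sub>l\<^bsup>-1\<^esup> \<Gamma>\<^sub>l \<Gamma>\<^sub>l\<^bsup>-1\<^esup> =
  \<Gamma>\<^sub>l\<^bsup>-1\<^esup>\<close> with the scalar factors; symmetry of \<open>\<Gamma>\<^sub>l\<close> turns the second inverse around.\<close>

lemma inv_gram_sandwich:
  assumes l: "l \<le> L"
  shows "(\<Sum>k\<in>UNIV. \<Sum>k'\<in>UNIV. inv_gram l $ i $ k * (inv_gram l $ j $ k' * ((2 * real l + 1) * CZ l * autocov_matrix M T l $ k $ k'))) =
    CZ l / (2 * real l + 1) * matrix_inv (autocov_matrix M T l) $ i $ j"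
proof -
  have one: "(\<Sum>k'\<in>UNIV. inv_gram l $ j $ k' * ((2 * real l + 1) * autocov_matrix M T l $ k' $ k)) = (if j = k then 1 else 0)" for k
    using inv_gram_inverse[OF l] unfolding matrix_matrix_mult_def vec_eq_iff mat_def by simp
  have "(\<Sum>k\<in>UNIV. \<Sum>k'\<in>UNIV. inv_gram l $ i $ k * (inv_gram l $ j $ k' * ((2 * real l + 1) * CZ l * autocov_matrix M T l $ k $ k'))) =
     (\<Sum>k\<in>UNIV. inv_gram l $ i $ k * CZ l * (\<Sum>k'\<in>UNIV. inv_gram l $ j $ k' * ((2 * real l + 1) * autocov_matrix M T l $ k' $ k)))"
    unfolding sum_distrib_left by (intro sum.cong refl) (simp only: autocov_matrix_sym[OF l] mult_ac)
  also have "\<dots> = inv_gram l $ i $ j * CZ l" unfolding one by (simp add: if_distrib cong: if_cong)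
  finally show ?thesis by (simp add: inv_gram_def)
qed

text \<open>Scores of different degrees are uncorrelated, and within one degree \<open>inv_gram_sandwich\<close> applies. The factor
  \<open>((2 l + 1) / (4 \<pi>))\<^sup>2 / (2 l + 1)\<close> is the \<open>(2 l + 1) / (16 \<pi>\<^sup>2)\<close> of the limiting covariance.\<close>

lemma limit_value_cov:
  "(LINT w|M. limit_value i z w * limit_value j z' w) = limit_covariance M T CZ L z z' $ i $ j"
proof -
  define wt where "wt l z = (2 * real l + 1) / (4 * pi) * legendre l z" for l z
  have iS: "integrable M (\<lambda>w. limit_score x w * limit_score y w)" for x y
  proof -
    have "integrable M (\<lambda>w. (sqrt ((2 * real (fst x) + 1) * CZ (fst x)) * sqrt ((2 * real (fst y) + 1) * CZ (fst y))) *
       (a (fst x, 0) (- int (lag (snd x))) w * a (fst y, 0) (- int (lag (snd y))) w))"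
      by (intro integrable_mult_right in_L2_mult_integrable coeff_L2)
    then show ?thesis by (simp add: limit_score_def mult_ac)
  qed
  have "(LINT w|M. limit_value i z w * limit_value j z' w) =
    (LINT w|M. (\<Sum>l\<le>L. \<Sum>l'\<le>L. \<Sum>k\<in>UNIV. \<Sum>k'\<in>UNIV. (wt l z * wt l' z' * (inv_gram l $ i $ k * inv_gram l' $ j $ k')) * (limit_score (l, k) w * limit_score (l', k') w)))"
  proof (rule Bochner_Integration.integral_cong[OF refl])
    have prod: "(x * (\<Sum>r\<in>UNIV. A r * C r)) * (y * (\<Sum>r'\<in>UNIV. B r' * D r')) = (\<Sum>r\<in>UNIV. \<Sum>r'\<in>UNIV. (x * y * (A r * B r')) * (C r * D r'))"
      for x y :: real and A B C D :: "'p \<Rightarrow> real"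
    proof -
      have "(x * (\<Sum>r\<in>UNIV. A r * C r)) * (y * (\<Sum>r'\<in>UNIV. B r' * D r')) = (x * y) * ((\<Sum>r\<in>UNIV. A r * C r) * (\<Sum>r'\<in>UNIV. B r' * D r'))"
        by (simp only: mult_ac)
      also have "\<dots> = (\<Sum>r\<in>UNIV. \<Sum>r'\<in>UNIV. (x * y) * ((A r * C r) * (B r' * D r')))"
        unfolding sum_product unfolding sum_distrib_left ..
      finally show ?thesis by (simp only: mult_ac)
    qed
    show "limit_value i z w * limit_value j z' w =
      (\<Sum>l\<le>L. \<Sum>l'\<le>L. \<Sum>k\<in>UNIV. \<Sum>k'\<in>UNIV. (wt l z * wt l' z' * (inv_gram l $ i $ k * inv_gram l' $ j $ k')) * (limit_score (l, k) w * limit_score (l', k') w))" for w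
      unfolding limit_value_def wt_def[symmetric] sum_product[of _ "{..L}"] prod ..
  qed
  also have "\<dots> = (\<Sum>l\<le>L. \<Sum>l'\<le>L. \<Sum>k\<in>UNIV. \<Sum>k'\<in>UNIV. (wt l z * wt l' z' * (inv_gram l $ i $ k * inv_gram l' $ j $ k')) *
      (LINT w|M. limit_score (l, k) w * limit_score (l', k') w))"
    using iS by simp
  also have "\<dots> = (\<Sum>l\<le>L. \<Sum>l'\<le>L. if l = l' then wt l z * wt l z' * (\<Sum>k\<in>UNIV. \<Sum>k'\<in>UNIV. inv_gram l $ i $ k * (inv_gram l $ j $ k' * ((2 * real l + 1) * CZ l * autocov_matrix M T l $ k $ k'))) else 0)"
    by (intro sum.cong refl) (simp add: limit_score_cov sum_distrib_left mult_ac)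
  also have "\<dots> = (\<Sum>l\<le>L. wt l z * wt l z' * (CZ l / (2 * real l + 1) * matrix_inv (autocov_matrix M T l) $ i $ j))"
    by (rule sum.cong[OF refl]) (simp add: inv_gram_sandwich)
  also have "\<dots> = limit_covariance M T CZ L z z' $ i $ j"
  proof -
    have arith: "(q / (4 * pi) * P) * (q / (4 * pi) * P') * (C / q * G) = C * (q / (16 * pi\<^sup>2)) * P * P' * G" if "q \<noteq> 0" for q P P' C G :: real
      using that by (simp add: power2_eq_square field_simps)
    have "2 * real l + 1 \<noteq> 0" for l by linarith
    from arith[OF this] show ?thesis unfolding limit_covariance_def wt_def sum_component vector_scaleR_component
      by (intro sum.cong refl) simp
  qed
  finally show ?thesis .
qed

lemma limit_law_gaussian: "centered_gaussian_law limit_law (limit_covariance M T CZ L)"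
  unfolding centered_gaussian_law_def
proof (intro conjI allI ballI)
  note m = limit_path_measurable
  show P: "prob_space limit_law" unfolding limit_law_def by (rule prob_space_distr[OF m])
  show "sets limit_law = sets (metric_borel C_metric)" by (simp add: limit_law_def)
  note ev = C_metric_eval_measurable
  have cg: "cgauss limit_law (\<lambda>f. \<Sum>i\<in>J. c i * (case i of (j, z) \<Rightarrow> \<lambda>f. f z $ j) f)" if J: "finite J" "J \<subseteq> UNIV \<times> {-1..1}" for J :: "('p \<times> real) set" and c
    unfolding limit_law_def
  proof (rule cgauss_push_forward[OF m])
    show "(\<lambda>f. \<Sum>i\<in>J. c i * (case i of (j, z) \<Rightarrow> \<lambda>f. f z $ j) f) \<in> borel_measurable (metric_borel C_metric)"
    proof (intro borel_measurable_sum borel_measurable_times borel_measurable_const)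
      fix i assume "i \<in> J"
      then have "snd i \<in> {-1..1}" using J by auto
      from ev[OF this, of "fst i"] show "(case i of (j, z) \<Rightarrow> \<lambda>f. f z $ j) \<in> borel_measurable (metric_borel C_metric)"
        by (simp add: case_prod_unfold)
    qed
    have eq: "(\<lambda>w. \<Sum>i\<in>J. c i * (case i of (j, z) \<Rightarrow> \<lambda>f. f z $ j) (legendre_path L (limit_vec w))) = (\<lambda>w. \<Sum>i\<in>J. c i * limit_value (fst i) (snd i) w)"
      using J by (intro ext sum.cong refl) (auto simp: limit_value_eq)
    have "joint_cgauss M UNIV (\<lambda>_::unit. \<lambda>w. \<Sum>i\<in>J. c i * limit_value (fst i) (snd i) w)"
      by (rule joint_cgauss_lin_span[OF ar.joint]) (intro lin_span_sum lin_span_scale limit_value_span J(1))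
    from joint_cgauss_single[OF this, of "()"]
    show "cgauss M (\<lambda>w. \<Sum>i\<in>J. c i * (case i of (j, z) \<Rightarrow> \<lambda>f. f z $ j) (legendre_path L (limit_vec w)))" unfolding eq by simp
  qed
  show "gaussian_process limit_law (UNIV \<times> {-1..1}) (\<lambda>(j, z) f. f z $ j)"
    unfolding gaussian_process_def
  proof (intro allI impI, elim conjE)
    fix J :: "('p \<times> real) set" and c assume "finite J" "J \<subseteq> UNIV \<times> {-1..1}"
    from cg[OF this] show "gaussian_rv limit_law (\<lambda>f. \<Sum>i\<in>J. c i * (case i of (j, z) \<Rightarrow> \<lambda>f. f z $ j) f)"
      by (rule cgauss_imp_gaussian_rv[OF P])
  qed
  show "(LINT f|limit_law. f z $ j) = 0" if "z \<in> {-1..1}" for j :: 'p and z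
    using cgauss_mean_zero[OF P cg[of "{(j, z)}" "\<lambda>_. 1"]] that by simp
  fix i j :: 'p and z z' :: real assume z: "z \<in> {-1..1}" "z' \<in> {-1..1}"
  have "(LINT f|limit_law. f z $ i * f z' $ j) = (LINT w|M. legendre_path L (limit_vec w) z $ i * legendre_path L (limit_vec w) z' $ j)"
    unfolding limit_law_def by (rule integral_distr[OF m]) (intro borel_measurable_times ev z)
  then show "(LINT f|limit_law. f z $ i * f z' $ j) = limit_covariance M T CZ L z z' $ i $ j"
    unfolding limit_value_eq[OF z(1)] limit_value_eq[OF z(2)] limit_value_cov .
qed

text \<open>Bounded continuous functionals of paths are bounded continuous functions of their coefficients, so the convergence
  of the coefficients carries over. The normalised estimator has such coefficients almost surely, and for
  \<open>N > p\<close> it is measurable as a path.\<close>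

lemma estimator_weak_limit:
  fixes khat :: "nat \<Rightarrow> 'w \<Rightarrow> real \<Rightarrow> real^'p::{finite,linorder}"
  assumes est: "\<And>N. N > CARD('p) \<Longrightarrow> ls_estimator M T L N (khat N)"
  shows "conv_in_distribution C_metric M (\<lambda>N w. \<lambda>z\<in>{-1..1}. sqrt (real N) *\<^sub>R (khat N w z - kernel_expansion \<phi> L z)) limit_law"
proof -
  define X where "X N w = (\<lambda>z\<in>{-1..1}. sqrt (real N) *\<^sub>R (khat N w z - kernel_expansion \<phi> L z))" for N w
  have hc: "continuous_on {-1..1} (kernel_expansion \<phi> L)"
    unfolding kernel_expansion_def[abs_def] by (intro continuous_intros continuous_on_legendre)
  have Xm: "X N \<in> measurable M (metric_borel C_metric)" if "N > CARD('p)" for N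
  proof -
    have "(\<lambda>w. restrict (khat N w) {-1..1}) \<in> measurable M (metric_borel C_metric)"
      using est[OF that] by (simp add: ls_estimator_def)
    from measurable_compose[OF this C_metric_affine_measurable[OF hc, of "sqrt (real N)"]]
    have "(\<lambda>w. \<lambda>z\<in>{-1..1}. sqrt (real N) *\<^sub>R (restrict (khat N w) {-1..1} z - kernel_expansion \<phi> L z)) \<in> measurable M (metric_borel C_metric)" .
    moreover have "X N = (\<lambda>w. \<lambda>z\<in>{-1..1}. sqrt (real N) *\<^sub>R (restrict (khat N w) {-1..1} z - kernel_expansion \<phi> L z))"
      unfolding X_def by (intro ext) (auto simp: restrict_def)
    ultimately show ?thesis by simp
  qed
  have "(\<lambda>N. LINT w|M. F (X N w)) \<longlonglongrightarrow> (LINT f|limit_law. F f)"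
    if F: "continuous_map (mtopology_of C_metric) euclideanreal F" "bounded (F ` mspace C_metric)" for F :: "(real \<Rightarrow> real^'p::{finite,linorder}) \<Rightarrow> real"
  proof -
    obtain b where b: "\<And>f. f \<in> mspace C_metric \<Longrightarrow> \<bar>F f\<bar> \<le> b" using F(2) unfolding bounded_iff by auto
    have Fm: "F \<in> borel_measurable (metric_borel C_metric)" by (rule measurable_metric_borel_real[OF F(1)])
    have Gc: "continuous_on UNIV (\<lambda>v. F (legendre_path L v))"
      using continuous_map_compose[OF legendre_path_continuous[of L] F(1)] by (simp add: o_def)
    have "(\<lambda>N. LINT w|M. F (X N w)) \<longlonglongrightarrow> (LINT w|M. F (legendre_path L (block_vec L (\<lambda>l. inv_gram l *v (\<chi> j. limit_score (l, j) w)))))"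
    proof (rule linear_equations_weak_limit[where U = score and A' = gram and A = "\<lambda>l. (2 * real l + 1) *\<^sub>R autocov_matrix M T l" and b = b and ?N0.0 = "Suc CARD('p)"])
      show "prob_space M" by unfold_locales
      show "score N i \<in> borel_measurable M" for N i unfolding score_def[abs_def] by measurable
      show "integrable M (limit_score i)" for i
      proof -
        have "integrable M (\<lambda>w. (a (fst i, 0) (- int (lag (snd i))) w)\<^sup>2)" using coeff_L2(1) unfolding in_L2_def by blast
        from square_integrable_imp_integrable[OF a_measurable this]
        show ?thesis unfolding limit_score_def[abs_def] by (rule integrable_mult_right)
      qed
      show "(\<lambda>N. LINT w|M. cos (d + (\<Sum>i\<in>{..L} \<times> UNIV. c i * score N i w))) \<longlonglongrightarrow>
        (LINT w|M. cos (d + (\<Sum>i\<in>{..L} \<times> UNIV. c i * limit_score i w)))" for c d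
        by (rule score_weak_limit)
      show "inv_gram l ** ((2 * real l + 1) *\<^sub>R autocov_matrix M T l) = mat 1" if "l \<le> L" for l by (rule inv_gram_inverse[OF that])
      show "integrable M (\<lambda>w. gram N l w $ i $ j)" for N l i j by (rule gram_integrable)
      show "(\<lambda>N. LINT w|M. \<bar>gram N l w $ i $ j - ((2 * real l + 1) *\<^sub>R autocov_matrix M T l) $ i $ j\<bar>) \<longlonglongrightarrow> 0" if "l \<le> L" for l i j
        by (rule gram_limit[OF that])
      show "continuous_on UNIV (\<lambda>v. F (legendre_path L v))" by (rule Gc)
      show "\<bar>F (legendre_path L v)\<bar> \<le> b" for v by (rule b[OF legendre_path_in])
      show "(\<lambda>w. F (X N w)) \<in> borel_measurable M" if "Suc CARD('p) \<le> N" for N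
        using measurable_compose[OF Xm Fm, of N] that by simp
      fix N assume N: "Suc CARD('p) \<le> N"
      then have "ls_estimator M T L N (khat N)" "N > 0" by (auto intro: est)
      from estimator_solves[OF this]
      show "AE w in M. \<exists>v. (\<forall>l\<le>L. gram N l w *v v l = (\<chi> j. score N (l, j) w)) \<and> F (X N w) = F (legendre_path L (block_vec L v))"
      proof eventually_elim
        case (elim w)
        then obtain v where v: "\<forall>l\<le>L. gram N l w *v v l = (\<chi> j. score N (l, j) w)"
          "\<And>z. sqrt (real N) *\<^sub>R (khat N w z - kernel_expansion \<phi> L z) = (\<Sum>l\<le>L. ((2 * real l + 1) / (4 * pi) * legendre l z) *\<^sub>R v l)" by blast
        have "X N w = legendre_path L (block_vec L v)"
          unfolding X_def v(2) legendre_path_def block_vec_def by (simp add: vec_nth_inverse)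
        then show ?case using v(1) by (intro exI[of _ v]) simp
      qed
    qed
    also have "(LINT w|M. F (legendre_path L (block_vec L (\<lambda>l. inv_gram l *v (\<chi> j. limit_score (l, j) w))))) = (LINT f|limit_law. F f)"
      unfolding limit_law_def limit_vec_def[symmetric] by (rule integral_distr[OF limit_path_measurable Fm, symmetric])
    finally show ?thesis .
  qed
  moreover have "\<forall>\<^sub>F N in sequentially. X N \<in> measurable M (metric_borel C_metric)"
    using eventually_gt_at_top[of "CARD('p)"] by eventually_elim (rule Xm)
  ultimately show ?thesis unfolding conv_in_distribution_def X_def[symmetric] by blast
qed

end

theorem theorem25:
  fixes M :: "'w measure"
    and T Z :: "int \<Rightarrow> real^3 \<Rightarrow> 'w \<Rightarrow> real"
    and CZ :: "nat \<Rightarrow> real"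
    and k :: "real \<Rightarrow> real^'p::{finite,linorder}"
    and \<phi> :: "nat \<Rightarrow> real^'p::{finite,linorder}"
    and L :: nat
    and khat :: "nat \<Rightarrow> 'w \<Rightarrow> real \<Rightarrow> real^'p::{finite,linorder}"
  assumes "prob_space M"
    and "gaussian_sphar M Z CZ k \<phi> T"
    and stationarity: "\<exists>\<delta>>0. \<forall>l. \<forall>z::complex. norm z \<le> 1 + \<delta> \<longrightarrow>
      1 - (\<Sum>j\<in>UNIV. of_real (\<phi> l $ j) * z ^ lag j) \<noteq> 0"
    and identifiability: "\<forall>l. CZ l > 0"
    and "L > 0"
    and finite_expansion: "\<forall>j. \<forall>l>L. (LBINT z:{-1..1}. k z $ j * legendre l z) = 0"
    and estimator: "\<forall>N>CARD('p). ls_estimator M T L N (khat N)"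
  shows "\<exists>W. centered_gaussian_law W (limit_covariance M T CZ L) \<and>
    conv_in_distribution C_metric M
      (\<lambda>N \<omega>. \<lambda>z\<in>{-1..1}. sqrt (real N) *\<^sub>R (khat N \<omega> z - kernel_expansion \<phi> L z)) W"
proof -
  interpret prob_space M by fact
  interpret sphar M T Z CZ k \<phi> L by unfold_locales (use assms in auto)
  show ?thesis using limit_law_gaussian estimator_weak_limit[of khat] estimator by blast
qed

end
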